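(* Let $q\ge4$ be a fixed even integer. For any constant $\beta>0$ there exists a constant $\epsilon>0$ such that, with probability $1-o(1)$ as $n\to\infty$ over the SYK couplings, the minimum number of $2$-local gates from a fixed finite universal gate set needed to prepare a state within trace distance $\epsilon$ of a purification of $\rho_\beta$, using arbitrary ancillas initialized in a product state, is $\Omega(n^{1+q/2}/\log n)$.
   Context: Majorana operators $\psi_1,\dots,\psi_n$ ($n$ even) are Hermitian operators on $n/2$ qubits (Hilbert space dimension $2^{n/2}$) with $\{\psi_i,\psi_j\}=\delta_{ij}$; for $I=\{i_1<\dots<i_q\}$, $\psi_I=i^{q/2}\psi_{i_1}\cdots\psi_{i_q}$. The SYK Hamiltonian is $H=\sum_{I\in\binom{[n]}{q}}J_I\psi_I$ with $J_I$ i.i.d. $\mathcal{N}(0,\sigma^2)$, $\sigma^2=(q-1)!/n^{q-1}$, and $\rho_\beta=e^{-\beta H}/\mathrm{Tr}\,e^{-\beta H}$. A purification of $\rho_\beta$ is a pure state on the system plus ancillas whose reduced state on the system is $\rho_\beta$. *)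

theory Defs
  imports "HOL-Probability.Probability" "Jordan_Normal_Form.Char_Poly"
begin

text \<open>Qubit j of an m-qubit register is bit j of the basis index x < 2^m.\<close>

definition qbit :: "nat \<Rightarrow> nat \<Rightarrow> nat" where
  "qbit j x = (x div 2 ^ j) mod 2"

definition adj :: "complex mat \<Rightarrow> complex mat" where
  "adj A = mat (dim_col A) (dim_row A) (\<lambda>(i,j). cnj (A $$ (j,i)))"

definition unitary_mat :: "nat \<Rightarrow> complex mat \<Rightarrow> bool" where
  "unitary_mat d U \<longleftrightarrow> U \<in> carrier_mat d d \<and> adj U * U = 1\<^sub>m d \<and> U * adj U = 1\<^sub>m d"

definition mat_exp :: "complex mat \<Rightarrow> complex mat" where
  "mat_exp A = mat (dim_row A) (dim_col A)
     (\<lambda>(i,j). \<Sum>k. (A ^\<^sub>m k) $$ (i,j) / of_nat (fact k))"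

definition trace_norm :: "complex mat \<Rightarrow> real" where
  "trace_norm A = sum_mset (image_mset (\<lambda>z. sqrt (Re z)) (proots (char_poly (adj A * A))))"

definition trace_dist :: "complex mat \<Rightarrow> complex mat \<Rightarrow> real" where
  "trace_dist A B = trace_norm (A - B) / 2"

definition proj :: "complex vec \<Rightarrow> complex mat" where
  "proj v = mat (dim_vec v) (dim_vec v) (\<lambda>(i,j). v $ i * cnj (v $ j))"

text \<open>Partial trace over the ancilla qubits s, ..., s+k-1 of a state on s+k qubits
  (system = qubits 0..s-1).\<close>
definition ptrace_anc :: "nat \<Rightarrow> nat \<Rightarrow> complex mat \<Rightarrow> complex mat" where
  "ptrace_anc s k R = mat (2^s) (2^s)
     (\<lambda>(a,b). \<Sum>e<2^k. R $$ (a + 2^s * e, b + 2^s * e))"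

definition is_purification :: "nat \<Rightarrow> nat \<Rightarrow> complex mat \<Rightarrow> complex vec \<Rightarrow> bool" where
  "is_purification s k rho v \<longleftrightarrow>
     dim_vec v = 2^(s+k) \<and> (\<Sum>x<2^(s+k). cmod (v $ x) ^ 2) = 1 \<and> ptrace_anc s k (proj v) = rho"

definition product_state :: "nat \<Rightarrow> complex vec \<Rightarrow> bool" where
  "product_state m v \<longleftrightarrow> (\<exists>u :: nat \<Rightarrow> nat \<Rightarrow> complex.
     (\<forall>j<m. cmod (u j 0) ^ 2 + cmod (u j 1) ^ 2 = 1) \<and>
     v = vec (2^m) (\<lambda>x. \<Prod>j<m. u j (qbit j x)))"

definition gate_on :: "nat \<Rightarrow> complex mat \<Rightarrow> nat \<Rightarrow> nat \<Rightarrow> complex mat" where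
  "gate_on m U a b = mat (2^m) (2^m) (\<lambda>(x,y).
     if (\<forall>j<m. j \<noteq> a \<longrightarrow> j \<noteq> b \<longrightarrow> qbit j x = qbit j y)
     then U $$ (2 * qbit a x + qbit b x, 2 * qbit a y + qbit b y) else 0)"

definition circuit_over :: "complex mat set \<Rightarrow> nat \<Rightarrow> (complex mat \<times> nat \<times> nat) list \<Rightarrow> bool" where
  "circuit_over S m cs \<longleftrightarrow> (\<forall>(U,a,b)\<in>set cs. U \<in> S \<and> a < m \<and> b < m \<and> a \<noteq> b)"

definition circuit_mat :: "nat \<Rightarrow> (complex mat \<times> nat \<times> nat) list \<Rightarrow> complex mat" where
  "circuit_mat m cs = foldl (\<lambda>M (U,a,b). gate_on m U a b * M) (1\<^sub>m (2^m)) cs"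

definition frob_dist :: "complex mat \<Rightarrow> complex mat \<Rightarrow> real" where
  "frob_dist A B = sqrt (\<Sum>i<dim_row A. \<Sum>j<dim_col A. cmod (A $$ (i,j) - B $$ (i,j)) ^ 2)"

definition universal_gate_set :: "complex mat set \<Rightarrow> bool" where
  "universal_gate_set S \<longleftrightarrow> finite S \<and> (\<forall>U\<in>S. unitary_mat 4 U) \<and>
     (\<forall>V. unitary_mat 4 V \<longrightarrow> (\<forall>e>0. \<exists>cs \<theta>. circuit_over S 2 cs \<and>
        frob_dist (circuit_mat 2 cs) (exp (\<i> * of_real \<theta>) \<cdot>\<^sub>m V) < e))"

definition majorana_family :: "nat \<Rightarrow> (nat \<Rightarrow> complex mat) \<Rightarrow> bool" where
  "majorana_family n psi \<longleftrightarrow> even n \<and>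
     (\<forall>i<n. psi i \<in> carrier_mat (2^(n div 2)) (2^(n div 2)) \<and> adj (psi i) = psi i) \<and>
     (\<forall>i<n. \<forall>j<n. psi i * psi j + psi j * psi i =
        (if i = j then 1\<^sub>m (2^(n div 2)) else 0\<^sub>m (2^(n div 2)) (2^(n div 2))))"

definition qsets :: "nat \<Rightarrow> nat \<Rightarrow> nat set set" where
  "qsets n q = {I. I \<subseteq> {..<n} \<and> card I = q}"

definition majorana_prod :: "nat \<Rightarrow> (nat \<Rightarrow> complex mat) \<Rightarrow> nat set \<Rightarrow> complex mat" where
  "majorana_prod n psi I = (\<i> ^ (card I div 2)) \<cdot>\<^sub>m
     foldr (\<lambda>i M. psi i * M) (sorted_list_of_set I) (1\<^sub>m (2^(n div 2)))"

definition syk_ham :: "nat \<Rightarrow> nat \<Rightarrow> (nat \<Rightarrow> complex mat) \<Rightarrow> (nat set \<Rightarrow> real) \<Rightarrow> complex mat" where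
  "syk_ham n q psi J = mat (2^(n div 2)) (2^(n div 2))
     (\<lambda>(x,y). \<Sum>I\<in>qsets n q. of_real (J I) * majorana_prod n psi I $$ (x,y))"

definition mtrace :: "complex mat \<Rightarrow> complex" where
  "mtrace A = (\<Sum>i<dim_row A. A $$ (i,i))"

definition gibbs :: "real \<Rightarrow> complex mat \<Rightarrow> complex mat" where
  "gibbs \<beta> H = (1 / mtrace (mat_exp ((- of_real \<beta>) \<cdot>\<^sub>m H))) \<cdot>\<^sub>m mat_exp ((- of_real \<beta>) \<cdot>\<^sub>m H)"

definition syk_var :: "nat \<Rightarrow> nat \<Rightarrow> real" where
  "syk_var n q = fact (q - 1) / real n ^ (q - 1)"

definition syk_couplings :: "nat \<Rightarrow> nat \<Rightarrow> (nat set \<Rightarrow> real) measure" where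
  "syk_couplings n q = PiM (qsets n q) (\<lambda>_. density lborel (normal_density 0 (sqrt (syk_var n q))))"

definition prepares :: "complex mat set \<Rightarrow> nat \<Rightarrow> nat \<Rightarrow> complex vec \<Rightarrow>
    (complex mat \<times> nat \<times> nat) list \<Rightarrow> real \<Rightarrow> complex mat \<Rightarrow> bool" where
  "prepares S s k v0 cs eps rho \<longleftrightarrow>
     product_state (s+k) v0 \<and> circuit_over S (s+k) cs \<and>
     (\<exists>w. is_purification s k rho w \<and>
        trace_dist (proj (circuit_mat (s+k) cs *\<^sub>v v0)) (proj w) \<le> eps)"

end

(*
  The Gibbs state has energy linear in n: Gaussian integration by parts writes the mean of Tr(-beta H rho)
  as a sum of Bogoliubov variances, which the double commutators bound from below by the number of terms
  minus a multiple of the energy itself and minus the sum of the squared expectations of the psi_I.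
  That last sum, the commutation index, is O(n^(q/2)) uniformly over all states, because products
  psi_I and psi_J with odd intersection anticommute.  The Efron-Stein inequality gives concentration of ln Z,
  hence an energy linear in n with high probability.

  The same uniform bound makes the energy of one fixed state a Gaussian of variance O(n^(1-q/2)), so it is
  linear in n only with probability exp(-c n^(1+q/2)).  Ancillas that no gate touches do not change the
  reduced state, hence G gates reach only exp(O((n+G) log n)) states up to a small error, even though the
  number of ancillas and their product state are arbitrary.  Since the norm of H is O(n), a union bound over
  this net excludes circuits with G << n^(1+q/2) / log n.
*)
theory Submission
  imports Defs "Jordan_Normal_Form.Schur_Decomposition" "HOL-Real_Asymp.Real_Asymp"
begin

unbundle no vec_syntax

section \<open>Spectral decomposition of Hermitian matrices\<close>

text \<open>Concentration is proved for ln Z, whose derivatives in the couplings are uniformly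
  bounded, and not for the energy itself. Convexity of the free energy carries the argument between
  temperatures: a mean energy at \<beta>/2 raises the mean of ln Z at \<beta>, where ln Z
  concentrates, and ln Z - ln d lies below the energy at \<beta>. Hence the
  \<open>\<beta> / 2\<close> in \<open>good_couplings\<close>. The lower bound for the mean energy
  is self-referential, because the double commutators subtract a multiple of the same mean; solving
  for it gives the denominator of \<open>gain\<close>. The mean of Z is bounded by adding one
  coupling at a time and comparing with a cosh. Every eigenvalue of A is at most ln Z, so tails for
  A and -A bound the norm. The commutation index is estimated by inverting binomial counts of common
  subsets. For circuits, gate sequences are counted exactly and only the product input is rounded to
  a grid. Closeness in trace distance means closeness in norm up to a phase, and every purification
  has the energy of the Gibbs state.\<close>

lemma exists_eigenvector:
  fixes A :: "nat \<Rightarrow> nat \<Rightarrow> complex"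
  assumes "n > 0"
  shows "\<exists>\<mu> v. (\<exists>i<n. v i \<noteq> 0) \<and> (\<forall>i<n. (\<Sum>j<n. A i j * v j) = \<mu> * v i)"
proof -
  let ?M = "mat n n (\<lambda>(i,j). A i j)"
  have M: "?M \<in> carrier_mat n n" by simp
  from degree_monic_char_poly[OF M] assms
  have "degree (char_poly ?M) \<noteq> 0" by simp
  then have "\<not> constant (poly (char_poly ?M))" by (simp add: constant_degree)
  then obtain \<mu> where "poly (char_poly ?M) \<mu> = 0"
    using fundamental_theorem_of_algebra by blast
  then have "eigenvalue ?M \<mu>" using eigenvalue_root_char_poly[OF M] by simp
  then obtain v where v: "v \<in> carrier_vec n" "v \<noteq> 0\<^sub>v n" "?M *\<^sub>v v = \<mu> \<cdot>\<^sub>v v"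
    unfolding eigenvalue_def eigenvector_def by auto
  have "\<exists>i<n. v $ i \<noteq> 0" using v(1,2) by (metis carrier_vecD eq_vecI index_zero_vec(1,2))
  moreover have "(\<Sum>j<n. A i j * v $ j) = \<mu> * v $ i" if "i < n" for i
  proof -
    have "(?M *\<^sub>v v) $ i = (\<Sum>j<n. A i j * v $ j)"
      using that v(1) by (simp add: scalar_prod_def atLeast0LessThan row_def)
    then show ?thesis using v(1,3) that by simp
  qed
  ultimately show ?thesis by blast
qed

text \<open>The second index numbers the vectors, the first their coordinates: these are the columns
  of a unitary matrix.\<close>

definition orthonormal :: "nat \<Rightarrow> (nat \<Rightarrow> nat \<Rightarrow> complex) \<Rightarrow> bool" where
  "orthonormal n U \<longleftrightarrow> (\<forall>l<n. \<forall>k<n. (\<Sum>i<n. cnj (U i l) * U i k) = (if l = k then 1 else 0))"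

text \<open>A one-sided inverse of a square matrix is two-sided, so orthonormality passes from the
  columns to the rows. In this form it is the resolution of the identity.\<close>

lemma orthonormal_rows:
  assumes "orthonormal n U" "i < n" "j < n"
  shows "(\<Sum>l<n. U i l * cnj (U j l)) = (if i = j then 1 else 0)"
proof -
  let ?A = "mat n n (\<lambda>(i,l). cnj (U l i))" and ?B = "mat n n (\<lambda>(i,l). U i l)"
  have "?A * ?B = 1\<^sub>m n"
    by (rule eq_matI) (use assms in \<open>auto simp: orthonormal_def scalar_prod_def atLeast0LessThan\<close>)
  moreover have "?A \<in> carrier_mat n n" "?B \<in> carrier_mat n n" by simp_all
  ultimately have "?B * ?A = 1\<^sub>m n" using mat_mult_left_right_inverse by blast
  then have "(?B * ?A) $$ (i,j) = 1\<^sub>m n $$ (i,j)" by simp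
  then show ?thesis using assms by (simp add: scalar_prod_def atLeast0LessThan)
qed

lemma orthonormal_expansion:
  assumes "orthonormal n U" "i < n"
  shows "y i = (\<Sum>p<n. U i p * (\<Sum>r<n. cnj (U r p) * y r))"
proof -
  have "(\<Sum>p<n. U i p * (\<Sum>r<n. cnj (U r p) * y r)) = (\<Sum>r<n. (\<Sum>p<n. U i p * cnj (U r p)) * y r)"
    by (simp add: sum_distrib_left sum_distrib_right mult.assoc) (rule sum.swap)
  also have "\<dots> = (\<Sum>r<n. if r = i then y r else 0)"
    using orthonormal_rows[OF assms(1)] assms(2) by (intro sum.cong) auto
  also have "\<dots> = y i" using assms(2) by simp
  finally show ?thesis by simp
qed

text \<open>Gram-Schmidt leaves the head of the list alone, so running it on a basis that starts
  with \<open>v\<close> and normalising yields a unitary whose column 0 is a multiple of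
  \<open>v\<close>.\<close>

lemma orthonormal_completion:
  fixes v :: "nat \<Rightarrow> complex"
  assumes "\<exists>i<n. v i \<noteq> 0"
  shows "\<exists>W s. s \<noteq> 0 \<and> orthonormal n W \<and> (\<forall>i<n. W i 0 = s * v i)"
proof -
  let ?v = "vec n v"
  have v: "?v \<in> carrier_vec n" by simp
  have v0: "?v \<noteq> 0\<^sub>v n" using assms by (metis index_vec index_zero_vec(1))
  have n: "n > 0" using assms by auto
  interpret cof_vec_space n "TYPE(complex)" .
  define b where "b = basis_completion ?v"
  define ws where "ws = gram_schmidt n b"
  note bc = basis_completion[OF v v0, folded b_def]
  then obtain vs where bv: "b = ?v # vs" using n by (cases b) auto
  from gram_schmidt_result[OF bc(2,4,5) refl, folded ws_def] bc(6)
  have ws: "set ws \<subseteq> carrier_vec n" "corthogonal ws" "length ws = n" by auto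
  have hd: "hd ws = ?v" using gram_schmidt_hd[OF v, of vs, folded bv] unfolding ws_def .
  have wsc: "dim_vec (ws ! l) = n" if "l < n" for l
    using ws that by (metis carrier_vecD nth_mem subsetD)
  have ip: "(ws ! l) \<bullet>c (ws ! k) = (\<Sum>i<n. ws ! l $ i * cnj (ws ! k $ i))" if "l < n" "k < n" for l k
    using wsc that by (simp add: scalar_prod_def atLeast0LessThan)
  define r where "r l = (\<Sum>i<n. cmod (ws ! l $ i) ^ 2)" for l
  have rr: "(\<Sum>i<n. ws ! l $ i * cnj (ws ! l $ i)) = of_real (r l)" for l
    unfolding r_def of_real_sum by (intro sum.cong refl) (simp only: complex_norm_square)
  have rpos: "r l > 0" if "l < n" for l
  proof -
    have "r l \<noteq> 0" using corthogonalD[OF ws(2), of l l] ip[OF that that] rr that ws(3) by auto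
    moreover have "r l \<ge> 0" unfolding r_def by (intro sum_nonneg) auto
    ultimately show ?thesis by simp
  qed
  define W where "W i l = ws ! l $ i / of_real (sqrt (r l))" for i l
  have ws0: "ws ! 0 = ?v"
    using hd n ws(3) by (metis hd_conv_nth list.size(3) less_numeral_extra(3))
  have "orthonormal n W" unfolding orthonormal_def
  proof (intro allI impI)
    fix l k assume lk: "l < n" "k < n"
    have "(\<Sum>i<n. cnj (W i l) * W i k) = (\<Sum>i<n. ws ! k $ i * cnj (ws ! l $ i)) / of_real (sqrt (r l) * sqrt (r k))"
      unfolding W_def sum_divide_distrib by (intro sum.cong refl) (simp add: field_simps)
    also have "\<dots> = (if l = k then 1 else 0)"
    proof (cases "l = k")
      case True
      then show ?thesis using rpos[OF lk(1)] by (simp only: rr) (simp flip: of_real_mult)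
    next
      case False
      then have "(\<Sum>i<n. ws ! k $ i * cnj (ws ! l $ i)) = 0"
        using corthogonalD[OF ws(2), of k l] ip[of k l] lk ws(3) by auto
      then show ?thesis using False by simp
    qed
    finally show "(\<Sum>i<n. cnj (W i l) * W i k) = (if l = k then 1 else 0)" .
  qed
  moreover have "W i 0 = (1 / of_real (sqrt (r 0))) * v i" if "i < n" for i
    using that by (simp add: W_def ws0)
  moreover have "(1 / of_real (sqrt (r 0)) :: complex) \<noteq> 0" using rpos[OF n] by simp
  ultimately show ?thesis by blast
qed

text \<open>Induction on the dimension: split off one eigenvector, pass to the compression of
  \<open>A\<close> to its orthogonal complement, and lift the eigenbasis of the compression. Index
  functions in place of matrices avoid block decompositions.\<close>

lemma hermitian_eigenbasis:
  fixes A :: "nat \<Rightarrow> nat \<Rightarrow> complex"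
  assumes "\<forall>i<n. \<forall>j<n. A i j = cnj (A j i)"
  shows "\<exists>(a :: nat \<Rightarrow> real) U. orthonormal n U \<and>
    (\<forall>i<n. \<forall>l<n. (\<Sum>j<n. A i j * U j l) = of_real (a l) * U i l)"
  using assms
proof (induction n arbitrary: A)
  case 0
  then show ?case by (auto simp: orthonormal_def)
next
  case (Suc n)
  define N where "N = Suc n"
  have prems: "A i j = cnj (A j i)" if "i < N" "j < N" for i j
    using Suc.prems that unfolding N_def by blast
  obtain \<mu> v where v: "\<exists>i<N. v i \<noteq> 0" "\<And>i. i < N \<Longrightarrow> (\<Sum>j<N. A i j * v j) = \<mu> * v i"
    using exists_eigenvector[of N A] by (auto simp: N_def)
  have N0: "0 < N" and SN [simp]: "\<And>k. Suc k < N \<longleftrightarrow> k < n" by (simp_all add: N_def)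
  obtain W s where W: "orthonormal (N) W" "\<And>i. i < N \<Longrightarrow> W i 0 = s * v i"
    using orthonormal_completion[OF v(1)] by blast
  have orth: "(\<Sum>i<N. cnj (W i l) * W i k) = (if l = k then 1 else 0)" if "l < N" "k < N" for l k
    using W(1) that unfolding orthonormal_def by blast
  have AW: "(\<Sum>j<N. A i j * W j 0) = \<mu> * W i 0" if "i < N" for i
  proof -
    have "(\<Sum>j<N. A i j * W j 0) = s * (\<Sum>j<N. A i j * v j)"
      unfolding sum_distrib_left by (intro sum.cong refl) (simp add: W(2))
    then show ?thesis using v(2)[OF that] W(2)[OF that] by simp
  qed
  \<comment> \<open>Hermiticity makes the eigenvector a left eigenvector as well. This gives both
    that \<open>\<mu>\<close> is real and that the complement is invariant.\<close>
  have AWc: "(\<Sum>i<N. cnj (W i 0) * A i j) = cnj \<mu> * cnj (W j 0)" if "j < N" for j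
  proof -
    have "(\<Sum>i<N. cnj (W i 0) * A i j) = cnj (\<Sum>i<N. A j i * W i 0)"
      unfolding cnj_sum by (intro sum.cong refl, subst prems) (use that in auto)
    then show ?thesis using AW[OF that] by simp
  qed
  have "\<mu> = (\<Sum>i<N. cnj (W i 0) * (\<mu> * W i 0))"
  proof -
    have "(\<Sum>i<N. cnj (W i 0) * (\<mu> * W i 0)) = \<mu> * (\<Sum>i<N. cnj (W i 0) * W i 0)"
      by (simp add: sum_distrib_left mult_ac)
    then show ?thesis using orth[of 0 0] N0 by simp
  qed
  also have "\<dots> = (\<Sum>i<N. cnj (W i 0) * (\<Sum>j<N. A i j * W j 0))"
    using AW by (simp)
  also have "\<dots> = (\<Sum>j<N. (\<Sum>i<N. cnj (W i 0) * A i j) * W j 0)"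
    unfolding sum_distrib_left sum_distrib_right mult.assoc by (rule sum.swap)
  also have "\<dots> = cnj \<mu> * (\<Sum>j<N. cnj (W j 0) * W j 0)"
    unfolding sum_distrib_left by (intro sum.cong refl) (simp add: AWc)
  also have "\<dots> = cnj \<mu>" using orth[of 0 0] N0 by simp
  finally have mu: "\<mu> = of_real (Re \<mu>)" by (metis Reals_cnj_iff of_real_Re)
  \<comment> \<open>The compression of \<open>A\<close> to the span of the columns of
    \<open>W\<close> other than column 0.\<close>
  define C where "C l k = (\<Sum>i<N. \<Sum>j<N. cnj (W i (Suc l)) * A i j * W j (Suc k))" for l k
  have "C l k = cnj (C k l)" for l k
  proof -
    have "cnj (C k l) = (\<Sum>i<N. \<Sum>j<N. W i (Suc k) * A j i * cnj (W j (Suc l)))"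
      unfolding C_def cnj_sum by (intro sum.cong refl) (subst (2) prems, auto)
    also have "\<dots> = (\<Sum>j<N. \<Sum>i<N. W i (Suc k) * A j i * cnj (W j (Suc l)))" by (rule sum.swap)
    finally show ?thesis by (simp add: C_def mult_ac)
  qed
  then have "\<forall>l<n. \<forall>k<n. C l k = cnj (C k l)" by blast
  from Suc.IH[OF this] obtain a' U' where U': "orthonormal n U'"
    "\<And>i l. i < n \<Longrightarrow> l < n \<Longrightarrow> (\<Sum>j<n. C i j * U' j l) = of_real (a' l) * U' i l" by blast
  define a where "a = case_nat (Re \<mu>) a'"
  define U where "U i = case_nat (W i 0) (\<lambda>l. \<Sum>k<n. W i (Suc k) * U' k l)" for i
  have US: "(\<Sum>i<N. cnj (W i p) * U i (Suc l)) = (case p of 0 \<Rightarrow> 0 | Suc k \<Rightarrow> U' k l)" if "p < N" for p l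
  proof -
    have "(\<Sum>i<N. cnj (W i p) * U i (Suc l)) = (\<Sum>k<n. (\<Sum>i<N. cnj (W i p) * W i (Suc k)) * U' k l)"
      unfolding U_def nat.case sum_distrib_left sum_distrib_right mult.assoc by (rule sum.swap)
    also have "\<dots> = (\<Sum>k<n. if p = Suc k then U' k l else 0)"
      by (intro sum.cong refl) (use orth[OF that] in \<open>auto\<close>)
    also have "\<dots> = (case p of 0 \<Rightarrow> 0 | Suc k \<Rightarrow> U' k l)" using that by (cases p) auto
    finally show ?thesis .
  qed
  have "orthonormal (N) U" unfolding orthonormal_def
  proof (intro allI impI)
    fix l k assume lk: "l < N" "k < N"
    show "(\<Sum>i<N. cnj (U i l) * U i k) = (if l = k then 1 else 0)"
    proof (cases l)
      case 0
      show ?thesis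
      proof (cases k)
        case 0 then show ?thesis using \<open>l = 0\<close> orth[of 0 0] N0 by (simp add: U_def)
      next
        case (Suc k')
        have "U i 0 = W i 0" for i by (simp add: U_def)
        then show ?thesis using US[of 0 k', OF N0] \<open>l = 0\<close> Suc by simp
      qed
    next
      case (Suc l')
      have "(\<Sum>i<N. cnj (U i l) * U i k) = (\<Sum>p<n. cnj (U' p l') * (\<Sum>i<N. cnj (W i (Suc p)) * U i k))"
        unfolding Suc U_def nat.case cnj_sum complex_cnj_mult sum_distrib_right sum_distrib_left
        by (subst sum.swap) (simp add: mult_ac)
      also have "\<dots> = (if l = k then 1 else 0)"
      proof (cases k)
        case 0
        have "(\<Sum>i<N. cnj (W i (Suc p)) * U i k) = 0" if "p < n" for p
          using 0 orth[of "Suc p" 0, OF _ N0] that by (simp add: U_def)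
        then show ?thesis using 0 Suc by simp
      next
        case (Suc k')
        have "(\<Sum>i<N. cnj (W i (Suc p)) * U i k) = U' p k'" if "p < n" for p
          using US[of "Suc p" k'] that Suc by (simp)
        then show ?thesis using U'(1) lk \<open>l = Suc l'\<close> Suc unfolding orthonormal_def by simp
      qed
      finally show ?thesis .
    qed
  qed
  moreover have "(\<Sum>j<N. A i j * U j l) = of_real (a l) * U i l" if il: "i < N" "l < N" for i l
  proof (cases l)
    case 0
    then show ?thesis using AW[OF il(1)] mu by (simp add: U_def a_def)
  next
    case (Suc l')
    define y where "y r = (\<Sum>j<N. A r j * U j l)" for r
    \<comment> \<open>By the left eigenvector equation, \<open>A\<close> applied to a lifted vector
      has no component along the eigenvector that was split off.\<close>
    have 0: "(\<Sum>r<N. cnj (W r 0) * y r) = 0"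
    proof -
      have "(\<Sum>r<N. cnj (W r 0) * y r) = (\<Sum>j<N. (\<Sum>r<N. cnj (W r 0) * A r j) * U j l)"
        unfolding y_def sum_distrib_left sum_distrib_right mult.assoc by (rule sum.swap)
      also have "\<dots> = cnj \<mu> * (\<Sum>j<N. cnj (W j 0) * U j l)"
        unfolding sum_distrib_left by (intro sum.cong refl) (simp add: AWc)
      finally show ?thesis using US[of 0 l', OF N0] Suc by (simp)
    qed
    have S: "(\<Sum>r<N. cnj (W r (Suc k)) * y r) = of_real (a' l') * U' k l'" if "k < n" for k
    proof -
      have "(\<Sum>r<N. cnj (W r (Suc k)) * y r)
          = (\<Sum>r<N. \<Sum>j<N. \<Sum>k'<n. cnj (W r (Suc k)) * A r j * W j (Suc k') * U' k' l')"
        unfolding y_def U_def Suc nat.case sum_distrib_left by (simp add: mult_ac)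
      also have "\<dots> = (\<Sum>r<N. \<Sum>k'<n. \<Sum>j<N. cnj (W r (Suc k)) * A r j * W j (Suc k') * U' k' l')"
        by (intro sum.cong refl sum.swap)
      also have "\<dots> = (\<Sum>k'<n. \<Sum>r<N. \<Sum>j<N. cnj (W r (Suc k)) * A r j * W j (Suc k') * U' k' l')"
        by (rule sum.swap)
      also have "\<dots> = (\<Sum>k'<n. C k k' * U' k' l')"
        unfolding C_def sum_distrib_right ..
      finally show ?thesis using U'(2) that Suc il by simp
    qed
    have "y i = (\<Sum>p<N. W i p * (\<Sum>r<N. cnj (W r p) * y r))"
      by (rule orthonormal_expansion[OF W(1) il(1)])
    also have "\<dots> = (\<Sum>k<n. W i (Suc k) * (of_real (a' l') * U' k l'))"
      unfolding N_def by (subst sum.lessThan_Suc_shift) (simp add: 0 S flip: N_def del: sum.lessThan_Suc)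
    also have "\<dots> = of_real (a l) * U i l"
      by (simp add: a_def U_def Suc sum_distrib_left mult_ac)
    finally show ?thesis unfolding y_def .
  qed
  ultimately have "orthonormal N U \<and> (\<forall>i<N. \<forall>l<N. (\<Sum>j<N. A i j * U j l) = of_real (a l) * U i l)"
    by simp
  then show ?case unfolding N_def by blast
qed

section \<open>The matrix exponential\<close>

definition hermitian :: "nat \<Rightarrow> complex mat \<Rightarrow> bool" where
  "hermitian d A \<longleftrightarrow> A \<in> carrier_mat d d \<and> (\<forall>i<d. \<forall>j<d. A $$ (i,j) = cnj (A $$ (j,i)))"

definition spectral :: "nat \<Rightarrow> complex mat \<Rightarrow> (nat \<Rightarrow> real) \<Rightarrow> (nat \<Rightarrow> nat \<Rightarrow> complex) \<Rightarrow> bool" where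
  "spectral d A a U \<longleftrightarrow> orthonormal d U \<and>
     (\<forall>i<d. \<forall>j<d. A $$ (i,j) = (\<Sum>l<d. of_real (a l) * U i l * cnj (U j l)))"

lemma mult_mat_sum:
  assumes "A \<in> carrier_mat d d" "B \<in> carrier_mat d d" "i < d" "j < d"
  shows "(A * B) $$ (i,j) = (\<Sum>p<d. A $$ (i,p) * B $$ (p,j))"
  using assms by (simp add: scalar_prod_def atLeast0LessThan)

lemma hermitian_spectral:
  assumes "hermitian d A"
  obtains a U where "spectral d A a U"
proof -
  have "\<forall>i<d. \<forall>j<d. A $$ (i,j) = cnj (A $$ (j,i))" using assms unfolding hermitian_def by blast
  from hermitian_eigenbasis[OF this] obtain a :: "nat \<Rightarrow> real" and U where
    U: "orthonormal d U" "\<And>i l. i < d \<Longrightarrow> l < d \<Longrightarrow> (\<Sum>j<d. A $$ (i,j) * U j l) = of_real (a l) * U i l"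
    by blast
  have "A $$ (i,j) = (\<Sum>l<d. of_real (a l) * U i l * cnj (U j l))" if ij: "i < d" "j < d" for i j
  proof -
    have "(\<Sum>l<d. of_real (a l) * U i l * cnj (U j l)) = (\<Sum>l<d. \<Sum>k<d. A $$ (i,k) * U k l * cnj (U j l))"
      by (intro sum.cong refl) (simp add: U(2)[symmetric] ij sum_distrib_right)
    also have "\<dots> = (\<Sum>k<d. \<Sum>l<d. A $$ (i,k) * U k l * cnj (U j l))" by (rule sum.swap)
    also have "\<dots> = (\<Sum>k<d. A $$ (i,k) * (\<Sum>l<d. U k l * cnj (U j l)))"
      by (simp add: sum_distrib_left mult.assoc)
    also have "\<dots> = (\<Sum>k<d. if k = j then A $$ (i,k) else 0)"
      by (intro sum.cong refl) (simp add: orthonormal_rows[OF U(1)] ij)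
    also have "\<dots> = A $$ (i,j)" using ij by simp
    finally show ?thesis by simp
  qed
  with U(1) that show ?thesis unfolding spectral_def by blast
qed

lemma spectral_pow:
  assumes "spectral d A a U" "A \<in> carrier_mat d d" "i < d" "j < d"
  shows "(A ^\<^sub>m k) $$ (i,j) = (\<Sum>l<d. of_real (a l ^ k) * U i l * cnj (U j l))"
  using assms(3,4)
proof (induction k arbitrary: i j)
  case 0
  then show ?case using assms(1,2) orthonormal_rows[of d U i j] by (simp add: spectral_def)
next
  case (Suc k)
  have orth: "(\<Sum>p<d. cnj (U p l) * U p m) = (if l = m then 1 else 0)" if "l < d" "m < d" for l m
    using assms(1) that unfolding spectral_def orthonormal_def by blast
  have "(A ^\<^sub>m Suc k) $$ (i,j) = (\<Sum>p<d. (A ^\<^sub>m k) $$ (i,p) * A $$ (p,j))"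
    using mult_mat_sum[of "A ^\<^sub>m k" d A i j] assms(2) Suc.prems by simp
  also have "\<dots> = (\<Sum>p<d. (\<Sum>l<d. of_real (a l ^ k) * U i l * cnj (U p l)) * (\<Sum>m<d. of_real (a m) * U p m * cnj (U j m)))"
    using assms(1) Suc by (intro sum.cong refl) (simp add: spectral_def)
  also have "\<dots> = (\<Sum>p<d. \<Sum>l<d. \<Sum>m<d. of_real (a l ^ k) * U i l * (of_real (a m) * cnj (U j m)) * (cnj (U p l) * U p m))"
    unfolding sum_product by (intro sum.cong refl) (simp add: mult_ac)
  also have "\<dots> = (\<Sum>l<d. \<Sum>p<d. \<Sum>m<d. of_real (a l ^ k) * U i l * (of_real (a m) * cnj (U j m)) * (cnj (U p l) * U p m))"
    by (rule sum.swap)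
  also have "\<dots> = (\<Sum>l<d. \<Sum>m<d. \<Sum>p<d. of_real (a l ^ k) * U i l * (of_real (a m) * cnj (U j m)) * (cnj (U p l) * U p m))"
    by (intro sum.cong refl sum.swap)
  also have "\<dots> = (\<Sum>l<d. \<Sum>m<d. of_real (a l ^ k) * U i l * (of_real (a m) * cnj (U j m)) * (if l = m then 1 else 0))"
    by (intro sum.cong refl) (simp add: sum_distrib_left[symmetric] orth)
  also have "\<dots> = (\<Sum>l<d. of_real (a l ^ Suc k) * U i l * cnj (U j l))"
    by (intro sum.cong refl) (simp add: if_distrib cong: if_cong)
  finally show ?case .
qed

lemma spectral_exp_sums:
  assumes "spectral d A a U" "A \<in> carrier_mat d d" "i < d" "j < d"
  shows "(\<lambda>k. (A ^\<^sub>m k) $$ (i,j) / of_nat (fact k)) sums (\<Sum>l<d. of_real (exp (a l)) * U i l * cnj (U j l))"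
proof -
  have e: "(\<lambda>k. complex_of_real (a l ^ k / fact k)) sums complex_of_real (exp (a l))" for l
    using exp_converges[of "a l"] by (intro sums_of_real) (simp add: field_simps scaleR_conv_of_real)
  have "(\<lambda>k. \<Sum>l<d. complex_of_real (a l ^ k / fact k) * U i l * cnj (U j l)) sums
     (\<Sum>l<d. complex_of_real (exp (a l)) * U i l * cnj (U j l))"
    by (intro sums_sum sums_mult2 e)
  moreover have "(\<Sum>l<d. complex_of_real (a l ^ k / fact k) * U i l * cnj (U j l)) = (A ^\<^sub>m k) $$ (i,j) / of_nat (fact k)" for k
    by (simp add: spectral_pow[OF assms] sum_divide_distrib)
  ultimately show ?thesis by simp
qed

lemma spectral_exp:
  assumes "spectral d A a U" "A \<in> carrier_mat d d" "i < d" "j < d"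
  shows "mat_exp A $$ (i,j) = (\<Sum>l<d. of_real (exp (a l)) * U i l * cnj (U j l))"
  using spectral_exp_sums[OF assms] assms by (simp add: mat_exp_def sums_iff)

text \<open>\<open>trp d C X\<close> is Tr(C X), \<open>qf\<close> is the expectation of
  \<open>C\<close> in an unnormalised vector, and \<open>conj_by\<close> gives the matrix elements
  of \<open>C\<close> between columns of \<open>U\<close>. As plain double sums they raise no
  dimension conditions on matrix products.\<close>

definition trp :: "nat \<Rightarrow> complex mat \<Rightarrow> complex mat \<Rightarrow> complex" where
  "trp d C X = (\<Sum>x<d. \<Sum>y<d. C $$ (x,y) * X $$ (y,x))"

definition qf :: "nat \<Rightarrow> complex mat \<Rightarrow> (nat \<Rightarrow> complex) \<Rightarrow> complex" where
  "qf d C f = (\<Sum>x<d. \<Sum>y<d. cnj (f x) * C $$ (x,y) * f y)"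

definition conj_by :: "nat \<Rightarrow> (nat \<Rightarrow> nat \<Rightarrow> complex) \<Rightarrow> complex mat \<Rightarrow> nat \<Rightarrow> nat \<Rightarrow> complex" where
  "conj_by d U C l k = (\<Sum>x<d. \<Sum>y<d. cnj (U x l) * C $$ (x,y) * U y k)"

lemma trp_spectral:
  assumes "\<And>i j. i < d \<Longrightarrow> j < d \<Longrightarrow> X $$ (i,j) = (\<Sum>l<d. of_real (f l) * U i l * cnj (U j l))"
  shows "trp d C X = (\<Sum>l<d. of_real (f l) * conj_by d U C l l)"
proof -
  have "trp d C X = (\<Sum>x<d. \<Sum>y<d. \<Sum>l<d. of_real (f l) * (cnj (U x l) * C $$ (x,y) * U y l))"
    unfolding trp_def by (intro sum.cong refl) (simp add: assms sum_distrib_left mult_ac)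
  also have "\<dots> = (\<Sum>x<d. \<Sum>l<d. \<Sum>y<d. of_real (f l) * (cnj (U x l) * C $$ (x,y) * U y l))"
    by (intro sum.cong refl sum.swap)
  also have "\<dots> = (\<Sum>l<d. \<Sum>x<d. \<Sum>y<d. of_real (f l) * (cnj (U x l) * C $$ (x,y) * U y l))"
    by (rule sum.swap)
  finally show ?thesis by (simp add: conj_by_def sum_distrib_left)
qed

lemma trp_exp:
  assumes "spectral d A a U" "A \<in> carrier_mat d d"
  shows "trp d C (mat_exp A) = (\<Sum>l<d. of_real (exp (a l)) * conj_by d U C l l)"
  by (rule trp_spectral) (rule spectral_exp[OF assms])

text \<open>The resolution of the identity by the columns of \<open>U\<close> is inserted between
  \<open>C\<close> and \<open>D\<close>.\<close>

lemma conj_by_spectral_mult: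
  assumes U: "orthonormal d U" and C: "C \<in> carrier_mat d d" "D \<in> carrier_mat d d" "p < d" "q < d"
  shows "conj_by d U (C * D) p q = (\<Sum>l<d. conj_by d U C p l * conj_by d U D l q)"
proof -
  have "(\<Sum>l<d. conj_by d U C p l * conj_by d U D l q)
     = (\<Sum>l<d. \<Sum>x<d. \<Sum>x'<d. \<Sum>y<d. \<Sum>y'<d. cnj (U x p) * C $$ (x,y) * U y l * (cnj (U x' l) * D $$ (x',y') * U y' q))"
    unfolding conj_by_def sum_product ..
  also have "\<dots> = (\<Sum>x<d. \<Sum>l<d. \<Sum>x'<d. \<Sum>y<d. \<Sum>y'<d. cnj (U x p) * C $$ (x,y) * U y l * (cnj (U x' l) * D $$ (x',y') * U y' q))"
    by (rule sum.swap)
  also have "\<dots> = (\<Sum>x<d. \<Sum>x'<d. \<Sum>l<d. \<Sum>y<d. \<Sum>y'<d. cnj (U x p) * C $$ (x,y) * U y l * (cnj (U x' l) * D $$ (x',y') * U y' q))"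
    by (intro sum.cong refl sum.swap)
  also have "\<dots> = (\<Sum>x<d. \<Sum>x'<d. \<Sum>y<d. \<Sum>l<d. \<Sum>y'<d. cnj (U x p) * C $$ (x,y) * U y l * (cnj (U x' l) * D $$ (x',y') * U y' q))"
    by (intro sum.cong refl sum.swap)
  also have "\<dots> = (\<Sum>x<d. \<Sum>x'<d. \<Sum>y<d. \<Sum>y'<d. \<Sum>l<d. cnj (U x p) * C $$ (x,y) * U y l * (cnj (U x' l) * D $$ (x',y') * U y' q))"
    by (intro sum.cong refl sum.swap)
  also have "\<dots> = (\<Sum>x<d. \<Sum>x'<d. \<Sum>y<d. \<Sum>y'<d. \<Sum>l<d. cnj (U x p) * C $$ (x,y) * D $$ (x',y') * U y' q * (U y l * cnj (U x' l)))"
    by (intro sum.cong refl) (simp add: mult_ac)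
  also have "\<dots> = (\<Sum>x<d. \<Sum>x'<d. \<Sum>y<d. \<Sum>y'<d. cnj (U x p) * C $$ (x,y) * D $$ (x',y') * U y' q * (if y = x' then 1 else 0))"
    by (intro sum.cong refl) (simp add: sum_distrib_left[symmetric] orthonormal_rows[OF U])
  also have "\<dots> = (\<Sum>x<d. \<Sum>x'<d. \<Sum>y'<d. cnj (U x p) * C $$ (x,x') * D $$ (x',y') * U y' q)"
  proof (rule sum.cong[OF refl], rule sum.cong[OF refl])
    fix x x' assume "x' \<in> {..<d}"
    have "(\<Sum>y<d. \<Sum>y'<d. cnj (U x p) * C $$ (x,y) * D $$ (x',y') * U y' q * (if y = x' then 1 else 0))
      = (\<Sum>y<d. if y = x' then (\<Sum>y'<d. cnj (U x p) * C $$ (x,y) * D $$ (x',y') * U y' q) else 0)"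
      by (intro sum.cong refl) simp
    then show "(\<Sum>y<d. \<Sum>y'<d. cnj (U x p) * C $$ (x,y) * D $$ (x',y') * U y' q * (if y = x' then 1 else 0))
      = (\<Sum>y'<d. cnj (U x p) * C $$ (x,x') * D $$ (x',y') * U y' q)" using \<open>x' \<in> {..<d}\<close> by simp
  qed
  also have "\<dots> = (\<Sum>x<d. \<Sum>y'<d. \<Sum>x'<d. cnj (U x p) * C $$ (x,x') * D $$ (x',y') * U y' q)"
    by (intro sum.cong refl sum.swap)
  also have "\<dots> = conj_by d U (C * D) p q"
    unfolding conj_by_def
    by (intro sum.cong refl)
      (simp add: mult_mat_sum[OF C(1,2)] sum_distrib_left sum_distrib_right mult_ac del: index_mult_mat)
  finally show ?thesis by simp
qed

lemma conj_by_hermitian: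
  assumes "hermitian d B"
  shows "conj_by d U B k l = cnj (conj_by d U B l k)"
proof -
  have h: "cnj (B $$ (x,y)) = B $$ (y,x)" if "x < d" "y < d" for x y
    using assms that unfolding hermitian_def by (metis complex_cnj_cnj)
  have "cnj (conj_by d U B l k) = (\<Sum>x<d. \<Sum>y<d. U x l * B $$ (y,x) * cnj (U y k))"
    unfolding conj_by_def cnj_sum by (intro sum.cong refl) (simp add: h)
  also have "\<dots> = (\<Sum>y<d. \<Sum>x<d. U x l * B $$ (y,x) * cnj (U y k))" by (rule sum.swap)
  finally show ?thesis by (simp add: conj_by_def mult_ac)
qed

lemma conj_by_one:
  assumes "orthonormal d U" "l < d" "k < d"
  shows "conj_by d U (1\<^sub>m d) l k = (if l = k then 1 else 0)"
proof -
  have "conj_by d U (1\<^sub>m d) l k = (\<Sum>x<d. \<Sum>y<d. if x = y then cnj (U x l) * U y k else 0)"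
    unfolding conj_by_def by (intro sum.cong refl) auto
  also have "\<dots> = (\<Sum>x<d. cnj (U x l) * U x k)" by simp
  finally show ?thesis using assms unfolding orthonormal_def by simp
qed

lemma conj_by_self:
  assumes S: "spectral d A a U" and "l < d" "k < d"
  shows "conj_by d U A l k = (if l = k then of_real (a l) else 0)"
proof -
  have o: "orthonormal d U" using S by (simp add: spectral_def)
  have "conj_by d U A l k = (\<Sum>x<d. \<Sum>y<d. \<Sum>p<d. of_real (a p) * (cnj (U x l) * U x p) * (cnj (U y p) * U y k))"
    unfolding conj_by_def using S
    by (intro sum.cong refl) (simp add: spectral_def sum_distrib_left sum_distrib_right mult_ac)
  also have "\<dots> = (\<Sum>x<d. \<Sum>p<d. \<Sum>y<d. of_real (a p) * (cnj (U x l) * U x p) * (cnj (U y p) * U y k))"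
    by (intro sum.cong refl sum.swap)
  also have "\<dots> = (\<Sum>x<d. \<Sum>p<d. of_real (a p) * (cnj (U x l) * U x p) * (if p = k then 1 else 0))"
    using o assms(3) by (intro sum.cong refl) (simp add: sum_distrib_left[symmetric] orthonormal_def)
  also have "\<dots> = (\<Sum>x<d. of_real (a k) * (cnj (U x l) * U x k))"
    using assms by (intro sum.cong refl) (simp add: if_distrib cong: if_cong)
  also have "\<dots> = (if l = k then of_real (a l) else 0)"
    using o assms by (simp add: sum_distrib_left[symmetric] orthonormal_def)
  finally show ?thesis .
qed

subsection \<open>Divided differences of the exponential\<close>

text \<open>The divided difference of exp, equal to the integral of exp(t x + (1 - t) y) over t in
  [0,1]. In an eigenbasis it is the kernel of Duhamel's formula for the derivative of a matrix
  exponential.\<close>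

definition dexp :: "real \<Rightarrow> real \<Rightarrow> real" where
  "dexp x y = (if x = y then exp x else (exp x - exp y) / (x - y))"

text \<open>The inner sums are what the noncommutative Leibniz rule for the k-th power produces in
  an eigenbasis. Off the diagonal they come from factoring x^k - y^k; on the diagonal all k summands
  coincide.\<close>

lemma dexp_sums: "(\<lambda>k. (\<Sum>l<k. x ^ l * y ^ (k - Suc l)) / fact k) sums dexp x y"
proof (cases "x = y")
  case True
  have "(\<lambda>k. x ^ k / fact k) sums exp x"
    using exp_converges[of x] by (simp add: field_simps)
  moreover have "(\<Sum>l<Suc k. x ^ l * x ^ (k - l)) / fact (Suc k) = x ^ k / fact k" for k
  proof -
    have "(\<Sum>l<Suc k. x ^ l * x ^ (k - l)) = (\<Sum>l<Suc k. x ^ k)"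
      by (intro sum.cong refl) (auto simp flip: power_add)
    then show ?thesis by (simp add: field_simps del: of_nat_Suc)
  qed
  ultimately have "(\<lambda>k. (\<Sum>l<Suc k. x ^ l * x ^ (Suc k - Suc l)) / fact (Suc k)) sums exp x"
    by simp
  \<comment> \<open>The term k = 0 is an empty sum, so the series is the exponential series shifted
    by one.\<close>
  from sums_Suc[OF this] show ?thesis using True by (simp add: dexp_def)
next
  case False
  have e: "(\<Sum>l<k. x ^ l * y ^ (k - Suc l)) = (x ^ k - y ^ k) / (x - y)" for k
    using power_diff_sumr2[of x k y] False by (simp add: mult.commute)
  have "(\<lambda>k. x ^ k / fact k - y ^ k / fact k) sums (exp x - exp y)"
    using exp_converges[of x] exp_converges[of y] by (intro sums_diff) (auto simp: field_simps)
  then have "(\<lambda>k. (x ^ k / fact k - y ^ k / fact k) / (x - y)) sums ((exp x - exp y) / (x - y))"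
    by (rule sums_divide)
  moreover have "(x ^ k / fact k - y ^ k / fact k) / (x - y) = (\<Sum>l<k. x ^ l * y ^ (k - Suc l)) / fact k" for k
    unfolding e by (simp add: diff_divide_distrib divide_divide_eq_left mult.commute)
  ultimately show ?thesis using False by (simp add: dexp_def)
qed

lemma dexp_sym: "dexp x y = dexp y x"
  by (auto simp: dexp_def) (metis minus_diff_eq minus_divide_divide)

lemma dexp_sinh:
  assumes "d \<noteq> 0"
  shows "dexp (m + d) (m - d) = exp m * (sinh d / d)"
  using assms by (simp add: dexp_def sinh_def exp_add exp_diff exp_minus field_simps)

text \<open>This and the next inequality compare functions that vanish at 0 through their
  derivatives. They are the two bounds on \<open>dexp\<close> after centring at the midpoint of its
  arguments.\<close>

lemma sinh_le_cosh: "0 \<le> d \<Longrightarrow> sinh d \<le> d * cosh (d::real)"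
proof -
  assume d: "0 \<le> d"
  have "(\<lambda>d. d * cosh d - sinh d) 0 \<le> (\<lambda>d::real. d * cosh d - sinh d) d"
    by (rule DERIV_nonneg_imp_nondecreasing[OF d])
      (auto intro!: exI derivative_eq_intros mult_nonneg_nonneg)
  then show ?thesis by simp
qed

lemma cosh_le_sinh: "0 \<le> d \<Longrightarrow> d * cosh d \<le> sinh d * (1 + d\<^sup>2)" for d :: real
proof -
  assume d: "0 \<le> d"
  have "(\<lambda>d. sinh d * (1 + d\<^sup>2) - d * cosh d) 0 \<le> (\<lambda>d::real. sinh d * (1 + d\<^sup>2) - d * cosh d) d"
  proof (rule DERIV_nonneg_imp_nondecreasing[OF d])
    fix x :: real assume x: "0 \<le> x" "x \<le> d"
    have "((\<lambda>d. sinh d * (1 + d\<^sup>2) - d * cosh d) has_real_derivative (x\<^sup>2 * cosh x + x * sinh x)) (at x)"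
      by (auto intro!: derivative_eq_intros simp: algebra_simps power2_eq_square)
    moreover have "0 \<le> x\<^sup>2 * cosh x + x * sinh x" using x by simp
    ultimately show "\<exists>y. ((\<lambda>d. sinh d * (1 + d\<^sup>2) - d * cosh d) has_real_derivative y) (at x) \<and> 0 \<le> y"
      by blast
  qed
  then show ?thesis by simp
qed

lemma dexp_bounds_aux:
  assumes "d > 0"
  shows "dexp (m + d) (m - d) \<le> (exp (m + d) + exp (m - d)) / 2"
    and "dexp (m + d) (m - d) \<ge> (exp (m + d) + exp (m - d)) / 2 - 2 * d * (exp (m + d) - exp (m - d)) / 4"
proof -
  have c: "(exp (m + d) + exp (m - d)) / 2 = exp m * cosh d"
    by (simp add: cosh_def exp_add exp_diff exp_minus field_simps)
  have s: "exp (m + d) - exp (m - d) = 2 * exp m * sinh d"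
    by (simp add: sinh_def exp_add exp_diff exp_minus field_simps)
  have ds: "dexp (m + d) (m - d) = exp m * (sinh d / d)" using assms by (simp add: dexp_sinh)
  have "sinh d / d \<le> cosh d" using sinh_le_cosh[of d] assms by (simp add: field_simps)
  then show "dexp (m + d) (m - d) \<le> (exp (m + d) + exp (m - d)) / 2"
    unfolding c ds by (intro mult_left_mono) auto
  have "cosh d \<le> sinh d / d + d * sinh d"
    using cosh_le_sinh[of d] assms by (simp add: field_simps power2_eq_square)
  then have "exp m * cosh d \<le> exp m * (sinh d / d + d * sinh d)" by simp
  then show "dexp (m + d) (m - d) \<ge> (exp (m + d) + exp (m - d)) / 2 - 2 * d * (exp (m + d) - exp (m - d)) / 4"
    unfolding c s ds by (simp add: algebra_simps)
qed

text \<open>The arithmetic mean as upper bound turns a Bogoliubov variance into an expectation of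
  B^2. The correction (x - y)(exp x - exp y) / 4 in the lower bound has this form because, summed in
  an eigenbasis, it becomes the trace of a double commutator.\<close>

lemma dexp_bounds:
  shows "dexp x y \<le> (exp x + exp y) / 2"
    and "dexp x y \<ge> (exp x + exp y) / 2 - (x - y) * (exp x - exp y) / 4"
    and "dexp x y \<ge> 0"
proof -
  have *: "dexp x y \<le> (exp x + exp y) / 2 \<and> dexp x y \<ge> (exp x + exp y) / 2 - (x - y) * (exp x - exp y) / 4" if "x > y" for x y
    using dexp_bounds_aux[of "(x - y) / 2" "(x + y) / 2"] that by (simp add: field_simps)
  have "dexp x y \<le> (exp x + exp y) / 2 \<and> dexp x y \<ge> (exp x + exp y) / 2 - (x - y) * (exp x - exp y) / 4"
  proof (cases x y rule: linorder_cases)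
    case less
    have "(y - x) * (exp y - exp x) = (x - y) * (exp x - exp y)" by (simp add: algebra_simps)
    with *[OF less] show ?thesis by (simp add: dexp_sym[of x y] add.commute)
  next
    case equal
    then show ?thesis by (simp add: dexp_def)
  next
    case greater
    then show ?thesis by (rule *)
  qed
  then show "dexp x y \<le> (exp x + exp y) / 2" "dexp x y \<ge> (exp x + exp y) / 2 - (x - y) * (exp x - exp y) / 4"
    by auto
  show "dexp x y \<ge> 0" by (cases x y rule: linorder_cases) (auto simp: dexp_def divide_nonpos_nonpos)
qed

subsection \<open>Differentiating traces of exponentials\<close>

text \<open>The Leibniz rule without commutation: \<open>B\<close> takes the place of one of the k
  factors. The induction splits off the last factor.\<close>

lemma pow_entry_deriv:
  fixes A B :: "complex mat"
  assumes A: "A \<in> carrier_mat d d" and B: "B \<in> carrier_mat d d" and "i < d" "j < d"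
  shows "((\<lambda>t. ((A + t \<cdot>\<^sub>m B) ^\<^sub>m k) $$ (i,j)) has_field_derivative
    (\<Sum>l<k. ((A + t \<cdot>\<^sub>m B) ^\<^sub>m l * B * (A + t \<cdot>\<^sub>m B) ^\<^sub>m (k - Suc l)) $$ (i,j))) (at t)"
  using assms(3,4)
proof (induction k arbitrary: i j)
  case 0
  then show ?case using A B by simp
next
  case (Suc k)
  define X where "X = A + t \<cdot>\<^sub>m B"
  have X: "X \<in> carrier_mat d d" unfolding X_def using A B by simp
  have eq: "((A + u \<cdot>\<^sub>m B) ^\<^sub>m Suc k) $$ (i,j) = (\<Sum>p<d. ((A + u \<cdot>\<^sub>m B) ^\<^sub>m k) $$ (i,p) * (A $$ (p,j) + u * B $$ (p,j)))" for u
    using mult_mat_sum[of "(A + u \<cdot>\<^sub>m B) ^\<^sub>m k" d "A + u \<cdot>\<^sub>m B" i j] A B Suc.prems by simp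
  have IH: "((\<lambda>t. ((A + t \<cdot>\<^sub>m B) ^\<^sub>m k) $$ (i,p)) has_field_derivative
      (\<Sum>l<k. (X ^\<^sub>m l * B * X ^\<^sub>m (k - Suc l)) $$ (i,p))) (at t)" if "p < d" for p
    using Suc.IH[OF Suc.prems(1) that] unfolding X_def .
  have "((\<lambda>u. \<Sum>p<d. ((A + u \<cdot>\<^sub>m B) ^\<^sub>m k) $$ (i,p) * (A $$ (p,j) + u * B $$ (p,j))) has_field_derivative
     (\<Sum>p<d. (\<Sum>l<k. (X ^\<^sub>m l * B * X ^\<^sub>m (k - Suc l)) $$ (i,p)) * X $$ (p,j) + (X ^\<^sub>m k) $$ (i,p) * B $$ (p,j))) (at t)"
  proof (rule DERIV_sum)
    fix p assume "p \<in> {..<d}"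
    then have p: "p < d" by simp
    show "((\<lambda>u. ((A + u \<cdot>\<^sub>m B) ^\<^sub>m k) $$ (i,p) * (A $$ (p,j) + u * B $$ (p,j))) has_field_derivative
     ((\<Sum>l<k. (X ^\<^sub>m l * B * X ^\<^sub>m (k - Suc l)) $$ (i,p)) * X $$ (p,j) + (X ^\<^sub>m k) $$ (i,p) * B $$ (p,j))) (at t)"
      by (rule derivative_eq_intros IH[OF p] refl)+ (use A B p Suc.prems in \<open>simp add: X_def\<close>)
  qed
  also have "(\<Sum>p<d. (\<Sum>l<k. (X ^\<^sub>m l * B * X ^\<^sub>m (k - Suc l)) $$ (i,p)) * X $$ (p,j) + (X ^\<^sub>m k) $$ (i,p) * B $$ (p,j))
     = (\<Sum>l<k. \<Sum>p<d. (X ^\<^sub>m l * B * X ^\<^sub>m (k - Suc l)) $$ (i,p) * X $$ (p,j)) + (\<Sum>p<d. (X ^\<^sub>m k) $$ (i,p) * B $$ (p,j))"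
    unfolding sum.distrib sum_distrib_right by (subst sum.swap) simp
  also have "(\<Sum>p<d. (X ^\<^sub>m k) $$ (i,p) * B $$ (p,j)) = (X ^\<^sub>m k * B * X ^\<^sub>m (Suc k - Suc k)) $$ (i,j)"
    using X B Suc.prems mult_mat_sum[of "X ^\<^sub>m k" d B i j] by simp
  also have "(\<Sum>l<k. \<Sum>p<d. (X ^\<^sub>m l * B * X ^\<^sub>m (k - Suc l)) $$ (i,p) * X $$ (p,j))
     = (\<Sum>l<k. (X ^\<^sub>m l * B * X ^\<^sub>m (Suc k - Suc l)) $$ (i,j))"
  proof (rule sum.cong[OF refl])
    fix l assume "l \<in> {..<k}"
    then have l: "Suc k - Suc l = Suc (k - Suc l)" by simp
    have c: "X ^\<^sub>m l * B * X ^\<^sub>m (k - Suc l) \<in> carrier_mat d d"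
      using X B by (intro mult_carrier_mat[of _ d d] pow_carrier_mat) auto
    have eq: "X ^\<^sub>m l * B * X ^\<^sub>m (Suc k - Suc l) = X ^\<^sub>m l * B * X ^\<^sub>m (k - Suc l) * X"
      unfolding l pow_mat.simps using X B by (intro assoc_mult_mat[symmetric, of _ d d _ d _ d]) auto
    show "(\<Sum>p<d. (X ^\<^sub>m l * B * X ^\<^sub>m (k - Suc l)) $$ (i,p) * X $$ (p,j)) = (X ^\<^sub>m l * B * X ^\<^sub>m (Suc k - Suc l)) $$ (i,j)"
      by (simp only: eq mult_mat_sum[OF c X Suc.prems])
  qed
  also have "\<dots> + (X ^\<^sub>m k * B * X ^\<^sub>m (Suc k - Suc k)) $$ (i,j) = (\<Sum>l<Suc k. (X ^\<^sub>m l * B * X ^\<^sub>m (Suc k - Suc l)) $$ (i,j))"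
    by simp
  finally show ?case unfolding eq X_def .
qed

text \<open>A crude majorant for the exponential series: \<open>K\<close> bounds the column sums, so
  each further multiplication costs a factor \<open>K\<close>.\<close>

lemma pow_entry_bound:
  assumes X: "X \<in> carrier_mat d d" and K: "\<And>j. j < d \<Longrightarrow> (\<Sum>p<d. cmod (X $$ (p,j))) \<le> K" "K \<ge> 0" and "i < d" "j < d"
  shows "cmod ((X ^\<^sub>m k) $$ (i,j)) \<le> K ^ k"
  using assms(4,5)
proof (induction k arbitrary: i j)
  case 0
  then show ?case using X by simp
next
  case (Suc k)
  have "cmod ((X ^\<^sub>m Suc k) $$ (i,j)) = cmod (\<Sum>p<d. (X ^\<^sub>m k) $$ (i,p) * X $$ (p,j))"
    using mult_mat_sum[of "X ^\<^sub>m k" d X i j] X Suc.prems by simp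
  also have "\<dots> \<le> (\<Sum>p<d. cmod ((X ^\<^sub>m k) $$ (i,p)) * cmod (X $$ (p,j)))"
    by (rule order_trans[OF norm_sum]) (simp add: norm_mult)
  also have "\<dots> \<le> (\<Sum>p<d. K ^ k * cmod (X $$ (p,j)))"
    by (intro sum_mono mult_right_mono) (auto simp: Suc.IH Suc.prems)
  also have "\<dots> \<le> K ^ k * K"
    unfolding sum_distrib_left[symmetric] by (intro mult_left_mono K Suc.prems) (simp add: K)
  finally show ?case by (simp add: mult.commute)
qed

lemma triple_entry_bound:
  assumes X: "X \<in> carrier_mat d d" and B: "B \<in> carrier_mat d d"
    and K: "\<And>j. j < d \<Longrightarrow> (\<Sum>p<d. cmod (X $$ (p,j))) \<le> K" "K \<ge> 0"
    and KB: "(\<Sum>p<d. \<Sum>r<d. cmod (B $$ (p,r))) \<le> K" and ij: "i < d" "j < d"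
  shows "cmod ((X ^\<^sub>m l * B * X ^\<^sub>m m) $$ (i,j)) \<le> K ^ Suc (l + m)"
proof -
  have "(X ^\<^sub>m l * B * X ^\<^sub>m m) $$ (i,j) = (\<Sum>r<d. (X ^\<^sub>m l * B) $$ (i,r) * (X ^\<^sub>m m) $$ (r,j))"
    using X B ij by (intro mult_mat_sum) auto
  also have "\<dots> = (\<Sum>r<d. \<Sum>p<d. (X ^\<^sub>m l) $$ (i,p) * B $$ (p,r) * (X ^\<^sub>m m) $$ (r,j))"
    by (intro sum.cong refl, subst mult_mat_sum[of _ d]) (use X B ij in \<open>auto simp: sum_distrib_right\<close>)
  finally have "cmod ((X ^\<^sub>m l * B * X ^\<^sub>m m) $$ (i,j)) \<le> (\<Sum>r<d. \<Sum>p<d. cmod ((X ^\<^sub>m l) $$ (i,p)) * cmod (B $$ (p,r)) * cmod ((X ^\<^sub>m m) $$ (r,j)))"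
    by (simp only:) (intro order_trans[OF norm_sum] sum_mono, simp add: norm_mult)
  also have "\<dots> \<le> (\<Sum>r<d. \<Sum>p<d. K ^ l * cmod (B $$ (p,r)) * K ^ m)"
    using pow_entry_bound[OF X K] ij K(2) by (intro sum_mono mult_mono) auto
  also have "\<dots> = K ^ l * K ^ m * (\<Sum>p<d. \<Sum>r<d. cmod (B $$ (p,r)))"
    by (subst sum.swap) (simp add: sum_distrib_left mult_ac)
  also have "\<dots> \<le> K ^ l * K ^ m * K" using KB K(2) by (intro mult_left_mono) auto
  finally show ?thesis by (simp add: power_add mult_ac)
qed

lemma trp_conj:
  assumes U: "orthonormal d U" and C: "C \<in> carrier_mat d d" "M \<in> carrier_mat d d"
  shows "trp d C M = (\<Sum>q<d. \<Sum>p<d. conj_by d U C q p * conj_by d U M p q)"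
proof -
  have "(\<Sum>q<d. conj_by d U (C * M) q q) = (\<Sum>q<d. \<Sum>x<d. \<Sum>y<d. (C * M) $$ (x,y) * (U y q * cnj (U x q)))"
    unfolding conj_by_def by (simp add: mult_ac)
  also have "\<dots> = (\<Sum>x<d. \<Sum>q<d. \<Sum>y<d. (C * M) $$ (x,y) * (U y q * cnj (U x q)))" by (rule sum.swap)
  also have "\<dots> = (\<Sum>x<d. \<Sum>y<d. \<Sum>q<d. (C * M) $$ (x,y) * (U y q * cnj (U x q)))"
    by (rule sum.cong[OF refl], rule sum.swap)
  also have "\<dots> = (\<Sum>x<d. \<Sum>y<d. if x = y then (C * M) $$ (x,y) else 0)"
    by (intro sum.cong refl) (auto simp: sum_distrib_left[symmetric] orthonormal_rows[OF U])
  also have "\<dots> = (\<Sum>x<d. (C * M) $$ (x,x))" by simp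
  also have "\<dots> = trp d C M"
    unfolding trp_def using C by (intro sum.cong refl) (simp add: mult_mat_sum del: index_mult_mat)
  finally show ?thesis using conj_by_spectral_mult[OF U C] by simp
qed

text \<open>Duhamel's formula under the trace. The exponential series is differentiated term by
  term; \<open>A\<close> is diagonalised only at the base point, where the Leibniz terms add up to
  divided differences.\<close>

lemma trp_exp_deriv:
  assumes S: "spectral d A a U" and A: "A \<in> carrier_mat d d" and B: "B \<in> carrier_mat d d" and C: "C \<in> carrier_mat d d"
  shows "((\<lambda>t. trp d C (mat_exp (A + t \<cdot>\<^sub>m B))) has_field_derivative
    (\<Sum>q<d. \<Sum>p<d. conj_by d U C q p * conj_by d U B p q * of_real (dexp (a p) (a q)))) (at 0)"
proof -
  \<comment> \<open>One constant for all |t| < 1: it dominates the column sums of A + t B and the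
    sum of all entries of \<open>B\<close> in modulus.\<close>
  define K where "K = 1 + (\<Sum>p<d. \<Sum>r<d. cmod (A $$ (p,r)) + cmod (B $$ (p,r)))"
  have K0: "K \<ge> 0" unfolding K_def by (intro add_nonneg_nonneg sum_nonneg) auto
  define X where "X t = A + t \<cdot>\<^sub>m B" for t
  have X: "X t \<in> carrier_mat d d" for t unfolding X_def using A B by simp
  have KB: "(\<Sum>p<d. \<Sum>r<d. cmod (B $$ (p,r))) \<le> K"
  proof -
    have "(\<Sum>p<d. \<Sum>r<d. cmod (B $$ (p,r))) \<le> (\<Sum>p<d. \<Sum>r<d. cmod (A $$ (p,r)) + cmod (B $$ (p,r)))"
      by (intro sum_mono) auto
    then show ?thesis unfolding K_def by simp
  qed
  have KX: "(\<Sum>p<d. cmod (X t $$ (p,j))) \<le> K" if "t \<in> ball 0 1" "j < d" for t j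
  proof -
    have "(\<Sum>p<d. cmod (X t $$ (p,j))) \<le> (\<Sum>p<d. \<Sum>r<d. cmod (A $$ (p,r)) + cmod (B $$ (p,r)))"
    proof (rule sum_mono)
      fix p assume "p \<in> {..<d}"
      then have p: "p < d" by simp
      have "cmod (X t $$ (p,j)) \<le> cmod (A $$ (p,j)) + cmod t * cmod (B $$ (p,j))"
        unfolding X_def using A B p that by (simp add: norm_triangle_le norm_mult)
      also have "\<dots> \<le> cmod (A $$ (p,j)) + 1 * cmod (B $$ (p,j))"
        using that by (intro add_left_mono mult_right_mono) auto
      also have "\<dots> \<le> (\<Sum>r<d. cmod (A $$ (p,r)) + cmod (B $$ (p,r)))"
        using that member_le_sum[of j "{..<d}" "\<lambda>r. cmod (A $$ (p,r)) + cmod (B $$ (p,r))"] by simp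
      finally show "cmod (X t $$ (p,j)) \<le> (\<Sum>r<d. cmod (A $$ (p,r)) + cmod (B $$ (p,r)))" .
    qed
    then show ?thesis unfolding K_def by simp
  qed
  define f where "f k t = (\<Sum>x<d. \<Sum>y<d. C $$ (x,y) * ((X t ^\<^sub>m k) $$ (y,x) / fact k))" for k t
  define f' where "f' k t = (\<Sum>x<d. \<Sum>y<d. C $$ (x,y) * ((\<Sum>l<k. (X t ^\<^sub>m l * B * X t ^\<^sub>m (k - Suc l)) $$ (y,x)) / fact k))" for k t
  define CC where "CC = (\<Sum>x<d. \<Sum>y<d. cmod (C $$ (x,y)))"
  have CC: "CC \<ge> 0" unfolding CC_def by (intro sum_nonneg) auto
  have deriv: "(f k has_field_derivative f' k t) (at t within ball 0 1)" for k t
    unfolding f_def f'_def X_def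
    by (intro DERIV_sum DERIV_cmult DERIV_cdivide has_field_derivative_at_within[OF pow_entry_deriv[OF A B]]) auto
  have f'bd: "cmod (f' k t) \<le> CC * ((2 * K) ^ k / fact k)" if t: "t \<in> ball 0 1" for k t
  proof -
    have in1: "cmod ((\<Sum>l<k. (X t ^\<^sub>m l * B * X t ^\<^sub>m (k - Suc l)) $$ (y,x)) / fact k) \<le> (2 * K) ^ k / fact k"
      if xy: "x < d" "y < d" for x y
    proof -
      \<comment> \<open>There are k Leibniz terms, each at most K^k, and k \<le> 2^k; this is where
        the 2 in the majorant comes from.\<close>
      have "cmod (\<Sum>l<k. (X t ^\<^sub>m l * B * X t ^\<^sub>m (k - Suc l)) $$ (y,x)) \<le> (\<Sum>l<k. K ^ k)"
      proof (rule order_trans[OF norm_sum sum_mono])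
        fix l assume "l \<in> {..<k}"
        then have "Suc (l + (k - Suc l)) = k" by simp
        then show "cmod ((X t ^\<^sub>m l * B * X t ^\<^sub>m (k - Suc l)) $$ (y,x)) \<le> K ^ k"
          using triple_entry_bound[OF X B KX[OF t] K0 KB xy(2,1), of l "k - Suc l"] by simp
      qed
      also have "\<dots> \<le> 2 ^ k * K ^ k"
        using mult_right_mono[OF less_imp_le[OF of_nat_less_two_power[of k, where 'a=real]], of "K ^ k"] K0
        by simp
      finally show ?thesis by (simp add: norm_divide divide_right_mono power_mult_distrib)
    qed
    have "cmod (f' k t) \<le> (\<Sum>x<d. \<Sum>y<d. cmod (C $$ (x,y)) * ((2 * K) ^ k / fact k))"
      unfolding f'_def
      by (intro order_trans[OF norm_sum] sum_mono) (simp only: norm_mult, intro mult_left_mono in1, auto)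
    then show ?thesis by (simp only: CC_def sum_distrib_right)
  qed
  have summ: "summable (\<lambda>k. CC * ((2 * K) ^ k / fact k))"
    using summable_exp[of "2 * K"] by (intro summable_mult) (simp add: field_simps)
  have entry_summable: "summable (\<lambda>k. (X t ^\<^sub>m k) $$ (y,x) / fact k)" if t: "t \<in> ball 0 1" and "x < d" "y < d" for t x y
  proof (rule summable_comparison_test)
    show "summable (\<lambda>k. K ^ k / fact k)" using summable_exp[of K] by (simp add: field_simps)
    show "\<exists>N. \<forall>n\<ge>N. norm ((X t ^\<^sub>m n) $$ (y,x) / fact n) \<le> K ^ n / fact n"
      using pow_entry_bound[OF X KX[OF t] K0] that by (auto simp: norm_divide divide_right_mono)
  qed
  have expeq: "trp d C (mat_exp (X t)) = (\<Sum>k. f k t)" and fsum: "summable (\<lambda>k. f k t)" if t: "t \<in> ball 0 1" for t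
  proof -
    have e: "mat_exp (X t) $$ (y,x) = (\<Sum>k. (X t ^\<^sub>m k) $$ (y,x) / fact k)" if "x < d" "y < d" for x y
      using X[of t] that by (simp add: mat_exp_def)
    have "(\<lambda>k. f k t) sums (\<Sum>x<d. \<Sum>y<d. C $$ (x,y) * (\<Sum>k. (X t ^\<^sub>m k) $$ (y,x) / fact k))"
      unfolding f_def by (intro sums_sum sums_mult summable_sums entry_summable[OF t]) auto
    also have "(\<Sum>x<d. \<Sum>y<d. C $$ (x,y) * (\<Sum>k. (X t ^\<^sub>m k) $$ (y,x) / fact k)) = trp d C (mat_exp (X t))"
      unfolding trp_def by (intro sum.cong refl) (simp add: e)
    finally show "trp d C (mat_exp (X t)) = (\<Sum>k. f k t)" "summable (\<lambda>k. f k t)" by (auto simp: sums_iff)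
  qed
  have unif: "uniformly_convergent_on (ball 0 1) (\<lambda>n t. \<Sum>k<n. f' k t)"
    by (rule Weierstrass_m_test'[OF _ summ]) (use f'bd in auto)
  have D0: "((\<lambda>t. \<Sum>k. f k t) has_field_derivative (\<Sum>k. f' k 0)) (at 0)"
    by (rule has_field_derivative_series'(2)[OF _ deriv unif, of 0]) (auto intro: fsum)
  have "f' k 0 = (\<Sum>q<d. \<Sum>p<d. conj_by d U C q p * conj_by d U B p q * of_real ((\<Sum>l<k. a p ^ l * a q ^ (k - Suc l)) / fact k))" for k
  proof -
    have o: "orthonormal d U" using S by (simp add: spectral_def)
    have X0: "X 0 = A" unfolding X_def using A B by (intro eq_matI) auto
    have Sk: "spectral d (A ^\<^sub>m l) (\<lambda>i. a i ^ l) U" for l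
      using S spectral_pow[OF S A] by (simp add: spectral_def)
    have tr: "trp d C (A ^\<^sub>m l * B * A ^\<^sub>m m) = (\<Sum>q<d. \<Sum>p<d. conj_by d U C q p * conj_by d U B p q * of_real (a p ^ l * a q ^ m))" for l m
    proof -
      have "conj_by d U (A ^\<^sub>m l * B * A ^\<^sub>m m) p q = of_real (a p ^ l) * conj_by d U B p q * of_real (a q ^ m)" if pq: "p < d" "q < d" for p q
      proof -
        have 1: "conj_by d U (A ^\<^sub>m l * B) p r = of_real (a p ^ l) * conj_by d U B p r" if "r < d" for r
          using A B pq that
          by (subst conj_by_spectral_mult[OF o]) (auto simp: conj_by_self[OF Sk] if_distrib[of "\<lambda>z. z * _"] cong: if_cong)
        show ?thesis using A B pq
          by (subst conj_by_spectral_mult[OF o]) (auto simp: conj_by_self[OF Sk] 1 if_distrib cong: if_cong)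
      qed
      then show ?thesis using A B C
        by (subst trp_conj[OF o]) (auto simp: mult_ac intro!: sum.cong)
    qed
    have "f' k 0 = (\<Sum>l<k. trp d C (A ^\<^sub>m l * B * A ^\<^sub>m (k - Suc l))) / fact k"
    proof -
      have "(\<Sum>l<k. trp d C (A ^\<^sub>m l * B * A ^\<^sub>m (k - Suc l))) = (\<Sum>x<d. \<Sum>l<k. \<Sum>y<d. C $$ (x,y) * (A ^\<^sub>m l * B * A ^\<^sub>m (k - Suc l)) $$ (y,x))"
        unfolding trp_def by (rule sum.swap)
      also have "\<dots> = (\<Sum>x<d. \<Sum>y<d. \<Sum>l<k. C $$ (x,y) * (A ^\<^sub>m l * B * A ^\<^sub>m (k - Suc l)) $$ (y,x))"
        by (rule sum.cong[OF refl], rule sum.swap)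
      finally show ?thesis
        unfolding f'_def X0 by (simp add: sum_divide_distrib sum_distrib_left)
    qed
    also have "(\<Sum>l<k. trp d C (A ^\<^sub>m l * B * A ^\<^sub>m (k - Suc l)))
      = (\<Sum>q<d. \<Sum>l<k. \<Sum>p<d. conj_by d U C q p * conj_by d U B p q * of_real (a p ^ l * a q ^ (k - Suc l)))"
      unfolding tr by (rule sum.swap)
    also have "\<dots> = (\<Sum>q<d. \<Sum>p<d. \<Sum>l<k. conj_by d U C q p * conj_by d U B p q * of_real (a p ^ l * a q ^ (k - Suc l)))"
      by (rule sum.cong[OF refl], rule sum.swap)
    finally show ?thesis by (simp add: sum_divide_distrib sum_distrib_left)
  qed
  moreover have "(\<lambda>k. \<Sum>q<d. \<Sum>p<d. conj_by d U C q p * conj_by d U B p q * complex_of_real ((\<Sum>l<k. a p ^ l * a q ^ (k - Suc l)) / fact k))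
     sums (\<Sum>q<d. \<Sum>p<d. conj_by d U C q p * conj_by d U B p q * complex_of_real (dexp (a p) (a q)))"
    by (intro sums_sum sums_mult sums_of_real dexp_sums)
  ultimately have "(\<Sum>k. f' k 0) = (\<Sum>q<d. \<Sum>p<d. conj_by d U C q p * conj_by d U B p q * of_real (dexp (a p) (a q)))"
    by (simp add: sums_iff)
  with D0 have "((\<lambda>t. \<Sum>k. f k t) has_field_derivative (\<Sum>q<d. \<Sum>p<d. conj_by d U C q p * conj_by d U B p q * of_real (dexp (a p) (a q)))) (at 0)"
    by simp
  then show ?thesis
    by (rule has_field_derivative_transform_within_open[of _ _ _ "ball 0 1"]) (auto simp: expeq X_def[symmetric])
qed

subsection \<open>The partition function\<close>

text \<open>Unnormalised Gibbs quantities for the weight exp A: the partition function, and then its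
  first and second derivative along \<open>B\<close>. The inverse temperature and its sign are
  absorbed in \<open>A\<close>.\<close>

definition Zf :: "nat \<Rightarrow> complex mat \<Rightarrow> real" where
  "Zf d A = Re (trp d (1\<^sub>m d) (mat_exp A))"

definition Gf :: "nat \<Rightarrow> complex mat \<Rightarrow> complex mat \<Rightarrow> real" where
  "Gf d A B = Re (trp d B (mat_exp A))"

definition Df :: "nat \<Rightarrow> complex mat \<Rightarrow> complex mat \<Rightarrow> real" where
  "Df d A B = deriv (\<lambda>t :: real. Gf d (A + of_real t \<cdot>\<^sub>m B) B) 0"

lemma hermitian_carrier: "hermitian d A \<Longrightarrow> A \<in> carrier_mat d d"
  by (simp add: hermitian_def)

lemma hermitian_entry: "hermitian d A \<Longrightarrow> i < d \<Longrightarrow> j < d \<Longrightarrow> cnj (A $$ (i,j)) = A $$ (j,i)"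
  unfolding hermitian_def by (metis complex_cnj_cnj)

lemma hermitian_add_smult:
  assumes "hermitian d A" "hermitian d B"
  shows "hermitian d (A + of_real t \<cdot>\<^sub>m B)"
proof -
  have c: "A \<in> carrier_mat d d" "B \<in> carrier_mat d d" using assms by (auto dest: hermitian_carrier)
  show ?thesis unfolding hermitian_def
    using c by (auto simp: hermitian_entry[OF assms(1)] hermitian_entry[OF assms(2)])
qed

lemma Zf_spectral:
  assumes "spectral d A a U" "A \<in> carrier_mat d d"
  shows "Zf d A = (\<Sum>l<d. exp (a l))"
proof -
  have o: "orthonormal d U" using assms by (simp add: spectral_def)
  have "trp d (1\<^sub>m d) (mat_exp A) = (\<Sum>l<d. of_real (exp (a l)))"
    unfolding trp_exp[OF assms] by (intro sum.cong refl) (simp add: conj_by_one[OF o])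
  then show ?thesis by (simp add: Zf_def)
qed

lemma Gf_spectral:
  assumes "spectral d A a U" "A \<in> carrier_mat d d"
  shows "Gf d A B = (\<Sum>l<d. exp (a l) * Re (conj_by d U B l l))"
  by (simp add: Gf_def trp_exp[OF assms])

lemma Gf_self:
  assumes "spectral d A a U" "A \<in> carrier_mat d d"
  shows "Gf d A A = (\<Sum>l<d. exp (a l) * a l)"
  by (simp add: Gf_spectral[OF assms] conj_by_self[OF assms(1)])

lemma Zf_pos:
  assumes "hermitian d A" "d > 0"
  shows "Zf d A > 0"
proof -
  obtain a U where S: "spectral d A a U" using hermitian_spectral[OF assms(1)] .
  show ?thesis unfolding Zf_spectral[OF S hermitian_carrier[OF assms(1)]]
    using assms(2) by (intro sum_pos) auto
qed

text \<open>The base point is moved to A + t B, so that the formula at 0 applies with an eigenbasis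
  belonging to that t.\<close>

lemma trp_exp_real_deriv:
  assumes "hermitian d A" "hermitian d B" "C \<in> carrier_mat d d" "spectral d (A + of_real t \<cdot>\<^sub>m B) a U"
  shows "((\<lambda>t :: real. Re (trp d C (mat_exp (A + of_real t \<cdot>\<^sub>m B)))) has_real_derivative
     Re (\<Sum>q<d. \<Sum>p<d. conj_by d U C q p * conj_by d U B p q * of_real (dexp (a p) (a q)))) (at t)"
    (is "(_ has_real_derivative Re ?D) _")
proof -
  have A: "A + of_real t \<cdot>\<^sub>m B \<in> carrier_mat d d" and B: "B \<in> carrier_mat d d" and A': "A \<in> carrier_mat d d"
    using assms by (auto simp: hermitian_def)
  have "((\<lambda>h. trp d C (mat_exp (A + of_real t \<cdot>\<^sub>m B + h \<cdot>\<^sub>m B))) has_field_derivative ?D) (at (of_real 0))"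
    using trp_exp_deriv[OF assms(4) A B assms(3)] by simp
  from has_vector_derivative_real_field[OF this]
  have "((\<lambda>h. trp d C (mat_exp (A + of_real t \<cdot>\<^sub>m B + of_real h \<cdot>\<^sub>m B))) has_vector_derivative ?D) (at 0)" .
  from bounded_linear.has_vector_derivative[OF bounded_linear_Re this]
  have "((\<lambda>h. Re (trp d C (mat_exp (A + of_real t \<cdot>\<^sub>m B + of_real h \<cdot>\<^sub>m B)))) has_real_derivative Re ?D) (at 0)"
    by (simp add: has_real_derivative_iff_has_vector_derivative)
  moreover have "A + of_real t \<cdot>\<^sub>m B + of_real h \<cdot>\<^sub>m B = A + of_real (h + t) \<cdot>\<^sub>m B" for h :: real
    using A' B by (intro eq_matI) (auto simp: algebra_simps)
  ultimately have "((\<lambda>h. Re (trp d C (mat_exp (A + of_real (h + t) \<cdot>\<^sub>m B)))) has_real_derivative Re ?D) (at 0)"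
    by simp
  then show ?thesis
    using DERIV_shift[of "\<lambda>t. Re (trp d C (mat_exp (A + of_real t \<cdot>\<^sub>m B)))" "Re ?D" 0 t] by simp
qed

lemma Zf_deriv:
  assumes "hermitian d A" "hermitian d B"
  shows "((\<lambda>t. Zf d (A + of_real t \<cdot>\<^sub>m B)) has_real_derivative Gf d (A + of_real t \<cdot>\<^sub>m B) B) (at t)"
proof -
  have h: "hermitian d (A + of_real t \<cdot>\<^sub>m B)" by (rule hermitian_add_smult[OF assms])
  obtain a U where S: "spectral d (A + of_real t \<cdot>\<^sub>m B) a U" using hermitian_spectral[OF h] .
  then have o: "orthonormal d U" by (simp add: spectral_def)
  \<comment> \<open>Against the identity matrix only the diagonal survives, and there
    \<open>dexp\<close> is exp.\<close>
  have "(\<Sum>q<d. \<Sum>p<d. conj_by d U (1\<^sub>m d) q p * conj_by d U B p q * complex_of_real (dexp (a p) (a q)))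
     = (\<Sum>q<d. of_real (exp (a q)) * conj_by d U B q q)"
  proof (rule sum.cong[OF refl])
    fix q assume "q \<in> {..<d}"
    then have q: "q < d" by simp
    have "(\<Sum>p<d. conj_by d U (1\<^sub>m d) q p * conj_by d U B p q * complex_of_real (dexp (a p) (a q)))
      = (\<Sum>p<d. if q = p then of_real (exp (a q)) * conj_by d U B q q else 0)"
      by (intro sum.cong refl) (auto simp: conj_by_one[OF o q] dexp_def)
    then show "(\<Sum>p<d. conj_by d U (1\<^sub>m d) q p * conj_by d U B p q * complex_of_real (dexp (a p) (a q)))
      = of_real (exp (a q)) * conj_by d U B q q" using q by simp
  qed
  with trp_exp_real_deriv[OF assms _ S, of "1\<^sub>m d"] show ?thesis
    unfolding Zf_def[symmetric] by (simp add: Gf_def trp_exp[OF S hermitian_carrier[OF h]])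
qed

lemma Gf_deriv_spectral:
  assumes "hermitian d A" "hermitian d B" "spectral d (A + of_real t \<cdot>\<^sub>m B) a U"
  shows "((\<lambda>t. Gf d (A + of_real t \<cdot>\<^sub>m B) B) has_real_derivative
    (\<Sum>q<d. \<Sum>p<d. (cmod (conj_by d U B q p))\<^sup>2 * dexp (a p) (a q))) (at t)"
proof -
  have e: "conj_by d U B q p * conj_by d U B p q = of_real ((cmod (conj_by d U B q p))\<^sup>2)" for p q
    unfolding conj_by_hermitian[OF assms(2), of U p q] complex_norm_square ..
  have "(\<Sum>q<d. \<Sum>p<d. conj_by d U B q p * conj_by d U B p q * complex_of_real (dexp (a p) (a q)))
     = complex_of_real (\<Sum>q<d. \<Sum>p<d. (cmod (conj_by d U B q p))\<^sup>2 * dexp (a p) (a q))"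
    by (simp add: e)
  with trp_exp_real_deriv[OF assms(1,2) hermitian_carrier[OF assms(2)] assms(3)] show ?thesis
    unfolding Gf_def[symmetric] by simp
qed

lemma Df_spectral:
  assumes "hermitian d A" "hermitian d B" "spectral d A a U"
  shows "Df d A B = (\<Sum>q<d. \<Sum>p<d. (cmod (conj_by d U B q p))\<^sup>2 * dexp (a p) (a q))"
proof -
  have "A + of_real (0::real) \<cdot>\<^sub>m B = A" using hermitian_carrier[OF assms(1)] hermitian_carrier[OF assms(2)] by (intro eq_matI) auto
  then show ?thesis using Gf_deriv_spectral[OF assms(1,2), of 0] assms(3)
    unfolding Df_def by (intro DERIV_imp_deriv) simp
qed

lemma Gf_deriv:
  assumes "hermitian d A" "hermitian d B"
  shows "((\<lambda>t. Gf d (A + of_real t \<cdot>\<^sub>m B) B) has_real_derivative Df d (A + of_real t \<cdot>\<^sub>m B) B) (at t)"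
proof -
  have h: "hermitian d (A + of_real t \<cdot>\<^sub>m B)" by (rule hermitian_add_smult[OF assms])
  obtain a U where S: "spectral d (A + of_real t \<cdot>\<^sub>m B) a U" using hermitian_spectral[OF h] .
  show ?thesis using Gf_deriv_spectral[OF assms S] Df_spectral[OF h assms(2) S] by simp
qed

text \<open>Diagonal entries of B^2 in the basis \<open>U\<close> are squared row norms of the
  Hermitian matrix of \<open>B\<close>.\<close>

lemma conj_by_square:
  assumes "hermitian d B" "B * B = of_real c \<cdot>\<^sub>m 1\<^sub>m d" "orthonormal d U" "q < d"
  shows "(\<Sum>p<d. (cmod (conj_by d U B q p))\<^sup>2) = c"
proof -
  have B: "B \<in> carrier_mat d d" using assms(1) by (simp add: hermitian_def)
  have "complex_of_real (\<Sum>p<d. (cmod (conj_by d U B q p))\<^sup>2) = (\<Sum>p<d. conj_by d U B q p * conj_by d U B p q)"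
    unfolding of_real_sum by (intro sum.cong refl, subst (3) conj_by_hermitian[OF assms(1)]) (rule complex_norm_square)
  also have "\<dots> = conj_by d U (B * B) q q" by (rule conj_by_spectral_mult[OF assms(3) B B assms(4,4), symmetric])
  also have "\<dots> = of_real c * conj_by d U (1\<^sub>m d) q q"
    unfolding assms(2) conj_by_def by (simp add: sum_distrib_left mult_ac)
  also have "\<dots> = of_real c" using conj_by_one[OF assms(3,4,4)] by simp
  finally show ?thesis using of_real_eq_iff by blast
qed

lemma sum_conj_sym:
  assumes "hermitian d B"
  shows "(\<Sum>q<d. \<Sum>p<d. (cmod (conj_by d U B q p))\<^sup>2 * f p q) = (\<Sum>q<d. \<Sum>p<d. (cmod (conj_by d U B q p))\<^sup>2 * f q p)"
proof -
  have s: "cmod (conj_by d U B q p) = cmod (conj_by d U B p q)" for p q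
    by (subst conj_by_hermitian[OF assms]) simp
  have "(\<Sum>q<d. \<Sum>p<d. (cmod (conj_by d U B q p))\<^sup>2 * f p q) = (\<Sum>p<d. \<Sum>q<d. (cmod (conj_by d U B q p))\<^sup>2 * f p q)"
    by (rule sum.swap)
  then show ?thesis by (subst (asm) (2) s) 
qed

text \<open>In an eigenbasis of \<open>A\<close> the numbers |B_qp|^2 form a symmetric matrix with
  all row sums \<open>c\<close>. Averaging the bounds for \<open>dexp\<close> with these weights
  gives the estimates for \<open>Df\<close>. The term subtracted in \<open>Df_lower\<close> is
  Tr([B,[B,A]] e^A) / 4, written out with B^2 = c.\<close>

lemma
  assumes A: "hermitian d A" and B: "hermitian d B" and sq: "B * B = of_real c \<cdot>\<^sub>m 1\<^sub>m d"
  shows Df_upper: "Df d A B \<le> c * Zf d A"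
    and Df_nonneg: "0 \<le> Df d A B"
    and Df_lower: "Df d A B \<ge> c * Zf d A - (c * Gf d A A - Gf d A (B * A * B)) / 2"
    and Gf_bound: "\<bar>Gf d A B\<bar> \<le> sqrt c * Zf d A"
proof -
  obtain a U where S: "spectral d A a U" using hermitian_spectral[OF A] .
  then have o: "orthonormal d U" by (simp add: spectral_def)
  have cA: "A \<in> carrier_mat d d" and cB: "B \<in> carrier_mat d d" using A B by (auto simp: hermitian_def)
  let ?b = "\<lambda>q p. (cmod (conj_by d U B q p))\<^sup>2"
  have D: "Df d A B = (\<Sum>q<d. \<Sum>p<d. ?b q p * dexp (a p) (a q))" by (rule Df_spectral[OF A B S])
  have Z: "Zf d A = (\<Sum>q<d. exp (a q))" by (rule Zf_spectral[OF S cA])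
  have row: "(\<Sum>q<d. \<Sum>p<d. ?b q p * f q) = c * (\<Sum>q<d. f q)" for f
    unfolding sum_distrib_right[symmetric] sum_distrib_left
    by (intro sum.cong refl) (simp add: conj_by_square[OF B sq o])
  have col: "(\<Sum>q<d. \<Sum>p<d. ?b q p * f p) = c * (\<Sum>q<d. f q)" for f
    using sum_conj_sym[OF B, of U "\<lambda>p q. f p"] row[of f] by simp
  have avg: "(\<Sum>q<d. \<Sum>p<d. ?b q p * ((exp (a p) + exp (a q)) / 2)) = c * Zf d A"
  proof -
    have "(\<Sum>q<d. \<Sum>p<d. ?b q p * ((exp (a p) + exp (a q)) / 2)) = ((\<Sum>q<d. \<Sum>p<d. ?b q p * exp (a p)) + (\<Sum>q<d. \<Sum>p<d. ?b q p * exp (a q))) / 2"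
      unfolding sum.distrib[symmetric] sum_divide_distrib by (intro sum.cong refl) (simp add: field_simps)
    then show ?thesis unfolding row col Z by simp
  qed
  show "Df d A B \<le> c * Zf d A"
    unfolding D avg[symmetric] by (intro sum_mono mult_left_mono dexp_bounds) auto
  show "0 \<le> Df d A B"
    unfolding D by (intro sum_nonneg mult_nonneg_nonneg dexp_bounds) auto
  have "conj_by d U (B * A * B) q q = (\<Sum>p<d. of_real (?b q p * a p))" if q: "q < d" for q
  proof -
    have "conj_by d U (B * A) q p = conj_by d U B q p * of_real (a p)" if p: "p < d" for p
      by (subst conj_by_spectral_mult[OF o cB cA q p])
        (use p in \<open>simp add: conj_by_self[OF S] if_distrib cong: if_cong\<close>)
    then have "conj_by d U (B * A * B) q q = (\<Sum>p<d. conj_by d U B q p * of_real (a p) * conj_by d U B p q)"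
      using cA cB q by (subst conj_by_spectral_mult[OF o]) auto
    also have "\<dots> = (\<Sum>p<d. of_real (?b q p * a p))"
    proof (rule sum.cong[OF refl])
      fix p
      have "conj_by d U B q p * conj_by d U B p q = of_real (?b q p)"
        unfolding conj_by_hermitian[OF B, of U p q] complex_norm_square ..
      then show "conj_by d U B q p * of_real (a p) * conj_by d U B p q = of_real (?b q p * a p)"
        by (simp add: mult_ac)
    qed
    finally show ?thesis .
  qed
  then have GBAB: "Gf d A (B * A * B) = (\<Sum>q<d. \<Sum>p<d. ?b q p * (exp (a q) * a p))"
    unfolding Gf_spectral[OF S cA] by (intro sum.cong refl) (simp add: sum_distrib_left mult_ac)
  have GA: "c * Gf d A A = (\<Sum>q<d. \<Sum>p<d. ?b q p * (exp (a q) * a q))"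
    unfolding Gf_self[OF S cA] row ..
  have "(\<Sum>q<d. \<Sum>p<d. ?b q p * ((a p - a q) * (exp (a p) - exp (a q)) / 4))
     = ((\<Sum>q<d. \<Sum>p<d. ?b q p * (exp (a p) * a p)) + (\<Sum>q<d. \<Sum>p<d. ?b q p * (exp (a q) * a q))
       - (\<Sum>q<d. \<Sum>p<d. ?b q p * (exp (a p) * a q)) - (\<Sum>q<d. \<Sum>p<d. ?b q p * (exp (a q) * a p))) / 4"
    unfolding sum.distrib[symmetric] sum_subtractf[symmetric] sum_divide_distrib
    by (intro sum.cong refl) (simp add: field_simps)
  also have "\<dots> = (c * Gf d A A - Gf d A (B * A * B)) / 2"
    using sum_conj_sym[OF B, of U "\<lambda>p q. exp (a p) * a p"] sum_conj_sym[OF B, of U "\<lambda>p q. exp (a p) * a q"]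
    unfolding GA GBAB by simp
  finally have dc: "(\<Sum>q<d. \<Sum>p<d. ?b q p * ((a p - a q) * (exp (a p) - exp (a q)) / 4)) = (c * Gf d A A - Gf d A (B * A * B)) / 2" .
  show "Df d A B \<ge> c * Zf d A - (c * Gf d A A - Gf d A (B * A * B)) / 2"
    unfolding D avg[symmetric] dc[symmetric] sum_subtractf[symmetric] right_diff_distrib[symmetric]
    by (intro sum_mono mult_left_mono dexp_bounds) auto
  have "\<bar>Re (conj_by d U B q q)\<bar> \<le> sqrt c" if "q < d" for q
  proof (rule real_le_rsqrt)
    have "\<bar>Re (conj_by d U B q q)\<bar>\<^sup>2 \<le> ?b q q" by (simp add: cmod_power2)
    also have "\<dots> \<le> (\<Sum>p<d. ?b q p)" using that member_le_sum[of q "{..<d}" "?b q"] by simp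
    finally show "\<bar>Re (conj_by d U B q q)\<bar>\<^sup>2 \<le> c" using conj_by_square[OF B sq o that] by simp
  qed
  then have "\<bar>Gf d A B\<bar> \<le> (\<Sum>l<d. exp (a l) * sqrt c)"
    unfolding Gf_spectral[OF S cA] by (intro order_trans[OF sum_abs] sum_mono) (simp add: abs_mult)
  then show "\<bar>Gf d A B\<bar> \<le> sqrt c * Zf d A" unfolding Z by (simp add: sum_distrib_left mult.commute)
qed

subsection \<open>Convexity of the free energy\<close>

text \<open>Jensen's inequality for the Gibbs weights of \<open>x\<close>.\<close>
lemma log_sum_exp_convex:
  fixes x y :: "nat \<Rightarrow> real"
  assumes "d > 0"
  shows "ln (\<Sum>l<d. exp (x l + y l)) - ln (\<Sum>l<d. exp (x l)) \<ge> (\<Sum>l<d. exp (x l) * y l) / (\<Sum>l<d. exp (x l))"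
proof -
  let ?Z = "\<Sum>l<d. exp (x l)"
  define \<mu> where "\<mu> = (\<Sum>l<d. exp (x l) * y l) / ?Z"
  have Z: "?Z > 0" using assms by (intro sum_pos) auto
  have S: "(\<Sum>l<d. exp (x l + y l)) > 0" using assms by (intro sum_pos) auto
  \<comment> \<open>The tangent to exp at the Gibbs mean \<open>\<mu>\<close>: its linear part
    averages to zero.\<close>
  have "exp \<mu> * ?Z = (\<Sum>l<d. exp (x l) * (exp \<mu> * (1 + (y l - \<mu>))))"
  proof -
    have "(\<Sum>l<d. exp (x l) * (exp \<mu> * (1 + (y l - \<mu>)))) = exp \<mu> * (?Z + (\<Sum>l<d. exp (x l) * y l) - \<mu> * ?Z)"
      by (simp add: sum_distrib_left sum.distrib sum_subtractf algebra_simps)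
    then show ?thesis using Z by (simp add: \<mu>_def)
  qed
  also have "\<dots> \<le> (\<Sum>l<d. exp (x l) * exp (y l))"
  proof (intro sum_mono mult_left_mono)
    fix l
    have "exp \<mu> * (1 + (y l - \<mu>)) \<le> exp \<mu> * exp (y l - \<mu>)"
      by (intro mult_left_mono exp_ge_add_one_self) auto
    then show "exp \<mu> * (1 + (y l - \<mu>)) \<le> exp (y l)" by (simp flip: exp_add)
  qed auto
  finally have "exp \<mu> * ?Z \<le> (\<Sum>l<d. exp (x l + y l))" by (simp add: exp_add)
  then have "ln (exp \<mu> * ?Z) \<le> ln (\<Sum>l<d. exp (x l + y l))" using Z S by simp
  then show ?thesis using Z by (simp add: ln_mult \<mu>_def)
qed

lemma spectral_smult:
  assumes "spectral d A a U" "A \<in> carrier_mat d d"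
  shows "spectral d (of_real r \<cdot>\<^sub>m A) (\<lambda>l. r * a l) U"
  using assms by (simp add: spectral_def sum_distrib_left mult_ac)

text \<open>Jensen along the ray through \<open>A\<close>. This inequality goes from A to 2 A, the
  next two go from A to 0 and from 0 to A; together they let energy and free energy bound each other
  at different temperatures.\<close>

lemma ln_Zf_double:
  assumes "hermitian d A" "d > 0"
  shows "ln (Zf d (of_real 2 \<cdot>\<^sub>m A)) \<ge> ln (Zf d A) + Gf d A A / Zf d A"
proof -
  obtain a U where S: "spectral d A a U" using hermitian_spectral[OF assms(1)] .
  have A: "A \<in> carrier_mat d d" using assms(1) by (rule hermitian_carrier)
  have "Zf d (of_real 2 \<cdot>\<^sub>m A) = (\<Sum>l<d. exp (a l + a l))"
    using Zf_spectral[OF spectral_smult[OF S A, of 2]] A by simp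
  with log_sum_exp_convex[OF assms(2), of a a] show ?thesis
    by (simp add: Zf_spectral[OF S A] Gf_self[OF S A])
qed

lemma ln_Zf_le:
  assumes "hermitian d A" "d > 0"
  shows "ln (Zf d A) - ln (real d) \<le> Gf d A A / Zf d A"
proof -
  obtain a U where S: "spectral d A a U" using hermitian_spectral[OF assms(1)] .
  have A: "A \<in> carrier_mat d d" using assms(1) by (rule hermitian_carrier)
  from log_sum_exp_convex[OF assms(2), of a "\<lambda>l. - a l"] show ?thesis
    by (simp add: Zf_spectral[OF S A] Gf_self[OF S A] sum_negf)
qed

lemma ln_Zf_ge:
  assumes "hermitian d A" "d > 0"
  shows "ln (Zf d A) \<ge> ln (real d) + Re (\<Sum>x<d. A $$ (x,x)) / real d"
proof -
  obtain a U where S: "spectral d A a U" using hermitian_spectral[OF assms(1)] .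
  have A: "A \<in> carrier_mat d d" using assms(1) by (rule hermitian_carrier)
  have o: "orthonormal d U" using S by (simp add: spectral_def)
  have "(\<Sum>x<d. A $$ (x,x)) = (\<Sum>x<d. \<Sum>l<d. of_real (a l) * (cnj (U x l) * U x l))"
    using S by (intro sum.cong refl) (simp add: spectral_def mult_ac)
  also have "\<dots> = (\<Sum>l<d. \<Sum>x<d. of_real (a l) * (cnj (U x l) * U x l))" by (rule sum.swap)
  also have "\<dots> = (\<Sum>l<d. of_real (a l))"
    using o by (simp add: sum_distrib_left[symmetric] orthonormal_def)
  finally have "Re (\<Sum>x<d. A $$ (x,x)) = (\<Sum>l<d. a l)" by simp
  with log_sum_exp_convex[OF assms(2), of "\<lambda>_. 0" a] show ?thesis
    by (simp add: Zf_spectral[OF S A])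
qed

section \<open>Quadratic forms, the top of the spectrum, and Gibbs states as mixtures of
  vectors\<close>

lemma qf_spectral:
  assumes "spectral d A a U"
  shows "qf d A w = (\<Sum>l<d. of_real (a l * (cmod (\<Sum>x<d. cnj (U x l) * w x))\<^sup>2))"
proof -
  have "qf d A w = (\<Sum>x<d. \<Sum>y<d. \<Sum>l<d. of_real (a l) * (cnj (w x) * U x l) * (cnj (U y l) * w y))"
    unfolding qf_def using assms
    by (intro sum.cong refl) (simp add: spectral_def sum_distrib_left sum_distrib_right mult_ac)
  also have "\<dots> = (\<Sum>x<d. \<Sum>l<d. \<Sum>y<d. of_real (a l) * (cnj (w x) * U x l) * (cnj (U y l) * w y))"
    by (rule sum.cong[OF refl], rule sum.swap)
  also have "\<dots> = (\<Sum>l<d. \<Sum>x<d. \<Sum>y<d. of_real (a l) * (cnj (w x) * U x l) * (cnj (U y l) * w y))"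
    by (rule sum.swap)
  also have "\<dots> = (\<Sum>l<d. of_real (a l * (cmod (\<Sum>x<d. cnj (U x l) * w x))\<^sup>2))"
  proof (rule sum.cong[OF refl])
    fix l
    have "(\<Sum>x<d. \<Sum>y<d. of_real (a l) * (cnj (w x) * U x l) * (cnj (U y l) * w y))
      = of_real (a l) * (cnj (\<Sum>x<d. cnj (U x l) * w x) * (\<Sum>y<d. cnj (U y l) * w y))"
      unfolding cnj_sum sum_product unfolding sum_distrib_left by (intro sum.cong refl) (simp add: mult_ac)
    then show "(\<Sum>x<d. \<Sum>y<d. of_real (a l) * (cnj (w x) * U x l) * (cnj (U y l) * w y))
      = of_real (a l * (cmod (\<Sum>x<d. cnj (U x l) * w x))\<^sup>2)"
      by (simp only: of_real_mult complex_norm_square mult.commute)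
  qed
  finally show ?thesis .
qed

lemma orthonormal_parseval:
  assumes "orthonormal d U"
  shows "(\<Sum>l<d. (cmod (\<Sum>x<d. cnj (U x l) * w x))\<^sup>2) = (\<Sum>x<d. (cmod (w x))\<^sup>2)"
proof -
  have S: "spectral d (1\<^sub>m d) (\<lambda>_. 1) U"
    using assms orthonormal_rows[OF assms] by (auto simp: spectral_def)
  have "qf d (1\<^sub>m d) w = (\<Sum>x<d. \<Sum>y<d. if x = y then cnj (w x) * w y else 0)"
    unfolding qf_def by (intro sum.cong refl) auto
  also have "\<dots> = (\<Sum>x<d. cnj (w x) * w x)" by simp
  also have "\<dots> = (\<Sum>x<d. of_real ((cmod (w x))\<^sup>2))"
    by (intro sum.cong refl) (simp only: complex_norm_square mult.commute)
  finally show ?thesis using qf_spectral[OF S, of w] by (simp flip: of_real_sum of_real_power)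
qed

text \<open>No eigenvalue exceeds ln Z, because its exponential is one summand of Z. Applied to A
  and to -A this takes the place of an operator norm estimate.\<close>

lemma qf_le_ln_Zf:
  assumes "hermitian d A" "d > 0"
  shows "Re (qf d A w) \<le> ln (Zf d A) * (\<Sum>x<d. (cmod (w x))\<^sup>2)"
proof -
  obtain a U where S: "spectral d A a U" using hermitian_spectral[OF assms(1)] .
  have A: "A \<in> carrier_mat d d" using assms(1) by (rule hermitian_carrier)
  have o: "orthonormal d U" using S by (simp add: spectral_def)
  have "a l \<le> ln (Zf d A)" if "l < d" for l
  proof -
    have "exp (a l) \<le> Zf d A" unfolding Zf_spectral[OF S A]
      using that member_le_sum[of l "{..<d}" "\<lambda>l. exp (a l)"] by simp
    then show ?thesis using Zf_pos[OF assms] by (simp add: ln_ge_iff)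
  qed
  then have "Re (qf d A w) \<le> (\<Sum>l<d. ln (Zf d A) * (cmod (\<Sum>x<d. cnj (U x l) * w x))\<^sup>2)"
    unfolding qf_spectral[OF S] Re_sum Re_complex_of_real by (intro sum_mono mult_right_mono) auto
  then show ?thesis by (simp add: sum_distrib_left[symmetric] orthonormal_parseval[OF o])
qed

text \<open>Eigenvectors scaled by the square roots of their Gibbs weights exhibit the Gibbs state
  as a mixture of vectors, the form in which the uniform bound over states is stated.\<close>

lemma Gf_ensemble:
  assumes "hermitian d A" "d > 0"
  shows "\<exists>\<phi>. (\<Sum>l<d. \<Sum>x<d. (cmod (\<phi> l x))\<^sup>2) = 1 \<and> (\<forall>B. Gf d A B / Zf d A = (\<Sum>l<d. Re (qf d B (\<phi> l))))"
proof -
  obtain a U where S: "spectral d A a U" using hermitian_spectral[OF assms(1)] .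
  have A: "A \<in> carrier_mat d d" using assms(1) by (rule hermitian_carrier)
  have o: "orthonormal d U" using S by (simp add: spectral_def)
  have Z: "Zf d A > 0" by (rule Zf_pos[OF assms])
  define s where "s l = sqrt (exp (a l) / Zf d A)" for l
  have s2: "s l * s l = exp (a l) / Zf d A" for l using Z by (simp add: s_def)
  define \<phi> where "\<phi> l x = of_real (s l) * U x l" for l x
  have "(\<Sum>x<d. (cmod (\<phi> l x))\<^sup>2) = exp (a l) / Zf d A" if "l < d" for l
  proof -
    have "(\<Sum>x<d. cnj (U x l) * U x l) = 1" using o that unfolding orthonormal_def by simp
    moreover have "(\<Sum>x<d. cnj (U x l) * U x l) = of_real (\<Sum>x<d. (cmod (U x l))\<^sup>2)"
      unfolding of_real_sum by (intro sum.cong refl) (simp only: complex_norm_square mult.commute)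
    ultimately have "(\<Sum>x<d. (cmod (U x l))\<^sup>2) = 1" by (metis of_real_1 of_real_eq_iff)
    moreover have "(cmod (\<phi> l x))\<^sup>2 = s l * s l * (cmod (U x l))\<^sup>2" for x
      by (simp add: \<phi>_def norm_mult power_mult_distrib power2_eq_square)
    ultimately show ?thesis
      by (simp add: s2 sum_distrib_left[symmetric] del: times_divide_eq_left)
  qed
  then have "(\<Sum>l<d. \<Sum>x<d. (cmod (\<phi> l x))\<^sup>2) = (\<Sum>l<d. exp (a l) / Zf d A)" by simp
  then have 1: "(\<Sum>l<d. \<Sum>x<d. (cmod (\<phi> l x))\<^sup>2) = 1"
    using Z by (simp add: Zf_spectral[OF S A] flip: sum_divide_distrib)
  have "Gf d A B / Zf d A = (\<Sum>l<d. Re (qf d B (\<phi> l)))" for B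
  proof -
    have "qf d B (\<phi> l) = of_real (s l * s l) * conj_by d U B l l" for l
      unfolding qf_def conj_by_def \<phi>_def by (simp add: sum_distrib_left mult_ac)
    then show ?thesis unfolding Gf_spectral[OF S A] s2 sum_divide_distrib by simp
  qed
  with 1 show ?thesis by blast
qed

section \<open>Independent Gaussians\<close>

definition gauss :: "real \<Rightarrow> real measure" where
  "gauss s = density lborel (\<lambda>x. ennreal (normal_density 0 s x))"

lemma sets_gauss [simp, measurable_cong]: "sets (gauss s) = sets borel"
  and space_gauss [simp]: "space (gauss s) = UNIV"
  by (simp_all add: gauss_def)

lemma measurable_gauss [simp]: "measurable (gauss s) M = measurable borel M"
  by (intro measurable_cong_sets) auto

lemma prob_space_gauss: "s > 0 \<Longrightarrow> prob_space (gauss s)"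
  unfolding gauss_def by (rule prob_space_normal_density)

lemma integral_gauss:
  "f \<in> borel_measurable borel \<Longrightarrow> (\<integral>x. f x \<partial>gauss s) = (\<integral>x. normal_density 0 s x * f x \<partial>lborel)" for f :: "real \<Rightarrow> real"
  unfolding gauss_def by (subst integral_density) auto

lemma integrable_gauss:
  "f \<in> borel_measurable borel \<Longrightarrow> integrable (gauss s) f \<longleftrightarrow> integrable lborel (\<lambda>x. normal_density 0 s x * f x)" for f :: "real \<Rightarrow> real"
  unfolding gauss_def by (subst integrable_density) auto

lemma gauss_moments:
  assumes "s > 0"
  shows "integrable (gauss s) (\<lambda>x. x)" "(\<integral>x. x \<partial>gauss s) = 0"
    "integrable (gauss s) (\<lambda>x. x\<^sup>2)" "(\<integral>x. x\<^sup>2 \<partial>gauss s) = s\<^sup>2"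
    "integrable (gauss s) (\<lambda>x. \<bar>x\<bar>)"
proof -
  show "integrable (gauss s) (\<lambda>x. x)" "integrable (gauss s) (\<lambda>x. x\<^sup>2)" "integrable (gauss s) (\<lambda>x. \<bar>x\<bar>)"
    using integrable_normal_moment[OF assms, of 0 1] integrable_normal_moment[OF assms, of 0 2]
      integrable_normal_moment_abs[OF assms, of 0 1] by (simp_all add: integrable_gauss)
  show "(\<integral>x. x \<partial>gauss s) = 0" using integral_normal_moment_odd[OF assms, of 0 0] by (simp add: integral_gauss)
  show "(\<integral>x. x\<^sup>2 \<partial>gauss s) = s\<^sup>2" using integral_normal_moment_even[OF assms, of 0 1] by (simp add: integral_gauss)
qed

text \<open>Completing the square moves the mean of the density to a s^2 and leaves the constant
  factor.\<close>

lemma gauss_exp: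
  assumes "s > 0"
  shows "(\<integral>\<^sup>+x. ennreal (exp (a * x)) \<partial>gauss s) = ennreal (exp (a\<^sup>2 * s\<^sup>2 / 2))"
proof -
  have e: "normal_density 0 s x * exp (a * x) = exp (a\<^sup>2 * s\<^sup>2 / 2) * normal_density (a * s\<^sup>2) s x" for x
  proof -
    have "- (x - 0)\<^sup>2 / (2 * s\<^sup>2) + a * x = a\<^sup>2 * s\<^sup>2 / 2 + - (x - a * s\<^sup>2)\<^sup>2 / (2 * s\<^sup>2)"
      using assms by (simp add: field_simps power2_eq_square)
    then show ?thesis unfolding normal_density_def by (simp add: mult.assoc flip: exp_add)
  qed
  have "(\<integral>\<^sup>+x. ennreal (exp (a * x)) \<partial>gauss s) = (\<integral>\<^sup>+x. ennreal (exp (a\<^sup>2 * s\<^sup>2 / 2)) * ennreal (normal_density (a * s\<^sup>2) s x) \<partial>lborel)"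
    unfolding gauss_def by (subst nn_integral_density) (auto simp flip: ennreal_mult simp: e)
  also have "\<dots> = ennreal (exp (a\<^sup>2 * s\<^sup>2 / 2)) * (\<integral>\<^sup>+x. ennreal (normal_density (a * s\<^sup>2) s x) \<partial>lborel)"
    by (rule nn_integral_cmult) auto
  also have "(\<integral>\<^sup>+x. ennreal (normal_density (a * s\<^sup>2) s x) \<partial>lborel) = 1"
    by (subst nn_integral_eq_integral) (auto simp: assms)
  finally show ?thesis by simp
qed

text \<open>Symmetry of the density; it lets a random coupling be averaged over both of its
  signs.\<close>

lemma gauss_reflect:
  assumes [measurable]: "f \<in> borel_measurable borel"
  shows "(\<integral>\<^sup>+x. f (- x) \<partial>gauss s) = (\<integral>\<^sup>+x. f x \<partial>gauss s)"
proof -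
  have "(\<integral>\<^sup>+x. f x \<partial>gauss s) = (\<integral>\<^sup>+x. ennreal (normal_density 0 s x) * f x \<partial>lborel)"
    unfolding gauss_def by (rule nn_integral_density) auto
  also have "\<dots> = (\<integral>\<^sup>+x. ennreal (normal_density 0 s (- x)) * f (- x) \<partial>lborel)"
    using nn_integral_real_affine[of "\<lambda>x. ennreal (normal_density 0 s x) * f x" "-1" 0] by simp
  also have "\<dots> = (\<integral>\<^sup>+x. ennreal (normal_density 0 s x) * f (- x) \<partial>lborel)"
    by (simp add: normal_density_def)
  also have "\<dots> = (\<integral>\<^sup>+x. f (- x) \<partial>gauss s)"
    unfolding gauss_def by (rule nn_integral_density[symmetric]) auto
  finally show ?thesis by simp
qed

lemma normal_density_deriv:
  "s > 0 \<Longrightarrow> (normal_density 0 s has_real_derivative - (x / s\<^sup>2) * normal_density 0 s x) (at x)"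
  unfolding normal_density_def[abs_def]
  by (auto intro!: derivative_eq_intros simp: field_simps power2_eq_square)

lemma normal_density_lim:
  assumes "s > 0"
  shows "(\<lambda>n. normal_density 0 s (real n)) \<longlonglongrightarrow> 0"
proof (rule tendsto_sandwich[of "\<lambda>_. 0"])
  have le: "normal_density 0 s (real n) \<le> (1 / sqrt (2 * pi * s\<^sup>2)) * (2 * s\<^sup>2 * inverse (real n))" if "n \<ge> 1" for n
  proof -
    have "exp (- (real n)\<^sup>2 / (2 * s\<^sup>2)) = inverse (exp ((real n)\<^sup>2 / (2 * s\<^sup>2)))"
      by (simp add: exp_minus)
    also have "\<dots> \<le> inverse ((real n)\<^sup>2 / (2 * s\<^sup>2))"
      using that assms order_trans[OF _ exp_ge_add_one_self[of "(real n)\<^sup>2 / (2 * s\<^sup>2)"], of "(real n)\<^sup>2 / (2 * s\<^sup>2)"]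
      by (intro le_imp_inverse_le) auto
    also have "\<dots> \<le> 2 * s\<^sup>2 * inverse (real n)"
      using that assms by (simp add: field_simps power2_eq_square)
    finally show ?thesis unfolding normal_density_def by (intro mult_mono) auto
  qed
  show "\<forall>\<^sub>F n in sequentially. normal_density 0 s (real n) \<le> (1 / sqrt (2 * pi * s\<^sup>2)) * (2 * s\<^sup>2 * inverse (real n))"
    using eventually_ge_at_top[of "1::nat"] by eventually_elim (rule le)
  show "(\<lambda>n. (1 / sqrt (2 * pi * s\<^sup>2)) * (2 * s\<^sup>2 * inverse (real n))) \<longlonglongrightarrow> 0"
    by (intro tendsto_mult_right_zero lim_inverse_n)
qed auto

text \<open>Stein's identity. The derivative of \<open>f\<close> times the density is integrated
  over [-n,n]; the boundary terms vanish because \<open>f\<close> is bounded and the density tends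
  to 0.\<close>

lemma gauss_ibp:
  fixes f f' :: "real \<Rightarrow> real"
  assumes s: "s > 0" and deriv: "\<And>x. (f has_real_derivative f' x) (at x)"
    and bd: "\<And>x. \<bar>f x\<bar> \<le> C" "\<And>x. \<bar>f' x\<bar> \<le> C'" and [measurable]: "f' \<in> borel_measurable borel"
  shows "(\<integral>x. x * f x \<partial>gauss s) = s\<^sup>2 * (\<integral>x. f' x \<partial>gauss s)"
proof -
  interpret G: prob_space "gauss s" by (rule prob_space_gauss[OF s])
  have "continuous_on UNIV f" using deriv by (intro DERIV_continuous_on) (auto intro: has_field_derivative_at_within)
  then have [measurable]: "f \<in> borel_measurable borel" by (rule borel_measurable_continuous_onI)
  let ?N = "normal_density 0 s"
  have i1: "integrable (gauss s) (\<lambda>x. x * f x)"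
  proof (rule Bochner_Integration.integrable_bound)
    show "integrable (gauss s) (\<lambda>x. C * \<bar>x\<bar>)" using gauss_moments(5)[OF s] by simp
    show "AE x in gauss s. norm (x * f x) \<le> norm (C * \<bar>x\<bar>)"
    proof (rule AE_I2)
      fix x
      have "\<bar>x\<bar> * \<bar>f x\<bar> \<le> \<bar>x\<bar> * \<bar>C\<bar>" using bd(1)[of x] by (intro mult_left_mono) auto
      then show "norm (x * f x) \<le> norm (C * \<bar>x\<bar>)" by (simp add: abs_mult mult.commute)
    qed
  qed simp
  have i2: "integrable (gauss s) f'"
    by (rule G.integrable_const_bound[of _ C']) (use bd in auto)
  define h where "h x = f' x * ?N x - (x / s\<^sup>2) * ?N x * f x" for x
  have [measurable]: "h \<in> borel_measurable borel" unfolding h_def by measurable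
  have i1': "integrable lborel (\<lambda>x. ?N x * (x * f x))" and i2': "integrable lborel (\<lambda>x. ?N x * f' x)"
    using i1 i2 by (simp_all add: integrable_gauss)
  have hd: "h x = ?N x * f' x - (?N x * (x * f x)) / s\<^sup>2" for x by (simp add: h_def)
  have ih: "integrable lborel h"
    unfolding hd[abs_def] by (intro Bochner_Integration.integrable_diff integrable_divide i1' i2')
  have hint: "(\<integral>x. h x \<partial>lborel) = (\<integral>x. ?N x * f' x \<partial>lborel) - (\<integral>x. ?N x * (x * f x) \<partial>lborel) / s\<^sup>2"
    unfolding hd using i1' i2' by (subst Bochner_Integration.integral_diff) auto
  have FTC: "(\<integral>x. indicator {- real n..real n} x * h x \<partial>lborel) = f (real n) * ?N (real n) - f (- real n) * ?N (- real n)" for n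
  proof -
    have "(h has_integral (f (real n) * ?N (real n) - f (- real n) * ?N (- real n))) {- real n..real n}"
    proof (rule fundamental_theorem_of_calculus)
      fix x
      have "((\<lambda>x. f x * ?N x) has_real_derivative h x) (at x)"
        unfolding h_def by (rule derivative_eq_intros deriv normal_density_deriv[OF s] refl)+ (simp add: algebra_simps)
      then show "((\<lambda>x. f x * ?N x) has_vector_derivative h x) (at x within {- real n..real n})"
        by (simp add: has_real_derivative_iff_has_vector_derivative has_vector_derivative_at_within)
    qed simp
    moreover have "set_integrable lborel {- real n..real n} h"
      unfolding set_integrable_def using ih by (intro integrable_mult_indicator) auto
    ultimately show ?thesis
      using set_borel_integral_eq_integral(2)[of "{- real n..real n}" h]
      by (simp add: set_lebesgue_integral_def integral_unique)
  qed
  have "(\<lambda>n. \<integral>x. indicator {- real n..real n} x * h x \<partial>lborel) \<longlonglongrightarrow> (\<integral>x. h x \<partial>lborel)"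
  proof (rule integral_dominated_convergence[where w = "\<lambda>x. \<bar>h x\<bar>"])
    show "AE x in lborel. (\<lambda>n. indicator {- real n..real n} x * h x) \<longlonglongrightarrow> h x"
    proof (rule AE_I2, rule tendsto_eventually)
      fix x
      obtain N :: nat where N: "\<bar>x\<bar> \<le> real N" using real_arch_simple by blast
      show "\<forall>\<^sub>F n in sequentially. indicator {- real n..real n} x * h x = h x"
        using eventually_ge_at_top[of N]
      proof eventually_elim
        case (elim n)
        then have "\<bar>x\<bar> \<le> real n" using N by linarith
        then show ?case by (auto simp: indicator_def)
      qed
    qed
    show "AE x in lborel. norm (indicator {- real n..real n} x * h x) \<le> \<bar>h x\<bar>" for n
      by (auto simp: indicator_def)
  qed (use ih in auto)
  moreover have "(\<lambda>n. f (real n) * ?N (real n) - f (- real n) * ?N (- real n)) \<longlonglongrightarrow> 0"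
  proof (rule Lim_null_comparison)
    show "(\<lambda>n. 2 * C * ?N (real n)) \<longlonglongrightarrow> 0" by (intro tendsto_mult_right_zero normal_density_lim s)
    have "norm (f (real n) * ?N (real n) - f (- real n) * ?N (- real n)) \<le> 2 * C * ?N (real n)" for n
    proof -
      have N: "?N (- real n) = ?N (real n)" by (simp add: normal_density_def)
      have "\<bar>f (real n) - f (- real n)\<bar> * ?N (real n) \<le> 2 * C * ?N (real n)"
        using bd(1)[of "real n"] bd(1)[of "- real n"] by (intro mult_right_mono) auto
      then show ?thesis unfolding N by (simp add: abs_mult flip: left_diff_distrib)
    qed
    then show "\<forall>\<^sub>F n in sequentially. norm (f (real n) * ?N (real n) - f (- real n) * ?N (- real n)) \<le> 2 * C * ?N (real n)"
      by simp
  qed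
  ultimately have "(\<integral>x. h x \<partial>lborel) = 0" unfolding FTC using LIMSEQ_unique by blast
  then show ?thesis using s unfolding hint by (simp add: integral_gauss field_simps)
qed

text \<open>The variance is at most the second moment about \<open>f 0\<close>, which is at most L^2
  times the Gaussian second moment. This elementary bound already has the constant of the Poincare
  inequality.\<close>

lemma gauss_lipschitz_variance:
  fixes f :: "real \<Rightarrow> real"
  assumes s: "s > 0" and [measurable]: "f \<in> borel_measurable borel" and lip: "\<And>x y. \<bar>f x - f y\<bar> \<le> L * \<bar>x - y\<bar>"
  shows "integrable (gauss s) f" "integrable (gauss s) (\<lambda>x. (f x)\<^sup>2)"
    "(\<integral>x. (f x)\<^sup>2 \<partial>gauss s) \<le> (\<integral>x. f x \<partial>gauss s)\<^sup>2 + L\<^sup>2 * s\<^sup>2"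
proof -
  interpret G: prob_space "gauss s" by (rule prob_space_gauss[OF s])
  let ?g = "\<lambda>x. f x - f 0"
  have sq: "(?g x)\<^sup>2 \<le> L\<^sup>2 * x\<^sup>2" for x
    using power_mono[OF lip[of x 0], of 2] by (simp add: power_mult_distrib)
  have ig: "integrable (gauss s) ?g"
  proof (rule Bochner_Integration.integrable_bound)
    show "integrable (gauss s) (\<lambda>x. L * \<bar>x\<bar>)" using gauss_moments(5)[OF s] by simp
    show "AE x in gauss s. norm (?g x) \<le> norm (L * \<bar>x\<bar>)"
      using lip[of _ 0] by (auto intro: order_trans[OF _ abs_ge_self])
  qed simp
  have ig2: "integrable (gauss s) (\<lambda>x. (?g x)\<^sup>2)"
  proof (rule Bochner_Integration.integrable_bound)
    show "integrable (gauss s) (\<lambda>x. L\<^sup>2 * x\<^sup>2)" using gauss_moments(3)[OF s] by simp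
  qed (use sq in auto)
  have fe: "f = (\<lambda>x. ?g x + f 0)" by simp
  show i: "integrable (gauss s) f" by (subst fe) (intro Bochner_Integration.integrable_add ig G.integrable_const)
  have f2e: "(\<lambda>x. (f x)\<^sup>2) = (\<lambda>x. (?g x)\<^sup>2 + 2 * f 0 * ?g x + (f 0)\<^sup>2)"
    by (auto simp: power2_eq_square algebra_simps)
  show i2: "integrable (gauss s) (\<lambda>x. (f x)\<^sup>2)"
    unfolding f2e by (intro Bochner_Integration.integrable_add ig2 integrable_mult_right ig G.integrable_const)
  define m S where "m = (\<integral>x. ?g x \<partial>gauss s)" and "S = (\<integral>x. (?g x)\<^sup>2 \<partial>gauss s)"
  have e1: "(\<integral>x. (f x)\<^sup>2 \<partial>gauss s) = S + 2 * f 0 * m + (f 0)\<^sup>2"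
    unfolding f2e m_def S_def using ig ig2 G.prob_space by simp
  have e2: "(\<integral>x. f x \<partial>gauss s) = m + f 0"
    unfolding m_def using i G.prob_space by simp
  have e3: "S \<le> L\<^sup>2 * s\<^sup>2"
  proof -
    have "S \<le> (\<integral>x. L\<^sup>2 * x\<^sup>2 \<partial>gauss s)"
      unfolding S_def using sq ig2 gauss_moments(3)[OF s] by (intro integral_mono) auto
    then show ?thesis using gauss_moments(4)[OF s] by simp
  qed
  have "0 \<le> m\<^sup>2" "2 * f 0 * m = 2 * m * f 0" by simp_all
  with e3 show "(\<integral>x. (f x)\<^sup>2 \<partial>gauss s) \<le> (\<integral>x. f x \<partial>gauss s)\<^sup>2 + L\<^sup>2 * s\<^sup>2"
    unfolding e1 e2 power2_sum by linarith
qed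

section \<open>Products of Gaussian measures: variance, integration by parts, tails\<close>

abbreviation gaussPi :: "real \<Rightarrow> 'i set \<Rightarrow> ('i \<Rightarrow> real) measure" where
  "gaussPi s K \<equiv> PiM K (\<lambda>_. gauss s)"

lemma product_prob_space_gauss: "s > 0 \<Longrightarrow> product_prob_space (\<lambda>_. gauss s)"
  by (intro product_prob_spaceI prob_space_gauss)

lemma prob_space_gaussPi: "s > 0 \<Longrightarrow> prob_space (gaussPi s K)"
  by (intro prob_space_PiM prob_space_gauss)

lemma gaussPi_component:
  assumes "i \<in> K"
  shows "(\<lambda>J. J i) \<in> borel_measurable (gaussPi s K)"
proof -
  have "(\<lambda>J. J i) \<in> measurable (gaussPi s K) (gauss s)" by (rule measurable_component_singleton[OF assms])
  moreover have "measurable (gaussPi s K) (gauss s) = borel_measurable (gaussPi s K)"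
    by (intro measurable_cong_sets) auto
  ultimately show ?thesis by simp
qed

text \<open>Tensorisation of the variance: integrating out one coordinate keeps the Lipschitz
  constants in the others, and the fibre over each point contributes at most L^2 s^2.\<close>

lemma gaussPi_lipschitz_variance:
  fixes F :: "('i \<Rightarrow> real) \<Rightarrow> real"
  assumes s: "s > 0" and fin: "finite K" and F: "F \<in> borel_measurable (gaussPi s K)"
    and lip: "\<And>J i x y. i \<in> K \<Longrightarrow> \<bar>F (J(i := x)) - F (J(i := y))\<bar> \<le> L * \<bar>x - y\<bar>"
  shows "integrable (gaussPi s K) F \<and> integrable (gaussPi s K) (\<lambda>J. (F J)\<^sup>2) \<and>
    (\<integral>J. (F J)\<^sup>2 \<partial>gaussPi s K) \<le> (\<integral>J. F J \<partial>gaussPi s K)\<^sup>2 + real (card K) * L\<^sup>2 * s\<^sup>2"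
  using fin F lip
proof (induction K arbitrary: F rule: finite_induct)
  case empty
  interpret Q: prob_space "gaussPi s ({} :: 'i set)" by (rule prob_space_gaussPi[OF s])
  \<comment> \<open>The empty product is a single point, so every function is constant
    there.\<close>
  have sp: "space (gaussPi s ({} :: 'i set)) = {\<lambda>_. undefined}" by (simp add: space_PiM)
  have 1: "(\<integral>J. g J \<partial>gaussPi s ({} :: 'i set)) = g (\<lambda>_. undefined)" for g :: "('i \<Rightarrow> real) \<Rightarrow> real"
  proof -
    have "(\<integral>J. g J \<partial>gaussPi s ({} :: 'i set)) = (\<integral>J. g (\<lambda>_. undefined) \<partial>gaussPi s ({} :: 'i set))"
      by (intro Bochner_Integration.integral_cong) (auto simp: sp)
    then show ?thesis using Q.prob_space by simp
  qed
  have 2: "integrable (gaussPi s ({} :: 'i set)) g" for g :: "('i \<Rightarrow> real) \<Rightarrow> real"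
  proof -
    have "integrable (gaussPi s ({} :: 'i set)) g \<longleftrightarrow> integrable (gaussPi s ({} :: 'i set)) (\<lambda>_. g (\<lambda>_. undefined))"
      by (intro Bochner_Integration.integrable_cong) (auto simp: sp)
    then show ?thesis by simp
  qed
  show ?case by (simp add: 1 2)
next
  case (insert i K)
  interpret G: prob_space "gauss s" by (rule prob_space_gauss[OF s])
  interpret product_prob_space "\<lambda>_::'i. gauss s" by (rule product_prob_space_gauss[OF s])
  interpret Q: prob_space "gaussPi s K" by (rule prob_space_gaussPi[OF s])
  interpret Q': prob_space "gaussPi s (insert i K)" by (rule prob_space_gaussPi[OF s])
  note F = insert.prems(1)
  have meas: "(\<lambda>(J,y). F (J(i := y))) \<in> borel_measurable (gaussPi s K \<Otimes>\<^sub>M gauss s)"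
    using measurable_comp[OF measurable_add_dim F] by (simp add: comp_def case_prod_beta)
  have Fi: "(\<lambda>y. F (J(i := y))) \<in> borel_measurable borel" if "J \<in> space (gaussPi s K)" for J
    using measurable_comp[OF measurable_component_update[OF that insert.hyps(2)] F] by (simp add: comp_def)
  define F' where "F' J = (\<integral>y. F (J(i := y)) \<partial>gauss s)" for J
  have F'm: "F' \<in> borel_measurable (gaussPi s K)"
    unfolding F'_def using meas by (intro G.borel_measurable_lebesgue_integral) simp
  note one = gauss_lipschitz_variance[OF s Fi insert.prems(2)[OF insertI1]]
  have lip': "\<bar>F' (J(j := x)) - F' (J(j := y))\<bar> \<le> L * \<bar>x - y\<bar>" if j: "j \<in> K" and J: "J \<in> space (gaussPi s K)" for J j x y
  proof -
    have ne: "i \<noteq> j" using insert.hyps j by auto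
    have sp: "J(j := x) \<in> space (gaussPi s K)" for x using J j by (auto simp: space_PiM PiE_def extensional_def)
    have tw: "J(j := x, i := z) = J(i := z, j := x)" for x z by (rule fun_upd_twist[OF ne[symmetric]])
    have a: "F' (J(j := x)) - F' (J(j := y)) = (\<integral>z. F (J(j := x, i := z)) - F (J(j := y, i := z)) \<partial>gauss s)"
      unfolding F'_def by (rule Bochner_Integration.integral_diff[symmetric]) (rule one(1)[OF sp])+
    have b: "\<bar>\<integral>z. F (J(j := x, i := z)) - F (J(j := y, i := z)) \<partial>gauss s\<bar> \<le> (\<integral>z. \<bar>F (J(j := x, i := z)) - F (J(j := y, i := z))\<bar> \<partial>gauss s)"
      by (rule integral_abs_bound)
    have c: "(\<integral>z. \<bar>F (J(j := x, i := z)) - F (J(j := y, i := z))\<bar> \<partial>gauss s) \<le> (\<integral>z. L * \<bar>x - y\<bar> \<partial>gauss s)"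
    proof (rule integral_mono)
      show "integrable (gauss s) (\<lambda>z. \<bar>F (J(j := x, i := z)) - F (J(j := y, i := z))\<bar>)"
        by (intro integrable_abs Bochner_Integration.integrable_diff one(1)[OF sp])
      show "\<bar>F (J(j := x, i := z)) - F (J(j := y, i := z))\<bar> \<le> L * \<bar>x - y\<bar>" for z
        unfolding tw by (rule insert.prems(2)) (use j in blast)
    qed simp
    have "(\<integral>z. L * \<bar>x - y\<bar> \<partial>gauss s) = L * \<bar>x - y\<bar>"
      using prob_space.prob_space[OF prob_space_gauss[OF s]] by simp
    with a b c show ?thesis by linarith
  qed
  text \<open>Outside the extensional functions \<open>F'\<close> is replaced by its value at the restriction.\<close>
  define F'' where "F'' J = F' (restrict J K)" for J
  have F''eq: "F'' J = F' J" if "J \<in> space (gaussPi s K)" for J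
    using that by (simp add: F''_def space_PiM PiE_restrict)
  have F''m: "F'' \<in> borel_measurable (gaussPi s K)"
    using F'm F''eq by (subst measurable_cong[of _ _ F']) auto
  have F''lip: "\<bar>F'' (J(j := x)) - F'' (J(j := y))\<bar> \<le> L * \<bar>x - y\<bar>" if j: "j \<in> K" for J j x y
  proof -
    have r: "restrict (J(j := x)) K = (restrict J K)(j := x)" for x using j by auto
    show ?thesis unfolding F''_def r by (rule lip'[OF j]) (auto simp: space_PiM)
  qed
  note IH = insert.IH[OF F''m F''lip]
  have cong: "(\<integral>J. g (F'' J) \<partial>gaussPi s K) = (\<integral>J. g (F' J) \<partial>gaussPi s K)" for g :: "real \<Rightarrow> real"
    using F''eq by (intro Bochner_Integration.integral_cong) auto
  \<comment> \<open>Square integrability is still open at this point, so the second moment is first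
    bounded as a nonnegative integral by Tonelli.\<close>
  have nn: "(\<integral>\<^sup>+J. ennreal ((F J)\<^sup>2) \<partial>gaussPi s (insert i K)) \<le> ennreal ((\<integral>J. F' J \<partial>gaussPi s K)\<^sup>2 + real (card (insert i K)) * L\<^sup>2 * s\<^sup>2)"
  proof -
    have "(\<integral>\<^sup>+J. ennreal ((F J)\<^sup>2) \<partial>gaussPi s (insert i K)) = (\<integral>\<^sup>+J. (\<integral>\<^sup>+y. ennreal ((F (J(i := y)))\<^sup>2) \<partial>gauss s) \<partial>gaussPi s K)"
      using insert.hyps F by (intro product_nn_integral_insert) auto
    also have "\<dots> \<le> (\<integral>\<^sup>+J. ennreal ((F'' J)\<^sup>2 + L\<^sup>2 * s\<^sup>2) \<partial>gaussPi s K)"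
    proof (rule nn_integral_mono)
      fix J assume J: "J \<in> space (gaussPi s K)"
      have "(\<integral>\<^sup>+y. ennreal ((F (J(i := y)))\<^sup>2) \<partial>gauss s) = ennreal (\<integral>y. (F (J(i := y)))\<^sup>2 \<partial>gauss s)"
        by (rule nn_integral_eq_integral[OF one(2)[OF J]]) auto
      also have "\<dots> \<le> ennreal ((F'' J)\<^sup>2 + L\<^sup>2 * s\<^sup>2)"
        unfolding F''eq[OF J] F'_def by (rule ennreal_leI[OF one(3)[OF J]])
      finally show "(\<integral>\<^sup>+y. ennreal ((F (J(i := y)))\<^sup>2) \<partial>gauss s) \<le> ennreal ((F'' J)\<^sup>2 + L\<^sup>2 * s\<^sup>2)" .
    qed
    also have "\<dots> = ennreal (\<integral>J. (F'' J)\<^sup>2 + L\<^sup>2 * s\<^sup>2 \<partial>gaussPi s K)"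
      using IH by (intro nn_integral_eq_integral) auto
    also have "(\<integral>J. (F'' J)\<^sup>2 + L\<^sup>2 * s\<^sup>2 \<partial>gaussPi s K) = (\<integral>J. (F'' J)\<^sup>2 \<partial>gaussPi s K) + L\<^sup>2 * s\<^sup>2"
      using IH Q.prob_space by simp
    also have "\<dots> \<le> (\<integral>J. F' J \<partial>gaussPi s K)\<^sup>2 + real (card (insert i K)) * L\<^sup>2 * s\<^sup>2"
      using IH cong[of "\<lambda>x. x"] insert.hyps by (simp add: algebra_simps)
    finally show ?thesis by (simp add: ennreal_leI)
  qed
  have i2: "integrable (gaussPi s (insert i K)) (\<lambda>J. (F J)\<^sup>2)"
  proof (rule integrableI_bounded)
    have "(\<integral>\<^sup>+J. ennreal ((F J)\<^sup>2) \<partial>gaussPi s (insert i K)) < \<infinity>" using nn by (rule le_less_trans) simp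
    then show "(\<integral>\<^sup>+J. ennreal (norm ((F J)\<^sup>2)) \<partial>gaussPi s (insert i K)) < \<infinity>" by simp
  qed (use F in auto)
  have i1: "integrable (gaussPi s (insert i K)) F"
    by (rule Q'.square_integrable_imp_integrable[OF F i2])
  have "(\<integral>J. F J \<partial>gaussPi s (insert i K)) = (\<integral>J. F' J \<partial>gaussPi s K)"
    unfolding F'_def using insert.hyps i1 by (intro product_integral_insert) auto
  moreover have "(\<integral>J. (F J)\<^sup>2 \<partial>gaussPi s (insert i K)) \<le> (\<integral>J. F' J \<partial>gaussPi s K)\<^sup>2 + real (card (insert i K)) * L\<^sup>2 * s\<^sup>2"
  proof -
    have y0: "0 \<le> (\<integral>J. F' J \<partial>gaussPi s K)\<^sup>2 + real (card (insert i K)) * L\<^sup>2 * s\<^sup>2" by simp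
    have eq: "ennreal (\<integral>J. (F J)\<^sup>2 \<partial>gaussPi s (insert i K)) = (\<integral>\<^sup>+J. ennreal ((F J)\<^sup>2) \<partial>gaussPi s (insert i K))"
      by (rule nn_integral_eq_integral[symmetric, OF i2]) auto
    show ?thesis using nn unfolding eq[symmetric] ennreal_le_iff[OF y0] .
  qed
  ultimately show ?case using i1 i2 by simp
qed

text \<open>Stein's identity in the coordinate \<open>i\<close>, with the others integrated by
  Fubini. Boundedness of \<open>g\<close> and \<open>g'\<close> supplies the integrability.\<close>

lemma gaussPi_ibp:
  fixes g g' :: "('i \<Rightarrow> real) \<Rightarrow> real"
  assumes s: "s > 0" and fin: "finite K" and i: "i \<in> K"
    and g: "g \<in> borel_measurable (gaussPi s K)"
    and deriv: "\<And>J x. ((\<lambda>x. g (J(i := x))) has_real_derivative g' (J(i := x))) (at x)"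
    and bd: "\<And>J. \<bar>g J\<bar> \<le> C" "\<And>J. \<bar>g' J\<bar> \<le> C'"
  shows "integrable (gaussPi s K) (\<lambda>J. J i * g J)" "integrable (gaussPi s K) g'"
    "(\<integral>J. J i * g J \<partial>gaussPi s K) = s\<^sup>2 * (\<integral>J. g' J \<partial>gaussPi s K)"
proof -
  interpret G: prob_space "gauss s" by (rule prob_space_gauss[OF s])
  interpret product_prob_space "\<lambda>_::'i. gauss s" by (rule product_prob_space_gauss[OF s])
  interpret Q: prob_space "gaussPi s K" by (rule prob_space_gaussPi[OF s])
  obtain K' where K: "K = insert i K'" "i \<notin> K'" using i by (meson Set.set_insert)
  then have fin': "finite K'" using fin by simp
  have [measurable]: "(\<lambda>J. J i) \<in> borel_measurable (gaussPi s K)"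
    by (rule gaussPi_component[OF i])
  \<comment> \<open>The derivative is a pointwise limit of difference quotients with steps 1/(n+1),
    and these are measurable.\<close>
  have g'm: "g' \<in> borel_measurable (gaussPi s K)"
  proof (rule borel_measurable_LIMSEQ_real)
    fix J
    have "((\<lambda>h. (g (J(i := J i + h)) - g J) / h) \<longlongrightarrow> g' J) (at 0)"
      using deriv[of J "J i"] unfolding DERIV_def by simp
    then have "((\<lambda>n. (g (J(i := J i + inverse (real (Suc n)))) - g J) / inverse (real (Suc n))) \<longlonglongrightarrow> g' J)"
    proof (rule filterlim_compose)
      show "filterlim (\<lambda>n. inverse (real (Suc n))) (at 0) sequentially"
        using LIMSEQ_inverse_real_of_nat by (simp add: filterlim_at)
    qed
    then show "(\<lambda>n. (g (J(i := J i + inverse (real (Suc n)))) - g J) / inverse (real (Suc n))) \<longlonglongrightarrow> g' J" .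
  next
    fix n
    have "(\<lambda>J. J(i := J i + inverse (real (Suc n)))) \<in> measurable (gaussPi s K) (gaussPi s K)"
      by (rule measurable_fun_upd[where J = K]) (use i in auto)
    from measurable_comp[OF this g]
    have "(\<lambda>J. g (J(i := J i + inverse (real (Suc n))))) \<in> borel_measurable (gaussPi s K)" by (simp add: comp_def)
    then show "(\<lambda>J. (g (J(i := J i + inverse (real (Suc n)))) - g J) / inverse (real (Suc n))) \<in> borel_measurable (gaussPi s K)"
      using g by measurable
  qed
  show i2: "integrable (gaussPi s K) g'"
    by (rule Q.integrable_const_bound[of _ C']) (use bd g'm in auto)
  have iJ: "integrable (gaussPi s K) (\<lambda>J. \<bar>J i\<bar>)"
  proof -
    have "integrable (distr (gaussPi s K) (gauss s) (\<lambda>J. J i)) (\<lambda>x. \<bar>x\<bar>)"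
      using distr_PiM_component[OF _ i, of "\<lambda>_. gauss s"] prob_space_gauss[OF s] gauss_moments(5)[OF s] by simp
    then show ?thesis
      by (subst (asm) integrable_distr_eq) (auto intro: measurable_component_singleton[OF i])
  qed
  show i1: "integrable (gaussPi s K) (\<lambda>J. J i * g J)"
  proof (rule Bochner_Integration.integrable_bound)
    show "integrable (gaussPi s K) (\<lambda>J. C * \<bar>J i\<bar>)" using iJ by simp
    show "AE J in gaussPi s K. norm (J i * g J) \<le> norm (C * \<bar>J i\<bar>)"
    proof (rule AE_I2)
      fix J
      have "\<bar>J i\<bar> * \<bar>g J\<bar> \<le> \<bar>J i\<bar> * \<bar>C\<bar>" using bd(1)[of J] by (intro mult_left_mono) auto
      then show "norm (J i * g J) \<le> norm (C * \<bar>J i\<bar>)" by (simp add: abs_mult mult.commute)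
    qed
  qed (use g in measurable)
  have "(\<integral>J. J i * g J \<partial>gaussPi s K) = (\<integral>J. (\<integral>x. (J(i := x)) i * g (J(i := x)) \<partial>gauss s) \<partial>gaussPi s K')"
    using i1 fin' K(2) unfolding K(1) by (intro product_integral_insert) auto
  also have "\<dots> = (\<integral>J. s\<^sup>2 * (\<integral>x. g' (J(i := x)) \<partial>gauss s) \<partial>gaussPi s K')"
  proof (rule Bochner_Integration.integral_cong[OF refl])
    fix J assume J: "J \<in> space (gaussPi s K')"
    have "(\<lambda>x. g' (J(i := x))) \<in> borel_measurable borel"
      using measurable_comp[OF measurable_component_update[OF J K(2)] g'm[unfolded K(1)]] by (simp add: comp_def)
    then show "(\<integral>x. (J(i := x)) i * g (J(i := x)) \<partial>gauss s) = s\<^sup>2 * (\<integral>x. g' (J(i := x)) \<partial>gauss s)"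
      using gauss_ibp[OF s deriv bd(1) bd(2)] by simp
  qed
  also have "\<dots> = s\<^sup>2 * (\<integral>J. g' J \<partial>gaussPi s K)"
    using product_integral_insert[OF fin' K(2) i2[unfolded K(1)]] unfolding K(1) by simp
  finally show "(\<integral>J. J i * g J \<partial>gaussPi s K) = s\<^sup>2 * (\<integral>J. g' J \<partial>gaussPi s K)" .
qed

text \<open>Chernoff's bound; the moment generating function factors over the independent
  coordinates.\<close>

lemma gaussPi_tail:
  fixes a :: "'i \<Rightarrow> real"
  assumes s: "s > 0" and fin: "finite K" and V: "(\<Sum>i\<in>K. (a i)\<^sup>2) \<le> V" "V > 0" and t: "t > 0"
  shows "measure (gaussPi s K) {J \<in> space (gaussPi s K). (\<Sum>i\<in>K. a i * J i) \<ge> t} \<le> exp (- t\<^sup>2 / (2 * s\<^sup>2 * V))"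
proof -
  interpret G: prob_space "gauss s" by (rule prob_space_gauss[OF s])
  interpret product_prob_space "\<lambda>_::'i. gauss s" by (rule product_prob_space_gauss[OF s])
  interpret Q: prob_space "gaussPi s K" by (rule prob_space_gaussPi[OF s])
  \<comment> \<open>The minimiser of -l t + l^2 s^2 V / 2.\<close>
  define l where "l = t / (s\<^sup>2 * V)"
  have l: "l > 0" using s V t by (simp add: l_def)
  have [measurable]: "(\<lambda>J. J i) \<in> borel_measurable (gaussPi s K)" if "i \<in> K" for i
    by (rule gaussPi_component[OF that])
  let ?A = "{J \<in> space (gaussPi s K). (\<Sum>i\<in>K. a i * J i) \<ge> t}"
  have A: "?A = {J \<in> space (gaussPi s K). 1 \<le> ennreal (exp (- l * t)) * ennreal (exp (l * (\<Sum>i\<in>K. a i * J i)))}"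
    using l by (auto simp flip: ennreal_mult ennreal_1 exp_add simp: right_diff_distrib[symmetric] zero_le_mult_iff)
  have "emeasure (gaussPi s K) ?A \<le> ennreal (exp (- l * t)) * (\<integral>\<^sup>+J. ennreal (exp (l * (\<Sum>i\<in>K. a i * J i))) * indicator (space (gaussPi s K)) J \<partial>gaussPi s K)"
    unfolding A by (rule nn_integral_Markov_inequality) auto
  also have "(\<integral>\<^sup>+J. ennreal (exp (l * (\<Sum>i\<in>K. a i * J i))) * indicator (space (gaussPi s K)) J \<partial>gaussPi s K)
     = (\<integral>\<^sup>+J. (\<Prod>i\<in>K. ennreal (exp ((l * a i) * J i))) \<partial>gaussPi s K)"
    using fin by (intro nn_integral_cong) (simp add: prod_ennreal exp_sum sum_distrib_left mult.assoc)
  also have "\<dots> = (\<Prod>i\<in>K. \<integral>\<^sup>+x. ennreal (exp ((l * a i) * x)) \<partial>gauss s)"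
    using fin by (intro product_nn_integral_prod) auto
  also have "\<dots> = ennreal (exp (\<Sum>i\<in>K. (l * a i)\<^sup>2 * s\<^sup>2 / 2))"
    using fin by (simp add: gauss_exp[OF s] prod_ennreal exp_sum)
  also have "\<dots> \<le> ennreal (exp (l\<^sup>2 * V * s\<^sup>2 / 2))"
  proof -
    have "(\<Sum>i\<in>K. (l * a i)\<^sup>2 * s\<^sup>2 / 2) = l\<^sup>2 * s\<^sup>2 / 2 * (\<Sum>i\<in>K. (a i)\<^sup>2)"
      by (simp add: sum_distrib_left power_mult_distrib mult_ac)
    also have "\<dots> \<le> l\<^sup>2 * s\<^sup>2 / 2 * V" using V by (intro mult_left_mono) auto
    finally show ?thesis by (intro ennreal_leI) (simp add: mult_ac)
  qed
  finally have "emeasure (gaussPi s K) ?A \<le> ennreal (exp (- l * t)) * ennreal (exp (l\<^sup>2 * V * s\<^sup>2 / 2))"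
    by (simp add: mult_left_mono)
  also have "\<dots> = ennreal (exp (- t\<^sup>2 / (2 * s\<^sup>2 * V)))"
  proof -
    have "- l * t + l\<^sup>2 * V * s\<^sup>2 / 2 = - t\<^sup>2 / (2 * s\<^sup>2 * V)"
      using s V by (simp add: l_def field_simps power2_eq_square)
    then show ?thesis by (simp flip: ennreal_mult exp_add)
  qed
  finally show ?thesis by (simp add: Q.emeasure_eq_measure)
qed

section \<open>Gibbs states of Gaussian Hamiltonians\<close>

definition ham :: "nat \<Rightarrow> ('i \<Rightarrow> complex mat) \<Rightarrow> 'i set \<Rightarrow> ('i \<Rightarrow> real) \<Rightarrow> complex mat" where
  "ham d B K J = mat d d (\<lambda>(x,y). \<Sum>I\<in>K. of_real (J I) * B I $$ (x,y))"

lemma ham_carrier [simp]: "ham d B K J \<in> carrier_mat d d"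
  and ham_entry: "x < d \<Longrightarrow> y < d \<Longrightarrow> ham d B K J $$ (x,y) = (\<Sum>I\<in>K. of_real (J I) * B I $$ (x,y))"
  by (simp_all add: ham_def)

lemma ham_hermitian:
  assumes "\<And>I. I \<in> K \<Longrightarrow> hermitian d (B I)"
  shows "hermitian d (ham d B K J)"
  unfolding hermitian_def
  by (auto simp: ham_entry hermitian_entry[OF assms] intro!: sum.cong)

lemma ham_smult: "ham d B K (\<lambda>I. r * J I) = of_real r \<cdot>\<^sub>m ham d B K J"
  by (intro eq_matI) (auto simp: ham_def sum_distrib_left mult_ac)

lemma ham_insert:
  assumes "finite K" "i \<notin> K" "B i \<in> carrier_mat d d"
  shows "ham d B (insert i K) (J(i := t)) = ham d B K J + of_real t \<cdot>\<^sub>m B i"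
proof (intro eq_matI)
  fix x y assume "x < dim_row (ham d B K J + of_real t \<cdot>\<^sub>m B i)" "y < dim_col (ham d B K J + of_real t \<cdot>\<^sub>m B i)"
  then have xy: "x < d" "y < d" using assms(3) by auto
  have "(\<Sum>I\<in>K. of_real ((J(i := t)) I) * B I $$ (x,y)) = (\<Sum>I\<in>K. of_real (J I) * B I $$ (x,y))"
    using assms(2) by (intro sum.cong) auto
  then show "ham d B (insert i K) (J(i := t)) $$ (x,y) = (ham d B K J + of_real t \<cdot>\<^sub>m B i) $$ (x,y)"
    using xy assms by (simp add: ham_entry)
qed (use assms in \<open>auto simp: ham_def\<close>)

lemma ham_upd:
  assumes "finite K" "i \<in> K" "B i \<in> carrier_mat d d"
  shows "ham d B K (J(i := t)) = ham d B (K - {i}) J + of_real t \<cdot>\<^sub>m B i"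
  using ham_insert[of "K - {i}" i B d J t] assms by (simp add: insert_absorb)

lemma Gf_ham: "Gf d A (ham d B K J) = (\<Sum>I\<in>K. J I * Gf d A (B I))"
proof -
  have "trp d (ham d B K J) M = (\<Sum>I\<in>K. of_real (J I) * trp d (B I) M)" for M
  proof -
    have "trp d (ham d B K J) M = (\<Sum>x<d. \<Sum>y<d. \<Sum>I\<in>K. of_real (J I) * (B I $$ (x,y) * M $$ (y,x)))"
      unfolding trp_def by (intro sum.cong refl) (simp add: ham_entry sum_distrib_right sum_distrib_left mult_ac)
    also have "\<dots> = (\<Sum>x<d. \<Sum>I\<in>K. \<Sum>y<d. of_real (J I) * (B I $$ (x,y) * M $$ (y,x)))"
      by (rule sum.cong[OF refl], rule sum.swap)
    also have "\<dots> = (\<Sum>I\<in>K. \<Sum>x<d. \<Sum>y<d. of_real (J I) * (B I $$ (x,y) * M $$ (y,x)))"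
      by (rule sum.swap)
    finally show ?thesis by (simp add: trp_def sum_distrib_left)
  qed
  then show ?thesis by (simp add: Gf_def)
qed

text \<open>The entries of a power are polynomials in the couplings.\<close>

lemma ham_pow_measurable:
  assumes "x < d" "y < d"
  shows "(\<lambda>J. (ham d B K (\<lambda>I. r * J I) ^\<^sub>m k) $$ (x,y)) \<in> borel_measurable (gaussPi s K)"
  using assms
proof (induction k arbitrary: x y)
  case 0
  have "(ham d B K (\<lambda>I. r * J I) ^\<^sub>m 0) $$ (x,y) = (if x = y then 1 else 0)" for J :: "'a \<Rightarrow> real"
    using 0 by (simp add: ham_def)
  then show ?case by simp
next
  case (Suc k)
  have e: "(ham d B K (\<lambda>I. r * J I) ^\<^sub>m Suc k) $$ (x,y)
     = (\<Sum>p<d. (ham d B K (\<lambda>I. r * J I) ^\<^sub>m k) $$ (x,p) * (\<Sum>I\<in>K. of_real (r * J I) * B I $$ (p,y)))" for J :: "'a \<Rightarrow> real"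
    unfolding pow_mat.simps
    by (subst mult_mat_sum[of _ d]) (use Suc.prems in \<open>auto simp: ham_entry intro!: sum.cong\<close>)
  have c: "(\<lambda>J. complex_of_real (r * J I)) \<in> borel_measurable (gaussPi s K)" if "I \<in> K" for I
    using gaussPi_component[OF that, of s] by measurable
  show ?case unfolding e
    by (intro borel_measurable_sum borel_measurable_times Suc.IH c) (use Suc.prems in auto)
qed

lemma trp_exp_measurable:
  "(\<lambda>J. trp d C (mat_exp (ham d B K (\<lambda>I. r * J I)))) \<in> borel_measurable (gaussPi s K)"
proof -
  have e: "mat_exp (ham d B K (\<lambda>I. r * J I)) $$ (y,x) = (\<Sum>k. (ham d B K (\<lambda>I. r * J I) ^\<^sub>m k) $$ (y,x) / of_nat (fact k))"
    if "x < d" "y < d" for x y and J :: "'a \<Rightarrow> real"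
    using that by (simp add: mat_exp_def ham_def)
  have "(\<lambda>J. mat_exp (ham d B K (\<lambda>I. r * J I)) $$ (y,x)) \<in> borel_measurable (gaussPi s K)" if "x < d" "y < d" for x y
    unfolding e[OF that]
    by (intro borel_measurable_suminf borel_measurable_divide ham_pow_measurable that borel_measurable_const)
  then show ?thesis unfolding trp_def
    by (intro borel_measurable_sum borel_measurable_times borel_measurable_const) auto
qed

lemma Zf_measurable: "(\<lambda>J. Zf d (ham d B K (\<lambda>I. r * J I))) \<in> borel_measurable (gaussPi s K)"
  and Gf_measurable: "(\<lambda>J. Gf d (ham d B K (\<lambda>I. r * J I)) C) \<in> borel_measurable (gaussPi s K)"
  unfolding Zf_def Gf_def
  by (intro borel_measurable_continuous_on[OF continuous_on_Re[OF continuous_on_id]] trp_exp_measurable)+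

subsection \<open>Exponential moments\<close>

text \<open>The even function u(t) = Z(A + t B) + Z(A - t B) satisfies u'' \<le> c u and u'(0) = 0,
  so it grows no faster than the solution u(0) cosh(sqrt(c) t) of the equation u'' = c u.\<close>

lemma Zf_cosh:
  assumes A: "hermitian d A" and B: "hermitian d B" and sq: "B * B = of_real c \<cdot>\<^sub>m 1\<^sub>m d" and c: "c > 0"
  shows "Zf d (A + of_real t \<cdot>\<^sub>m B) + Zf d (A + of_real (- t) \<cdot>\<^sub>m B) \<le> 2 * cosh (sqrt c * t) * Zf d A"
proof -
  define u where "u t = Zf d (A + of_real t \<cdot>\<^sub>m B) + Zf d (A + of_real (- t) \<cdot>\<^sub>m B)" for t
  define v where "v t = Gf d (A + of_real t \<cdot>\<^sub>m B) B - Gf d (A + of_real (- t) \<cdot>\<^sub>m B) B" for t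
  define w where "w t = Df d (A + of_real t \<cdot>\<^sub>m B) B + Df d (A + of_real (- t) \<cdot>\<^sub>m B) B" for t
  have uv: "(u has_real_derivative v t) (at t)" for t
  proof -
    have "((\<lambda>t. Zf d (A + of_real (- t) \<cdot>\<^sub>m B)) has_real_derivative Gf d (A + of_real (- t) \<cdot>\<^sub>m B) B * (- 1)) (at t)"
      by (rule DERIV_chain2[OF Zf_deriv[OF A B]]) (auto intro!: derivative_eq_intros)
    from DERIV_add[OF Zf_deriv[OF A B] this] show ?thesis unfolding u_def v_def by simp
  qed
  have vw: "(v has_real_derivative w t) (at t)" for t
  proof -
    have "((\<lambda>t. Gf d (A + of_real (- t) \<cdot>\<^sub>m B) B) has_real_derivative Df d (A + of_real (- t) \<cdot>\<^sub>m B) B * (- 1)) (at t)"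
      by (rule DERIV_chain2[OF Gf_deriv[OF A B]]) (auto intro!: derivative_eq_intros)
    from DERIV_diff[OF Gf_deriv[OF A B] this] show ?thesis unfolding v_def w_def by simp
  qed
  have wu: "w t \<le> c * u t" for t
    unfolding w_def u_def using Df_upper[OF hermitian_add_smult[OF A B] B sq, of t] Df_upper[OF hermitian_add_smult[OF A B] B sq, of "- t"]
    by (simp add: algebra_simps)
  have pos: "u \<bar>t\<bar> \<le> 2 * cosh (sqrt c * \<bar>t\<bar>) * Zf d A"
  proof -
    define k where "k = sqrt c"
    have k: "k > 0" "k * k = c" using c by (simp_all add: k_def)
    \<comment> \<open>The Wronskian of \<open>u\<close> and cosh. Its derivative is (u'' - c u)
      cosh, hence it is nonpositive for t \<ge> 0, and u / cosh does not increase.\<close>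
    define W where "W t = v t * cosh (k * t) - k * (u t * sinh (k * t))" for t
    have dW: "(W has_real_derivative (w t - c * u t) * cosh (k * t)) (at t)" for t
      unfolding W_def by (rule derivative_eq_intros uv vw refl)+ (use k in \<open>simp add: algebra_simps flip: k(2)\<close>)
    have "v 0 = 0" by (simp add: v_def)
    then have W0: "W 0 = 0" by (simp add: W_def)
    have W: "W t \<le> 0" if "t \<ge> 0" for t
    proof -
      have "W t \<le> W 0"
      proof (rule DERIV_nonpos_imp_nonincreasing[OF that])
        fix x
        have "(w x - c * u x) * cosh (k * x) \<le> 0"
          using wu[of x] by (intro mult_nonpos_nonneg) auto
        then show "\<exists>y. (W has_real_derivative y) (at x) \<and> y \<le> 0" using dW[of x] by blast
      qed
      then show ?thesis using W0 by simp
    qed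
    have dR: "((\<lambda>t. u t / cosh (k * t)) has_real_derivative W t / (cosh (k * t))\<^sup>2) (at t)" for t
      unfolding W_def
      by (rule derivative_eq_intros uv refl)+ (auto simp: power2_eq_square algebra_simps)
    have "u \<bar>t\<bar> / cosh (k * \<bar>t\<bar>) \<le> u 0 / cosh (k * 0)"
    proof (rule DERIV_nonpos_imp_nonincreasing[of 0 "\<bar>t\<bar>" "\<lambda>t. u t / cosh (k * t)"])
      fix x :: real assume "0 \<le> x"
      then have "W x / (cosh (k * x))\<^sup>2 \<le> 0" using W by (simp add: divide_nonpos_nonneg)
      then show "\<exists>y. ((\<lambda>t. u t / cosh (k * t)) has_real_derivative y) (at x) \<and> y \<le> 0" using dR by blast
    qed simp
    moreover have "A + of_real (0::real) \<cdot>\<^sub>m B = A"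
      using hermitian_carrier[OF A] hermitian_carrier[OF B] by (intro eq_matI) auto
    then have "u 0 = 2 * Zf d A" by (simp add: u_def)
    ultimately show ?thesis using cosh_real_pos[of "k * \<bar>t\<bar>"] by (simp add: field_simps k_def)
  qed
  have e1: "u t = u \<bar>t\<bar>" by (cases "t \<ge> 0") (auto simp: u_def)
  have e2: "cosh (sqrt c * t) = cosh (sqrt c * \<bar>t\<bar>)" by (simp add: abs_mult)
  show ?thesis using pos unfolding e1[symmetric] e2[symmetric] unfolding u_def .
qed

lemma Zf_zero:
  assumes "d > 0"
  shows "Zf d (0\<^sub>m d d) = real d"
proof -
  have "hermitian d (0\<^sub>m d d)" by (simp add: hermitian_def)
  then obtain a U where S: "spectral d (0\<^sub>m d d) a U" using hermitian_spectral by blast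
  have "a l = 0" if "l < d" for l
    using conj_by_self[OF S that that] by (simp add: conj_by_def)
  then show ?thesis by (simp add: Zf_spectral[OF S])
qed

text \<open>One coupling is integrated out at a time. By symmetry of the Gaussian it acts as an
  average over both signs, which costs at most the mean of a cosh.\<close>

lemma Zf_expectation:
  assumes s: "s > 0" and c: "c > 0" and d: "d > 0" and "finite K"
    and "\<And>I. I \<in> K \<Longrightarrow> hermitian d (B I)" "\<And>I. I \<in> K \<Longrightarrow> B I * B I = of_real c \<cdot>\<^sub>m 1\<^sub>m d"
  shows "(\<integral>\<^sup>+J. ennreal (Zf d (ham d B K (\<lambda>I. r * J I))) \<partial>gaussPi s K) \<le> ennreal (real d * exp (real (card K) * (c * r\<^sup>2 * s\<^sup>2 / 2)))"
  using assms(4-6)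
proof (induction K rule: finite_induct)
  case empty
  interpret Q: prob_space "gaussPi s ({} :: 'a set)" by (rule prob_space_gaussPi[OF s])
  have "ham d B {} (\<lambda>I. r * J I) = 0\<^sub>m d d" for J :: "'a \<Rightarrow> real" by (intro eq_matI) (auto simp: ham_def)
  then show ?case using Zf_zero[OF d] Q.emeasure_space_1 by simp
next
  case (insert i K)
  interpret product_prob_space "\<lambda>_::'a. gauss s" by (rule product_prob_space_gauss[OF s])
  note B = insert.prems(1) and sq = insert.prems(2)
  define k where "k = sqrt c * r"
  define E where "E = exp (c * r\<^sup>2 * s\<^sup>2 / 2)"
  \<comment> \<open>The Gaussian mean of the cosh, which is the factor that each coupling
    contributes.\<close>
  have cc: "(\<integral>\<^sup>+x. ennreal (cosh (k * x)) \<partial>gauss s) = ennreal E"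
  proof -
    define h :: real where "h = 1 / 2"
    have h: "h \<ge> 0" by (simp add: h_def)
    have "cosh (k * x) = h * exp (k * x) + h * exp (- k * x)" for x
      by (simp add: cosh_def h_def field_simps)
    then have "(\<integral>\<^sup>+x. ennreal (cosh (k * x)) \<partial>gauss s) = (\<integral>\<^sup>+x. ennreal h * ennreal (exp (k * x)) + ennreal h * ennreal (exp (- k * x)) \<partial>gauss s)"
      using h by (simp only: ennreal_plus ennreal_mult mult_nonneg_nonneg exp_ge_zero)
    also have "\<dots> = ennreal h * (\<integral>\<^sup>+x. ennreal (exp (k * x)) \<partial>gauss s) + ennreal h * (\<integral>\<^sup>+x. ennreal (exp (- k * x)) \<partial>gauss s)"
      by (subst nn_integral_add) (auto simp: nn_integral_cmult)
    also have "\<dots> = ennreal (h * exp (k\<^sup>2 * s\<^sup>2 / 2) + h * exp ((- k)\<^sup>2 * s\<^sup>2 / 2))"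
      using h by (simp only: gauss_exp[OF s] ennreal_plus ennreal_mult mult_nonneg_nonneg exp_ge_zero)
    also have "h * exp (k\<^sup>2 * s\<^sup>2 / 2) + h * exp ((- k)\<^sup>2 * s\<^sup>2 / 2) = E"
      using c by (simp add: k_def power_mult_distrib E_def h_def)
    finally show ?thesis .
  qed
  have inner: "(\<integral>\<^sup>+x. ennreal (Zf d (ham d B (insert i K) (\<lambda>I. r * (J(i := x)) I))) \<partial>gauss s) \<le> ennreal E * ennreal (Zf d (ham d B K (\<lambda>I. r * J I)))" for J
  proof -
    define A where "A = ham d B K (\<lambda>I. r * J I)"
    have hA: "hermitian d A" unfolding A_def by (rule ham_hermitian) (use B in auto)
    have hB: "hermitian d (B i)" and sB: "B i * B i = of_real c \<cdot>\<^sub>m 1\<^sub>m d" using B sq by auto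
    have e: "ham d B (insert i K) (\<lambda>I. r * (J(i := x)) I) = A + of_real (r * x) \<cdot>\<^sub>m B i" for x
    proof -
      have "(\<lambda>I. r * (J(i := x)) I) = (\<lambda>I. r * J I)(i := r * x)" by auto
      then show ?thesis using ham_insert[of K i B d, OF insert.hyps hermitian_carrier[OF hB]] unfolding A_def by simp
    qed
    let ?f = "\<lambda>x. ennreal (Zf d (A + of_real (r * x) \<cdot>\<^sub>m B i))"
    have Zpos: "Zf d (A + of_real t \<cdot>\<^sub>m B i) > 0" for t by (rule Zf_pos[OF hermitian_add_smult[OF hA hB] d])
    have "continuous_on UNIV (\<lambda>t. Zf d (A + of_real t \<cdot>\<^sub>m B i))"
      by (rule DERIV_continuous_on) (rule has_field_derivative_at_within[OF Zf_deriv[OF hA hB]])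
    then have "(\<lambda>t. Zf d (A + of_real t \<cdot>\<^sub>m B i)) \<in> borel_measurable borel" by (rule borel_measurable_continuous_onI)
    from measurable_compose[OF _ this, of "\<lambda>x. r * x" borel]
    have fm[measurable]: "?f \<in> borel_measurable borel" by measurable
    have fm': "(\<lambda>x. ?f (- x)) \<in> borel_measurable borel"
      using measurable_compose[OF _ fm, of uminus borel] by simp
    have [measurable]: "(\<lambda>x. cosh (k * x)) \<in> borel_measurable borel"
      by (intro borel_measurable_continuous_onI continuous_intros)
    have "2 * (\<integral>\<^sup>+x. ?f x \<partial>gauss s) = (\<integral>\<^sup>+x. ?f x \<partial>gauss s) + (\<integral>\<^sup>+x. ?f (- x) \<partial>gauss s)"
      using gauss_reflect[OF fm, of s] by (simp add: mult_2)
    also have "\<dots> = (\<integral>\<^sup>+x. ?f x + ?f (- x) \<partial>gauss s)"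
      by (rule nn_integral_add[symmetric]) (simp_all only: measurable_gauss fm fm')
    also have "\<dots> \<le> (\<integral>\<^sup>+x. ennreal (2 * Zf d A) * ennreal (cosh (k * x)) \<partial>gauss s)"
    proof (rule nn_integral_mono)
      fix x
      have "?f x + ?f (- x) = ennreal (Zf d (A + of_real (r * x) \<cdot>\<^sub>m B i) + Zf d (A + of_real (- (r * x)) \<cdot>\<^sub>m B i))"
        using Zpos[of "r * x"] Zpos[of "- (r * x)"] by (simp add: ennreal_plus less_imp_le)
      also have "\<dots> \<le> ennreal (2 * cosh (sqrt c * (r * x)) * Zf d A)"
        by (rule ennreal_leI[OF Zf_cosh[OF hA hB sB c]])
      also have "\<dots> = ennreal (2 * Zf d A) * ennreal (cosh (k * x))"
        using Zf_pos[OF hA d] by (simp add: k_def mult_ac flip: ennreal_mult)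
      finally show "?f x + ?f (- x) \<le> ennreal (2 * Zf d A) * ennreal (cosh (k * x))" .
    qed
    also have "\<dots> = ennreal (2 * Zf d A) * ennreal E"
      by (subst nn_integral_cmult) (auto simp: cc)
    also have "\<dots> = 2 * (ennreal E * ennreal (Zf d A))"
      using Zf_pos[OF hA d] by (simp add: ennreal_mult' mult_ac flip: ennreal_numeral)
    finally have "2 * (\<integral>\<^sup>+x. ?f x \<partial>gauss s) \<le> 2 * (ennreal E * ennreal (Zf d A))" .
    then show ?thesis unfolding e A_def[symmetric] by (simp add: ennreal_mult_le_mult_iff)
  qed
  have "(\<integral>\<^sup>+J. ennreal (Zf d (ham d B (insert i K) (\<lambda>I. r * J I))) \<partial>gaussPi s (insert i K))
     = (\<integral>\<^sup>+J. (\<integral>\<^sup>+x. ennreal (Zf d (ham d B (insert i K) (\<lambda>I. r * (J(i := x)) I))) \<partial>gauss s) \<partial>gaussPi s K)"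
    using insert.hyps Zf_measurable[of d B "insert i K" r s] by (intro product_nn_integral_insert) auto
  also have "\<dots> \<le> (\<integral>\<^sup>+J. ennreal E * ennreal (Zf d (ham d B K (\<lambda>I. r * J I))) \<partial>gaussPi s K)"
    by (intro nn_integral_mono inner)
  also have "\<dots> = ennreal E * (\<integral>\<^sup>+J. ennreal (Zf d (ham d B K (\<lambda>I. r * J I))) \<partial>gaussPi s K)"
    using Zf_measurable[of d B K r s] by (intro nn_integral_cmult) auto
  also have "\<dots> \<le> ennreal E * ennreal (real d * exp (real (card K) * (c * r\<^sup>2 * s\<^sup>2 / 2)))"
    using insert.IH B sq by (intro mult_left_mono) auto
  also have "\<dots> = ennreal (real d * exp (real (card (insert i K)) * (c * r\<^sup>2 * s\<^sup>2 / 2)))"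
    using insert.hyps by (simp add: E_def algebra_simps add_divide_distrib exp_add flip: ennreal_mult)
  finally show ?case .
qed

subsection \<open>The energy of the Gibbs state\<close>

text \<open>In the application \<open>\<kappa>\<close> counts the terms that anticommute with a
  given one: a commuting \<open>B I\<close> conjugates \<open>B J\<close> to c B J, an anticommuting
  one to -c B J, and the signs add up to N - 2 \<kappa>. The constant \<open>\<Lambda>\<close> is
  the commutation index, required for mixtures of vectors so that it covers Gibbs states.\<close>

locale gaussian_ham =
  fixes K :: "'i set" and B :: "'i \<Rightarrow> complex mat" and d :: nat and c s \<kappa> \<Lambda> :: real
  assumes fin: "finite K" and d: "d > 0" and s: "s > 0" and c: "c > 0" and \<kappa>: "\<kappa> \<ge> 0"
    and herm: "I \<in> K \<Longrightarrow> hermitian d (B I)"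
    and sq: "I \<in> K \<Longrightarrow> B I * B I = of_real c \<cdot>\<^sub>m 1\<^sub>m d"
    and conj_sum: "J \<in> K \<Longrightarrow> x < d \<Longrightarrow> y < d \<Longrightarrow>
      (\<Sum>I\<in>K. (B I * B J * B I) $$ (x,y)) = of_real (c * (real (card K) - 2 * \<kappa>)) * B J $$ (x,y)"
    and state_bound: "(\<Sum>l<n :: nat. \<Sum>x<d. (cmod (\<phi> l x))\<^sup>2) = 1 \<Longrightarrow>
      (\<Sum>I\<in>K. (\<Sum>l<n. Re (qf d (B I) (\<phi> l)))\<^sup>2) \<le> \<Lambda>"
begin

text \<open>The parameter \<open>r\<close> is minus the inverse temperature when it is negative; the
  values used later are -\<beta>/2, -\<beta> and \<beta>. Thus \<open>energy\<close> at r = -\<beta>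
  is the Gibbs mean of -\<beta> H, and \<open>obs\<close> is the Gibbs mean of a single
  term.\<close>

definition A :: "real \<Rightarrow> ('i \<Rightarrow> real) \<Rightarrow> complex mat" where
  "A r J = ham d B K (\<lambda>I. r * J I)"

definition energy :: "real \<Rightarrow> ('i \<Rightarrow> real) \<Rightarrow> real" where
  "energy r J = Gf d (A r J) (A r J) / Zf d (A r J)"

definition obs :: "real \<Rightarrow> 'i \<Rightarrow> ('i \<Rightarrow> real) \<Rightarrow> real" where
  "obs r i J = Gf d (A r J) (B i) / Zf d (A r J)"

lemma hA: "hermitian d (A r J)"
  unfolding A_def by (rule ham_hermitian) (rule herm)

lemma cA: "A r J \<in> carrier_mat d d"
  by (rule hermitian_carrier[OF hA])

lemma cB: "I \<in> K \<Longrightarrow> B I \<in> carrier_mat d d"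
  by (rule hermitian_carrier[OF herm])

lemma Zpos: "Zf d (A r J) > 0"
  by (rule Zf_pos[OF hA d])

lemma A_upd:
  assumes "i \<in> K"
  obtains A0 where "hermitian d A0" "\<And>x. A r (J(i := x)) = A0 + of_real (r * x) \<cdot>\<^sub>m B i"
proof
  show "hermitian d (ham d B (K - {i}) (\<lambda>I. r * J I))" by (rule ham_hermitian) (use herm in auto)
  fix x
  have "(\<lambda>I. r * (J(i := x)) I) = (\<lambda>I. r * J I)(i := r * x)" by auto
  then show "A r (J(i := x)) = ham d B (K - {i}) (\<lambda>I. r * J I) + of_real (r * x) \<cdot>\<^sub>m B i"
    unfolding A_def using ham_upd[of K i B d, OF fin assms cB[OF assms]] by simp
qed

lemma energy_sum: "energy r J = (\<Sum>i\<in>K. r * (J i * obs r i J))"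
  unfolding energy_def obs_def by (subst (2) A_def) (simp add: Gf_ham sum_divide_distrib mult.assoc)

lemma Z_measurable: "(\<lambda>J. Zf d (A r J)) \<in> borel_measurable (gaussPi s K)"
  unfolding A_def by (rule Zf_measurable)

lemma obs_measurable: "obs r i \<in> borel_measurable (gaussPi s K)"
  unfolding obs_def[abs_def] A_def by (intro borel_measurable_divide Zf_measurable Gf_measurable)

lemma obs_bound: "i \<in> K \<Longrightarrow> \<bar>obs r i J\<bar> \<le> sqrt c"
  using Gf_bound[OF hA[of r J] herm sq, of i] Zpos[of r J] unfolding obs_def by (simp add: abs_divide pos_divide_le_eq)

lemma ln_Z_deriv:
  assumes "i \<in> K"
  shows "((\<lambda>x. ln (Zf d (A r (J(i := x))))) has_real_derivative r * obs r i (J(i := x))) (at x)"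
proof -
  obtain A0 where A0: "hermitian d A0" "\<And>x. A r (J(i := x)) = A0 + of_real (r * x) \<cdot>\<^sub>m B i"
    using A_upd[OF assms] by blast
  have "((\<lambda>x. Zf d (A r (J(i := x)))) has_real_derivative Gf d (A r (J(i := x))) (B i) * r) (at x)"
    unfolding A0(2) by (rule DERIV_chain2[OF Zf_deriv[OF A0(1) herm[OF assms]]]) (auto intro!: derivative_eq_intros)
  from DERIV_chain2[OF DERIV_ln_divide[OF Zpos[of r "J(i := x)"]] this] show ?thesis
    unfolding obs_def by (simp add: field_simps)
qed

lemma ln_Z_lipschitz:
  assumes "i \<in> K"
  shows "\<bar>ln (Zf d (A r (J(i := x)))) - ln (Zf d (A r (J(i := y))))\<bar> \<le> (\<bar>r\<bar> * sqrt c) * \<bar>x - y\<bar>"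
proof -
  have "norm (ln (Zf d (A r (J(i := x)))) - ln (Zf d (A r (J(i := y))))) \<le> (\<bar>r\<bar> * sqrt c) * norm (x - y)"
  proof (rule field_differentiable_bound[where S = UNIV])
    show "((\<lambda>x. ln (Zf d (A r (J(i := x))))) has_field_derivative r * obs r i (J(i := z))) (at z within UNIV)" for z
      using ln_Z_deriv[OF assms] by simp
    show "norm (r * obs r i (J(i := z))) \<le> \<bar>r\<bar> * sqrt c" for z
      using obs_bound[OF assms] by (simp add: abs_mult mult_left_mono)
  qed auto
  then show ?thesis by simp
qed

text \<open>\<open>r\<close> times the Bogoliubov variance of \<open>B i\<close>, which is what the
  quotient rule leaves of the derivative of a Gibbs mean.\<close>

definition obs' :: "real \<Rightarrow> 'i \<Rightarrow> ('i \<Rightarrow> real) \<Rightarrow> real" where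
  "obs' r i J = r * (Df d (A r J) (B i) / Zf d (A r J) - (obs r i J)\<^sup>2)"

lemma obs_deriv:
  assumes "i \<in> K"
  shows "((\<lambda>x. obs r i (J(i := x))) has_real_derivative obs' r i (J(i := x))) (at x)"
proof -
  obtain A0 where A0: "hermitian d A0" "\<And>x. A r (J(i := x)) = A0 + of_real (r * x) \<cdot>\<^sub>m B i"
    using A_upd[OF assms] by blast
  have Z: "((\<lambda>x. Zf d (A r (J(i := x)))) has_real_derivative Gf d (A r (J(i := x))) (B i) * r) (at x)"
    unfolding A0(2) by (rule DERIV_chain2[OF Zf_deriv[OF A0(1) herm[OF assms]]]) (auto intro!: derivative_eq_intros)
  have G: "((\<lambda>x. Gf d (A r (J(i := x))) (B i)) has_real_derivative Df d (A r (J(i := x))) (B i) * r) (at x)"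
    unfolding A0(2) by (rule DERIV_chain2[OF Gf_deriv[OF A0(1) herm[OF assms]]]) (auto intro!: derivative_eq_intros)
  have nz: "Zf d (A r (J(i := x))) \<noteq> 0" using Zpos[of r "J(i := x)"] by simp
  have alg: "(D * r * z - g * (g * r)) / (z * z) = r * (D / z - (g / z)\<^sup>2)" if "z \<noteq> 0" for D g z :: real
    using that by (simp add: field_simps power2_eq_square)
  show ?thesis unfolding obs_def obs'_def
    by (rule DERIV_cong[OF DERIV_divide[OF G Z nz]]) (rule alg[OF nz])
qed

lemma obs'_bound:
  assumes "i \<in> K"
  shows "\<bar>obs' r i J\<bar> \<le> \<bar>r\<bar> * (c + c)"
proof -
  have "Df d (A r J) (B i) / Zf d (A r J) \<le> c"
    using Df_upper[OF hA[of r J] herm[OF assms] sq[OF assms]] Zpos by (simp add: field_simps)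
  moreover have "0 \<le> Df d (A r J) (B i) / Zf d (A r J)"
    using Df_nonneg[OF hA[of r J] herm[OF assms] sq[OF assms]] Zpos[of r J] by (simp add: field_simps)
  moreover have "(obs r i J)\<^sup>2 \<le> c"
    using power_mono[OF obs_bound[OF assms, of r J], of 2] c by simp
  moreover have "0 \<le> (obs r i J)\<^sup>2" by simp
  ultimately have "\<bar>Df d (A r J) (B i) / Zf d (A r J) - (obs r i J)\<^sup>2\<bar> \<le> c + c" by linarith
  then show ?thesis unfolding obs'_def abs_mult by (intro mult_left_mono) auto
qed

text \<open>The double commutator bounds for the individual terms add up to a multiple of the energy.\<close>
lemma sum_Df_lower:
  "(\<Sum>i\<in>K. Df d (A r J) (B i) / Zf d (A r J) - (obs r i J)\<^sup>2) \<ge> c * real (card K) - c * \<kappa> * energy r J - \<Lambda>"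
proof -
  let ?Z = "Zf d (A r J)" and ?N = "real (card K)"
  have BAB: "(B i * A r J * B i) $$ (x,y) = (\<Sum>I\<in>K. of_real (r * J I) * (B i * B I * B i) $$ (x,y))"
    if i: "i \<in> K" and xy: "x < d" "y < d" for i x y
  proof -
    have t: "(B i * M * B i) $$ (x,y) = (\<Sum>q<d. \<Sum>p<d. B i $$ (x,p) * M $$ (p,q) * B i $$ (q,y))" if M: "M \<in> carrier_mat d d" for M
      using cB[OF i] xy M
      by (subst mult_mat_sum[of _ d], simp, simp, simp, simp, intro sum.cong refl, subst mult_mat_sum[of _ d])
        (auto simp: sum_distrib_right)
    have "(B i * A r J * B i) $$ (x,y) = (\<Sum>q<d. \<Sum>p<d. \<Sum>I\<in>K. of_real (r * J I) * (B i $$ (x,p) * B I $$ (p,q) * B i $$ (q,y)))"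
      unfolding t[OF cA] by (intro sum.cong refl) (simp add: A_def ham_entry sum_distrib_left sum_distrib_right mult_ac)
    also have "\<dots> = (\<Sum>q<d. \<Sum>I\<in>K. \<Sum>p<d. of_real (r * J I) * (B i $$ (x,p) * B I $$ (p,q) * B i $$ (q,y)))"
      by (rule sum.cong[OF refl], rule sum.swap)
    also have "\<dots> = (\<Sum>I\<in>K. \<Sum>q<d. \<Sum>p<d. of_real (r * J I) * (B i $$ (x,p) * B I $$ (p,q) * B i $$ (q,y)))"
      by (rule sum.swap)
    also have "\<dots> = (\<Sum>I\<in>K. of_real (r * J I) * (B i * B I * B i) $$ (x,y))"
      by (intro sum.cong refl) (simp add: t[OF cB] sum_distrib_left)
    finally show ?thesis .
  qed
  have "(\<Sum>i\<in>K. (B i * A r J * B i) $$ (x,y)) = of_real (c * (?N - 2 * \<kappa>)) * A r J $$ (x,y)" if xy: "x < d" "y < d" for x y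
  proof -
    have "(\<Sum>i\<in>K. (B i * A r J * B i) $$ (x,y)) = (\<Sum>i\<in>K. \<Sum>I\<in>K. of_real (r * J I) * (B i * B I * B i) $$ (x,y))"
      by (intro sum.cong refl BAB xy)
    also have "\<dots> = (\<Sum>I\<in>K. of_real (r * J I) * (\<Sum>i\<in>K. (B i * B I * B i) $$ (x,y)))"
      unfolding sum_distrib_left by (rule sum.swap)
    also have "\<dots> = of_real (c * (?N - 2 * \<kappa>)) * A r J $$ (x,y)"
      using xy by (simp add: conj_sum A_def ham_entry sum_distrib_left mult_ac)
    finally show ?thesis .
  qed
  note BABsum = this
  have GB: "(\<Sum>i\<in>K. Gf d (A r J) (B i * A r J * B i)) = c * (?N - 2 * \<kappa>) * Gf d (A r J) (A r J)"
  proof -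
    have "(\<Sum>i\<in>K. trp d (B i * A r J * B i) M) = of_real (c * (?N - 2 * \<kappa>)) * trp d (A r J) M" for M
    proof -
      have "(\<Sum>i\<in>K. trp d (B i * A r J * B i) M) = (\<Sum>x<d. \<Sum>i\<in>K. \<Sum>y<d. (B i * A r J * B i) $$ (x,y) * M $$ (y,x))"
        unfolding trp_def by (rule sum.swap)
      also have "\<dots> = (\<Sum>x<d. \<Sum>y<d. \<Sum>i\<in>K. (B i * A r J * B i) $$ (x,y) * M $$ (y,x))"
        by (rule sum.cong[OF refl], rule sum.swap)
      also have "\<dots> = (\<Sum>x<d. \<Sum>y<d. of_real (c * (?N - 2 * \<kappa>)) * A r J $$ (x,y) * M $$ (y,x))"
        unfolding sum_distrib_right[symmetric] by (intro sum.cong refl) (simp add: BABsum del: index_mult_mat)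
      finally show ?thesis by (simp add: trp_def sum_distrib_left mult.assoc)
    qed
    then have "Re (\<Sum>i\<in>K. trp d (B i * A r J * B i) (mat_exp (A r J))) = c * (?N - 2 * \<kappa>) * Gf d (A r J) (A r J)"
      by (simp add: Gf_def)
    then show ?thesis by (simp add: Gf_def)
  qed
  \<comment> \<open>Each term loses half of c G(A) - G(B A B). Summed over the terms, N - (N - 2
    \<kappa>) leaves exactly \<kappa> times c G(A).\<close>
  have "c * ?N * ?Z - c * \<kappa> * Gf d (A r J) (A r J)
     = (\<Sum>i\<in>K. c * ?Z - (c * Gf d (A r J) (A r J) - Gf d (A r J) (B i * A r J * B i)) / 2)"
    unfolding sum_subtractf sum_divide_distrib[symmetric] GB by (simp add: algebra_simps)
  also have "\<dots> \<le> (\<Sum>i\<in>K. Df d (A r J) (B i))"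
    by (intro sum_mono Df_lower hA herm sq)
  finally have "(c * ?N * ?Z - c * \<kappa> * Gf d (A r J) (A r J)) / ?Z \<le> (\<Sum>i\<in>K. Df d (A r J) (B i)) / ?Z"
    using Zpos[of r J] by (intro divide_right_mono) auto
  then have D: "c * ?N - c * \<kappa> * energy r J \<le> (\<Sum>i\<in>K. Df d (A r J) (B i) / ?Z)"
    using Zpos[of r J] by (simp add: energy_def diff_divide_distrib sum_divide_distrib)
  \<comment> \<open>The Gibbs state becomes an ensemble of vectors, since \<open>state_bound\<close>
    speaks of those.\<close>
  obtain \<phi> where \<phi>: "(\<Sum>l<d. \<Sum>x<d. (cmod (\<phi> l x))\<^sup>2) = 1"
    "\<And>M. Gf d (A r J) M / ?Z = (\<Sum>l<d. Re (qf d M (\<phi> l)))"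
    using Gf_ensemble[OF hA[of r J] d] by blast
  have "(\<Sum>i\<in>K. (obs r i J)\<^sup>2) \<le> \<Lambda>"
    unfolding obs_def \<phi>(2) by (rule state_bound[OF \<phi>(1)])
  with D show ?thesis by (simp add: sum_subtractf)
qed

text \<open>Integration by parts turns the mean energy into r^2 s^2 times the mean sum of Bogoliubov
  variances. The lower bound for that sum contains the energy with a negative sign, and the
  resulting inequality is solved for the mean.\<close>

lemma expected_energy:
  shows "integrable (gaussPi s K) (energy r)"
    and "(\<integral>J. energy r J \<partial>gaussPi s K) \<ge> r\<^sup>2 * s\<^sup>2 * (c * real (card K) - \<Lambda>) / (1 + r\<^sup>2 * s\<^sup>2 * c * \<kappa>)"
proof -
  interpret Q: prob_space "gaussPi s K" by (rule prob_space_gaussPi[OF s])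
  note ibp = gaussPi_ibp[OF s fin _ obs_measurable obs_deriv obs_bound obs'_bound]
  show i: "integrable (gaussPi s K) (energy r)"
    unfolding energy_sum[abs_def] by (intro Bochner_Integration.integrable_sum integrable_mult_right ibp(1))
  have "(\<integral>J. energy r J \<partial>gaussPi s K) = (\<Sum>i\<in>K. r * (\<integral>J. J i * obs r i J \<partial>gaussPi s K))"
    unfolding energy_sum using ibp(1) by (subst Bochner_Integration.integral_sum) auto
  also have "\<dots> = r * s\<^sup>2 * (\<Sum>i\<in>K. \<integral>J. obs' r i J \<partial>gaussPi s K)"
    by (simp add: ibp(3) sum_distrib_left mult.assoc)
  also have "(\<Sum>i\<in>K. \<integral>J. obs' r i J \<partial>gaussPi s K) = (\<integral>J. (\<Sum>i\<in>K. obs' r i J) \<partial>gaussPi s K)"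
    using ibp(2) by (intro Bochner_Integration.integral_sum[symmetric]) auto
  also have "r * s\<^sup>2 * \<dots> = s\<^sup>2 * (\<integral>J. r * (\<Sum>i\<in>K. obs' r i J) \<partial>gaussPi s K)"
    by simp
  also have "\<dots> \<ge> s\<^sup>2 * (\<integral>J. r\<^sup>2 * (c * real (card K) - c * \<kappa> * energy r J - \<Lambda>) \<partial>gaussPi s K)"
  proof (intro mult_left_mono integral_mono)
    show "integrable (gaussPi s K) (\<lambda>J. r\<^sup>2 * (c * real (card K) - c * \<kappa> * energy r J - \<Lambda>))"
      using i by (intro integrable_mult_right Bochner_Integration.integrable_diff) auto
    show "integrable (gaussPi s K) (\<lambda>J. r * (\<Sum>i\<in>K. obs' r i J))"
      using ibp(2) by (intro integrable_mult_right Bochner_Integration.integrable_sum) auto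
    fix J
    have "r * (\<Sum>i\<in>K. obs' r i J) = r\<^sup>2 * (\<Sum>i\<in>K. Df d (A r J) (B i) / Zf d (A r J) - (obs r i J)\<^sup>2)"
      by (simp add: obs'_def sum_distrib_left power2_eq_square mult.assoc)
    then show "r\<^sup>2 * (c * real (card K) - c * \<kappa> * energy r J - \<Lambda>) \<le> r * (\<Sum>i\<in>K. obs' r i J)"
      using sum_Df_lower[of r J] by (simp add: mult_left_mono)
  qed simp
  also have "(\<integral>J. r\<^sup>2 * (c * real (card K) - c * \<kappa> * energy r J - \<Lambda>) \<partial>gaussPi s K)
     = r\<^sup>2 * (c * real (card K) - c * \<kappa> * (\<integral>J. energy r J \<partial>gaussPi s K) - \<Lambda>)"
    using i Q.prob_space by simp
  finally have "(\<integral>J. energy r J \<partial>gaussPi s K) * (1 + r\<^sup>2 * s\<^sup>2 * c * \<kappa>) \<ge> r\<^sup>2 * s\<^sup>2 * (c * real (card K) - \<Lambda>)"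
    by (simp add: algebra_simps)
  moreover have "1 + r\<^sup>2 * s\<^sup>2 * c * \<kappa> > 0" using c \<kappa> by (intro add_pos_nonneg) auto
  ultimately show "(\<integral>J. energy r J \<partial>gaussPi s K) \<ge> r\<^sup>2 * s\<^sup>2 * (c * real (card K) - \<Lambda>) / (1 + r\<^sup>2 * s\<^sup>2 * c * \<kappa>)"
    by (simp add: pos_divide_le_eq)
qed

lemma ln_Z_facts:
  shows "integrable (gaussPi s K) (\<lambda>J. ln (Zf d (A r J)))"
    "integrable (gaussPi s K) (\<lambda>J. (ln (Zf d (A r J)))\<^sup>2)"
    "(\<integral>J. (ln (Zf d (A r J)))\<^sup>2 \<partial>gaussPi s K) \<le> (\<integral>J. ln (Zf d (A r J)) \<partial>gaussPi s K)\<^sup>2 + real (card K) * (\<bar>r\<bar> * sqrt c)\<^sup>2 * s\<^sup>2"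
  using gaussPi_lipschitz_variance[OF s fin borel_measurable_ln[OF Z_measurable] ln_Z_lipschitz] by blast+

text \<open>ln Z at 2 A exceeds ln Z at A by at least the energy, and ln Z at A exceeds ln d by at
  least the normalised trace of A. That trace is linear in the couplings and has mean zero.\<close>

lemma expected_ln_Z:
  "(\<integral>J. ln (Zf d (A (2 * r) J)) \<partial>gaussPi s K) \<ge> ln (real d) + (\<integral>J. energy r J \<partial>gaussPi s K)"
proof -
  interpret Q: prob_space "gaussPi s K" by (rule prob_space_gaussPi[OF s])
  have Ji: "integrable (gaussPi s K) (\<lambda>J. J i)" "(\<integral>J. J i \<partial>gaussPi s K) = 0" if "i \<in> K" for i
    using gaussPi_ibp(1,3)[OF s fin that, of "\<lambda>_. 1" "\<lambda>_. 0" 1 0] by simp_all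
  define t where "t i = Re (\<Sum>x<d. B i $$ (x,x)) / real d" for i
  have tr: "Re (\<Sum>x<d. A r J $$ (x,x)) / real d = (\<Sum>i\<in>K. r * t i * J i)" for J
  proof -
    have "(\<Sum>x<d. A r J $$ (x,x)) = (\<Sum>x<d. \<Sum>i\<in>K. of_real (r * J i) * B i $$ (x,x))"
      by (intro sum.cong refl) (simp add: A_def ham_entry)
    also have "\<dots> = (\<Sum>i\<in>K. of_real (r * J i) * (\<Sum>x<d. B i $$ (x,x)))"
      unfolding sum_distrib_left by (rule sum.swap)
    finally show ?thesis by (simp add: t_def sum_divide_distrib sum_distrib_left mult_ac)
  qed
  have iT: "integrable (gaussPi s K) (\<lambda>J. \<Sum>i\<in>K. r * t i * J i)"
    using Ji(1) by (intro Bochner_Integration.integrable_sum integrable_mult_right) auto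
  have T0: "(\<integral>J. (\<Sum>i\<in>K. r * t i * J i) \<partial>gaussPi s K) = 0"
    using Ji by (subst Bochner_Integration.integral_sum) auto
  have "ln (real d) + (\<integral>J. energy r J \<partial>gaussPi s K) = (\<integral>J. ln (real d) + (\<Sum>i\<in>K. r * t i * J i) + energy r J \<partial>gaussPi s K)"
    using iT T0 expected_energy(1) Q.prob_space by simp
  also have "\<dots> \<le> (\<integral>J. ln (Zf d (A (2 * r) J)) \<partial>gaussPi s K)"
  proof (rule integral_mono)
    show "integrable (gaussPi s K) (\<lambda>J. ln (real d) + (\<Sum>i\<in>K. r * t i * J i) + energy r J)"
      using iT expected_energy(1) by (intro Bochner_Integration.integrable_add) auto
    fix J
    have "A (2 * r) J = of_real 2 \<cdot>\<^sub>m A r J"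
      unfolding A_def using ham_smult[of d B K 2 "\<lambda>I. r * J I"] by (simp add: mult.assoc)
    then show "ln (real d) + (\<Sum>i\<in>K. r * t i * J i) + energy r J \<le> ln (Zf d (A (2 * r) J))"
      using ln_Zf_double[OF hA[of r J] d] ln_Zf_ge[OF hA[of r J] d] unfolding tr energy_def by simp
  qed (rule ln_Z_facts(1))
  finally show ?thesis .
qed

text \<open>The lower bound for the mean energy at \<open>r\<close>, and therefore for the mean
  excess of ln Z over ln d at 2 r.\<close>

definition gain :: "real \<Rightarrow> real" where
  "gain r = r\<^sup>2 * s\<^sup>2 * (c * real (card K) - \<Lambda>) / (1 + r\<^sup>2 * s\<^sup>2 * c * \<kappa>)"

text \<open>Chebyshev at distance half the gain. The 16 collects a 4 from the variance at parameter
  2 r and a 4 from squaring the half.\<close>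

theorem free_energy_gain:
  assumes "gain r > 0"
  shows "measure (gaussPi s K) {J \<in> space (gaussPi s K). ln (Zf d (A (2 * r) J)) - ln (real d) \<le> gain r / 2}
    \<le> 16 * r\<^sup>2 * c * s\<^sup>2 * real (card K) / (gain r)\<^sup>2"
proof -
  interpret Q: prob_space "gaussPi s K" by (rule prob_space_gaussPi[OF s])
  let ?F = "\<lambda>J. ln (Zf d (A (2 * r) J))"
  have m: "?F \<in> borel_measurable (gaussPi s K)" by (rule borel_measurable_ln[OF Z_measurable])
  have E: "Q.expectation ?F \<ge> ln (real d) + gain r"
    using expected_ln_Z[of r] expected_energy(2)[of r] unfolding gain_def by linarith
  have V: "Q.variance ?F \<le> 4 * r\<^sup>2 * c * s\<^sup>2 * real (card K)"
    using ln_Z_facts[of "2 * r"] c by (subst Q.variance_eq) (auto simp: power_mult_distrib mult_ac)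
  have "Q.prob {J \<in> space (gaussPi s K). ?F J - ln (real d) \<le> gain r / 2}
     \<le> Q.prob {J \<in> space (gaussPi s K). gain r / 2 \<le> \<bar>?F J - Q.expectation ?F\<bar>}"
    using E assms m by (intro Q.finite_measure_mono) auto
  also have "\<dots> \<le> Q.variance ?F / (gain r / 2)\<^sup>2"
    using assms by (intro Q.Chebyshev_inequality m ln_Z_facts(2)) auto
  also have "\<dots> \<le> (4 * r\<^sup>2 * c * s\<^sup>2 * real (card K)) / (gain r / 2)\<^sup>2"
    by (intro divide_right_mono V) auto
  finally show ?thesis by (simp add: power_divide)
qed

lemma energy_ge_ln_Z: "ln (Zf d (A r J)) - ln (real d) \<le> energy r J"
  unfolding energy_def by (rule ln_Zf_le[OF hA d])

text \<open>Markov's inequality for Z, whose mean is at most d exp(N c r^2 s^2 / 2). Since ln Z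
  dominates every eigenvalue, this is a tail bound for the top of the spectrum.\<close>

theorem norm_tail:
  assumes "t > 0"
  shows "measure (gaussPi s K) {J \<in> space (gaussPi s K). ln (Zf d (A r J)) \<ge> ln (real d) + real (card K) * (c * r\<^sup>2 * s\<^sup>2 / 2) + t} \<le> exp (- t)"
proof -
  interpret Q: prob_space "gaussPi s K" by (rule prob_space_gaussPi[OF s])
  define M where "M = real d * exp (real (card K) * (c * r\<^sup>2 * s\<^sup>2 / 2))"
  have M: "M > 0" using d by (simp add: M_def)
  let ?S = "{J \<in> space (gaussPi s K). ln (Zf d (A r J)) \<ge> ln (real d) + real (card K) * (c * r\<^sup>2 * s\<^sup>2 / 2) + t}"
  have "?S = {J \<in> space (gaussPi s K). 1 \<le> ennreal (inverse (M * exp t)) * ennreal (Zf d (A r J))}"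
  proof (rule Collect_cong, rule conj_cong[OF refl])
    fix J
    have "ln (real d) + real (card K) * (c * r\<^sup>2 * s\<^sup>2 / 2) + t = ln (M * exp t)"
      using d by (simp add: M_def ln_mult)
    also have "ln (M * exp t) \<le> ln (Zf d (A r J)) \<longleftrightarrow> M * exp t \<le> Zf d (A r J)"
      using M Zpos[of r J] by simp
    also have "\<dots> \<longleftrightarrow> 1 \<le> inverse (M * exp t) * Zf d (A r J)"
      using M by (simp add: field_simps)
    also have "\<dots> \<longleftrightarrow> 1 \<le> ennreal (inverse (M * exp t)) * ennreal (Zf d (A r J))"
      using M Zpos[of r J] by (simp flip: ennreal_mult ennreal_1 add: less_imp_le)
    finally show "(ln (real d) + real (card K) * (c * r\<^sup>2 * s\<^sup>2 / 2) + t \<le> ln (Zf d (A r J)))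
      = (1 \<le> ennreal (inverse (M * exp t)) * ennreal (Zf d (A r J)))" .
  qed
  then have "emeasure (gaussPi s K) ?S \<le> ennreal (inverse (M * exp t)) * (\<integral>\<^sup>+J. ennreal (Zf d (A r J)) * indicator (space (gaussPi s K)) J \<partial>gaussPi s K)"
    by (simp only:, intro nn_integral_Markov_inequality borel_measurable_times_ennreal borel_measurable_indicator
        measurable_compose[OF Z_measurable measurable_ennreal] sets.top)
  also have "(\<integral>\<^sup>+J. ennreal (Zf d (A r J)) * indicator (space (gaussPi s K)) J \<partial>gaussPi s K) = (\<integral>\<^sup>+J. ennreal (Zf d (A r J)) \<partial>gaussPi s K)"
    by (intro nn_integral_cong) simp
  also have "\<dots> \<le> ennreal M"
    unfolding M_def A_def by (rule Zf_expectation[OF s c d fin herm sq])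
  finally have "emeasure (gaussPi s K) ?S \<le> ennreal (inverse (M * exp t)) * ennreal M"
    by (simp add: mult_left_mono)
  also have "\<dots> = ennreal (exp (- t))"
    using M by (simp add: exp_minus flip: ennreal_mult)
  finally show ?thesis by (simp add: Q.emeasure_eq_measure)
qed

end

section \<open>The commutation index of Majorana products\<close>

lemma finite_qsets [simp]: "finite (qsets n q)"
  by (rule finite_subset[of _ "Pow {..<n}"]) (auto simp: qsets_def)

lemma card_qsets: "card (qsets n q) = n choose q"
  using n_subsets[of "{..<n}" q] by (simp add: qsets_def)

lemma qsets_finite: "I \<in> qsets n q \<Longrightarrow> finite I"
  by (auto simp: qsets_def intro: finite_subset)

text \<open>It passes from counting common r-subsets to testing whether two sets share exactly k
  elements. Terms with r > m vanish, so one upper limit \<open>q\<close> serves every m.\<close>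

lemma binomial_inversion:
  "(\<Sum>r\<in>{k..q}. (- 1) ^ (r - k) * real (r choose k) * real (m choose r)) = (if m = k then 1 else 0)" if "m \<le> q" "k \<le> q"
proof (cases "m < k")
  case True
  then have "(r choose k) * (m choose r) = 0" if "r \<in> {k..q}" for r using that by (simp add: binomial_eq_0)
  then have "(\<Sum>r\<in>{k..q}. (- 1) ^ (r - k) * real (r choose k) * real (m choose r)) = 0"
    by (intro sum.neutral ballI) (auto simp: mult.assoc simp flip: of_nat_mult)
  then show ?thesis using True by simp
next
  case False
  then have km: "k \<le> m" by simp
  have "(\<Sum>r\<in>{k..q}. (- 1) ^ (r - k) * real (r choose k) * real (m choose r)) = (\<Sum>r\<in>{k..m}. (- 1) ^ (r - k) * real (r choose k) * real (m choose r))"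
    using that by (intro sum.mono_neutral_right) (auto simp: binomial_eq_0)
  also have "\<dots> = (\<Sum>i\<le>m - k. (- 1) ^ i * real ((k + i) choose k) * real (m choose (k + i)))"
    using km by (intro sum.reindex_bij_witness[of _ "\<lambda>i. k + i" "\<lambda>r. r - k"]) auto
  also have "\<dots> = (\<Sum>i\<le>m - k. real (m choose k) * ((- 1) ^ i * real ((m - k) choose i)))"
  proof (rule sum.cong[OF refl])
    fix i assume "i \<in> {..m - k}"
    then have "(m choose (k + i)) * ((k + i) choose k) = (m choose k) * ((m - k) choose i)"
      using choose_mult[of k "k + i" m] km by simp
    then have "real (m choose (k + i)) * real ((k + i) choose k) = real (m choose k) * real ((m - k) choose i)"
      by (metis of_nat_mult)
    then show "(- 1) ^ i * real ((k + i) choose k) * real (m choose (k + i)) = real (m choose k) * ((- 1) ^ i * real ((m - k) choose i))"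
      by (simp add: mult_ac)
  qed
  also have "\<dots> = real (m choose k) * (\<Sum>i\<le>m - k. (- 1) ^ i * real ((m - k) choose i))"
    by (simp add: sum_distrib_left)
  also have "\<dots> = (if m = k then 1 else 0)"
    using choose_alternating_sum[of "m - k", where 'a = real] km by (cases "m = k") auto
  finally show ?thesis .
qed

text \<open>
  The quantities \<open>S r\<close> below are squared norms of partial sums over the sets containing a given
  \<open>r\<close>-set.  Orthogonality for odd intersections expresses \<open>S r\<close>, \<open>r\<close> odd, by an alternating sum of
  later terms, and a step from even to odd \<open>r\<close> costs only a factor \<open>n\<close> by Cauchy--Schwarz.
\<close>
lemma odd_orthogonal_sum_bound:
  fixes V :: "nat set \<Rightarrow> 'x \<Rightarrow> complex"
  assumes X: "finite X" and q: "even q" and n: "n \<ge> 1"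
    and orth: "\<And>I J. I \<in> qsets n q \<Longrightarrow> J \<in> qsets n q \<Longrightarrow> odd (card (I \<inter> J)) \<Longrightarrow> Re (\<Sum>x\<in>X. cnj (V I x) * V J x) = 0"
  shows "(\<Sum>x\<in>X. (cmod (\<Sum>I\<in>qsets n q. V I x))\<^sup>2)
    \<le> (real q * real (q + 1) * 2 ^ q * real n) ^ (q div 2) * (\<Sum>I\<in>qsets n q. \<Sum>x\<in>X. (cmod (V I x))\<^sup>2)"
proof -
  let ?Q = "qsets n q"
  define W where "W R x = (\<Sum>I\<in>?Q. if R \<subseteq> I then V I x else 0)" for R x
  define S where "S r = (\<Sum>R\<in>qsets n r. \<Sum>x\<in>X. (cmod (W R x))\<^sup>2)" for r
  define ip where "ip I J = Re (\<Sum>x\<in>X. cnj (V I x) * V J x)" for I J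
  have S0: "S r \<ge> 0" for r unfolding S_def by (intro sum_nonneg) auto
  \<comment> \<open>A pair I, J is counted once for each r-subset of its intersection.\<close>
  have S_expand: "S r = (\<Sum>I\<in>?Q. \<Sum>J\<in>?Q. real (card (I \<inter> J) choose r) * ip I J)" for r
  proof -
    have "(cmod (W R x))\<^sup>2 = (\<Sum>I\<in>?Q. \<Sum>J\<in>?Q. if R \<subseteq> I \<inter> J then Re (cnj (V I x) * V J x) else 0)" for R x
    proof -
      have "(cmod (W R x))\<^sup>2 = Re (cnj (W R x) * W R x)"
        unfolding cmod_power2 by (simp add: power2_eq_square)
      also have "cnj (W R x) * W R x = (\<Sum>I\<in>?Q. \<Sum>J\<in>?Q. cnj (if R \<subseteq> I then V I x else 0) * (if R \<subseteq> J then V J x else 0))"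
        unfolding W_def cnj_sum sum_product ..
      also have "Re \<dots> = (\<Sum>I\<in>?Q. \<Sum>J\<in>?Q. if R \<subseteq> I \<inter> J then Re (cnj (V I x) * V J x) else 0)"
        unfolding Re_sum by (intro sum.cong refl) auto
      finally show ?thesis .
    qed
    then have "S r = (\<Sum>R\<in>qsets n r. \<Sum>x\<in>X. \<Sum>I\<in>?Q. \<Sum>J\<in>?Q. if R \<subseteq> I \<inter> J then Re (cnj (V I x) * V J x) else 0)"
      unfolding S_def by simp
    also have "\<dots> = (\<Sum>R\<in>qsets n r. \<Sum>I\<in>?Q. \<Sum>x\<in>X. \<Sum>J\<in>?Q. if R \<subseteq> I \<inter> J then Re (cnj (V I x) * V J x) else 0)"
      by (rule sum.cong[OF refl], rule sum.swap)
    also have "\<dots> = (\<Sum>I\<in>?Q. \<Sum>R\<in>qsets n r. \<Sum>x\<in>X. \<Sum>J\<in>?Q. if R \<subseteq> I \<inter> J then Re (cnj (V I x) * V J x) else 0)"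
      by (rule sum.swap)
    also have "\<dots> = (\<Sum>I\<in>?Q. \<Sum>R\<in>qsets n r. \<Sum>J\<in>?Q. \<Sum>x\<in>X. if R \<subseteq> I \<inter> J then Re (cnj (V I x) * V J x) else 0)"
      by (rule sum.cong[OF refl], rule sum.cong[OF refl], rule sum.swap)
    also have "\<dots> = (\<Sum>I\<in>?Q. \<Sum>J\<in>?Q. \<Sum>R\<in>qsets n r. \<Sum>x\<in>X. if R \<subseteq> I \<inter> J then Re (cnj (V I x) * V J x) else 0)"
      by (rule sum.cong[OF refl], rule sum.swap)
    also have "\<dots> = (\<Sum>I\<in>?Q. \<Sum>J\<in>?Q. real (card (I \<inter> J) choose r) * ip I J)"
    proof (rule sum.cong[OF refl], rule sum.cong[OF refl])
      fix I J assume I: "I \<in> ?Q"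
      then have f: "finite (I \<inter> J)" using qsets_finite by blast
      have "(\<Sum>R\<in>qsets n r. \<Sum>x\<in>X. if R \<subseteq> I \<inter> J then Re (cnj (V I x) * V J x) else 0)
         = (\<Sum>R\<in>qsets n r. if R \<subseteq> I \<inter> J then ip I J else 0)"
      proof (rule sum.cong[OF refl])
        fix R
        show "(\<Sum>x\<in>X. if R \<subseteq> I \<inter> J then Re (cnj (V I x) * V J x) else 0) = (if R \<subseteq> I \<inter> J then ip I J else 0)"
          by (cases "R \<subseteq> I \<inter> J") (simp_all only: ip_def Re_sum if_True if_False sum.neutral_const)
      qed
      also have "\<dots> = (\<Sum>R\<in>{R \<in> qsets n r. R \<subseteq> I \<inter> J}. ip I J)"
        by (rule sum.inter_filter[symmetric]) simp
      also have "{R \<in> qsets n r. R \<subseteq> I \<inter> J} = {R. R \<subseteq> I \<inter> J \<and> card R = r}"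
        using I by (auto simp: qsets_def)
      finally show "(\<Sum>R\<in>qsets n r. \<Sum>x\<in>X. if R \<subseteq> I \<inter> J then Re (cnj (V I x) * V J x) else 0)
         = real (card (I \<inter> J) choose r) * ip I J"
        unfolding sum_constant n_subsets[OF f] .
    qed
    finally show ?thesis .
  qed
  \<comment> \<open>Inversion isolates the pairs that meet in exactly \<open>k\<close> points, and
    for odd \<open>k\<close> these are orthogonal. When the identity is solved for
    \<open>S k\<close>, the terms with odd r enter with a negative sign and are dropped.\<close>
  have step1: "S k \<le> 2 ^ q * (\<Sum>r\<in>{r \<in> {k..q}. even r}. S r)" if k: "odd k" "k \<le> q" for k
  proof -
    have "(\<Sum>r\<in>{k..q}. (- 1) ^ (r - k) * real (r choose k) * S r)
       = (\<Sum>r\<in>{k..q}. \<Sum>I\<in>?Q. \<Sum>J\<in>?Q. ((- 1) ^ (r - k) * real (r choose k) * real (card (I \<inter> J) choose r)) * ip I J)"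
      unfolding S_expand by (simp add: sum_distrib_left mult.assoc)
    also have "\<dots> = (\<Sum>I\<in>?Q. \<Sum>r\<in>{k..q}. \<Sum>J\<in>?Q. ((- 1) ^ (r - k) * real (r choose k) * real (card (I \<inter> J) choose r)) * ip I J)"
      by (rule sum.swap)
    also have "\<dots> = (\<Sum>I\<in>?Q. \<Sum>J\<in>?Q. \<Sum>r\<in>{k..q}. ((- 1) ^ (r - k) * real (r choose k) * real (card (I \<inter> J) choose r)) * ip I J)"
      by (rule sum.cong[OF refl], rule sum.swap)
    also have "\<dots> = (\<Sum>I\<in>?Q. \<Sum>J\<in>?Q. (if card (I \<inter> J) = k then 1 else 0) * ip I J)"
    proof (rule sum.cong[OF refl], rule sum.cong[OF refl])
      fix I J assume I: "I \<in> ?Q"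
      then have "card (I \<inter> J) \<le> q"
        using card_mono[of I "I \<inter> J"] qsets_finite[OF I] by (simp add: qsets_def)
      then show "(\<Sum>r\<in>{k..q}. ((- 1) ^ (r - k) * real (r choose k) * real (card (I \<inter> J) choose r)) * ip I J)
        = (if card (I \<inter> J) = k then 1 else 0) * ip I J"
        using k unfolding sum_distrib_right[symmetric] by (simp add: binomial_inversion)
    qed
    also have "\<dots> = 0"
      using orth k by (intro sum.neutral ballI) (auto simp: ip_def)
    finally have z: "(\<Sum>r\<in>{k..q}. (- 1) ^ (r - k) * real (r choose k) * S r) = 0" .
    have split: "{k..q} = insert k {Suc k..q}" using k by auto
    from z have "S k = - (\<Sum>r\<in>{Suc k..q}. (- 1) ^ (r - k) * real (r choose k) * S r)"
      unfolding split by simp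
    also have "\<dots> = (\<Sum>r\<in>{Suc k..q}. - ((- 1) ^ (r - k) * real (r choose k) * S r))"
      by (simp add: sum_negf)
    also have "\<dots> \<le> (\<Sum>r\<in>{Suc k..q}. if even r then 2 ^ q * S r else 0)"
    proof (rule sum_mono)
      fix r assume r: "r \<in> {Suc k..q}"
      show "- ((- 1) ^ (r - k) * real (r choose k) * S r) \<le> (if even r then 2 ^ q * S r else 0)"
      proof (cases "even r")
        case True
        then have "odd (r - k)" using r k by auto
        then have e: "- ((- 1) ^ (r - k) * real (r choose k) * S r) = real (r choose k) * S r" by simp
        have "(r choose k) \<le> 2 ^ q"
          using order_trans[OF binomial_le_pow2[of r k] power_increasing[of r q "2::nat"]] r by simp
        then have "real (r choose k) \<le> 2 ^ q" by (metis of_nat_le_iff of_nat_numeral of_nat_power)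
        then show ?thesis unfolding e using True S0 by (simp add: mult_right_mono)
      next
        case False
        then have "even (r - k)" using r k by auto
        then show ?thesis using False S0[of r] by simp
      qed
    qed
    also have "\<dots> = (\<Sum>r\<in>{r \<in> {Suc k..q}. even r}. 2 ^ q * S r)"
      by (rule sum.inter_filter[symmetric]) simp
    also have "{r \<in> {Suc k..q}. even r} = {r \<in> {k..q}. even r}"
      using k by (auto simp: not_less_eq_eq le_eq_less_or_eq)
    finally show ?thesis by (simp add: sum_distrib_left)
  qed
  \<comment> \<open>Each \<open>I\<close> that contains \<open>R\<close> contains q - r of its
    one-point extensions. Cauchy-Schwarz over at most n added points, and the r + 1 \<le> q ways to
    delete a point again, give the factor n q.\<close>
  have step2: "S r \<le> real n * real q * S (Suc r)" if r: "r < q" for r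
  proof -
    have W_step: "real (q - r) * cmod (W R x) \<le> (\<Sum>i\<in>{..<n} - R. cmod (W (insert i R) x))" if R: "R \<in> qsets n r" for R x
    proof -
      have "of_nat (q - r) * W R x = (\<Sum>I\<in>?Q. \<Sum>i\<in>{..<n} - R. if insert i R \<subseteq> I then V I x else 0)"
        unfolding W_def sum_distrib_left
      proof (rule sum.cong[OF refl])
        fix I assume I: "I \<in> ?Q"
        show "of_nat (q - r) * (if R \<subseteq> I then V I x else 0) = (\<Sum>i\<in>{..<n} - R. if insert i R \<subseteq> I then V I x else 0)"
        proof (cases "R \<subseteq> I")
          case True
          have "(\<Sum>i\<in>{..<n} - R. if insert i R \<subseteq> I then V I x else 0) = (\<Sum>i\<in>{i \<in> {..<n} - R. insert i R \<subseteq> I}. V I x)"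
            by (rule sum.inter_filter[symmetric]) simp
          also have "{i \<in> {..<n} - R. insert i R \<subseteq> I} = I - R" using True I by (auto simp: qsets_def)
          also have "card (I - R) = q - r"
            using card_Diff_subset[of R I] True I R qsets_finite[OF R] by (simp add: qsets_def)
          then have "(\<Sum>i\<in>I - R. V I x) = of_nat (q - r) * V I x" by simp
          finally show ?thesis using True by simp
        qed (auto intro!: sum.neutral)
      qed
      also have "\<dots> = (\<Sum>i\<in>{..<n} - R. W (insert i R) x)" unfolding W_def by (rule sum.swap)
      finally have "cmod (of_nat (q - r) * W R x) \<le> (\<Sum>i\<in>{..<n} - R. cmod (W (insert i R) x))"
        by (simp only: norm_sum)
      then show ?thesis by (simp add: norm_mult)
    qed
    have sq: "(cmod (W R x))\<^sup>2 \<le> real n * (\<Sum>i\<in>{..<n} - R. (cmod (W (insert i R) x))\<^sup>2)" if R: "R \<in> qsets n r" for R x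
    proof -
      have "1 * cmod (W R x) \<le> real (q - r) * cmod (W R x)" using r by (intro mult_right_mono) auto
      also note W_step[OF R]
      finally have "(cmod (W R x))\<^sup>2 \<le> (\<Sum>i\<in>{..<n} - R. 1 * cmod (W (insert i R) x))\<^sup>2"
        by (intro power_mono) auto
      also have "\<dots> \<le> (\<Sum>i\<in>{..<n} - R. 1\<^sup>2) * (\<Sum>i\<in>{..<n} - R. (cmod (W (insert i R) x))\<^sup>2)"
        by (rule Cauchy_Schwarz_ineq_sum)
      also have "\<dots> \<le> real n * (\<Sum>i\<in>{..<n} - R. (cmod (W (insert i R) x))\<^sup>2)"
        using card_mono[of "{..<n}" "{..<n} - R"] by (intro mult_right_mono sum_nonneg) auto
      finally show ?thesis .
    qed
    define Y where "Y R = (\<Sum>x\<in>X. (cmod (W R x))\<^sup>2)" for R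
    have "S r \<le> (\<Sum>R\<in>qsets n r. real n * (\<Sum>i\<in>{..<n} - R. Y (insert i R)))"
      unfolding S_def
    proof (rule sum_mono)
      fix R assume R: "R \<in> qsets n r"
      have "(\<Sum>x\<in>X. (cmod (W R x))\<^sup>2) \<le> (\<Sum>x\<in>X. real n * (\<Sum>i\<in>{..<n} - R. (cmod (W (insert i R) x))\<^sup>2))"
        by (intro sum_mono sq R)
      also have "\<dots> = real n * (\<Sum>i\<in>{..<n} - R. Y (insert i R))"
        unfolding sum_distrib_left[symmetric] Y_def by (subst sum.swap) simp
      finally show "(\<Sum>x\<in>X. (cmod (W R x))\<^sup>2) \<le> real n * (\<Sum>i\<in>{..<n} - R. Y (insert i R))" .
    qed
    also have "\<dots> = real n * (\<Sum>(R,i)\<in>(SIGMA R:qsets n r. {..<n} - R). Y (insert i R))"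
      by (simp add: sum_distrib_left[symmetric] sum.Sigma)
    also have "(\<Sum>(R,i)\<in>(SIGMA R:qsets n r. {..<n} - R). Y (insert i R)) = (\<Sum>(R,i)\<in>(SIGMA R:qsets n (Suc r). R). Y R)"
      by (rule sum.reindex_bij_witness[of _ "\<lambda>(R,i). (R - {i}, i)" "\<lambda>(R,i). (insert i R, i)"])
        (auto simp: qsets_def card_insert_if finite_subset[of _ "{..<n}"])
    also have "\<dots> = (\<Sum>R\<in>qsets n (Suc r). \<Sum>i\<in>R. Y R)"
      by (subst sum.Sigma) (auto intro: qsets_finite)
    also have "\<dots> = real (Suc r) * S (Suc r)"
      unfolding S_def Y_def[symmetric] sum_distrib_left by (intro sum.cong refl) (simp add: qsets_def)
    also have "real n * (real (Suc r) * S (Suc r)) \<le> real n * (real q * S (Suc r))"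
      using r S0 by (intro mult_left_mono mult_right_mono) auto
    finally show ?thesis by (simp add: mult.assoc)
  qed
  \<comment> \<open>The cost of descending by two levels: n q for the step from even to odd, 2^q for
    the inversion, and q + 1 for the number of even levels above.\<close>
  define b where "b = real q * real (q + 1) * 2 ^ q * real n"
  have main: "S (q - 2 * j) \<le> b ^ j * S q" if "j \<le> q div 2" for j
    using that
  proof (induction j rule: less_induct)
    case (less j)
    show ?case
    proof (cases j)
      case 0
      then show ?thesis by simp
    next
      case (Suc i)
      define e where "e = q - 2 * j"
      have e: "even e" "e + 2 * j = q" using less.prems q by (auto simp: e_def)
      then have q2: "q \<ge> 2" using Suc by simp
      have b1: "b \<ge> 1"
      proof -
        have "1 \<le> (q * (q + 1) * 2 ^ q) * n" using q2 n by simp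
        then have "real 1 \<le> real ((q * (q + 1) * 2 ^ q) * n)" by (rule of_nat_mono)
        then show ?thesis by (simp add: b_def algebra_simps)
      qed
      have "S e \<le> real n * real q * S (Suc e)" using e Suc by (intro step2) auto
      also have "\<dots> \<le> real n * real q * (2 ^ q * (\<Sum>r\<in>{r \<in> {Suc e..q}. even r}. S r))"
        using e Suc by (intro mult_left_mono step1) auto
      also have "(\<Sum>r\<in>{r \<in> {Suc e..q}. even r}. S r) \<le> (\<Sum>r\<in>{r \<in> {Suc e..q}. even r}. b ^ i * S q)"
      proof (rule sum_mono)
        fix r assume r: "r \<in> {r \<in> {Suc e..q}. even r}"
        then have "even (q - r)" using q by simp
        then obtain k where k: "q - r = 2 * k" by blast
        have "r = q - 2 * k" "k < j" "k \<le> q div 2" using k r e by auto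
        then have "S r \<le> b ^ k * S q" using less.IH[of k] by simp
        also have "\<dots> \<le> b ^ i * S q"
          using \<open>k < j\<close> Suc b1 S0 by (intro mult_right_mono power_increasing) auto
        finally show "S r \<le> b ^ i * S q" .
      qed
      also have "\<dots> \<le> real (q + 1) * (b ^ i * S q)"
      proof -
        have "card {r \<in> {Suc e..q}. even r} \<le> card {..q}" by (intro card_mono) auto
        then have "real (card {r \<in> {Suc e..q}. even r}) \<le> real (q + 1)" by simp
        then show ?thesis using b1 S0 by (simp add: mult_right_mono)
      qed
      finally have "S e \<le> real n * real q * (2 ^ q * (real (q + 1) * (b ^ i * S q)))"
        by (simp add: mult_left_mono)
      also have "\<dots> = b ^ j * S q" by (simp add: b_def Suc mult_ac)
      finally show ?thesis by (simp add: e_def)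
    qed
  qed
  have Sq: "S q = (\<Sum>I\<in>?Q. \<Sum>x\<in>X. (cmod (V I x))\<^sup>2)"
  proof -
    have "W R x = V R x" if R: "R \<in> ?Q" for R x
    proof -
      have "W R x = (\<Sum>I\<in>?Q. if R = I then V I x else 0)"
        unfolding W_def
      proof (rule sum.cong[OF refl])
        fix I assume I: "I \<in> ?Q"
        have "R \<subseteq> I \<longleftrightarrow> R = I" using card_subset_eq[OF qsets_finite[OF I], of R] R I by (auto simp: qsets_def)
        then show "(if R \<subseteq> I then V I x else 0) = (if R = I then V I x else 0)" by simp
      qed
      then show ?thesis using R by simp
    qed
    then show ?thesis unfolding S_def by simp
  qed
  have "qsets n 0 = {{}}" by (auto simp: qsets_def card_eq_0_iff dest: infinite_super)
  then have "S 0 = (\<Sum>x\<in>X. (cmod (\<Sum>I\<in>qsets n q. V I x))\<^sup>2)" unfolding S_def W_def by simp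
  moreover have "q - 2 * (q div 2) = 0" using q by simp
  ultimately show ?thesis using main[of "q div 2"] unfolding Sq b_def by simp
qed

text \<open>Weighting each \<open>v I\<close> by its own expectation writes the sum of squares L as
  an inner product with \<open>\<phi>\<close>. Cauchy-Schwarz and the bound for odd-orthogonal
  families give L^2 \<le> c b L with b the stated power, and one factor L cancels.\<close>

lemma sum_sq_expectations_bound:
  fixes v :: "nat set \<Rightarrow> 'x \<Rightarrow> complex" and \<phi> :: "'x \<Rightarrow> complex"
  assumes X: "finite X" and q: "even q" and n: "n \<ge> 1" and \<phi>: "(\<Sum>x\<in>X. (cmod (\<phi> x))\<^sup>2) = 1"
    and orth: "\<And>I J. I \<in> qsets n q \<Longrightarrow> J \<in> qsets n q \<Longrightarrow> odd (card (I \<inter> J)) \<Longrightarrow> Re (\<Sum>x\<in>X. cnj (v I x) * v J x) = 0"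
    and norm: "\<And>I. I \<in> qsets n q \<Longrightarrow> (\<Sum>x\<in>X. (cmod (v I x))\<^sup>2) \<le> c" and c: "c \<ge> 0"
  shows "(\<Sum>I\<in>qsets n q. (Re (\<Sum>x\<in>X. cnj (\<phi> x) * v I x))\<^sup>2) \<le> c * (real q * real (q + 1) * 2 ^ q * real n) ^ (q div 2)"
proof -
  let ?Q = "qsets n q"
  define a where "a I = Re (\<Sum>x\<in>X. cnj (\<phi> x) * v I x)" for I
  define V where "V I x = of_real (a I) * v I x" for I x
  define L where "L = (\<Sum>I\<in>?Q. (a I)\<^sup>2)"
  define b where "b = (real q * real (q + 1) * 2 ^ q * real n) ^ (q div 2)"
  have b0: "b \<ge> 0" by (simp add: b_def)
  have L0: "L \<ge> 0" unfolding L_def by (intro sum_nonneg) auto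
  have "L = Re (\<Sum>x\<in>X. cnj (\<phi> x) * (\<Sum>I\<in>?Q. V I x))"
  proof -
    have "(\<Sum>x\<in>X. cnj (\<phi> x) * (\<Sum>I\<in>?Q. V I x)) = (\<Sum>I\<in>?Q. of_real (a I) * (\<Sum>x\<in>X. cnj (\<phi> x) * v I x))"
      unfolding V_def sum_distrib_left by (subst sum.swap) (simp add: mult_ac)
    then show ?thesis by (simp add: L_def a_def power2_eq_square)
  qed
  also have "\<dots> \<le> cmod (\<Sum>x\<in>X. cnj (\<phi> x) * (\<Sum>I\<in>?Q. V I x))" by (rule complex_Re_le_cmod)
  also have "\<dots> \<le> (\<Sum>x\<in>X. cmod (\<phi> x) * cmod (\<Sum>I\<in>?Q. V I x))"
    by (rule order_trans[OF norm_sum]) (simp add: norm_mult)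
  finally have "L\<^sup>2 \<le> (\<Sum>x\<in>X. cmod (\<phi> x) * cmod (\<Sum>I\<in>?Q. V I x))\<^sup>2" using L0 by (intro power_mono)
  also have "\<dots> \<le> (\<Sum>x\<in>X. (cmod (\<phi> x))\<^sup>2) * (\<Sum>x\<in>X. (cmod (\<Sum>I\<in>?Q. V I x))\<^sup>2)"
    by (rule Cauchy_Schwarz_ineq_sum)
  also have "\<dots> \<le> b * (\<Sum>I\<in>?Q. \<Sum>x\<in>X. (cmod (V I x))\<^sup>2)"
    unfolding \<phi> b_def mult_1
  proof (rule odd_orthogonal_sum_bound[OF X q n])
    fix I J assume IJ: "I \<in> ?Q" "J \<in> ?Q" "odd (card (I \<inter> J))"
    have "(\<Sum>x\<in>X. cnj (V I x) * V J x) = of_real (a I * a J) * (\<Sum>x\<in>X. cnj (v I x) * v J x)"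
      unfolding V_def sum_distrib_left by (intro sum.cong refl) simp
    then show "Re (\<Sum>x\<in>X. cnj (V I x) * V J x) = 0" using orth[OF IJ] by simp
  qed
  also have "\<dots> \<le> b * (\<Sum>I\<in>?Q. (a I)\<^sup>2 * c)"
  proof (intro mult_left_mono sum_mono b0)
    fix I assume I: "I \<in> ?Q"
    have "(\<Sum>x\<in>X. (cmod (V I x))\<^sup>2) = (a I)\<^sup>2 * (\<Sum>x\<in>X. (cmod (v I x))\<^sup>2)"
      unfolding V_def sum_distrib_left by (intro sum.cong refl) (simp add: norm_mult power_mult_distrib)
    then show "(\<Sum>x\<in>X. (cmod (V I x))\<^sup>2) \<le> (a I)\<^sup>2 * c" using norm[OF I] by (simp add: mult_left_mono)
  qed
  also have "\<dots> = (c * b) * L" by (simp add: L_def sum_distrib_left mult_ac)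
  finally have "L * L \<le> (c * b) * L" by (simp add: power2_eq_square)
  then have "L \<le> c * b" using L0 b0 c by (cases "L = 0") (auto simp: mult_le_cancel_right)
  then show ?thesis unfolding L_def a_def b_def .
qed

section \<open>Majorana operators\<close>

lemma smult_smult_mat: "a \<cdot>\<^sub>m (k \<cdot>\<^sub>m A) = (a * k) \<cdot>\<^sub>m A" for a :: complex
  by (intro eq_matI) (auto simp: mult.assoc)

lemma one_smult_mat [simp]: "(1 :: complex) \<cdot>\<^sub>m A = A"
  by (intro eq_matI) auto

lemma qf_mult_hermitian:
  assumes "hermitian e A" "hermitian e B"
  shows "(\<Sum>x<e. cnj (\<Sum>y<e. A $$ (x,y) * f y) * (\<Sum>y<e. B $$ (x,y) * f y)) = qf e (A * B) f"
proof -
  have c: "A \<in> carrier_mat e e" "B \<in> carrier_mat e e" using assms by (auto dest: hermitian_carrier)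
  have "(\<Sum>x<e. cnj (\<Sum>y<e. A $$ (x,y) * f y) * (\<Sum>y<e. B $$ (x,y) * f y))
     = (\<Sum>x<e. \<Sum>y<e. \<Sum>z<e. cnj (f y) * (A $$ (y,x) * B $$ (x,z)) * f z)"
    unfolding cnj_sum sum_product
    by (intro sum.cong refl) (simp add: hermitian_entry[OF assms(1)] mult_ac)
  also have "\<dots> = (\<Sum>y<e. \<Sum>x<e. \<Sum>z<e. cnj (f y) * (A $$ (y,x) * B $$ (x,z)) * f z)" by (rule sum.swap)
  also have "\<dots> = (\<Sum>y<e. \<Sum>z<e. \<Sum>x<e. cnj (f y) * (A $$ (y,x) * B $$ (x,z)) * f z)"
    by (rule sum.cong[OF refl], rule sum.swap)
  also have "\<dots> = qf e (A * B) f"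
    unfolding qf_def
    by (intro sum.cong refl) (simp add: mult_mat_sum[OF c] sum_distrib_left sum_distrib_right del: index_mult_mat)
  finally show ?thesis .
qed

locale majoranas =
  fixes n :: nat and psi :: "nat \<Rightarrow> complex mat"
  assumes fam: "majorana_family n psi"
begin

abbreviation d :: nat where "d \<equiv> 2 ^ (n div 2)"

lemma psi_carrier: "i < n \<Longrightarrow> psi i \<in> carrier_mat d d"
  using fam by (simp add: majorana_family_def)

lemma psi_adj: "i < n \<Longrightarrow> adj (psi i) = psi i"
  using fam by (simp add: majorana_family_def)

lemma psi_anti: "i < n \<Longrightarrow> j < n \<Longrightarrow> i \<noteq> j \<Longrightarrow> psi i * psi j = (-1) \<cdot>\<^sub>m (psi j * psi i)"
proof -
  assume ij: "i < n" "j < n" "i \<noteq> j"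
  then have e: "psi i * psi j + psi j * psi i = 0\<^sub>m d d"
    using fam unfolding majorana_family_def by (metis (full_types))
  have c: "psi i * psi j \<in> carrier_mat d d" "psi j * psi i \<in> carrier_mat d d"
    using psi_carrier ij by (auto intro: mult_carrier_mat)
  show ?thesis
  proof (rule eq_matI)
    fix x y assume "x < dim_row ((-1) \<cdot>\<^sub>m (psi j * psi i))" "y < dim_col ((-1) \<cdot>\<^sub>m (psi j * psi i))"
    then have xy: "x < d" "y < d" using c by auto
    have "(psi i * psi j + psi j * psi i) $$ (x,y) = 0" using e xy by simp
    then have "(psi i * psi j) $$ (x,y) + (psi j * psi i) $$ (x,y) = 0"
      using xy c by (simp del: index_mult_mat)
    then show "(psi i * psi j) $$ (x,y) = ((-1) \<cdot>\<^sub>m (psi j * psi i)) $$ (x,y)"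
      using xy c by (simp add: add_eq_0_iff2 del: index_mult_mat)
  qed (use psi_carrier[OF ij(1)] psi_carrier[OF ij(2)] in auto)
qed

text \<open>The anticommutator of an operator with itself counts the square twice, hence 1/2. This
  is the origin of all factors 1 / 2^q.\<close>

lemma psi_sq: "i < n \<Longrightarrow> psi i * psi i = (1/2) \<cdot>\<^sub>m 1\<^sub>m d"
proof -
  assume i: "i < n"
  then have e: "psi i * psi i + psi i * psi i = 1\<^sub>m d"
    using fam unfolding majorana_family_def by (metis (full_types))
  have c: "psi i * psi i \<in> carrier_mat d d" using psi_carrier i by (auto intro: mult_carrier_mat)
  show ?thesis
  proof (rule eq_matI)
    fix x y assume "x < dim_row ((1/2 :: complex) \<cdot>\<^sub>m 1\<^sub>m d)" "y < dim_col ((1/2 :: complex) \<cdot>\<^sub>m 1\<^sub>m d)"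
    then have xy: "x < d" "y < d" by auto
    have "(psi i * psi i + psi i * psi i) $$ (x,y) = 1\<^sub>m d $$ (x,y)" using e by simp
    then have "(psi i * psi i) $$ (x,y) + (psi i * psi i) $$ (x,y) = 1\<^sub>m d $$ (x,y)"
      using xy c by (simp del: index_mult_mat index_one_mat)
    then have "(psi i * psi i) $$ (x,y) = (1/2) * 1\<^sub>m d $$ (x,y)"
      by (simp add: field_simps del: index_mult_mat index_one_mat)
    then show "(psi i * psi i) $$ (x,y) = ((1/2) \<cdot>\<^sub>m 1\<^sub>m d) $$ (x,y)"
      using xy by (simp del: index_mult_mat)
  qed (use psi_carrier[OF i] in auto)
qed

definition P :: "nat list \<Rightarrow> complex mat" where
  "P xs = foldr (\<lambda>i M. psi i * M) xs (1\<^sub>m d)"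

lemma P_simps: "P [] = 1\<^sub>m d" "P (x # xs) = psi x * P xs"
  by (simp_all add: P_def)

lemma P_carrier: "set xs \<subseteq> {..<n} \<Longrightarrow> P xs \<in> carrier_mat d d"
  by (induction xs) (auto simp: P_simps intro: mult_carrier_mat psi_carrier)

text \<open>Passing a factor other than \<open>psi j\<close> costs a sign, passing
  \<open>psi j\<close> itself does not. The number of signs is the length minus the indicator, which
  has the parity of the exponent.\<close>

lemma psi_P:
  assumes "j < n" "set xs \<subseteq> {..<n}" "distinct xs"
  shows "psi j * P xs = ((-1) ^ (length xs + (if j \<in> set xs then 1 else 0))) \<cdot>\<^sub>m (P xs * psi j)"
  using assms(2,3)
proof (induction xs)
  case Nil
  then show ?case using psi_carrier[OF assms(1)] by (simp add: P_simps)
next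
  case (Cons x xs)
  let ?e = "length xs + (if j \<in> set xs then 1 else 0)"
  have cj: "psi j \<in> carrier_mat d d" and cx: "psi x \<in> carrier_mat d d" and cP: "P xs \<in> carrier_mat d d"
    using psi_carrier assms(1) Cons.prems P_carrier by auto
  have IH: "psi j * P xs = ((-1) ^ ?e) \<cdot>\<^sub>m (P xs * psi j)" using Cons by simp
  show ?case
  proof (cases "j = x")
    case True
    have "psi j * P (x # xs) = psi x * (((-1) ^ ?e) \<cdot>\<^sub>m (P xs * psi j))"
      unfolding P_simps using IH True by simp
    also have "\<dots> = ((-1) ^ ?e) \<cdot>\<^sub>m (psi x * (P xs * psi j))"
      using cj cx cP by (intro mult_smult_distrib) auto
    also have "psi x * (P xs * psi j) = P (x # xs) * psi j"
      unfolding P_simps using cj cx cP by (intro assoc_mult_mat[symmetric]) auto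
    finally show ?thesis using True Cons.prems by simp
  next
    case False
    have "psi j * P (x # xs) = psi j * psi x * P xs"
      unfolding P_simps using cj cx cP by (intro assoc_mult_mat[symmetric]) auto
    also have "\<dots> = (-1) \<cdot>\<^sub>m (psi x * psi j) * P xs"
      using psi_anti[OF assms(1), of x] False Cons.prems by simp
    also have "\<dots> = (-1) \<cdot>\<^sub>m (psi x * psi j * P xs)"
      using cj cx cP by (intro mult_smult_assoc_mat) auto
    also have "psi x * psi j * P xs = psi x * (psi j * P xs)"
      using cj cx cP by (intro assoc_mult_mat) auto
    also have "\<dots> = ((-1) ^ ?e) \<cdot>\<^sub>m (psi x * (P xs * psi j))"
      unfolding IH using cj cx cP by (intro mult_smult_distrib) auto
    also have "psi x * (P xs * psi j) = P (x # xs) * psi j"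
      unfolding P_simps using cj cx cP by (intro assoc_mult_mat[symmetric]) auto
    finally show ?thesis using False by (simp add: smult_smult_mat)
  qed
qed

lemma P_comm:
  assumes "set ys \<subseteq> {..<n}" "distinct ys" "set xs \<subseteq> {..<n}" "distinct xs"
  shows "P ys * P xs = ((-1) ^ (length ys * length xs + card (set ys \<inter> set xs))) \<cdot>\<^sub>m (P xs * P ys)"
  using assms(1,2)
proof (induction ys)
  case Nil
  then show ?case using P_carrier[OF assms(3)] by (simp add: P_simps)
next
  case (Cons y ys)
  let ?e = "length ys * length xs + card (set ys \<inter> set xs)"
  let ?f = "length xs + (if y \<in> set xs then 1 else 0)"
  have cy: "psi y \<in> carrier_mat d d" and cx: "P xs \<in> carrier_mat d d" and cP: "P ys \<in> carrier_mat d d"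
    using psi_carrier assms Cons.prems P_carrier by auto
  have "P (y # ys) * P xs = psi y * (P ys * P xs)"
    unfolding P_simps using cx cy cP by (intro assoc_mult_mat) auto
  also have "\<dots> = ((-1) ^ ?e) \<cdot>\<^sub>m (psi y * (P xs * P ys))"
    using Cons cx cy cP by (simp, intro mult_smult_distrib) auto
  also have "psi y * (P xs * P ys) = psi y * P xs * P ys"
    using cx cy cP by (intro assoc_mult_mat[symmetric]) auto
  also have "psi y * P xs = ((-1) ^ ?f) \<cdot>\<^sub>m (P xs * psi y)"
    using Cons.prems assms by (intro psi_P) auto
  also have "((-1) ^ ?f) \<cdot>\<^sub>m (P xs * psi y) * P ys = ((-1) ^ ?f) \<cdot>\<^sub>m (P xs * psi y * P ys)"
    using cx cy cP by (intro mult_smult_assoc_mat) auto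
  also have "P xs * psi y * P ys = P xs * P (y # ys)"
    unfolding P_simps using cx cy cP by (intro assoc_mult_mat) auto
  finally have "P (y # ys) * P xs = ((-1) ^ (?e + ?f)) \<cdot>\<^sub>m (P xs * P (y # ys))"
    by (simp add: smult_smult_mat power_add)
  moreover have "?e + ?f = length (y # ys) * length xs + card (set (y # ys) \<inter> set xs)"
    using Cons.prems by (auto simp: Int_insert_left)
  ultimately show ?case by simp
qed

text \<open>Reversing k anticommuting factors takes k (k - 1) / 2 transpositions, and each square
  then contributes 1/2. The adjoint reverses the product too and shows the same sign.\<close>

lemma P_sq:
  assumes "set xs \<subseteq> {..<n}" "distinct xs"
  shows "P xs * P xs = ((-1) ^ (length xs * (length xs - 1) div 2) / 2 ^ length xs) \<cdot>\<^sub>m 1\<^sub>m d"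
  using assms
proof (induction xs)
  case Nil
  then show ?case by (simp add: P_simps)
next
  case (Cons x xs)
  have xn: "x < n" using Cons.prems by simp
  let ?k = "length xs"
  have cx: "psi x \<in> carrier_mat d d" and cP: "P xs \<in> carrier_mat d d"
    using psi_carrier Cons.prems P_carrier by auto
  have "P (x # xs) * P (x # xs) = psi x * P xs * (psi x * P xs)" by (simp add: P_simps)
  also have "\<dots> = ((-1) ^ ?k) \<cdot>\<^sub>m (P xs * psi x) * (psi x * P xs)"
    using psi_P[of x xs] Cons.prems by simp
  also have "\<dots> = ((-1) ^ ?k) \<cdot>\<^sub>m (P xs * psi x * (psi x * P xs))"
    using cx cP by (intro mult_smult_assoc_mat) auto
  also have "P xs * psi x * (psi x * P xs) = P xs * (psi x * (psi x * P xs))"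
    using cx cP by (intro assoc_mult_mat) auto
  also have "psi x * (psi x * P xs) = psi x * psi x * P xs"
    using cx cP by (intro assoc_mult_mat[symmetric]) auto
  also have "\<dots> = (1/2) \<cdot>\<^sub>m (1\<^sub>m d * P xs)"
    unfolding psi_sq[OF xn] using cP by (intro mult_smult_assoc_mat) auto
  also have "1\<^sub>m d * P xs = P xs" using cP by simp
  also have "P xs * ((1/2) \<cdot>\<^sub>m P xs) = (1/2) \<cdot>\<^sub>m (P xs * P xs)"
    using cP by (intro mult_smult_distrib) auto
  also have "P xs * P xs = ((-1) ^ (?k * (?k - 1) div 2) / 2 ^ ?k) \<cdot>\<^sub>m 1\<^sub>m d" using Cons by simp
  finally have "P (x # xs) * P (x # xs) = ((-1) ^ (?k + ?k * (?k - 1) div 2) / 2 ^ Suc ?k) \<cdot>\<^sub>m 1\<^sub>m d"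
    by (simp add: smult_smult_mat power_add)
  moreover have "?k + ?k * (?k - 1) div 2 = Suc ?k * (Suc ?k - 1) div 2"
    by (cases ?k) (auto simp: algebra_simps)
  ultimately show ?case by simp
qed

lemma adj_mult:
  assumes "A \<in> carrier_mat d d" "B \<in> carrier_mat d d"
  shows "adj (A * B) = adj B * adj A"
proof (rule eq_matI)
  fix x y assume "x < dim_row (adj B * adj A)" "y < dim_col (adj B * adj A)"
  then have xy: "x < d" "y < d" using assms by (auto simp: adj_def)
  have ca: "adj A \<in> carrier_mat d d" "adj B \<in> carrier_mat d d" using assms by (auto simp: adj_def)
  have "adj (A * B) $$ (x,y) = cnj ((A * B) $$ (y,x))" using xy assms by (simp add: adj_def)
  also have "\<dots> = (\<Sum>p<d. cnj (A $$ (y,p)) * cnj (B $$ (p,x)))"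
    using mult_mat_sum[OF assms, of y x] xy by simp
  also have "\<dots> = (\<Sum>p<d. adj B $$ (x,p) * adj A $$ (p,y))"
    using xy assms by (intro sum.cong refl) (simp add: adj_def)
  also have "\<dots> = (adj B * adj A) $$ (x,y)" using mult_mat_sum[OF ca(2,1) xy] by simp
  finally show "adj (A * B) $$ (x,y) = (adj B * adj A) $$ (x,y)" .
qed (use assms in \<open>auto simp: adj_def\<close>)

lemma P_adj:
  assumes "set xs \<subseteq> {..<n}" "distinct xs"
  shows "adj (P xs) = ((-1) ^ (length xs * (length xs - 1) div 2)) \<cdot>\<^sub>m P xs"
  using assms
proof (induction xs)
  case Nil
  show ?case by (intro eq_matI) (auto simp: P_simps adj_def)
next
  case (Cons x xs)
  let ?k = "length xs"
  have cx: "psi x \<in> carrier_mat d d" and cP: "P xs \<in> carrier_mat d d"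
    using psi_carrier Cons.prems P_carrier by auto
  have "adj (P (x # xs)) = adj (P xs) * adj (psi x)" unfolding P_simps by (rule adj_mult[OF cx cP])
  also have "\<dots> = ((-1) ^ (?k * (?k - 1) div 2)) \<cdot>\<^sub>m P xs * psi x"
    using Cons psi_adj by simp
  also have "\<dots> = ((-1) ^ (?k * (?k - 1) div 2)) \<cdot>\<^sub>m (P xs * psi x)"
    using cx cP by (intro mult_smult_assoc_mat) auto
  also have "P xs * psi x = ((-1) ^ ?k) \<cdot>\<^sub>m P (x # xs)"
  proof -
    have "P (x # xs) = ((-1) ^ ?k) \<cdot>\<^sub>m (P xs * psi x)" using psi_P[of x xs] Cons.prems by (simp add: P_simps)
    then have "((-1) ^ ?k) \<cdot>\<^sub>m P (x # xs) = ((-1) ^ (?k + ?k)) \<cdot>\<^sub>m (P xs * psi x)"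
      by (simp only: smult_smult_mat power_add)
    also have "\<dots> = P xs * psi x" using cx cP by (intro eq_matI) auto
    finally show ?thesis by simp
  qed
  finally have "adj (P (x # xs)) = ((-1) ^ (?k + ?k * (?k - 1) div 2)) \<cdot>\<^sub>m P (x # xs)"
    by (simp add: smult_smult_mat power_add mult.commute)
  moreover have "?k + ?k * (?k - 1) div 2 = Suc ?k * (Suc ?k - 1) div 2"
    by (cases ?k) (auto simp: algebra_simps)
  ultimately show ?case by simp
qed

section \<open>Products of an even number of Majorana operators\<close>

abbreviation \<Psi> :: "nat set \<Rightarrow> complex mat" where
  "\<Psi> \<equiv> majorana_prod n psi"

lemma \<Psi>_P: "\<Psi> I = (\<i> ^ (card I div 2)) \<cdot>\<^sub>m P (sorted_list_of_set I)"
  by (simp add: majorana_prod_def P_def)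

text \<open>With q = 2 p the exponent is p (q - 1), which has the parity of p. The phase i^p in
  \<open>majorana_prod\<close> therefore compensates the reversal sign, both in the square and in
  the adjoint.\<close>

lemma half_sign:
  assumes "even q"
  shows "(-1 :: complex) ^ (q * (q - 1) div 2) = (-1) ^ (q div 2)"
proof -
  obtain p where p: "q = 2 * p" using assms by blast
  have "q * (q - 1) div 2 = p * (q - 1)" using p by simp
  moreover have "even (p * (q - 1)) = even p" using p by (cases p) auto
  ultimately show ?thesis using p by (simp add: minus_one_power_iff)
qed

context
  fixes q :: nat
  assumes q: "even q"
begin

lemma slist:
  assumes "I \<in> qsets n q"
  shows "set (sorted_list_of_set I) = I" "set (sorted_list_of_set I) \<subseteq> {..<n}"
    "distinct (sorted_list_of_set I)" "length (sorted_list_of_set I) = q" "card I = q"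
  using assms qsets_finite[OF assms] by (auto simp: qsets_def)

lemma \<Psi>_carrier: "I \<in> qsets n q \<Longrightarrow> \<Psi> I \<in> carrier_mat d d"
  using P_carrier[OF slist(2)] by (simp add: \<Psi>_P)

lemma \<Psi>_hermitian:
  assumes "I \<in> qsets n q"
  shows "hermitian d (\<Psi> I)"
proof -
  let ?M = "P (sorted_list_of_set I)"
  have c: "?M \<in> carrier_mat d d" by (rule P_carrier[OF slist(2)[OF assms]])
  have a: "adj ?M = ((-1) ^ (q div 2)) \<cdot>\<^sub>m ?M"
    using P_adj[OF slist(2,3)[OF assms]] slist(4)[OF assms] half_sign[OF q] by simp
  have "\<Psi> I $$ (x,y) = cnj (\<Psi> I $$ (y,x))" if xy: "x < d" "y < d" for x y
  proof -
    have "cnj (?M $$ (y,x)) = adj ?M $$ (x,y)" using xy c by (simp add: adj_def)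
    also have "\<dots> = (-1) ^ (q div 2) * ?M $$ (x,y)" unfolding a using xy c by simp
    finally have "cnj (\<Psi> I $$ (y,x)) = (- \<i>) ^ (q div 2) * (-1) ^ (q div 2) * ?M $$ (x,y)"
      using xy c slist(5)[OF assms] by (simp add: \<Psi>_P)
    also have "(- \<i>) ^ (q div 2) * (-1) ^ (q div 2) = \<i> ^ (q div 2)"
      by (simp flip: power_mult_distrib)
    finally show ?thesis using xy c slist(5)[OF assms] by (simp add: \<Psi>_P)
  qed
  then show ?thesis using \<Psi>_carrier[OF assms] unfolding hermitian_def by blast
qed

lemma \<Psi>_sq:
  assumes "I \<in> qsets n q"
  shows "\<Psi> I * \<Psi> I = of_real (1 / 2 ^ q) \<cdot>\<^sub>m 1\<^sub>m d"
proof -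
  let ?M = "P (sorted_list_of_set I)" and ?k = "\<i> ^ (q div 2)"
  have c: "?M \<in> carrier_mat d d" by (rule P_carrier[OF slist(2)[OF assms]])
  have "\<Psi> I * \<Psi> I = ?k \<cdot>\<^sub>m (?M * (?k \<cdot>\<^sub>m ?M))"
    unfolding \<Psi>_P slist(5)[OF assms] using c by (intro mult_smult_assoc_mat) auto
  also have "?M * (?k \<cdot>\<^sub>m ?M) = ?k \<cdot>\<^sub>m (?M * ?M)" using c by (intro mult_smult_distrib) auto
  also have "?M * ?M = ((-1) ^ (q div 2) / 2 ^ q) \<cdot>\<^sub>m 1\<^sub>m d"
    using P_sq[OF slist(2,3)[OF assms]] slist(4)[OF assms] half_sign[OF q] by simp
  finally have "\<Psi> I * \<Psi> I = (?k * ?k * ((-1) ^ (q div 2) / 2 ^ q)) \<cdot>\<^sub>m 1\<^sub>m d"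
    by (simp only: smult_smult_mat mult.assoc)
  also have "?k * ?k * ((-1) ^ (q div 2) / 2 ^ q) = of_real (1 / 2 ^ q)"
    by (simp flip: power_mult_distrib add: mult.assoc)
  finally show ?thesis .
qed

text \<open>Exchanging the two products costs a sign for each of the q q pairs of factors except the
  pairs of equal ones. As q is even, only the size of the overlap decides.\<close>

lemma \<Psi>_comm:
  assumes I: "I \<in> qsets n q" and J: "J \<in> qsets n q"
  shows "\<Psi> I * \<Psi> J = ((-1) ^ card (I \<inter> J)) \<cdot>\<^sub>m (\<Psi> J * \<Psi> I)"
proof -
  let ?M = "P (sorted_list_of_set I)" and ?N = "P (sorted_list_of_set J)" and ?k = "\<i> ^ (q div 2)"
  have c: "?M \<in> carrier_mat d d" "?N \<in> carrier_mat d d" 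
    using P_carrier[OF slist(2)[OF I]] P_carrier[OF slist(2)[OF J]] by simp_all
  have e: "?k \<cdot>\<^sub>m A * (?k \<cdot>\<^sub>m B) = (?k * ?k) \<cdot>\<^sub>m (A * B)" if "A \<in> carrier_mat d d" "B \<in> carrier_mat d d" for A B
  proof -
    have "?k \<cdot>\<^sub>m A * (?k \<cdot>\<^sub>m B) = ?k \<cdot>\<^sub>m (A * (?k \<cdot>\<^sub>m B))" using that by (intro mult_smult_assoc_mat) auto
    also have "A * (?k \<cdot>\<^sub>m B) = ?k \<cdot>\<^sub>m (A * B)" using that by (intro mult_smult_distrib) auto
    finally show ?thesis by (simp add: smult_smult_mat)
  qed
  have "?M * ?N = ((-1) ^ (q * q + card (I \<inter> J))) \<cdot>\<^sub>m (?N * ?M)"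
    using P_comm[OF slist(2,3)[OF I] slist(2,3)[OF J]] slist(1,4)[OF I] slist(1,4)[OF J] by simp
  also have "(-1 :: complex) ^ (q * q + card (I \<inter> J)) = (-1) ^ card (I \<inter> J)"
    using q by (simp add: power_add)
  finally show ?thesis
    unfolding \<Psi>_P slist(5)[OF I] slist(5)[OF J] e[OF c] e[OF c(2,1)] by (simp add: smult_smult_mat mult.commute)
qed

text \<open>The ensemble is flattened to one unit vector indexed by pairs. When two products
  anticommute, the inner product of their images of this vector equals minus its own conjugate, so
  its real part vanishes; this is the odd orthogonality.\<close>

lemma \<Psi>_state_bound:
  fixes \<phi> :: "'l \<Rightarrow> nat \<Rightarrow> complex"
  assumes n: "n \<ge> 1" and L: "finite L" and \<phi>: "(\<Sum>l\<in>L. \<Sum>x<d. (cmod (\<phi> l x))\<^sup>2) = 1"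
  shows "(\<Sum>I\<in>qsets n q. (\<Sum>l\<in>L. Re (qf d (\<Psi> I) (\<phi> l)))\<^sup>2)
    \<le> 1 / 2 ^ q * (real q * real (q + 1) * 2 ^ q * real n) ^ (q div 2)"
proof -
  define v where "v I = (\<lambda>(l,x). \<Sum>y<d. \<Psi> I $$ (x,y) * \<phi> l y)" for I
  let ?X = "L \<times> {..<d}"
  have pr: "(\<Sum>z\<in>?X. f z) = (\<Sum>l\<in>L. \<Sum>x<d. f (l,x))" for f :: "'l \<times> nat \<Rightarrow> 'b::comm_monoid_add"
    by (simp add: sum.cartesian_product)
  have vv: "(\<Sum>z\<in>?X. cnj (v I z) * v J z) = (\<Sum>l\<in>L. qf d (\<Psi> I * \<Psi> J) (\<phi> l))"
    if "I \<in> qsets n q" "J \<in> qsets n q" for I J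
    by (simp only: pr v_def prod.case qf_mult_hermitian[OF \<Psi>_hermitian[OF that(1)] \<Psi>_hermitian[OF that(2)]])
  have "(\<Sum>I\<in>qsets n q. (Re (\<Sum>z\<in>?X. cnj (case z of (l,x) \<Rightarrow> \<phi> l x) * v I z))\<^sup>2)
     \<le> 1 / 2 ^ q * (real q * real (q + 1) * 2 ^ q * real n) ^ (q div 2)"
  proof (rule sum_sq_expectations_bound[OF _ q n])
    show "(\<Sum>z\<in>?X. (cmod (case z of (l,x) \<Rightarrow> \<phi> l x))\<^sup>2) = 1"
      by (simp only: pr prod.case \<phi>)
    fix I assume I: "I \<in> qsets n q"
    have "complex_of_real (\<Sum>z\<in>?X. (cmod (v I z))\<^sup>2) = (\<Sum>z\<in>?X. cnj (v I z) * v I z)"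
      unfolding of_real_sum by (intro sum.cong refl) (simp only: complex_norm_square mult.commute)
    also have "\<dots> = (\<Sum>l\<in>L. of_real (1 / 2 ^ q) * (\<Sum>x<d. of_real ((cmod (\<phi> l x))\<^sup>2)))"
      unfolding vv[OF I I] \<Psi>_sq[OF I]
    proof (rule sum.cong[OF refl])
      fix l
      have "qf d (of_real (1 / 2 ^ q) \<cdot>\<^sub>m 1\<^sub>m d) (\<phi> l) = (\<Sum>x<d. \<Sum>y<d. if x = y then of_real (1 / 2 ^ q) * (cnj (\<phi> l x) * \<phi> l y) else 0)"
        unfolding qf_def by (intro sum.cong refl) auto
      also have "\<dots> = of_real (1 / 2 ^ q) * (\<Sum>x<d. cnj (\<phi> l x) * \<phi> l x)" by (simp add: sum_distrib_left)
      also have "(\<Sum>x<d. cnj (\<phi> l x) * \<phi> l x) = (\<Sum>x<d. of_real ((cmod (\<phi> l x))\<^sup>2))"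
        by (intro sum.cong refl) (simp only: complex_norm_square mult.commute)
      finally show "qf d (of_real (1 / 2 ^ q) \<cdot>\<^sub>m 1\<^sub>m d) (\<phi> l) = of_real (1 / 2 ^ q) * (\<Sum>x<d. of_real ((cmod (\<phi> l x))\<^sup>2))" .
    qed
    also have "\<dots> = of_real (1 / 2 ^ q * (\<Sum>l\<in>L. \<Sum>x<d. (cmod (\<phi> l x))\<^sup>2))"
      unfolding of_real_mult of_real_sum sum_distrib_left ..
    finally show "(\<Sum>z\<in>?X. (cmod (v I z))\<^sup>2) \<le> 1 / 2 ^ q" unfolding \<phi> of_real_eq_iff by simp
  next
    fix I J assume IJ: "I \<in> qsets n q" "J \<in> qsets n q" "odd (card (I \<inter> J))"
    have "qf d (\<Psi> I * \<Psi> J) f = - qf d (\<Psi> J * \<Psi> I) f" for f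
    proof -
      have "\<Psi> J * \<Psi> I \<in> carrier_mat d d" using \<Psi>_carrier IJ by (intro mult_carrier_mat) auto
      then show ?thesis
        unfolding \<Psi>_comm[OF IJ(1,2)] using IJ(3) by (simp add: qf_def sum_negf del: index_mult_mat)
    qed
    then have "(\<Sum>z\<in>?X. cnj (v I z) * v J z) = - (\<Sum>z\<in>?X. cnj (v J z) * v I z)"
      unfolding vv[OF IJ(1,2)] vv[OF IJ(2,1)] by (simp add: sum_negf)
    also have "(\<Sum>z\<in>?X. cnj (v J z) * v I z) = cnj (\<Sum>z\<in>?X. cnj (v I z) * v J z)"
      by (simp add: mult.commute)
    finally have "Re (\<Sum>z\<in>?X. cnj (v I z) * v J z) = Re (- cnj (\<Sum>z\<in>?X. cnj (v I z) * v J z))"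
      by (rule arg_cong)
    then show "Re (\<Sum>z\<in>?X. cnj (v I z) * v J z) = 0"
      by (simp only: uminus_complex.sel cnj.sel)
  qed (use L in auto)
  also have "(\<Sum>I\<in>qsets n q. (Re (\<Sum>z\<in>?X. cnj (case z of (l,x) \<Rightarrow> \<phi> l x) * v I z))\<^sup>2)
    = (\<Sum>I\<in>qsets n q. (\<Sum>l\<in>L. Re (qf d (\<Psi> I) (\<phi> l)))\<^sup>2)"
    by (simp only: pr v_def prod.case qf_def Re_sum sum_distrib_left mult.assoc)
  finally show ?thesis .
qed

text \<open>The reference set {0, ..., q - 1} stands for any q-set: by symmetry they all have the
  same number of anticommuting partners.\<close>

definition \<kappa> :: real where
  "\<kappa> = real (card {I \<in> qsets n q. odd (card (I \<inter> {..<q}))})"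

text \<open>A permutation of the indices that carries \<open>J\<close> to \<open>J'\<close>
  preserves overlaps and maps one family injectively into the other. Equality follows by exchanging
  the roles.\<close>

lemma odd_overlap_card_le:
  assumes "J \<in> qsets n q" "J' \<in> qsets n q"
  shows "card {I \<in> qsets n q. odd (card (I \<inter> J))} \<le> card {I \<in> qsets n q. odd (card (I \<inter> J'))}"
proof -
  have f: "finite J" "finite J'" using assms qsets_finite by blast+
  have c: "card J = card J'" and sub: "J \<subseteq> {..<n}" "J' \<subseteq> {..<n}" using assms by (simp_all add: qsets_def)
  obtain g where g: "bij_betw g J J'" using finite_same_card_bij[OF f c] by blast
  have cc: "card ({..<n} - J) = card ({..<n} - J')" using f c sub by (simp add: card_Diff_subset)
  have fd: "finite ({..<n} - J)" "finite ({..<n} - J')" by simp_all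
  obtain h where h: "bij_betw h ({..<n} - J) ({..<n} - J')" using finite_same_card_bij[OF fd cc] by blast
  define p where "p x = (if x \<in> J then g x else h x)" for x
  have pg: "bij_betw p J J'" using g by (rule bij_betw_cong[THEN iffD1, rotated]) (simp add: p_def)
  have ph: "bij_betw p ({..<n} - J) ({..<n} - J')"
    using h by (rule bij_betw_cong[THEN iffD1, rotated]) (simp add: p_def)
  have "bij_betw p (J \<union> ({..<n} - J)) (J' \<union> ({..<n} - J'))" by (rule bij_betw_combine[OF pg ph]) auto
  moreover have "J \<union> ({..<n} - J) = {..<n}" "J' \<union> ({..<n} - J') = {..<n}" using sub by auto
  ultimately have p: "bij_betw p {..<n} {..<n}" by simp
  then have inj: "inj_on p {..<n}" and im: "p ` {..<n} = {..<n}" by (auto simp: bij_betw_def)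
  have pJ: "p ` J = J'" using pg by (simp add: bij_betw_def)
  show ?thesis
  proof (rule card_inj_on_le[where f = "\<lambda>I. p ` I"])
    show "inj_on (\<lambda>I. p ` I) {I \<in> qsets n q. odd (card (I \<inter> J))}"
      by (rule inj_onI) (use inj_on_image_eq_iff[OF inj] in \<open>auto simp: qsets_def\<close>)
    show "(\<lambda>I. p ` I) ` {I \<in> qsets n q. odd (card (I \<inter> J))} \<subseteq> {I \<in> qsets n q. odd (card (I \<inter> J'))}"
    proof
      fix K assume "K \<in> (\<lambda>I. p ` I) ` {I \<in> qsets n q. odd (card (I \<inter> J))}"
      then obtain I where I: "I \<in> qsets n q" "odd (card (I \<inter> J))" and K: "K = p ` I" by auto
      have In: "I \<subseteq> {..<n}" using I by (simp add: qsets_def)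
      have injI: "inj_on p A" if "A \<subseteq> {..<n}" for A using inj that by (rule inj_on_subset)
      have "K \<inter> J' = p ` (I \<inter> J)"
        unfolding K pJ[symmetric] using inj_on_image_Int[OF inj In sub(1)] by simp
      then have "card (K \<inter> J') = card (I \<inter> J)"
        using In by (simp add: card_image[OF injI] le_infI1)
      moreover have "card K = q" unfolding K using I In by (simp add: card_image[OF injI] qsets_def)
      moreover have "K \<subseteq> {..<n}" unfolding K using In im by blast
      ultimately show "K \<in> {I \<in> qsets n q. odd (card (I \<inter> J'))}" using I(2) by (simp add: qsets_def)
    qed
  qed simp
qed

lemma \<kappa>_eq:
  assumes "J \<in> qsets n q" "q \<le> n"
  shows "real (card {I \<in> qsets n q. odd (card (I \<inter> J))}) = \<kappa>"
proof -
  have m: "{..<q} \<in> qsets n q" using assms(2) by (auto simp: qsets_def)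
  show ?thesis unfolding \<kappa>_def
    using odd_overlap_card_le[OF assms(1) m] odd_overlap_card_le[OF m assms(1)] by simp
qed

text \<open>An odd overlap is nonempty, so the set contains one of the q reference points. A union
  bound over these and n C(n-1,q-1) = q C(n,q) finish the count.\<close>

lemma \<kappa>_le:
  assumes "q \<ge> 1" "q \<le> n"
  shows "\<kappa> * real n \<le> real q ^ 2 * real (card (qsets n q))"
proof -
  have one: "card {I \<in> qsets n q. j \<in> I} \<le> (n - 1) choose (q - 1)" if j: "j < n" for j
  proof -
    have "card {I \<in> qsets n q. j \<in> I} \<le> card {R. R \<subseteq> {..<n} - {j} \<and> card R = q - 1}"
    proof (rule card_inj_on_le[where f = "\<lambda>I. I - {j}"])
      show "inj_on (\<lambda>I. I - {j}) {I \<in> qsets n q. j \<in> I}" by (rule inj_onI) blast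
      show "(\<lambda>I. I - {j}) ` {I \<in> qsets n q. j \<in> I} \<subseteq> {R. R \<subseteq> {..<n} - {j} \<and> card R = q - 1}"
        using qsets_finite by (auto simp: qsets_def)
    qed (rule finite_subset[of _ "Pow {..<n}"], auto)
    also have "\<dots> = (n - 1) choose (q - 1)" using j by (subst n_subsets) auto
    finally show ?thesis .
  qed
  have "{I \<in> qsets n q. odd (card (I \<inter> {..<q}))} \<subseteq> (\<Union>j\<in>{..<q}. {I \<in> qsets n q. j \<in> I})"
  proof
    fix I assume I: "I \<in> {I \<in> qsets n q. odd (card (I \<inter> {..<q}))}"
    then have "I \<inter> {..<q} \<noteq> {}" by (metis (mono_tags, lifting) card.empty even_zero mem_Collect_eq)
    then show "I \<in> (\<Union>j\<in>{..<q}. {I \<in> qsets n q. j \<in> I})" using I by auto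
  qed
  then have "card {I \<in> qsets n q. odd (card (I \<inter> {..<q}))} \<le> card (\<Union>j\<in>{..<q}. {I \<in> qsets n q. j \<in> I})"
    by (intro card_mono) auto
  also have "\<dots> \<le> (\<Sum>j\<in>{..<q}. card {I \<in> qsets n q. j \<in> I})" by (rule card_UN_le) simp
  also have "\<dots> \<le> (\<Sum>j\<in>{..<q}. (n - 1) choose (q - 1))" using one assms(2) by (intro sum_mono) auto
  finally have "card {I \<in> qsets n q. odd (card (I \<inter> {..<q}))} * n \<le> q * (n * ((n - 1) choose (q - 1)))"
    by (simp add: mult_ac)
  also have "n * ((n - 1) choose (q - 1)) = q * (n choose q)"
    using times_binomial_minus1_eq[of q n] assms by simp
  finally have "card {I \<in> qsets n q. odd (card (I \<inter> {..<q}))} * n \<le> q\<^sup>2 * card (qsets n q)"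
    by (simp add: card_qsets power2_eq_square mult_ac)
  then have "real (card {I \<in> qsets n q. odd (card (I \<inter> {..<q}))} * n) \<le> real (q\<^sup>2 * card (qsets n q))"
    by (rule of_nat_mono)
  then show ?thesis by (simp add: \<kappa>_def)
qed

text \<open>Conjugating one product by another returns it with the commutation sign and a factor
  2^(-q); the signs add up to N - 2 \<kappa>.\<close>

lemma gaussian_ham_majorana:
  assumes "q \<ge> 1" "q \<le> n" "s > 0"
  shows "gaussian_ham (qsets n q) \<Psi> d (1 / 2 ^ q) s \<kappa> (1 / 2 ^ q * (real q * real (q + 1) * 2 ^ q * real n) ^ (q div 2))"
proof
  fix J x y assume J: "J \<in> qsets n q" and xy: "x < d" "y < d"
  have e: "(\<Psi> I * \<Psi> J * \<Psi> I) $$ (x,y) = (-1) ^ card (I \<inter> J) * of_real (1 / 2 ^ q) * \<Psi> J $$ (x,y)" if I: "I \<in> qsets n q" for I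
  proof -
    have cI: "\<Psi> I \<in> carrier_mat d d" and cJ: "\<Psi> J \<in> carrier_mat d d" using I J \<Psi>_carrier by auto
    have "\<Psi> I * \<Psi> J * \<Psi> I = (-1) ^ card (I \<inter> J) \<cdot>\<^sub>m (\<Psi> J * \<Psi> I * \<Psi> I)"
      unfolding \<Psi>_comm[OF I J] using cI cJ by (intro mult_smult_assoc_mat) auto
    also have "\<Psi> J * \<Psi> I * \<Psi> I = \<Psi> J * (\<Psi> I * \<Psi> I)" using cI cJ by (intro assoc_mult_mat) auto
    also have "\<dots> = of_real (1 / 2 ^ q) \<cdot>\<^sub>m (\<Psi> J * 1\<^sub>m d)"
      unfolding \<Psi>_sq[OF I] using cJ by (intro mult_smult_distrib) auto
    also have "\<Psi> J * 1\<^sub>m d = \<Psi> J" using cJ by simp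
    finally show ?thesis using xy cJ by simp
  qed
  have sgn: "(-1 :: real) ^ k = 1 - 2 * (if odd k then 1 else 0)" for k :: nat by simp
  have "(\<Sum>I\<in>qsets n q. (-1 :: real) ^ card (I \<inter> J)) = real (card (qsets n q)) - 2 * (\<Sum>I\<in>qsets n q. if odd (card (I \<inter> J)) then 1 else 0)"
    unfolding sgn sum_subtractf sum_distrib_left[symmetric] by simp
  also have "(\<Sum>I\<in>qsets n q. if odd (card (I \<inter> J)) then 1 else 0) = real (card {I \<in> qsets n q. odd (card (I \<inter> J))})"
    by (subst sum.inter_filter[symmetric]) simp_all
  finally have S: "(\<Sum>I\<in>qsets n q. (-1 :: real) ^ card (I \<inter> J)) = real (card (qsets n q)) - 2 * \<kappa>"
    using \<kappa>_eq[OF J assms(2)] by simp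
  have "(\<Sum>I\<in>qsets n q. (\<Psi> I * \<Psi> J * \<Psi> I) $$ (x,y)) = (\<Sum>I\<in>qsets n q. of_real ((-1) ^ card (I \<inter> J)) * (of_real (1 / 2 ^ q) * \<Psi> J $$ (x,y)))"
    by (intro sum.cong refl) (simp add: e del: index_mult_mat)
  also have "\<dots> = of_real (\<Sum>I\<in>qsets n q. (-1 :: real) ^ card (I \<inter> J)) * (of_real (1 / 2 ^ q) * \<Psi> J $$ (x,y))"
    by (simp only: of_real_sum sum_distrib_right)
  finally show "(\<Sum>I\<in>qsets n q. (\<Psi> I * \<Psi> J * \<Psi> I) $$ (x,y)) = of_real (1 / 2 ^ q * (real (card (qsets n q)) - 2 * \<kappa>)) * \<Psi> J $$ (x,y)"
    unfolding S by (simp only: of_real_mult mult_ac)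
next
  fix l :: nat and \<phi> assume "(\<Sum>l<l. \<Sum>x<d. (cmod (\<phi> l x))\<^sup>2) = 1"
  then show "(\<Sum>I\<in>qsets n q. (\<Sum>l<l. Re (qf d (\<Psi> I) (\<phi> l)))\<^sup>2) \<le> 1 / 2 ^ q * (real q * real (q + 1) * 2 ^ q * real n) ^ (q div 2)"
    using assms by (intro \<Psi>_state_bound) auto
qed (use assms \<Psi>_hermitian \<Psi>_sq in \<open>auto simp: \<kappa>_def\<close>)

lemma syk_ham_eq: "syk_ham n q psi J = ham d \<Psi> (qsets n q) J"
  by (simp add: syk_ham_def ham_def)

end

end

section \<open>Trace distance and energies\<close>

text \<open>Polarisation for v - w and v + w, rescaled by s and 1/s so that a short and a long
  vector can be balanced.\<close>

lemma qf_add_diff: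
  "4 * (qf d H v - qf d H w) = qf d H (\<lambda>x. of_real s * (v x - w x) + of_real (1 / s) * (v x + w x))
     - qf d H (\<lambda>x. of_real s * (v x - w x) - of_real (1 / s) * (v x + w x))"
  if "s \<noteq> 0"
proof -
  have ss: "complex_of_real s * complex_of_real (1 / s) = 1" using that by (simp flip: of_real_mult)
  have e: "4 * (cnj a * h * b - cnj a' * h * b')
    = cnj (of_real s * (a - a') + of_real (1 / s) * (a + a')) * h * (of_real s * (b - b') + of_real (1 / s) * (b + b'))
     - cnj (of_real s * (a - a') - of_real (1 / s) * (a + a')) * h * (of_real s * (b - b') - of_real (1 / s) * (b + b'))"
    for a b a' b' h :: complex
  proof -
    define t where "t = complex_of_real (1 / s)"
    define r where "r = complex_of_real s"
    have rt: "r * t = 1" using ss by (simp add: r_def t_def)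
    have c: "cnj r = r" "cnj t = t" by (simp_all add: r_def t_def)
    have "cnj (r * (a - a') + t * (a + a')) * h * (r * (b - b') + t * (b + b'))
      - cnj (r * (a - a') - t * (a + a')) * h * (r * (b - b') - t * (b + b'))
      = (r * t) * (4 * (cnj a * h * b - cnj a' * h * b'))"
      by (simp add: c algebra_simps)
    then show ?thesis unfolding rt by (simp add: r_def t_def)
  qed
  show ?thesis unfolding qf_def sum_subtractf[symmetric] sum_distrib_left
    by (intro sum.cong refl) (rule e)
qed

lemma norm_sq_add_diff: "(cmod (a + b))\<^sup>2 + (cmod (a - b))\<^sup>2 = 2 * ((cmod a)\<^sup>2 + (cmod b)\<^sup>2)"
  unfolding cmod_power2 by (simp add: power2_eq_square algebra_simps)

text \<open>Polarisation reduces the difference to expectations, which a bound on the numerical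
  range controls. The weights 1/\<eta> and \<eta> balance |v - w|^2 \<le> \<eta>^2 against |v + w|^2
  \<le> 4, and 2 (1 + 4) \<eta> / 4 is the stated 5 \<eta> / 2.\<close>

lemma qf_perturb:
  fixes v w :: "'l \<Rightarrow> nat \<Rightarrow> complex"
  assumes B: "\<And>f. \<bar>Re (qf d H f)\<bar> \<le> B * (\<Sum>x<d. (cmod (f x))\<^sup>2)" and B0: "B \<ge> 0"
    and v: "(\<Sum>l\<in>L. \<Sum>x<d. (cmod (v l x))\<^sup>2) = 1" and w: "(\<Sum>l\<in>L. \<Sum>x<d. (cmod (w l x))\<^sup>2) = 1"
    and vw: "(\<Sum>l\<in>L. \<Sum>x<d. (cmod (v l x - w l x))\<^sup>2) \<le> \<eta>\<^sup>2" and \<eta>: "\<eta> > 0"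
  shows "\<bar>(\<Sum>l\<in>L. Re (qf d H (v l))) - (\<Sum>l\<in>L. Re (qf d H (w l)))\<bar> \<le> 5 / 2 * B * \<eta>"
proof -
  define s where "s = 1 / sqrt \<eta>"
  have s: "s \<noteq> 0" "s\<^sup>2 = 1 / \<eta>" "(1 / s)\<^sup>2 = \<eta>" using \<eta> by (simp_all add: s_def power_divide)
  let ?p = "\<lambda>l x. of_real s * (v l x - w l x) + of_real (1 / s) * (v l x + w l x)"
  let ?m = "\<lambda>l x. of_real s * (v l x - w l x) - of_real (1 / s) * (v l x + w l x)"
  have one: "4 * \<bar>Re (qf d H (v l)) - Re (qf d H (w l))\<bar>
      \<le> B * (\<Sum>x<d. 2 * (1 / \<eta> * (cmod (v l x - w l x))\<^sup>2 + \<eta> * (cmod (v l x + w l x))\<^sup>2))" for l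
  proof -
    have "4 * (Re (qf d H (v l)) - Re (qf d H (w l))) = Re (4 * (qf d H (v l) - qf d H (w l)))" by simp
    also have "\<dots> = Re (qf d H (?p l)) - Re (qf d H (?m l))" by (subst qf_add_diff[OF s(1)]) simp
    finally have "4 * \<bar>Re (qf d H (v l)) - Re (qf d H (w l))\<bar> \<le> \<bar>Re (qf d H (?p l))\<bar> + \<bar>Re (qf d H (?m l))\<bar>"
      by linarith
    also have "\<dots> \<le> B * (\<Sum>x<d. (cmod (?p l x))\<^sup>2) + B * (\<Sum>x<d. (cmod (?m l x))\<^sup>2)"
      by (intro add_mono B)
    also have "\<dots> = B * (\<Sum>x<d. (cmod (?p l x))\<^sup>2 + (cmod (?m l x))\<^sup>2)"
      by (simp add: sum.distrib distrib_left)
    also have "(\<Sum>x<d. (cmod (?p l x))\<^sup>2 + (cmod (?m l x))\<^sup>2) = (\<Sum>x<d. 2 * (1 / \<eta> * (cmod (v l x - w l x))\<^sup>2 + \<eta> * (cmod (v l x + w l x))\<^sup>2))"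
      unfolding norm_sq_add_diff using s by (simp only: norm_mult power_mult_distrib norm_of_real power2_abs)
    finally show ?thesis .
  qed
  have sum4: "(\<Sum>l\<in>L. \<Sum>x<d. (cmod (v l x + w l x))\<^sup>2) \<le> 4"
  proof -
    have "(\<Sum>l\<in>L. \<Sum>x<d. (cmod (v l x + w l x))\<^sup>2) \<le> (\<Sum>l\<in>L. \<Sum>x<d. 2 * ((cmod (v l x))\<^sup>2 + (cmod (w l x))\<^sup>2))"
    proof (intro sum_mono)
      fix l x
      show "(cmod (v l x + w l x))\<^sup>2 \<le> 2 * ((cmod (v l x))\<^sup>2 + (cmod (w l x))\<^sup>2)"
        using norm_sq_add_diff[of "v l x" "w l x"] zero_le_power2[of "cmod (v l x - w l x)"] by linarith
    qed
    also have "\<dots> = 2 * ((\<Sum>l\<in>L. \<Sum>x<d. (cmod (v l x))\<^sup>2) + (\<Sum>l\<in>L. \<Sum>x<d. (cmod (w l x))\<^sup>2))"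
      by (simp only: sum_distrib_left[symmetric] sum.distrib)
    finally show ?thesis unfolding v w by simp
  qed
  have "4 * \<bar>(\<Sum>l\<in>L. Re (qf d H (v l))) - (\<Sum>l\<in>L. Re (qf d H (w l)))\<bar> \<le> (\<Sum>l\<in>L. 4 * \<bar>Re (qf d H (v l)) - Re (qf d H (w l))\<bar>)"
    unfolding sum_subtractf[symmetric] sum_distrib_left[symmetric] by (intro mult_left_mono sum_abs) auto
  also have "\<dots> \<le> (\<Sum>l\<in>L. B * (\<Sum>x<d. 2 * (1 / \<eta> * (cmod (v l x - w l x))\<^sup>2 + \<eta> * (cmod (v l x + w l x))\<^sup>2)))"
    by (intro sum_mono one)
  also have "\<dots> = B * (2 * (1 / \<eta> * (\<Sum>l\<in>L. \<Sum>x<d. (cmod (v l x - w l x))\<^sup>2) + \<eta> * (\<Sum>l\<in>L. \<Sum>x<d. (cmod (v l x + w l x))\<^sup>2)))"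
    by (simp only: sum_distrib_left[symmetric] sum.distrib)
  also have "\<dots> \<le> B * (2 * (1 / \<eta> * \<eta>\<^sup>2 + \<eta> * 4))"
    using vw sum4 B0 \<eta> by (intro mult_left_mono add_mono) auto
  also have "\<dots> = 4 * (5 / 2 * B * \<eta>)" using \<eta> by (simp add: power2_eq_square algebra_simps)
  finally show ?thesis by (simp only: mult_le_cancel_left_pos zero_less_numeral)
qed

lemma mult_mat_vec_sum:
  assumes "A \<in> carrier_mat n m" "v \<in> carrier_vec m" "i < n"
  shows "(A *\<^sub>v v) $ i = (\<Sum>j<m. A $$ (i,j) * v $ j)"
  using assms by (simp add: scalar_prod_def atLeast0LessThan)

text \<open>The difference of two pure states squares to \<open>1 - \<bar>\<langle>v,w\<rangle>\<bar>\<^sup>2\<close> on the span of \<open>v\<close> and \<open>w\<close>.\<close>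
lemma trace_norm_proj_diff:
  assumes v: "v \<in> carrier_vec n" "(\<Sum>x<n. (cmod (v $ x))\<^sup>2) = 1"
    and w: "w \<in> carrier_vec n" "(\<Sum>x<n. (cmod (w $ x))\<^sup>2) = 1"
  shows "sqrt (1 - (cmod (\<Sum>x<n. cnj (w $ x) * v $ x))\<^sup>2) \<le> trace_norm (proj v - proj w)"
proof -
  define B where "B = proj v - proj w"
  define c where "c = (\<Sum>x<n. cnj (w $ x) * v $ x)"
  have cB: "B \<in> carrier_mat n n" and Be: "\<And>i j. i < n \<Longrightarrow> j < n \<Longrightarrow> B $$ (i,j) = v $ i * cnj (v $ j) - w $ i * cnj (w $ j)"
    using v w by (auto simp: B_def proj_def)
  have adjB: "adj B = B"
    using cB by (intro eq_matI) (auto simp: adj_def Be)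
  let ?M = "adj B * B"
  have cM: "?M \<in> carrier_mat n n" unfolding adjB using cB by (intro mult_carrier_mat)
  have vv: "(\<Sum>x<n. cnj (v $ x) * v $ x) = 1" and ww: "(\<Sum>x<n. cnj (w $ x) * w $ x) = 1"
  proof -
    have e: "(\<Sum>x<n. cnj (u $ x) * u $ x) = of_real (\<Sum>x<n. (cmod (u $ x))\<^sup>2)" for u
      unfolding of_real_sum by (intro sum.cong refl) (simp only: complex_norm_square mult.commute)
    show "(\<Sum>x<n. cnj (v $ x) * v $ x) = 1" "(\<Sum>x<n. cnj (w $ x) * w $ x) = 1"
      unfolding e v(2) w(2) by simp_all
  qed
  have cv: "(\<Sum>x<n. cnj (v $ x) * w $ x) = cnj c" unfolding c_def by (simp add: mult.commute)
  have Bu: "(B *\<^sub>v u) $ i = v $ i * (\<Sum>j<n. cnj (v $ j) * u $ j) - w $ i * (\<Sum>j<n. cnj (w $ j) * u $ j)"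
    if "u \<in> carrier_vec n" "i < n" for u i
    unfolding mult_mat_vec_sum[OF cB that] sum_distrib_left sum_subtractf[symmetric]
    by (intro sum.cong refl) (use that in \<open>simp add: Be algebra_simps\<close>)
  have Bv: "B *\<^sub>v v = v - c \<cdot>\<^sub>v w"
    using cB v w by (intro eq_vecI) (auto simp: Bu[OF v(1)] vv c_def[symmetric] mult.commute[of _ c] simp del: index_mult_mat_vec)
  have Bw: "B *\<^sub>v w = cnj c \<cdot>\<^sub>v v - w"
    using cB v w by (intro eq_vecI) (auto simp: Bu[OF w(1)] ww cv mult.commute[of _ "cnj c"] simp del: index_mult_mat_vec)
  have "?M *\<^sub>v v = B *\<^sub>v (B *\<^sub>v v)" unfolding adjB using cB v by (intro assoc_mult_mat_vec) auto
  also have "\<dots> = B *\<^sub>v v - c \<cdot>\<^sub>v (B *\<^sub>v w)"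
    unfolding Bv using cB v w by (simp add: mult_minus_distrib_mat_vec mult_mat_vec Bv)
  also have "\<dots> = of_real (1 - (cmod c)\<^sup>2) \<cdot>\<^sub>v v"
  proof -
    have "c * cnj c = of_real ((cmod c)\<^sup>2)" by (simp only: complex_norm_square)
    then show ?thesis unfolding Bv Bw using v w by (intro eq_vecI) (auto simp: algebra_simps)
  qed
  finally have ev: "?M *\<^sub>v v = of_real (1 - (cmod c)\<^sup>2) \<cdot>\<^sub>v v" .
  have v0: "v \<noteq> 0\<^sub>v n" using v(2) by auto
  have "eigenvalue ?M (of_real (1 - (cmod c)\<^sup>2))"
    unfolding eigenvalue_def eigenvector_def using ev v0 v(1) cM by (intro exI[of _ v]) auto
  then have root: "poly (char_poly ?M) (of_real (1 - (cmod c)\<^sup>2)) = 0" using eigenvalue_root_char_poly[OF cM] by simp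
  have nz: "char_poly ?M \<noteq> 0" using degree_monic_char_poly[OF cM] by auto
  have mem: "of_real (1 - (cmod c)\<^sup>2) \<in># proots (char_poly ?M)"
    using root nz by (simp add: set_count_proots[OF nz])
  \<comment> \<open>Since no root contributes negatively, the trace norm is at least the
    contribution of the one eigenvalue just found.\<close>
  have nonneg: "Re z \<ge> 0" if "z \<in># proots (char_poly ?M)" for z
  proof -
    from that have "poly (char_poly ?M) z = 0" by (simp add: set_count_proots[OF nz])
    then have "eigenvalue ?M z" using eigenvalue_root_char_poly[OF cM] by simp
    then obtain u where u: "u \<in> carrier_vec n" "u \<noteq> 0\<^sub>v n" "?M *\<^sub>v u = z \<cdot>\<^sub>v u"
      using cM unfolding eigenvalue_def eigenvector_def by auto
    define U where "U = (\<Sum>x<n. (cmod (u $ x))\<^sup>2)"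
    have herm: "hermitian n B" using cB by (auto simp: hermitian_def Be)
    have "z * of_real U = (\<Sum>x<n. z * (u $ x * cnj (u $ x)))"
      by (simp only: U_def of_real_sum sum_distrib_left complex_norm_square)
    also have "\<dots> = (\<Sum>x<n. cnj (u $ x) * (?M *\<^sub>v u) $ x)"
      unfolding u(3) by (intro sum.cong refl) (use u(1) in \<open>simp add: mult_ac\<close>)
    also have "\<dots> = qf n (B * B) (\<lambda>x. u $ x)"
      unfolding qf_def adjB
      by (intro sum.cong refl) (simp add: mult_mat_vec_sum[OF cM[unfolded adjB] u(1)] sum_distrib_left mult.assoc del: index_mult_mat index_mult_mat_vec)
    also have "\<dots> = (\<Sum>x<n. of_real ((cmod (\<Sum>y<n. B $$ (x,y) * u $ y))\<^sup>2))"
      unfolding qf_mult_hermitian[OF herm herm, symmetric] by (intro sum.cong refl) (simp only: complex_norm_square mult.commute)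
    finally have zU: "z * of_real U = (\<Sum>x<n. of_real ((cmod (\<Sum>y<n. B $$ (x,y) * u $ y))\<^sup>2))" .
    have "Re z * U = Re (z * of_real U)" by simp
    also have "\<dots> = (\<Sum>x<n. (cmod (\<Sum>y<n. B $$ (x,y) * u $ y))\<^sup>2)"
      unfolding zU Re_sum Re_complex_of_real ..
    finally have "Re z * U = (\<Sum>x<n. (cmod (\<Sum>y<n. B $$ (x,y) * u $ y))\<^sup>2)" .
    moreover have "(\<Sum>x<n. (cmod (\<Sum>y<n. B $$ (x,y) * u $ y))\<^sup>2) \<ge> 0" by (intro sum_nonneg) auto
    moreover have "U > 0"
    proof -
      obtain i where "i < n" "u $ i \<noteq> 0" using u(1,2) by (metis carrier_vecD eq_vecI index_zero_vec(1,2))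
      then have "0 < (cmod (u $ i))\<^sup>2" "(cmod (u $ i))\<^sup>2 \<le> U"
        unfolding U_def using member_le_sum[of i "{..<n}" "\<lambda>x. (cmod (u $ x))\<^sup>2"] by auto
      then show ?thesis by linarith
    qed
    ultimately show ?thesis using zero_le_mult_iff[of "Re z" U] by auto
  qed
  have "(\<lambda>z. sqrt (Re z)) (of_real (1 - (cmod c)\<^sup>2)) \<le> trace_norm B"
  proof -
    obtain N where N: "proots (char_poly ?M) = add_mset (of_real (1 - (cmod c)\<^sup>2)) N"
      using mem by (metis insert_DiffM)
    have "0 \<le> sum_mset (image_mset (\<lambda>z. sqrt (Re z)) N')" if "\<forall>z\<in>#N'. Re z \<ge> 0" for N'
      using that by (induction N') auto
    moreover have "\<forall>z\<in>#N. Re z \<ge> 0" using nonneg unfolding N by simp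
    ultimately have "0 \<le> sum_mset (image_mset (\<lambda>z. sqrt (Re z)) N)" by blast
    then show ?thesis unfolding trace_norm_def N by simp
  qed
  then show ?thesis unfolding B_def c_def by simp
qed

text \<open>The phase makes the overlap c real and nonnegative, so the squared distance is 2 - 2|c|.
  As |c| \<le> 1 this is at most 2 (1 - |c|^2), and the trace distance bounds 1 - |c|^2 by 4
  eps^2.\<close>

lemma close_up_to_phase:
  assumes v: "v \<in> carrier_vec n" "(\<Sum>x<n. (cmod (v $ x))\<^sup>2) = 1"
    and w: "w \<in> carrier_vec n" "(\<Sum>x<n. (cmod (w $ x))\<^sup>2) = 1"
    and eps: "trace_dist (proj v) (proj w) \<le> eps"
  shows "\<exists>\<theta>. cmod \<theta> = 1 \<and> (\<Sum>x<n. (cmod (v $ x - \<theta> * w $ x))\<^sup>2) \<le> 8 * eps\<^sup>2"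
proof -
  define c where "c = (\<Sum>x<n. cnj (w $ x) * v $ x)"
  define \<theta> where "\<theta> = (if c = 0 then 1 else c / of_real (cmod c))"
  have \<theta>: "cmod \<theta> = 1" "cnj \<theta> * c = of_real (cmod c)"
  proof -
    show "cmod \<theta> = 1" by (simp add: \<theta>_def norm_divide)
    have "cnj c * c = of_real ((cmod c)\<^sup>2)" by (simp only: complex_norm_square mult.commute)
    then show "cnj \<theta> * c = of_real (cmod c)" by (auto simp: \<theta>_def power2_eq_square)
  qed
  have c1: "cmod c \<le> 1"
  proof -
    have "cmod c \<le> (\<Sum>x<n. cmod (w $ x) * cmod (v $ x))"
      unfolding c_def by (rule order_trans[OF norm_sum]) (simp add: norm_mult)
    then have "(cmod c)\<^sup>2 \<le> (\<Sum>x<n. cmod (w $ x) * cmod (v $ x))\<^sup>2" by (intro power_mono) auto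
    also have "\<dots> \<le> 1" using Cauchy_Schwarz_ineq_sum[of "\<lambda>x. cmod (w $ x)" "\<lambda>x. cmod (v $ x)" "{..<n}"] v(2) w(2) by simp
    finally show ?thesis by (simp add: power_le_one_iff abs_square_le_1)
  qed
  have "(cmod (v $ x - \<theta> * w $ x))\<^sup>2 = (cmod (v $ x))\<^sup>2 + (cmod (w $ x))\<^sup>2 - 2 * Re (cnj \<theta> * (cnj (w $ x) * v $ x))" for x
  proof -
    have "(cmod (a - b))\<^sup>2 = (cmod a)\<^sup>2 + (cmod b)\<^sup>2 - 2 * Re (cnj b * a)" for a b
      unfolding cmod_power2 by (simp add: power2_eq_square algebra_simps)
    from this[of "v $ x" "\<theta> * w $ x"] show ?thesis using \<theta>(1) by (simp add: norm_mult mult.assoc)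
  qed
  then have "(\<Sum>x<n. (cmod (v $ x - \<theta> * w $ x))\<^sup>2) = (\<Sum>x<n. (cmod (v $ x))\<^sup>2) + (\<Sum>x<n. (cmod (w $ x))\<^sup>2) - 2 * (\<Sum>x<n. Re (cnj \<theta> * (cnj (w $ x) * v $ x)))"
    by (simp only: sum_subtractf sum.distrib sum_distrib_left)
  also have "(\<Sum>x<n. Re (cnj \<theta> * (cnj (w $ x) * v $ x))) = cmod c"
    using \<theta>(2) unfolding Re_sum[symmetric] sum_distrib_left[symmetric] c_def[symmetric] by simp
  finally have e: "(\<Sum>x<n. (cmod (v $ x - \<theta> * w $ x))\<^sup>2) = 2 - 2 * cmod c" using v(2) w(2) by simp
  have "sqrt (1 - (cmod c)\<^sup>2) \<le> trace_norm (proj v - proj w)"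
    unfolding c_def by (rule trace_norm_proj_diff[OF v w])
  also have "\<dots> \<le> 2 * eps" using eps by (simp add: trace_dist_def)
  finally have s: "sqrt (1 - (cmod c)\<^sup>2) \<le> 2 * eps" .
  have "1 - (cmod c)\<^sup>2 = (sqrt (1 - (cmod c)\<^sup>2))\<^sup>2" using c1 by (simp add: abs_square_le_1)
  also have "\<dots> \<le> (2 * eps)\<^sup>2" using s c1 by (intro power_mono) (auto simp: abs_square_le_1)
  finally have "1 - (cmod c)\<^sup>2 \<le> 4 * eps\<^sup>2" by (simp add: power_mult_distrib)
  moreover have "(cmod c)\<^sup>2 \<le> cmod c" using c1 by (simp add: power2_eq_square mult_left_le)
  ultimately show ?thesis using \<theta>(1) e by (intro exI[of _ \<theta>]) auto
qed

section \<open>Circuits acting on functions of bit configurations\<close>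

text \<open>
  A configuration is the set of qubits in state 1; \<open>set_encode\<close> turns it into a basis index.  The action
  of a gate on amplitude functions refers only to its two qubits, not to the size of the register.
\<close>

definition bitv :: "nat \<Rightarrow> nat set \<Rightarrow> nat" where
  "bitv j c = (if j \<in> c then 1 else 0)"

definition setb :: "nat \<Rightarrow> nat \<Rightarrow> nat set \<Rightarrow> nat set" where
  "setb j p c = (if p = 1 then insert j c else c - {j})"

definition act :: "complex mat \<Rightarrow> nat \<Rightarrow> nat \<Rightarrow> (nat set \<Rightarrow> complex) \<Rightarrow> nat set \<Rightarrow> complex" where
  "act U a b f c = (\<Sum>(p,r)\<in>{0,1}\<times>{0,1}. U $$ (2 * bitv a c + bitv b c, 2 * p + r) * f (setb a p (setb b r c)))"

definition run :: "(complex mat \<times> nat \<times> nat) list \<Rightarrow> (nat set \<Rightarrow> complex) \<Rightarrow> nat set \<Rightarrow> complex" where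
  "run cs f = foldl (\<lambda>f (U,a,b). act U a b f) f cs"

definition prodst :: "nat set \<Rightarrow> (nat \<Rightarrow> nat \<Rightarrow> complex) \<Rightarrow> nat set \<Rightarrow> complex" where
  "prodst Q u c = (\<Prod>j\<in>Q. u j (bitv j c))"

definition nrm :: "nat set \<Rightarrow> (nat set \<Rightarrow> complex) \<Rightarrow> real" where
  "nrm Q f = (\<Sum>c\<in>Pow Q. (cmod (f c))\<^sup>2)"

lemma run_simps: "run [] f = f" "run (cs @ [(U,a,b)]) f = act U a b (run cs f)"
  by (simp_all add: run_def)

lemma setb_subset: "c \<subseteq> Q \<Longrightarrow> j \<in> Q \<Longrightarrow> setb j p c \<subseteq> Q"
  by (auto simp: setb_def)

lemma setb_setb: "setb j p (setb j p' c) = setb j p c"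
  by (auto simp: setb_def)

lemma setb_commute: "a \<noteq> b \<Longrightarrow> setb a p (setb b r c) = setb b r (setb a p c)"
  by (auto simp: setb_def)

lemma qbit_bit: "qbit j x = bitv j (set_decode x)"
  by (auto simp: qbit_def bitv_def set_decode_def odd_iff_mod_2_eq_one)

lemma qbit_encode: "finite c \<Longrightarrow> qbit j (set_encode c) = bitv j c"
  by (simp add: qbit_bit)

lemma set_decode_subset: "x < 2 ^ M \<Longrightarrow> set_decode x \<subseteq> {..<M}"
proof
  fix j assume x: "x < 2 ^ M" and j: "j \<in> set_decode x"
  show "j \<in> {..<M}"
  proof (rule ccontr)
    assume "j \<notin> {..<M}"
    then have "x < 2 ^ j" using less_le_trans[OF x power_increasing[of M j "2 :: nat"]] by simp
    then show False using j by (simp add: set_decode_def)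
  qed
qed

lemma set_encode_less: "c \<subseteq> {..<M} \<Longrightarrow> set_encode c < 2 ^ M"
proof -
  assume c: "c \<subseteq> {..<M}"
  have "set_encode c \<le> (\<Sum>i<M. 2 ^ i)" unfolding set_encode_def using c by (intro sum_mono2) auto
  also have "\<dots> < (2 :: nat) ^ M" by (induction M) auto
  finally show ?thesis .
qed

lemma decode_bij: "bij_betw set_decode {..<2 ^ M} (Pow {..<M})"
proof (rule bij_betw_byWitness[where f' = set_encode])
  show "set_encode ` Pow {..<M} \<subseteq> {..<2 ^ M}" using set_encode_less by auto
  show "\<forall>a'\<in>Pow {..<M}. set_decode (set_encode a') = a'"
    using set_encode_inverse finite_subset[OF _ finite_lessThan] by blast
qed (use set_decode_subset in auto)

lemma sum_decode: "(\<Sum>x<2 ^ M. g (set_decode x)) = (\<Sum>c\<in>Pow {..<M}. g c)"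
  using sum.reindex_bij_betw[OF decode_bij] by blast

text \<open>The system occupies the low \<open>s\<close> bits, the ancilla index \<open>e\<close>
  the bits above them.\<close>

lemma set_decode_shift:
  assumes "x < 2 ^ s"
  shows "set_decode (x + 2 ^ s * e) = set_decode x \<union> (+) s ` set_decode e"
proof -
  have "j \<in> set_decode (x + 2 ^ s * e) \<longleftrightarrow> j \<in> set_decode x \<union> (+) s ` set_decode e" for j
  proof (cases "j < s")
    case True
    then obtain k where k: "s = Suc (j + k)" using less_imp_Suc_add by blast
    have "(x + 2 ^ s * e) div 2 ^ j = x div 2 ^ j + 2 * 2 ^ k * e"
      unfolding k by (simp add: power_add mult.assoc mult.left_commute[of 2])
    then show ?thesis using True by (auto simp: set_decode_def)
  next
    case False
    then obtain k where k: "j = s + k" using le_Suc_ex not_less by blast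
    have "(x + 2 ^ s * e) div 2 ^ j = e div 2 ^ k" using assms by (simp add: k power_add div_mult2_eq)
    moreover have "x div 2 ^ j = 0"
      using less_le_trans[OF assms power_increasing[of s j "2 :: nat"]] False by simp
    ultimately show ?thesis by (auto simp: set_decode_def k)
  qed
  then show ?thesis by blast
qed

subsection \<open>Agreement with the matrix semantics\<close>

definition amp :: "complex vec \<Rightarrow> nat set \<Rightarrow> complex" where
  "amp v c = v $ set_encode c"

text \<open>In the matrix-vector product only the four basis states that agree with \<open>c\<close>
  off the two qubits contribute.\<close>

lemma gate_amp:
  assumes v: "v \<in> carrier_vec (2 ^ M)" and ab: "a < M" "b < M" "a \<noteq> b" and c: "c \<subseteq> {..<M}"
  shows "amp (gate_on M U a b *\<^sub>v v) c = act U a b (amp v) c"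
proof -
  have fc: "finite c" using c finite_subset by blast
  have cx: "set_encode c < 2 ^ M" by (rule set_encode_less[OF c])
  have g: "gate_on M U a b \<in> carrier_mat (2 ^ M) (2 ^ M)" by (simp add: gate_on_def)
  define ag where "ag c' \<longleftrightarrow> (\<forall>j<M. j \<noteq> a \<longrightarrow> j \<noteq> b \<longrightarrow> bitv j c = bitv j c')" for c'
  have "amp (gate_on M U a b *\<^sub>v v) c = (\<Sum>y<2 ^ M. gate_on M U a b $$ (set_encode c, y) * v $ y)"
    unfolding amp_def by (rule mult_mat_vec_sum[OF g v cx])
  also have "\<dots> = (\<Sum>y<2 ^ M. (if ag (set_decode y) then U $$ (2 * bitv a c + bitv b c, 2 * bitv a (set_decode y) + bitv b (set_decode y)) * amp v (set_decode y) else 0))"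
    using cx fc by (intro sum.cong refl) (auto simp: gate_on_def ag_def amp_def qbit_encode qbit_bit[of _ "_ :: nat"])
  also have "\<dots> = (\<Sum>c'\<in>Pow {..<M}. if ag c' then U $$ (2 * bitv a c + bitv b c, 2 * bitv a c' + bitv b c') * amp v c' else 0)"
    by (rule sum_decode)
  also have "\<dots> = (\<Sum>c'\<in>{c' \<in> Pow {..<M}. ag c'}. U $$ (2 * bitv a c + bitv b c, 2 * bitv a c' + bitv b c') * amp v c')"
    by (rule sum.inter_filter[symmetric]) simp
  also have "\<dots> = (\<Sum>(p,r)\<in>{0,1}\<times>{0,1}. U $$ (2 * bitv a c + bitv b c, 2 * p + r) * amp v (setb a p (setb b r c)))"
  proof (rule sum.reindex_bij_witness[of _ "\<lambda>(p,r). setb a p (setb b r c)" "\<lambda>c'. (bitv a c', bitv b c')"])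
    fix c' assume c': "c' \<in> {c' \<in> Pow {..<M}. ag c'}"
    have agree: "j \<in> c' \<longleftrightarrow> j \<in> c" if "j \<noteq> a" "j \<noteq> b" for j
    proof (cases "j < M")
      case True
      then have "bitv j c = bitv j c'" using c' that by (simp add: ag_def)
      then show ?thesis by (auto simp: bitv_def split: if_splits)
    next
      case False
      then show ?thesis using c c' by auto
    qed
    have "setb a (bitv a c') (setb b (bitv b c') c) = c'"
    proof (rule Set.set_eqI)
      fix j
      show "j \<in> setb a (bitv a c') (setb b (bitv b c') c) \<longleftrightarrow> j \<in> c'"
        using agree[of j] ab(3) by (auto simp: setb_def bitv_def)
    qed
    then show "(case (bitv a c', bitv b c') of (p,r) \<Rightarrow> setb a p (setb b r c)) = c'" by simp
    show "(bitv a c', bitv b c') \<in> {0,1}\<times>{0,1}" by (simp add: bitv_def)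
    show "(case (bitv a c', bitv b c') of (p,r) \<Rightarrow> U $$ (2 * bitv a c + bitv b c, 2 * p + r) * amp v (setb a p (setb b r c)))
      = U $$ (2 * bitv a c + bitv b c, 2 * bitv a c' + bitv b c') * amp v c'"
      using \<open>setb a (bitv a c') (setb b (bitv b c') c) = c'\<close> by simp
  next
    fix z :: "nat \<times> nat" assume z: "z \<in> {0,1}\<times>{0,1}"
    obtain p r where pr: "z = (p,r)" using surj_pair[of z] by blast
    show "(bitv a (case z of (p,r) \<Rightarrow> setb a p (setb b r c)), bitv b (case z of (p,r) \<Rightarrow> setb a p (setb b r c))) = z"
      using z ab(3) pr by (auto simp: setb_def bitv_def)
    show "(case z of (p,r) \<Rightarrow> setb a p (setb b r c)) \<in> {c' \<in> Pow {..<M}. ag c'}"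
      using z ab c pr by (auto simp: setb_def bitv_def ag_def)
  qed
  finally show ?thesis by (simp add: act_def)
qed

lemma act_cong:
  assumes "\<And>c. c \<subseteq> Q \<Longrightarrow> f c = g c" "a \<in> Q" "b \<in> Q" "c \<subseteq> Q"
  shows "act U a b f c = act U a b g c"
  unfolding act_def
  by (intro sum.cong refl) (use assms in \<open>auto intro!: arg_cong2[where f = "(*)"] simp: setb_subset\<close>)

lemma circuit_mat_snoc: "circuit_mat M (cs @ [(U,a,b)]) = gate_on M U a b * circuit_mat M cs"
  by (simp add: circuit_mat_def)

lemma circuit_mat_carrier: "circuit_mat M cs \<in> carrier_mat (2 ^ M) (2 ^ M)"
proof (induction cs rule: rev_induct)
  case Nil
  then show ?case by (simp add: circuit_mat_def)
next
  case (snoc x cs)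
  obtain U a b where x: "x = (U,a,b)" by (cases x) auto
  have "gate_on M U a b \<in> carrier_mat (2 ^ M) (2 ^ M)" by (simp add: gate_on_def)
  with snoc show ?case unfolding x circuit_mat_snoc by (intro mult_carrier_mat) auto
qed

lemma circuit_amp:
  assumes "circuit_over S M cs" "v \<in> carrier_vec (2 ^ M)" "c \<subseteq> {..<M}"
  shows "amp (circuit_mat M cs *\<^sub>v v) c = run cs (amp v) c"
  using assms(1,3)
proof (induction cs arbitrary: c rule: rev_induct)
  case Nil
  then show ?case using assms(2) by (simp add: circuit_mat_def run_simps)
next
  case (snoc x cs)
  obtain U a b where x: "x = (U,a,b)" by (cases x) auto
  have ab: "a < M" "b < M" "a \<noteq> b" using snoc.prems by (auto simp: circuit_over_def x)
  have cc: "circuit_over S M cs" using snoc.prems by (auto simp: circuit_over_def)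
  have g: "gate_on M U a b \<in> carrier_mat (2 ^ M) (2 ^ M)" by (simp add: gate_on_def)
  have "circuit_mat M (cs @ [x]) *\<^sub>v v = gate_on M U a b *\<^sub>v (circuit_mat M cs *\<^sub>v v)"
    unfolding x circuit_mat_snoc using g circuit_mat_carrier assms(2) by (rule assoc_mult_mat_vec)
  then have "amp (circuit_mat M (cs @ [x]) *\<^sub>v v) c = act U a b (amp (circuit_mat M cs *\<^sub>v v)) c"
    using gate_amp[OF _ ab snoc.prems(2)] circuit_mat_carrier assms(2) by (metis mult_mat_vec_carrier)
  also have "\<dots> = act U a b (run cs (amp v)) c"
    by (rule act_cong[of "{..<M}"]) (use snoc.IH[OF cc] ab snoc.prems in auto)
  finally show ?case by (simp add: x run_simps)
qed

subsection \<open>Unitarity\<close>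

lemma sum_Pow_insert2:
  fixes g :: "nat set \<Rightarrow> real"
  assumes Q: "finite Q" and ab: "a \<in> Q" "b \<in> Q" "a \<noteq> b"
  shows "(\<Sum>c\<in>Pow Q. g c) = (\<Sum>c\<in>Pow (Q - {a,b}). \<Sum>(p,r)\<in>{0,1}\<times>{0,1}. g (setb a p (setb b r c)))"
proof -
  have "(\<Sum>c\<in>Pow (Q - {a,b}). \<Sum>(p,r)\<in>{0,1}\<times>{0,1}. g (setb a p (setb b r c)))
     = (\<Sum>(c,p,r)\<in>Pow (Q - {a,b}) \<times> ({0,1}\<times>{0,1}). g (setb a p (setb b r c)))"
    by (simp only: sum.cartesian_product split_def)
  also have "\<dots> = (\<Sum>c\<in>Pow Q. g c)"
  proof (rule sum.reindex_bij_witness[of _ "\<lambda>c. (c - {a,b}, bitv a c, bitv b c)" "\<lambda>(c,p,r). setb a p (setb b r c)"])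
    fix z assume z: "z \<in> Pow (Q - {a,b}) \<times> ({0,1 :: nat}\<times>{0,1 :: nat})"
    obtain c p r where zz: "z = (c,p,r)" by (cases z) auto
    show "((case z of (c,p,r) \<Rightarrow> setb a p (setb b r c)) - {a,b}, bitv a (case z of (c,p,r) \<Rightarrow> setb a p (setb b r c)), bitv b (case z of (c,p,r) \<Rightarrow> setb a p (setb b r c))) = z"
      using z ab(3) unfolding zz by (auto simp: setb_def bitv_def)
    show "(case z of (c,p,r) \<Rightarrow> setb a p (setb b r c)) \<in> Pow Q"
      using z ab unfolding zz by (auto simp: setb_def)
    show "g (case z of (c,p,r) \<Rightarrow> setb a p (setb b r c)) = (case z of (c,p,r) \<Rightarrow> g (setb a p (setb b r c)))"
      unfolding zz by simp
  next
    fix c assume "c \<in> Pow Q"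
    then show "(c - {a,b}, bitv a c, bitv b c) \<in> Pow (Q - {a,b}) \<times> ({0,1}\<times>{0,1})" by (auto simp: bitv_def)
    show "(case (c - {a,b}, bitv a c, bitv b c) of (c,p,r) \<Rightarrow> setb a p (setb b r c)) = c"
      using ab(3) by (auto simp: setb_def bitv_def)
  qed
  finally show ?thesis by simp
qed

lemma unitary_norm:
  assumes U: "unitary_mat n U"
  shows "(\<Sum>x<n. (cmod (\<Sum>y<n. U $$ (x,y) * w y))\<^sup>2) = (\<Sum>y<n. (cmod (w y))\<^sup>2)"
proof -
  have c: "U \<in> carrier_mat n n" and u: "adj U * U = 1\<^sub>m n" using U by (auto simp: unitary_mat_def)
  have ca: "adj U \<in> carrier_mat n n" using c by (simp add: adj_def)
  have ent: "(\<Sum>x<n. cnj (U $$ (x,y)) * U $$ (x,z)) = (if y = z then 1 else 0)" if "y < n" "z < n" for y z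
  proof -
    have "(adj U * U) $$ (y,z) = (\<Sum>x<n. adj U $$ (y,x) * U $$ (x,z))" by (rule mult_mat_sum[OF ca c that])
    also have "\<dots> = (\<Sum>x<n. cnj (U $$ (x,y)) * U $$ (x,z))"
      using c that by (intro sum.cong refl) (simp add: adj_def)
    finally show ?thesis unfolding u using that by simp
  qed
  have "complex_of_real (\<Sum>x<n. (cmod (\<Sum>y<n. U $$ (x,y) * w y))\<^sup>2) = (\<Sum>x<n. cnj (\<Sum>y<n. U $$ (x,y) * w y) * (\<Sum>z<n. U $$ (x,z) * w z))"
    unfolding of_real_sum by (intro sum.cong refl) (simp only: complex_norm_square mult.commute)
  also have "\<dots> = (\<Sum>x<n. \<Sum>y<n. \<Sum>z<n. cnj (w y) * w z * (cnj (U $$ (x,y)) * U $$ (x,z)))"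
    unfolding cnj_sum sum_product by (intro sum.cong refl) (simp add: mult_ac)
  also have "\<dots> = (\<Sum>y<n. \<Sum>x<n. \<Sum>z<n. cnj (w y) * w z * (cnj (U $$ (x,y)) * U $$ (x,z)))" by (rule sum.swap)
  also have "\<dots> = (\<Sum>y<n. \<Sum>z<n. \<Sum>x<n. cnj (w y) * w z * (cnj (U $$ (x,y)) * U $$ (x,z)))"
    by (rule sum.cong[OF refl], rule sum.swap)
  also have "\<dots> = (\<Sum>y<n. \<Sum>z<n. if y = z then cnj (w y) * w z else 0)"
    by (intro sum.cong refl) (auto simp: sum_distrib_left[symmetric] ent)
  also have "\<dots> = (\<Sum>y<n. cnj (w y) * w y)" by simp
  also have "\<dots> = complex_of_real (\<Sum>y<n. (cmod (w y))\<^sup>2)"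
    unfolding of_real_sum by (intro sum.cong refl) (simp only: complex_norm_square mult.commute)
  finally show ?thesis unfolding of_real_eq_iff .
qed

lemma sum_two_bits: "(\<Sum>(p,r)\<in>{0,1}\<times>{0,1}. h (2 * p + r :: nat)) = (\<Sum>k<4. h k)" for h :: "nat \<Rightarrow> 'a :: comm_monoid_add"
proof -
  have "(\<Sum>(p,r)\<in>{0,1}\<times>{0,1}. h (2 * p + r)) = h 0 + h 1 + (h 2 + h 3)"
    by (simp add: sum.cartesian_product[symmetric] numeral_eq_Suc add.assoc)
  also have "\<dots> = (\<Sum>k<4. h k)" by (simp add: numeral_eq_Suc add.assoc)
  finally show ?thesis .
qed

text \<open>Configurations are grouped into fours that differ only in the two qubits; on each group
  the gate acts as the 4 by 4 unitary \<open>U\<close>.\<close>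

lemma nrm_act:
  assumes Q: "finite Q" and ab: "a \<in> Q" "b \<in> Q" "a \<noteq> b" and U: "unitary_mat 4 U"
  shows "nrm Q (act U a b f) = nrm Q f"
proof -
  have loc: "(\<Sum>(p,r)\<in>{0,1}\<times>{0,1}. (cmod (act U a b f (setb a p (setb b r c))))\<^sup>2)
     = (\<Sum>(p,r)\<in>{0,1}\<times>{0,1}. (cmod (f (setb a p (setb b r c))))\<^sup>2)" if c: "c \<in> Pow (Q - {a,b})" for c
  proof -
    define w where "w k = f (setb a (k div 2) (setb b (k mod 2) c))" for k
    have wpr: "f (setb a p (setb b r c)) = w (2 * p + r)" if "(p,r) \<in> {0,1}\<times>{0,1}" for p r
      using that by (auto simp: w_def)
    have actw: "act U a b f (setb a p (setb b r c)) = (\<Sum>y<4. U $$ (2 * p + r, y) * w y)" if pr: "(p,r) \<in> {0,1}\<times>{0,1}" for p r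
    proof -
      have bits: "bitv a (setb a p (setb b r c)) = p" "bitv b (setb a p (setb b r c)) = r"
        using pr c ab(3) by (auto simp: bitv_def setb_def)
      have ss: "setb a p' (setb b r' (setb a p (setb b r c))) = setb a p' (setb b r' c)" for p' r'
        by (simp only: setb_commute[OF ab(3)[symmetric], of r'] setb_setb)
      have "act U a b f (setb a p (setb b r c)) = (\<Sum>(p',r')\<in>{0,1}\<times>{0,1}. U $$ (2 * p + r, 2 * p' + r') * w (2 * p' + r'))"
        unfolding act_def bits ss by (intro sum.cong refl) (auto simp: wpr)
      also have "\<dots> = (\<Sum>y<4. U $$ (2 * p + r, y) * w y)" by (rule sum_two_bits)
      finally show ?thesis .
    qed
    have "(\<Sum>(p,r)\<in>{0,1}\<times>{0,1}. (cmod (act U a b f (setb a p (setb b r c))))\<^sup>2)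
      = (\<Sum>(p,r)\<in>{0,1}\<times>{0,1}. (cmod (\<Sum>y<4. U $$ (2 * p + r, y) * w y))\<^sup>2)"
      by (rule sum.cong[OF refl]) (simp only: split_paired_all prod.case actw)
    also have "\<dots> = (\<Sum>k<4. (cmod (\<Sum>y<4. U $$ (k, y) * w y))\<^sup>2)" by (rule sum_two_bits)
    also have "\<dots> = (\<Sum>k<4. (cmod (w k))\<^sup>2)" by (rule unitary_norm[OF U])
    also have "\<dots> = (\<Sum>(p,r)\<in>{0,1}\<times>{0,1}. (cmod (w (2 * p + r)))\<^sup>2)" by (rule sum_two_bits[symmetric])
    also have "\<dots> = (\<Sum>(p,r)\<in>{0,1}\<times>{0,1}. (cmod (f (setb a p (setb b r c))))\<^sup>2)"
      by (intro sum.cong refl) (auto simp: wpr)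
    finally show ?thesis .
  qed
  show ?thesis unfolding nrm_def sum_Pow_insert2[OF Q ab]
    by (intro sum.cong refl loc)
qed

lemma act_diff: "act U a b (\<lambda>c. f c - g c) c = act U a b f c - act U a b g c"
  unfolding act_def sum_subtractf[symmetric] by (intro sum.cong refl) (auto simp: right_diff_distrib)

lemma run_diff: "run cs (\<lambda>c. f c - g c) = (\<lambda>c. run cs f c - run cs g c)"
proof (induction cs rule: rev_induct)
  case (snoc x cs)
  obtain U a b where "x = (U,a,b)" by (cases x) auto
  then show ?case using snoc by (auto simp: run_simps act_diff)
qed (simp add: run_simps)

lemma nrm_run:
  assumes "\<forall>U\<in>S. unitary_mat 4 U" "circuit_over S M cs"
  shows "nrm {..<M} (run cs f) = nrm {..<M} f"
  using assms(2)
proof (induction cs rule: rev_induct)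
  case (snoc x cs)
  obtain U a b where x: "x = (U,a,b)" by (cases x) auto
  have "nrm {..<M} (act U a b (run cs f)) = nrm {..<M} (run cs f)"
    using snoc.prems assms(1) by (intro nrm_act) (auto simp: circuit_over_def x)
  then show ?case using snoc by (simp add: x run_simps circuit_over_def)
qed (simp add: run_simps)

subsection \<open>Product states\<close>

text \<open>Multiplying out a product of two-term sums; choosing a summand in each factor is
  choosing a configuration.\<close>

lemma sum_Pow_prod:
  fixes g :: "nat \<Rightarrow> nat \<Rightarrow> 'a :: comm_semiring_1"
  assumes "finite R"
  shows "(\<Sum>z\<in>Pow R. \<Prod>j\<in>R. g j (bitv j z)) = (\<Prod>j\<in>R. g j 0 + g j 1)"
  using assms
proof (induction R rule: finite_induct)
  case (insert i R)
  have "(\<Sum>z\<in>Pow (insert i R). \<Prod>j\<in>insert i R. g j (bitv j z))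
     = (\<Sum>z\<in>Pow R. \<Prod>j\<in>insert i R. g j (bitv j z)) + (\<Sum>z\<in>insert i ` Pow R. \<Prod>j\<in>insert i R. g j (bitv j z))"
    unfolding Pow_insert using insert.hyps by (intro sum.union_disjoint) auto
  also have "(\<Sum>z\<in>Pow R. \<Prod>j\<in>insert i R. g j (bitv j z)) = (\<Sum>z\<in>Pow R. g i 0 * (\<Prod>j\<in>R. g j (bitv j z)))"
    using insert.hyps by (intro sum.cong refl) (auto simp: bitv_def)
  also have "(\<Sum>z\<in>insert i ` Pow R. \<Prod>j\<in>insert i R. g j (bitv j z)) = (\<Sum>z\<in>Pow R. \<Prod>j\<in>insert i R. g j (bitv j (insert i z)))"
    using insert.hyps by (intro sum.reindex_cong[of "insert i"]) (auto simp: inj_on_def)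
  also have "\<dots> = (\<Sum>z\<in>Pow R. g i 1 * (\<Prod>j\<in>R. g j (bitv j z)))"
  proof (rule sum.cong[OF refl])
    fix z
    have "(\<Prod>j\<in>R. g j (bitv j (insert i z))) = (\<Prod>j\<in>R. g j (bitv j z))"
      using insert.hyps by (intro prod.cong refl) (auto simp: bitv_def)
    then show "(\<Prod>j\<in>insert i R. g j (bitv j (insert i z))) = g i 1 * (\<Prod>j\<in>R. g j (bitv j z))"
      using insert.hyps by (simp add: bitv_def)
  qed
  finally show ?case using insert by (simp add: sum_distrib_left[symmetric] distrib_right)
qed simp

lemma nrm_prodst:
  assumes "finite Q" "\<And>j. j \<in> Q \<Longrightarrow> (cmod (u j 0))\<^sup>2 + (cmod (u j 1))\<^sup>2 = 1"
  shows "nrm Q (prodst Q u) = 1"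
proof -
  have "nrm Q (prodst Q u) = (\<Sum>z\<in>Pow Q. \<Prod>j\<in>Q. (\<lambda>j k. (cmod (u j k))\<^sup>2) j (bitv j z))"
    by (simp add: nrm_def prodst_def prod_norm[symmetric] prod_power_distrib)
  also have "\<dots> = (\<Prod>j\<in>Q. (cmod (u j 0))\<^sup>2 + (cmod (u j 1))\<^sup>2)"
    by (rule sum_Pow_prod[OF assms(1)])
  also have "\<dots> = 1" using assms(2) by simp
  finally show ?thesis .
qed

lemma sqrt_nrm: "sqrt (nrm Q f) = L2_set (\<lambda>c. cmod (f c)) (Pow Q)"
  by (simp add: nrm_def L2_set_def)

lemma sqrt_nrm_triangle: "finite Q \<Longrightarrow> sqrt (nrm Q (\<lambda>c. f c + g c)) \<le> sqrt (nrm Q f) + sqrt (nrm Q g)"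
  unfolding sqrt_nrm
  by (rule order_trans[OF L2_set_mono L2_set_triangle_ineq]) (auto intro: norm_triangle_ineq)

lemma nrm_tensor:
  assumes "finite Q" "i \<notin> Q" and f: "\<And>c. f (insert i c) = f c"
  shows "nrm (insert i Q) (\<lambda>c. f c * w (bitv i c)) = nrm Q f * ((cmod (w 0))\<^sup>2 + (cmod (w 1))\<^sup>2)"
proof -
  have inj: "inj_on (insert i) (Pow Q)"
  proof (rule inj_onI)
    fix x y assume "x \<in> Pow Q" "y \<in> Pow Q" "insert i x = insert i y"
    then show "x = y" using insert_ident[of i x y] assms(2) by blast
  qed
  have "nrm (insert i Q) (\<lambda>c. f c * w (bitv i c))
     = (\<Sum>c\<in>Pow Q. (cmod (f c * w (bitv i c)))\<^sup>2) + (\<Sum>c\<in>insert i ` Pow Q. (cmod (f c * w (bitv i c)))\<^sup>2)"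
    unfolding nrm_def Pow_insert using assms by (intro sum.union_disjoint) auto
  also have "(\<Sum>c\<in>Pow Q. (cmod (f c * w (bitv i c)))\<^sup>2) = (\<Sum>c\<in>Pow Q. (cmod (f c))\<^sup>2 * (cmod (w 0))\<^sup>2)"
    using assms by (intro sum.cong refl) (auto simp: bitv_def norm_mult power_mult_distrib)
  also have "(\<Sum>c\<in>insert i ` Pow Q. (cmod (f c * w (bitv i c)))\<^sup>2) = (\<Sum>c\<in>Pow Q. (cmod (f c))\<^sup>2 * (cmod (w 1))\<^sup>2)"
    using assms inj by (intro sum.reindex_cong[of "insert i"]) (auto simp: bitv_def norm_mult power_mult_distrib)
  finally show ?thesis by (simp add: nrm_def sum_distrib_right[symmetric] distrib_left)
qed

text \<open>A hybrid argument: the factors are exchanged one by one, each at cost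
  \<open>\<delta>\<close> because all other factors are normalised.\<close>

lemma prodst_close:
  assumes "finite Q" "\<And>j. j \<in> Q \<Longrightarrow> (cmod (u j 0))\<^sup>2 + (cmod (u j 1))\<^sup>2 = 1"
    "\<And>j. j \<in> Q \<Longrightarrow> (cmod (u' j 0))\<^sup>2 + (cmod (u' j 1))\<^sup>2 = 1"
    "\<And>j. j \<in> Q \<Longrightarrow> (cmod (u j 0 - u' j 0))\<^sup>2 + (cmod (u j 1 - u' j 1))\<^sup>2 \<le> \<delta>\<^sup>2" and \<delta>: "\<delta> \<ge> 0"
  shows "sqrt (nrm Q (\<lambda>c. prodst Q u c - prodst Q u' c)) \<le> real (card Q) * \<delta>"
  using assms(1-4)
proof (induction Q rule: finite_induct)
  case empty
  then show ?case by (simp add: nrm_def prodst_def)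
next
  case (insert i Q)
  have ins: "prodst Q u (insert i c) = prodst Q u c" for u c
    unfolding prodst_def using insert.hyps by (intro prod.cong refl) (auto simp: bitv_def)
  have split: "prodst (insert i Q) u c = prodst Q u c * u i (bitv i c)" for u c
    unfolding prodst_def using insert.hyps by (simp add: mult.commute)
  have e: "(\<lambda>c. prodst (insert i Q) u c - prodst (insert i Q) u' c)
    = (\<lambda>c. (prodst Q u c - prodst Q u' c) * u i (bitv i c) + prodst Q u' c * (\<lambda>k. u i k - u' i k) (bitv i c))"
    unfolding split by (auto simp: algebra_simps)
  have "sqrt (nrm (insert i Q) (\<lambda>c. prodst (insert i Q) u c - prodst (insert i Q) u' c))
     \<le> sqrt (nrm (insert i Q) (\<lambda>c. (prodst Q u c - prodst Q u' c) * u i (bitv i c)))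
      + sqrt (nrm (insert i Q) (\<lambda>c. prodst Q u' c * (\<lambda>k. u i k - u' i k) (bitv i c)))"
    unfolding e using insert.hyps by (intro sqrt_nrm_triangle) auto
  also have "nrm (insert i Q) (\<lambda>c. (prodst Q u c - prodst Q u' c) * u i (bitv i c)) = nrm Q (\<lambda>c. prodst Q u c - prodst Q u' c)"
    using insert by (subst nrm_tensor) (auto simp: ins)
  also have "nrm (insert i Q) (\<lambda>c. prodst Q u' c * (\<lambda>k. u i k - u' i k) (bitv i c)) = (cmod (u i 0 - u' i 0))\<^sup>2 + (cmod (u i 1 - u' i 1))\<^sup>2"
    using insert by (subst nrm_tensor) (auto simp: ins nrm_prodst)
  also have "sqrt ((cmod (u i 0 - u' i 0))\<^sup>2 + (cmod (u i 1 - u' i 1))\<^sup>2) \<le> \<delta>"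
    using insert.prems(3)[of i] \<delta> by (intro real_le_lsqrt) auto
  also have "sqrt (nrm Q (\<lambda>c. prodst Q u c - prodst Q u' c)) \<le> real (card Q) * \<delta>"
    using insert by simp
  finally show ?case using insert.hyps by (simp add: algebra_simps)
qed

subsection \<open>Restriction to the qubits touched by the circuit\<close>

text \<open>The map \<open>h\<close> embeds a small register into a large one, and
  \<open>pull\<close> reads a large configuration through it. The next definition,
  \<open>ens\<close>, is the expectation of a system operator after the qubits s, ..., M - 1 are
  traced out.\<close>

definition pull :: "nat \<Rightarrow> (nat \<Rightarrow> nat) \<Rightarrow> nat set \<Rightarrow> nat set" where
  "pull n h c = {j. j < n \<and> h j \<in> c}"

definition ens :: "nat \<Rightarrow> nat \<Rightarrow> (nat set \<Rightarrow> complex) \<Rightarrow> complex mat \<Rightarrow> complex" where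
  "ens s M f A = (\<Sum>z\<in>Pow {s..<M}. qf (2 ^ s) A (\<lambda>x. f (set_decode x \<union> z)))"

lemma bitv_pull: "j < n \<Longrightarrow> bitv (h j) c = bitv j (pull n h c)"
  by (simp add: bitv_def pull_def)

lemma pull_setb:
  assumes "inj_on h {..<n}" "a < n"
  shows "pull n h (setb (h a) p c) = setb a p (pull n h c)"
proof (rule Set.set_eqI)
  fix j
  show "j \<in> pull n h (setb (h a) p c) \<longleftrightarrow> j \<in> setb a p (pull n h c)"
    using inj_onD[OF assms(1), of j a] assms(2) by (auto simp: pull_def setb_def)
qed

lemma run_cong:
  assumes "\<And>c. c \<subseteq> {..<M} \<Longrightarrow> f c = g c" "circuit_over S M cs" "c \<subseteq> {..<M}"
  shows "run cs f c = run cs g c"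
  using assms(2,3)
proof (induction cs arbitrary: c rule: rev_induct)
  case Nil
  then show ?case using assms(1) by (simp add: run_simps)
next
  case (snoc x cs)
  obtain U a b where x: "x = (U,a,b)" by (cases x) auto
  have "act U a b (run cs f) c = act U a b (run cs g) c"
    by (rule act_cong[of "{..<M}"]) (use snoc in \<open>auto simp: circuit_over_def x\<close>)
  then show ?case by (simp add: x run_simps)
qed

text \<open>\<open>r\<close> carries the amplitude of the spectator qubits. It ignores every bit in
  the image of \<open>h\<close>, so gates on relabelled qubits pass through it.\<close>

lemma run_pull:
  assumes h: "inj_on h {..<n}" and cs: "circuit_over S n cs"
    and r: "\<And>c j p. j < n \<Longrightarrow> r (setb (h j) p c) = r c"
  shows "run (map (\<lambda>(U,a,b). (U, h a, h b)) cs) (\<lambda>c. f (pull n h c) * r c) = (\<lambda>c. run cs f (pull n h c) * r c)"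
  using cs
proof (induction cs rule: rev_induct)
  case Nil
  then show ?case by (simp add: run_simps)
next
  case (snoc x cs)
  obtain U a b where x: "x = (U,a,b)" by (cases x) auto
  have ab: "a < n" "b < n" using snoc.prems by (auto simp: circuit_over_def x)
  have IH: "run (map (\<lambda>(U,a,b). (U, h a, h b)) cs) (\<lambda>c. f (pull n h c) * r c) = (\<lambda>c. run cs f (pull n h c) * r c)"
    using snoc by (simp add: circuit_over_def)
  have "act U (h a) (h b) (\<lambda>c. F (pull n h c) * r c) c = act U a b F (pull n h c) * r c" for F c
    unfolding act_def sum_distrib_right
    by (intro sum.cong refl) (auto simp: bitv_pull ab pull_setb[OF h] r mult.assoc simp flip: bitv_pull[OF ab(1)] bitv_pull[OF ab(2)])
  then show ?case by (simp add: x run_simps IH)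
qed

lemma qf_scale: "qf d A (\<lambda>x. F x * \<rho>) = of_real ((cmod \<rho>)\<^sup>2) * qf d A F"
  unfolding qf_def sum_distrib_left by (intro sum.cong refl) (simp only: complex_norm_square complex_cnj_mult mult_ac)

text \<open>Untouched ancillas factor off and trace out to the squared norm of their state, which is
  1. As \<open>h\<close> fixes the system qubits, the reduced state is that of the small
  register.\<close>

lemma ens_factor:
  assumes h: "inj_on h {..<s + t}" "\<And>j. j < s \<Longrightarrow> h j = j" "h ` {s..<s + t} \<subseteq> {s..<M}"
    and R: "R = {s..<M} - h ` {s..<s + t}" and r: "\<And>c. r c = r (c \<inter> R)" "(\<Sum>z\<in>Pow R. (cmod (r z))\<^sup>2) = 1"
  shows "ens s M (\<lambda>c. f (pull (s + t) h c) * r c) A = ens s (s + t) f A"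
proof -
  let ?T = "{s..<s + t}"
  have hT: "h j \<in> {s..<M}" if "j \<in> ?T" for j using h(3) that by blast
  have "ens s M (\<lambda>c. f (pull (s + t) h c) * r c) A
     = (\<Sum>(z1,z2)\<in>Pow ?T \<times> Pow R. of_real ((cmod (r z2))\<^sup>2) * qf (2 ^ s) A (\<lambda>x. f (set_decode x \<union> z1)))"
    unfolding ens_def
  proof (rule sum.reindex_bij_witness[of _ "\<lambda>(z1,z2). h ` z1 \<union> z2" "\<lambda>z. ({j \<in> ?T. h j \<in> z}, z \<inter> R)"])
    fix z assume z: "z \<in> Pow {s..<M}"
    show "(case ({j \<in> ?T. h j \<in> z}, z \<inter> R) of (z1,z2) \<Rightarrow> h ` z1 \<union> z2) = z"
      using z unfolding R by auto
    show "({j \<in> ?T. h j \<in> z}, z \<inter> R) \<in> Pow ?T \<times> Pow R" by auto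
    show "(case ({j \<in> ?T. h j \<in> z}, z \<inter> R) of (z1,z2) \<Rightarrow> of_real ((cmod (r z2))\<^sup>2) * qf (2 ^ s) A (\<lambda>x. f (set_decode x \<union> z1)))
      = qf (2 ^ s) A (\<lambda>x. f (pull (s + t) h (set_decode x \<union> z)) * r (set_decode x \<union> z))"
    proof -
      have "f (pull (s + t) h (set_decode x \<union> z)) * r (set_decode x \<union> z) = f (set_decode x \<union> {j \<in> ?T. h j \<in> z}) * r (z \<inter> R)"
        if x: "x < 2 ^ s" for x
      proof -
        have xs: "set_decode x \<subseteq> {..<s}" by (rule set_decode_subset[OF x])
        have "pull (s + t) h (set_decode x \<union> z) = set_decode x \<union> {j \<in> ?T. h j \<in> z}"
        proof (rule Set.set_eqI)
          fix j
          show "j \<in> pull (s + t) h (set_decode x \<union> z) \<longleftrightarrow> j \<in> set_decode x \<union> {j \<in> ?T. h j \<in> z}"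
          proof (cases "j < s")
            case True
            then show ?thesis using h(2)[OF True] z xs by (auto simp: pull_def)
          next
            case False
            then show ?thesis using hT[of j] xs by (auto simp: pull_def)
          qed
        qed
        moreover have "(set_decode x \<union> z) \<inter> R = z \<inter> R" using xs R by auto
        ultimately show ?thesis using r(1)[of "set_decode x \<union> z"] by simp
      qed
      then have "qf (2 ^ s) A (\<lambda>x. f (pull (s + t) h (set_decode x \<union> z)) * r (set_decode x \<union> z))
        = qf (2 ^ s) A (\<lambda>x. f (set_decode x \<union> {j \<in> ?T. h j \<in> z}) * r (z \<inter> R))"
        unfolding qf_def by (intro sum.cong refl) simp
      then show ?thesis by (simp add: qf_scale)
    qed
  next
    fix zz assume zz: "zz \<in> Pow ?T \<times> Pow R"
    obtain z1 z2 where e: "zz = (z1,z2)" using surj_pair[of zz] by blast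
    have z: "z1 \<subseteq> ?T" "z2 \<subseteq> R" using zz e by auto
    have inj: "inj_on h ?T" using h(1) by (rule inj_on_subset) auto
    have "{j \<in> ?T. h j \<in> h ` z1 \<union> z2} = z1"
      using z inj_onD[OF inj] unfolding R by blast
    moreover have "(h ` z1 \<union> z2) \<inter> R = z2" using z unfolding R by blast
    ultimately show "({j \<in> ?T. h j \<in> (case zz of (z1,z2) \<Rightarrow> h ` z1 \<union> z2)}, (case zz of (z1,z2) \<Rightarrow> h ` z1 \<union> z2) \<inter> R) = zz"
      unfolding e by simp
    show "(case zz of (z1,z2) \<Rightarrow> h ` z1 \<union> z2) \<in> Pow {s..<M}"
      using z h(3) unfolding e R by auto
  qed
  also have "\<dots> = (\<Sum>z1\<in>Pow ?T. \<Sum>z2\<in>Pow R. of_real ((cmod (r z2))\<^sup>2) * qf (2 ^ s) A (\<lambda>x. f (set_decode x \<union> z1)))"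
    by (rule sum.cartesian_product[symmetric])
  also have "\<dots> = (\<Sum>z1\<in>Pow ?T. of_real (\<Sum>z2\<in>Pow R. (cmod (r z2))\<^sup>2) * qf (2 ^ s) A (\<lambda>x. f (set_decode x \<union> z1)))"
    by (simp only: sum_distrib_right of_real_sum)
  finally show ?thesis unfolding r(2) ens_def by simp
qed

lemma sum_Pow_split:
  fixes g :: "nat set \<Rightarrow> real"
  assumes "s \<le> M"
  shows "(\<Sum>z\<in>Pow {s..<M}. \<Sum>x<2 ^ s. g (set_decode x \<union> z)) = (\<Sum>c\<in>Pow {..<M}. g c)"
proof -
  have "(\<Sum>z\<in>Pow {s..<M}. \<Sum>x<2 ^ s. g (set_decode x \<union> z)) = (\<Sum>z\<in>Pow {s..<M}. \<Sum>a\<in>Pow {..<s}. g (a \<union> z))"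
    by (rule sum.cong[OF refl]) (rule sum_decode)
  also have "\<dots> = (\<Sum>(z,a)\<in>Pow {s..<M} \<times> Pow {..<s}. g (a \<union> z))" by (rule sum.cartesian_product)
  also have "\<dots> = (\<Sum>c\<in>Pow {..<M}. g c)"
    by (rule sum.reindex_bij_witness[of _ "\<lambda>c. (c \<inter> {s..<M}, c \<inter> {..<s})" "\<lambda>(z,a). a \<union> z"]) (use assms in auto)
  finally show ?thesis .
qed

lemma ens_amp:
  assumes "v \<in> carrier_vec (2 ^ (s + k))"
  shows "(\<Sum>e<2 ^ k. qf (2 ^ s) A (\<lambda>x. v $ (x + 2 ^ s * e))) = ens s (s + k) (amp v) A"
proof -
  have "v $ (x + 2 ^ s * e) = amp v (set_decode x \<union> (+) s ` set_decode e)" if "x < 2 ^ s" for x e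
    by (simp add: amp_def flip: set_decode_shift[OF that])
  then have "(\<Sum>e<2 ^ k. qf (2 ^ s) A (\<lambda>x. v $ (x + 2 ^ s * e)))
    = (\<Sum>e<2 ^ k. qf (2 ^ s) A (\<lambda>x. amp v (set_decode x \<union> (+) s ` set_decode e)))"
    unfolding qf_def by (intro sum.cong refl) simp
  also have "\<dots> = (\<Sum>c\<in>Pow {..<k}. qf (2 ^ s) A (\<lambda>x. amp v (set_decode x \<union> (+) s ` c)))"
    by (rule sum_decode)
  also have "\<dots> = ens s (s + k) (amp v) A"
    unfolding ens_def
  proof (rule sum.reindex_bij_witness[of _ "\<lambda>z. {j. s + j \<in> z}" "\<lambda>c. (+) s ` c"])
    fix z assume z: "z \<in> Pow {s..<s + k}"
    show "(+) s ` {j. s + j \<in> z} = z"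
    proof (rule Set.set_eqI)
      fix i
      show "i \<in> (+) s ` {j. s + j \<in> z} \<longleftrightarrow> i \<in> z"
        using z by (auto simp: image_iff) (metis PowD atLeastLessThan_iff le_Suc_ex subsetD)
    qed
    show "{j. s + j \<in> z} \<in> Pow {..<k}" using z by auto
  qed auto
  finally show ?thesis .
qed

lemma product_state_amp:
  assumes "product_state M v"
  obtains u where "\<And>j. j < M \<Longrightarrow> (cmod (u j 0))\<^sup>2 + (cmod (u j 1))\<^sup>2 = 1"
    "v \<in> carrier_vec (2 ^ M)" "\<And>c. c \<subseteq> {..<M} \<Longrightarrow> amp v c = prodst {..<M} u c"
proof -
  obtain u :: "nat \<Rightarrow> nat \<Rightarrow> complex" where u: "\<And>j. j < M \<Longrightarrow> (cmod (u j 0))\<^sup>2 + (cmod (u j 1))\<^sup>2 = 1"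
    and v: "v = vec (2 ^ M) (\<lambda>x. \<Prod>j<M. u j (qbit j x))"
    using assms unfolding product_state_def by blast
  have vc: "v \<in> carrier_vec (2 ^ M)" by (simp add: v)
  have am: "amp v c = prodst {..<M} u c" if c: "c \<subseteq> {..<M}" for c
    using set_encode_less[OF c] finite_subset[OF c] by (simp add: v amp_def prodst_def qbit_encode)
  show thesis by (rule that[OF u vc am])
qed

text \<open>A gate touches at most two ancillas, so renumbering the touched ones leaves at most
  twice as many as there are gates, however large \<open>k\<close> is. The system qubits keep their
  numbers.\<close>

lemma touched_relabelling:
  assumes cs: "circuit_over S (s + k) cs"
  obtains t h cs' where "t \<le> 2 * length cs" "inj_on h {..<s + t}" "\<And>j. j < s \<Longrightarrow> h j = j"
    "h ` {s..<s + t} \<subseteq> {s..<s + k}" "circuit_over S (s + t) cs'" "cs = map (\<lambda>(U,a,b). (U, h a, h b)) cs'"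
proof -
  define \<tau> where "\<tau> = (\<Union>(U,a,b)\<in>set cs. {a,b}) \<inter> {s..}"
  have fin: "finite \<tau>" unfolding \<tau>_def by auto
  have "card \<tau> \<le> card (\<Union>(U,a,b)\<in>set cs. {a,b})"
    unfolding \<tau>_def by (intro card_mono) auto
  also have "\<dots> \<le> (\<Sum>x\<in>set cs. card (case x of (U,a,b) \<Rightarrow> {a,b}))" by (rule card_UN_le) simp
  also have "\<dots> \<le> (\<Sum>x\<in>set cs. 2)" by (intro sum_mono) (auto simp: card_insert_if)
  also have "\<dots> \<le> 2 * length cs" using card_length[of cs] by simp
  finally have card: "card \<tau> \<le> 2 * length cs" .
  define t where "t = card \<tau>"
  obtain g where g: "bij_betw g {0..<t} \<tau>" using ex_bij_betw_nat_finite[OF fin] unfolding t_def by blast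
  define h where "h j = (if j < s then j else g (j - s))" for j
  have gT: "g i \<in> \<tau>" if "i < t" for i using g that by (auto simp: bij_betw_def)
  have ginj: "i = j" if "g i = g j" "i < t" "j < t" for i j
    using g that by (auto simp: bij_betw_def dest: inj_onD)
  have hinj: "inj_on h {..<s + t}"
  proof (rule inj_onI)
    fix i j assume ij: "i \<in> {..<s + t}" "j \<in> {..<s + t}" "h i = h j"
    have ge: "h i \<ge> s" if "i \<in> {..<s + t}" "\<not> i < s" for i
      using gT[of "i - s"] that by (auto simp: h_def \<tau>_def)
    show "i = j"
    proof (cases "i < s"; cases "j < s")
      assume "\<not> i < s" "\<not> j < s"
      moreover from this have "g (i - s) = g (j - s)" using ij(3) by (simp add: h_def)
      moreover have "i - s < t" "j - s < t" using ij(1,2) calculation(1,2) by auto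
      ultimately have "i - s = j - s" "s \<le> i" "s \<le> j" using ginj[of "i - s" "j - s"] by simp_all
      then show ?thesis by linarith
    qed (use ij ge[of i] ge[of j] in \<open>auto simp: h_def split: if_splits\<close>)
  qed
  have hT: "h ` {s..<s + t} = \<tau>"
  proof -
    have "h ` {s..<s + t} = g ` {0..<t}"
    proof (intro equalityI subsetI)
      fix y assume "y \<in> h ` {s..<s + t}"
      then obtain j where j: "s \<le> j" "j < s + t" "y = h j" by auto
      then have "y = g (j - s)" "j - s \<in> {0..<t}" by (auto simp: h_def)
      then show "y \<in> g ` {0..<t}" by (rule image_eqI)
    next
      fix y assume "y \<in> g ` {0..<t}"
      then obtain i where i: "i < t" "y = g i" by auto
      then have "y = h (s + i)" "s + i \<in> {s..<s + t}" by (simp_all add: h_def)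
      then show "y \<in> h ` {s..<s + t}" by (rule image_eqI)
    qed
    then show ?thesis using g by (simp add: bij_betw_def)
  qed
  have \<tau>M: "\<tau> \<subseteq> {s..<s + k}" using cs unfolding \<tau>_def circuit_over_def by auto
  have surj: "a \<in> h ` {..<s + t}" if x: "(U,a',b) \<in> set cs" and a: "a = a' \<or> a = b" for U a a' b
  proof (cases "a < s")
    case True
    then have "h a = a" "a \<in> {..<s + t}" by (simp_all add: h_def)
    then show ?thesis by (metis imageI)
  next
    case False
    then have "a \<in> \<tau>" using x a unfolding \<tau>_def by force
    then show ?thesis unfolding hT[symmetric] by auto
  qed
  define hi where "hi = inv_into {..<s + t} h"
  define cs' where "cs' = map (\<lambda>(U,a,b). (U, hi a, hi b)) cs"
  have hhi: "h (hi a) = a" and hit: "hi a < s + t" if "a \<in> h ` {..<s + t}" for a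
    using f_inv_into_f[OF that] inv_into_into[OF that] by (simp_all add: hi_def)
  have "cs = map (\<lambda>(U,a,b). (U, h a, h b)) cs'"
    unfolding cs'_def map_map by (rule map_idI[symmetric]) (auto simp: hhi[OF surj])
  moreover have "circuit_over S (s + t) cs'"
    unfolding circuit_over_def
  proof (rule ballI, clarify)
    fix U a b assume "(U,a,b) \<in> set cs'"
    then obtain a' b' where x: "(U,a',b') \<in> set cs" "a = hi a'" "b = hi b'" unfolding cs'_def by auto
    have "U \<in> S" "a' \<noteq> b'" using cs x(1) unfolding circuit_over_def by auto
    moreover have "h a = a'" "h b = b'" "a < s + t" "b < s + t"
      unfolding x(2,3) using surj[OF x(1)] hhi hit by blast+
    ultimately show "U \<in> S \<and> a < s + t \<and> b < s + t \<and> a \<noteq> b" by auto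
  qed
  ultimately show thesis
    using that[of t h cs'] card hinj hT \<tau>M unfolding t_def[symmetric] by (simp add: h_def)
qed

text \<open>The number \<open>k\<close> of ancillas drops out of the description of the reduced
  state; what remains is a circuit and a product state on a register whose size is controlled by the
  gate count. This makes a finite net possible.\<close>

lemma circuit_reduction:
  assumes S: "\<forall>U\<in>S. unitary_mat 4 U" and v0: "product_state (s + k) v0" and cs: "circuit_over S (s + k) cs"
  obtains t cs' u where "t \<le> 2 * length cs" "length cs' = length cs" "circuit_over S (s + t) cs'"
    "\<And>j. j < s + t \<Longrightarrow> (cmod (u j 0))\<^sup>2 + (cmod (u j 1))\<^sup>2 = 1"
    "\<And>A. (\<Sum>e<2 ^ k. qf (2 ^ s) A (\<lambda>x. (circuit_mat (s + k) cs *\<^sub>v v0) $ (x + 2 ^ s * e)))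
        = ens s (s + t) (run cs' (prodst {..<s + t} u)) A"
    "(\<Sum>x<2 ^ (s + k). (cmod ((circuit_mat (s + k) cs *\<^sub>v v0) $ x))\<^sup>2) = 1"
proof -
  obtain u where u: "\<And>j. j < s + k \<Longrightarrow> (cmod (u j 0))\<^sup>2 + (cmod (u j 1))\<^sup>2 = 1"
    "v0 \<in> carrier_vec (2 ^ (s + k))" "\<And>c. c \<subseteq> {..<s + k} \<Longrightarrow> amp v0 c = prodst {..<s + k} u c"
    using product_state_amp[OF v0] by blast
  obtain t h cs' where t: "t \<le> 2 * length cs" and h: "inj_on h {..<s + t}" "\<And>j. j < s \<Longrightarrow> h j = j"
    "h ` {s..<s + t} \<subseteq> {s..<s + k}" and cs': "circuit_over S (s + t) cs'" "cs = map (\<lambda>(U,a,b). (U, h a, h b)) cs'"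
    using touched_relabelling[OF cs] by blast
  define R where "R = {s..<s + k} - h ` {s..<s + t}"
  define v where "v = circuit_mat (s + k) cs *\<^sub>v v0"
  have vc: "v \<in> carrier_vec (2 ^ (s + k))"
    unfolding v_def using circuit_mat_carrier u(2) by (rule mult_mat_vec_carrier)
  have split: "{..<s + k} = h ` {..<s + t} \<union> R" and disj: "h ` {..<s + t} \<inter> R = {}"
  proof -
    have "{..<s + t} = {..<s} \<union> {s..<s + t}" by auto
    moreover have "h ` {..<s} = {..<s}" using h(2) by auto
    ultimately have "h ` {..<s + t} = {..<s} \<union> h ` {s..<s + t}" by (simp add: image_Un)
    then show "{..<s + k} = h ` {..<s + t} \<union> R" "h ` {..<s + t} \<inter> R = {}"
      using h(3) unfolding R_def by auto
  qed
  have fR: "finite R" unfolding R_def by simp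
  have init: "prodst {..<s + k} u c = prodst {..<s + t} (\<lambda>j. u (h j)) (pull (s + t) h c) * prodst R u c" for c
    unfolding prodst_def split using fR disj
    by (subst prod.union_disjoint) (auto simp: prod.reindex[OF h(1)] bitv_pull)
  have r: "prodst R u (setb (h j) p c) = prodst R u c" if "j < s + t" for c j p
    unfolding prodst_def using disj that by (intro prod.cong refl) (auto simp: bitv_def setb_def)
  have RP: "run (map (\<lambda>(U,a,b). (U, h a, h b)) cs') (\<lambda>c. prodst {..<s + t} (\<lambda>j. u (h j)) (pull (s + t) h c) * prodst R u c)
    = (\<lambda>c. run cs' (prodst {..<s + t} (\<lambda>j. u (h j))) (pull (s + t) h c) * prodst R u c)"
    by (rule run_pull[OF h(1) cs'(1)]) (rule r)
  have amp: "amp v c = run cs' (prodst {..<s + t} (\<lambda>j. u (h j))) (pull (s + t) h c) * prodst R u c" if c: "c \<subseteq> {..<s + k}" for c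
  proof -
    have "amp v c = run cs (amp v0) c" unfolding v_def by (rule circuit_amp[OF cs u(2) c])
    also have "\<dots> = run cs (\<lambda>c. prodst {..<s + t} (\<lambda>j. u (h j)) (pull (s + t) h c) * prodst R u c) c"
      by (rule run_cong[OF _ cs c]) (simp add: u(3) init)
    also have "\<dots> = run cs' (prodst {..<s + t} (\<lambda>j. u (h j))) (pull (s + t) h c) * prodst R u c"
      unfolding cs'(2) RP ..
    finally show ?thesis .
  qed
  have hM: "h j < s + k" if "j < s + t" for j using split that by auto
  have "ens s (s + k) (amp v) A = ens s (s + t) (run cs' (prodst {..<s + t} (\<lambda>j. u (h j)))) A" for A
  proof -
    have "ens s (s + k) (amp v) A = ens s (s + k) (\<lambda>c. run cs' (prodst {..<s + t} (\<lambda>j. u (h j))) (pull (s + t) h c) * prodst R u c) A"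
      unfolding ens_def qf_def
    proof (rule sum.cong[OF refl], rule sum.cong[OF refl], rule sum.cong[OF refl])
      fix z x y :: "nat set" and x' y' :: nat
      assume z: "z \<in> Pow {s..<s + k}" and xy: "x' \<in> {..<2 ^ s}" "y' \<in> {..<2 ^ s}"
      have sub: "set_decode x' \<union> z \<subseteq> {..<s + k}" "set_decode y' \<union> z \<subseteq> {..<s + k}"
        using set_decode_subset[of x' s] set_decode_subset[of y' s] xy z by fastforce+
      show "cnj (amp v (set_decode x' \<union> z)) * A $$ (x',y') * amp v (set_decode y' \<union> z)
        = cnj (run cs' (prodst {..<s + t} (\<lambda>j. u (h j))) (pull (s + t) h (set_decode x' \<union> z)) * prodst R u (set_decode x' \<union> z)) * A $$ (x',y')
         * (run cs' (prodst {..<s + t} (\<lambda>j. u (h j))) (pull (s + t) h (set_decode y' \<union> z)) * prodst R u (set_decode y' \<union> z))"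
        unfolding amp[OF sub(1)] amp[OF sub(2)] ..
    qed
    also have "\<dots> = ens s (s + t) (run cs' (prodst {..<s + t} (\<lambda>j. u (h j)))) A"
    proof (rule ens_factor[OF h R_def])
      show "prodst R u c = prodst R u (c \<inter> R)" for c
        unfolding prodst_def by (intro prod.cong refl) (simp add: bitv_def)
      have "nrm R (prodst R u) = 1" by (rule nrm_prodst[OF fR]) (use u(1) in \<open>auto simp: R_def\<close>)
      then show "(\<Sum>z\<in>Pow R. (cmod (prodst R u z))\<^sup>2) = 1" by (simp add: nrm_def)
    qed
    finally show ?thesis .
  qed
  then have E: "(\<Sum>e<2 ^ k. qf (2 ^ s) A (\<lambda>x. v $ (x + 2 ^ s * e))) = ens s (s + t) (run cs' (prodst {..<s + t} (\<lambda>j. u (h j)))) A" for A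
    by (simp only: ens_amp[OF vc])
  have N: "(\<Sum>x<2 ^ (s + k). (cmod (v $ x))\<^sup>2) = 1"
  proof -
    have "(\<Sum>x<2 ^ (s + k). (cmod (v $ x))\<^sup>2) = (\<Sum>x<2 ^ (s + k). (cmod (amp v (set_decode x)))\<^sup>2)"
      by (simp add: amp_def)
    also have "\<dots> = (\<Sum>c\<in>Pow {..<s + k}. (cmod (amp v c))\<^sup>2)" by (rule sum_decode)
    also have "\<dots> = (\<Sum>c\<in>Pow {..<s + k}. (cmod (run cs (prodst {..<s + k} u) c))\<^sup>2)"
    proof (rule sum.cong[OF refl])
      fix c assume "c \<in> Pow {..<s + k}"
      then have c: "c \<subseteq> {..<s + k}" by simp
      have "amp v c = run cs (amp v0) c" unfolding v_def by (rule circuit_amp[OF cs u(2) c])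
      also have "\<dots> = run cs (prodst {..<s + k} u) c" by (rule run_cong[OF u(3) cs c])
      finally show "(cmod (amp v c))\<^sup>2 = (cmod (run cs (prodst {..<s + k} u) c))\<^sup>2" by simp
    qed
    also have "\<dots> = nrm {..<s + k} (run cs (prodst {..<s + k} u))" by (simp add: nrm_def)
    also have "\<dots> = 1" unfolding nrm_run[OF S cs] by (rule nrm_prodst) (use u(1) in auto)
    finally show ?thesis .
  qed
  have l: "length cs' = length cs" by (simp add: cs'(2))
  show thesis by (rule that[OF t l cs'(1) u(1)[OF hM] E[unfolded v_def] N[unfolded v_def]])
qed

subsection \<open>A net of circuit outputs\<close>

text \<open>Cells of a grid of mesh 1/K in the four real coordinates of a qubit.\<close>

definition cell :: "nat \<Rightarrow> (nat \<Rightarrow> complex) \<Rightarrow> int \<times> int \<times> int \<times> int" where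
  "cell K u = (\<lfloor>real K * Re (u 0)\<rfloor>, \<lfloor>real K * Im (u 0)\<rfloor>, \<lfloor>real K * Re (u 1)\<rfloor>, \<lfloor>real K * Im (u 1)\<rfloor>)"

definition unit_qubit :: "(nat \<Rightarrow> complex) \<Rightarrow> bool" where
  "unit_qubit u \<longleftrightarrow> (cmod (u 0))\<^sup>2 + (cmod (u 1))\<^sup>2 = 1"

text \<open>The representative is itself a unit vector from the cell rather than a grid corner, so
  net elements are normalised states. Cells without unit vectors receive the first basis state,
  which keeps this true for every index.\<close>

definition cell_rep :: "nat \<Rightarrow> int \<times> int \<times> int \<times> int \<Rightarrow> nat \<Rightarrow> complex" where
  "cell_rep K x = (if \<exists>u. unit_qubit u \<and> cell K u = x then SOME u. unit_qubit u \<and> cell K u = x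
     else (\<lambda>k. if k = 0 then 1 else 0))"

lemma unit_cell_rep: "unit_qubit (cell_rep K x)"
proof (cases "\<exists>u. unit_qubit u \<and> cell K u = x")
  case True
  then show ?thesis using someI_ex[OF True] by (simp add: cell_rep_def)
next
  case False
  then have "cell_rep K x = (\<lambda>k. if k = 0 then 1 else 0)" by (simp only: cell_rep_def if_False)
  then show ?thesis by (simp add: unit_qubit_def)
qed

text \<open>Each of the four real coordinates changes by at most 1/K, hence the squared distance by
  at most 4 / K^2.\<close>

lemma cell_rep_close:
  assumes "unit_qubit u" and K: "K \<ge> 1"
  shows "(cmod (u 0 - cell_rep K (cell K u) 0))\<^sup>2 + (cmod (u 1 - cell_rep K (cell K u) 1))\<^sup>2 \<le> (2 / real K)\<^sup>2"
proof -
  let ?w = "cell_rep K (cell K u)"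
  have "\<exists>u'. unit_qubit u' \<and> cell K u' = cell K u" using assms by blast
  from someI_ex[OF this] this have c: "cell K ?w = cell K u" by (simp add: cell_rep_def)
  have fl: "(a - b)\<^sup>2 \<le> (1 / real K)\<^sup>2" if "\<lfloor>real K * a\<rfloor> = \<lfloor>real K * b\<rfloor>" for a b
  proof -
    have "\<bar>real K * a - real K * b\<bar> \<le> 1" using that by linarith
    then have "real K * \<bar>a - b\<bar> \<le> 1" using K by (simp add: abs_mult flip: right_diff_distrib)
    then have "\<bar>a - b\<bar> \<le> 1 / real K" using K by (simp add: field_simps)
    then show ?thesis by (metis abs_ge_zero power2_abs power_mono)
  qed
  have "(Re (u 0) - Re (?w 0))\<^sup>2 \<le> (1 / real K)\<^sup>2" "(Im (u 0) - Im (?w 0))\<^sup>2 \<le> (1 / real K)\<^sup>2"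
    "(Re (u 1) - Re (?w 1))\<^sup>2 \<le> (1 / real K)\<^sup>2" "(Im (u 1) - Im (?w 1))\<^sup>2 \<le> (1 / real K)\<^sup>2"
    using c by (auto simp: cell_def intro!: fl)
  then have "(cmod (u 0 - ?w 0))\<^sup>2 + (cmod (u 1 - ?w 1))\<^sup>2 \<le> 4 * (1 / real K)\<^sup>2"
    unfolding cmod_power2 by simp
  then show ?thesis by (simp add: power_divide)
qed

definition cells :: "nat \<Rightarrow> (int \<times> int \<times> int \<times> int) set" where
  "cells K = (let I = {- int K..int K} in I \<times> I \<times> I \<times> I)"

lemma card_cells: "card (cells K) = (2 * K + 1) ^ 4" and finite_cells: "finite (cells K)"
proof -
  have c: "card {- int K..int K} = 2 * K + 1" by simp
  show "card (cells K) = (2 * K + 1) ^ 4"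
    unfolding cells_def Let_def card_cartesian_product c by (simp only: power4_eq_xxxx mult.assoc)
qed (simp add: cells_def Let_def)

lemma cell_in_cells:
  assumes "unit_qubit u"
  shows "cell K u \<in> cells K"
proof -
  have fl: "\<lfloor>real K * a\<rfloor> \<in> {- int K..int K}" if "\<bar>a\<bar> \<le> 1" for a
  proof -
    have "\<bar>real K * a\<bar> \<le> real K" using that by (simp add: abs_mult mult_left_le)
    then show ?thesis by (simp add: le_floor_iff floor_le_iff abs_le_iff)
  qed
  have le1: "\<bar>Re z\<bar> \<le> 1" "\<bar>Im z\<bar> \<le> 1" if "(cmod z)\<^sup>2 \<le> 1" for z
    using that abs_Re_le_cmod[of z] abs_Im_le_cmod[of z] by (auto simp: abs_square_le_1)
  have "(cmod (u 0))\<^sup>2 \<le> 1" "(cmod (u 1))\<^sup>2 \<le> 1"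
    using assms zero_le_power2[of "cmod (u 0)"] zero_le_power2[of "cmod (u 1)"] unfolding unit_qubit_def by linarith+
  then show ?thesis unfolding cell_def cells_def Let_def using fl le1 by blast
qed

definition circuits_le :: "complex mat set \<Rightarrow> nat \<Rightarrow> nat \<Rightarrow> (complex mat \<times> nat \<times> nat) list set" where
  "circuits_le S M G = {cs. circuit_over S M cs \<and> length cs \<le> G}"

lemma card_circuits_le:
  assumes "finite S"
  shows "finite (circuits_le S M G)" "card (circuits_le S M G) \<le> (G + 1) * (card S * M\<^sup>2 + 1) ^ G"
proof -
  let ?X = "S \<times> {..<M} \<times> {..<M}"
  have sub: "circuits_le S M G \<subseteq> {cs. set cs \<subseteq> ?X \<and> length cs \<le> G}"
    unfolding circuits_le_def circuit_over_def by auto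
  have fX: "finite ?X" using assms by simp
  show "finite (circuits_le S M G)" using finite_subset[OF sub finite_lists_length_le[OF fX]] .
  have "card (circuits_le S M G) \<le> card {cs. set cs \<subseteq> ?X \<and> length cs \<le> G}"
    by (rule card_mono[OF finite_lists_length_le[OF fX] sub])
  also have "\<dots> = (\<Sum>i\<le>G. card ?X ^ i)" by (rule card_lists_length_le[OF fX])
  also have "\<dots> \<le> (\<Sum>i\<le>G. (card S * M\<^sup>2 + 1) ^ G)"
  proof (rule sum_mono)
    fix i assume "i \<in> {..G}"
    have "card ?X ^ i \<le> (card S * M\<^sup>2 + 1) ^ i"
      by (intro power_mono) (simp_all add: card_cartesian_product power2_eq_square)
    also have "\<dots> \<le> (card S * M\<^sup>2 + 1) ^ G" using \<open>i \<in> {..G}\<close> by (intro power_increasing) auto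
    finally show "card ?X ^ i \<le> (card S * M\<^sup>2 + 1) ^ G" .
  qed
  also have "\<dots> = (G + 1) * (card S * M\<^sup>2 + 1) ^ G" by simp
  finally show "card (circuits_le S M G) \<le> (G + 1) * (card S * M\<^sup>2 + 1) ^ G" .
qed

text \<open>The ancilla count \<open>t\<close> is stored next to the amplitude function, because
  norm and energy of that function depend on the register size.\<close>

definition net :: "complex mat set \<Rightarrow> nat \<Rightarrow> nat \<Rightarrow> nat \<Rightarrow> (nat \<times> (nat set \<Rightarrow> complex)) set" where
  "net S s G K = (\<Union>t\<in>{..2 * G}. (\<lambda>(cs,x). (t, run cs (prodst {..<s + t} (\<lambda>j. cell_rep K (x j)))))
     ` (circuits_le S (s + t) G \<times> ({..<s + t} \<rightarrow>\<^sub>E cells K)))"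

lemma card_net:
  assumes "finite S"
  shows "finite (net S s G K)"
    "card (net S s G K) \<le> (2 * G + 1) * ((G + 1) * (card S * (s + 2 * G)\<^sup>2 + 1) ^ G * ((2 * K + 1) ^ 4) ^ (s + 2 * G))"
proof -
  let ?N = "\<lambda>t. (\<lambda>(cs,x). (t, run cs (prodst {..<s + t} (\<lambda>j. cell_rep K (x j)))))
     ` (circuits_le S (s + t) G \<times> ({..<s + t} \<rightarrow>\<^sub>E cells K))"
  have fX: "finite (circuits_le S (s + t) G \<times> ({..<s + t} \<rightarrow>\<^sub>E cells K))" for t
    using card_circuits_le(1)[OF assms] finite_cells by (intro finite_cartesian_product finite_PiE) auto
  then show "finite (net S s G K)" unfolding net_def by auto
  have "card (net S s G K) \<le> (\<Sum>t\<in>{..2 * G}. card (?N t))" unfolding net_def by (rule card_UN_le) simp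
  also have "\<dots> \<le> (\<Sum>t\<in>{..2 * G}. (G + 1) * (card S * (s + 2 * G)\<^sup>2 + 1) ^ G * ((2 * K + 1) ^ 4) ^ (s + 2 * G))"
  proof (rule sum_mono)
    fix t assume t: "t \<in> {..2 * G}"
    have "card (?N t) \<le> card (circuits_le S (s + t) G \<times> ({..<s + t} \<rightarrow>\<^sub>E cells K))" by (rule card_image_le[OF fX])
    also have "\<dots> = card (circuits_le S (s + t) G) * ((2 * K + 1) ^ 4) ^ (s + t)"
      by (simp add: card_cartesian_product card_PiE card_cells)
    also have "\<dots> \<le> ((G + 1) * (card S * (s + t)\<^sup>2 + 1) ^ G) * ((2 * K + 1) ^ 4) ^ (s + t)"
      by (intro mult_right_mono card_circuits_le assms) auto
    also have "\<dots> \<le> ((G + 1) * (card S * (s + 2 * G)\<^sup>2 + 1) ^ G) * ((2 * K + 1) ^ 4) ^ (s + 2 * G)"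
      using t by (intro mult_mono power_mono power_increasing add_mono le_refl) auto
    finally show "card (?N t) \<le> (G + 1) * (card S * (s + 2 * G)\<^sup>2 + 1) ^ G * ((2 * K + 1) ^ 4) ^ (s + 2 * G)" by simp
  qed
  finally show "card (net S s G K) \<le> (2 * G + 1) * ((G + 1) * (card S * (s + 2 * G)\<^sup>2 + 1) ^ G * ((2 * K + 1) ^ 4) ^ (s + 2 * G))"
    by simp
qed

lemma net_norm:
  assumes "\<forall>U\<in>S. unitary_mat 4 U" "(t,g) \<in> net S s G K"
  shows "nrm {..<s + t} g = 1"
proof -
  obtain cs x where g: "g = run cs (prodst {..<s + t} (\<lambda>j. cell_rep K (x j)))" and cs: "circuit_over S (s + t) cs"
    using assms(2) unfolding net_def circuits_le_def by auto
  show ?thesis unfolding g nrm_run[OF assms(1) cs]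
    by (rule nrm_prodst) (use unit_cell_rep in \<open>auto simp: unit_qubit_def\<close>)
qed

text \<open>The gate sequence is reproduced exactly. Only the input is rounded, and unitarity
  carries the input error unchanged to the output.\<close>

lemma net_close:
  assumes S: "\<forall>U\<in>S. unitary_mat 4 U" and K: "K \<ge> 1" and v0: "product_state (s + k) v0"
    and cs: "circuit_over S (s + k) cs" and len: "length cs \<le> G"
  shows "\<exists>t g f. (t,g) \<in> net S s G K \<and> nrm {..<s + t} f = 1
      \<and> sqrt (nrm {..<s + t} (\<lambda>c. f c - g c)) \<le> real (s + 2 * G) * (2 / real K)
      \<and> (\<forall>A. (\<Sum>e<2 ^ k. qf (2 ^ s) A (\<lambda>x. (circuit_mat (s + k) cs *\<^sub>v v0) $ (x + 2 ^ s * e))) = ens s (s + t) f A)"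
proof -
  obtain t cs' u where t: "t \<le> 2 * length cs" and cs': "length cs' = length cs" "circuit_over S (s + t) cs'"
    and u: "\<And>j. j < s + t \<Longrightarrow> (cmod (u j 0))\<^sup>2 + (cmod (u j 1))\<^sup>2 = 1"
    and E: "\<And>A. (\<Sum>e<2 ^ k. qf (2 ^ s) A (\<lambda>x. (circuit_mat (s + k) cs *\<^sub>v v0) $ (x + 2 ^ s * e)))
        = ens s (s + t) (run cs' (prodst {..<s + t} u)) A"
    using circuit_reduction[OF S v0 cs] by metis
  define x where "x = restrict (\<lambda>j. cell K (u j)) {..<s + t}"
  define w where "w j = cell_rep K (x j)" for j
  have uu: "unit_qubit (u j)" if "j < s + t" for j using u[OF that] by (simp add: unit_qubit_def)
  have "x \<in> {..<s + t} \<rightarrow>\<^sub>E cells K" unfolding x_def using uu cell_in_cells by auto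
  then have "(t, run cs' (prodst {..<s + t} w)) \<in> net S s G K"
    unfolding net_def w_def using t len cs' by (intro UN_I[of t] image_eqI[of _ _ "(cs',x)"]) (simp_all add: circuits_le_def)
  moreover have "nrm {..<s + t} (run cs' (prodst {..<s + t} u)) = 1"
    unfolding nrm_run[OF S cs'(2)] by (rule nrm_prodst) (use u in auto)
  moreover have "sqrt (nrm {..<s + t} (\<lambda>c. run cs' (prodst {..<s + t} u) c - run cs' (prodst {..<s + t} w) c)) \<le> real (s + 2 * G) * (2 / real K)"
  proof -
    have a: "nrm {..<s + t} (\<lambda>c. run cs' (prodst {..<s + t} u) c - run cs' (prodst {..<s + t} w) c)
      = nrm {..<s + t} (\<lambda>c. prodst {..<s + t} u c - prodst {..<s + t} w c)"
      unfolding run_diff[symmetric] by (rule nrm_run[OF S cs'(2)])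
    have b: "sqrt (nrm {..<s + t} (\<lambda>c. prodst {..<s + t} u c - prodst {..<s + t} w c)) \<le> real (card {..<s + t}) * (2 / real K)"
    proof (rule prodst_close)
      fix j assume "j \<in> {..<s + t}"
      then have j: "j < s + t" by simp
      show "(cmod (u j 0))\<^sup>2 + (cmod (u j 1))\<^sup>2 = 1" by (rule u[OF j])
      show "(cmod (w j 0))\<^sup>2 + (cmod (w j 1))\<^sup>2 = 1" using unit_cell_rep unfolding w_def unit_qubit_def .
      show "(cmod (u j 0 - w j 0))\<^sup>2 + (cmod (u j 1 - w j 1))\<^sup>2 \<le> (2 / real K)\<^sup>2"
        using cell_rep_close[OF uu[OF j] K] j by (simp add: w_def x_def)
    qed auto
    have "real (card {..<s + t}) * (2 / real K) \<le> real (s + 2 * G) * (2 / real K)"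
      using t len by (intro mult_right_mono) auto
    then show ?thesis unfolding a using b by linarith
  qed
  ultimately show ?thesis using E by blast
qed

subsection \<open>States prepared by short circuits have large energy on the net\<close>

lemma sum_shifted_blocks: "(\<Sum>e<b. \<Sum>x<a. g (x + a * e)) = (\<Sum>x<a * b. g x)"
  for g :: "nat \<Rightarrow> 'a :: comm_monoid_add"
proof -
  have "(\<Sum>x<a. g (x + a * e)) = sum g {e * a..<e * a + a}" for e
    using sum.shift_bounds_nat_ivl[of g 0 "e * a" a] by (simp add: atLeast0LessThan add.commute mult.commute)
  then show ?thesis by (simp add: sum.nat_group mult.commute)
qed

lemma mtrace_mat_exp:
  assumes "hermitian d A"
  shows "mtrace (mat_exp A) = of_real (Zf d A)"
proof -
  obtain a U where S: "spectral d A a U" using hermitian_spectral[OF assms] by blast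
  note c = hermitian_carrier[OF assms]
  have dr: "dim_row (mat_exp A) = d" using c by (simp add: mat_exp_def)
  have "mtrace (mat_exp A) = (\<Sum>x<d. \<Sum>y<d. if x = y then mat_exp A $$ (y,x) else 0)"
    unfolding mtrace_def dr by simp
  also have "\<dots> = trp d (1\<^sub>m d) (mat_exp A)"
    unfolding trp_def by (intro sum.cong refl) auto
  also have "\<dots> = (\<Sum>l<d. of_real (exp (a l)))"
    unfolding trp_exp[OF S c] using S by (intro sum.cong refl) (simp add: conj_by_one spectral_def)
  finally show ?thesis by (simp add: Zf_spectral[OF S c])
qed

text \<open>The expectation of a system operator sees only the reduced state, so the choice of
  purification does not influence it.\<close>

lemma purification_energy:
  assumes A: "hermitian (2 ^ s) A"
    and w: "is_purification s k ((1 / mtrace (mat_exp A)) \<cdot>\<^sub>m mat_exp A) w"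
  shows "(\<Sum>e<2 ^ k. Re (qf (2 ^ s) A (\<lambda>x. w $ (x + 2 ^ s * e)))) = Gf (2 ^ s) A A / Zf (2 ^ s) A"
proof -
  have dr: "dim_row (mat_exp A) = 2 ^ s" "dim_col (mat_exp A) = 2 ^ s"
    using hermitian_carrier[OF A] by (simp_all add: mat_exp_def)
  have \<rho>: "(\<Sum>e<2 ^ k. w $ (y + 2 ^ s * e) * cnj (w $ (x + 2 ^ s * e))) = of_real (1 / Zf (2 ^ s) A) * mat_exp A $$ (y,x)"
    if xy: "x < 2 ^ s" "y < 2 ^ s" for x y
  proof -
    have lt: "z + 2 ^ s * e < 2 ^ (s + k)" if "z < 2 ^ s" "e < 2 ^ k" for z e :: nat
    proof -
      have "z + 2 ^ s * e < 2 ^ s * (e + 1)" using that by simp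
      also have "\<dots> \<le> 2 ^ s * 2 ^ k" using that by (intro mult_left_mono) auto
      finally show ?thesis by (simp add: power_add)
    qed
    have dw: "dim_vec w = 2 ^ (s + k)" using w by (simp add: is_purification_def)
    have "ptrace_anc s k (proj w) $$ (y,x) = (\<Sum>e<2 ^ k. w $ (y + 2 ^ s * e) * cnj (w $ (x + 2 ^ s * e)))"
      using xy lt by (simp add: ptrace_anc_def proj_def dw)
    moreover have "ptrace_anc s k (proj w) $$ (y,x) = (1 / mtrace (mat_exp A)) * mat_exp A $$ (y,x)"
      using w xy by (simp add: is_purification_def dr)
    ultimately show ?thesis by (simp add: mtrace_mat_exp[OF A])
  qed
  have "(\<Sum>e<2 ^ k. qf (2 ^ s) A (\<lambda>x. w $ (x + 2 ^ s * e)))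
     = (\<Sum>e<2 ^ k. \<Sum>x<2 ^ s. \<Sum>y<2 ^ s. A $$ (x,y) * (w $ (y + 2 ^ s * e) * cnj (w $ (x + 2 ^ s * e))))"
    unfolding qf_def by (intro sum.cong refl) (simp only: mult_ac)
  also have "\<dots> = (\<Sum>x<2 ^ s. \<Sum>e<2 ^ k. \<Sum>y<2 ^ s. A $$ (x,y) * (w $ (y + 2 ^ s * e) * cnj (w $ (x + 2 ^ s * e))))"
    by (rule sum.swap)
  also have "\<dots> = (\<Sum>x<2 ^ s. \<Sum>y<2 ^ s. \<Sum>e<2 ^ k. A $$ (x,y) * (w $ (y + 2 ^ s * e) * cnj (w $ (x + 2 ^ s * e))))"
    by (intro sum.cong refl sum.swap)
  also have "\<dots> = (\<Sum>x<2 ^ s. \<Sum>y<2 ^ s. A $$ (x,y) * (of_real (1 / Zf (2 ^ s) A) * mat_exp A $$ (y,x)))"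
    unfolding sum_distrib_left[symmetric] by (intro sum.cong refl) (simp add: \<rho>)
  also have "\<dots> = of_real (1 / Zf (2 ^ s) A) * trp (2 ^ s) A (mat_exp A)"
    unfolding trp_def sum_distrib_left by (intro sum.cong refl) (simp only: mult_ac)
  finally have "Re (\<Sum>e<2 ^ k. qf (2 ^ s) A (\<lambda>x. w $ (x + 2 ^ s * e))) = Re (of_real (1 / Zf (2 ^ s) A) * trp (2 ^ s) A (mat_exp A))"
    by (rule arg_cong)
  also have "\<dots> = Gf (2 ^ s) A A / Zf (2 ^ s) A"
    unfolding Gf_def by (simp only: Re_complex_of_real times_complex.sel Im_complex_of_real) simp
  finally show ?thesis by simp
qed

lemma Re_ens: "Re (ens s M f A) = (\<Sum>z\<in>Pow {s..<M}. Re (qf (2 ^ s) A (\<lambda>x. f (set_decode x \<union> z))))"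
  by (simp add: ens_def)

lemma ensemble_norm: "(\<Sum>z\<in>Pow {s..<s + t}. \<Sum>x<2 ^ s. (cmod (f (set_decode x \<union> z)))\<^sup>2) = nrm {..<s + t} f"
  unfolding nrm_def by (rule sum_Pow_split) simp

text \<open>Two perturbations add up: from the purification to the prepared state, and from there to
  the net. The first has norm at most 3 eps, because 8 eps^2 \<le> (3 eps)^2, and 5/2 times 3 is the
  constant 15/2.\<close>

lemma prepared_net_energy:
  assumes S: "\<forall>U\<in>S. unitary_mat 4 U" and A: "hermitian (2 ^ s) A"
    and B: "\<And>f. \<bar>Re (qf (2 ^ s) A f)\<bar> \<le> B * (\<Sum>x<2 ^ s. (cmod (f x))\<^sup>2)" "B \<ge> 0"
    and prep: "prepares S s k v0 cs eps ((1 / mtrace (mat_exp A)) \<cdot>\<^sub>m mat_exp A)"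
    and len: "length cs \<le> G" and eps: "eps > 0" and K: "K \<ge> 1" and M: "s + 2 * G > 0"
  obtains t g where "(t,g) \<in> net S s G K"
    "Re (ens s (s + t) g A) \<ge> Gf (2 ^ s) A A / Zf (2 ^ s) A - 15 / 2 * B * eps - 5 / 2 * B * (real (s + 2 * G) * (2 / real K))"
proof -
  obtain w where v0: "product_state (s + k) v0" and cs: "circuit_over S (s + k) cs"
    and w: "is_purification s k ((1 / mtrace (mat_exp A)) \<cdot>\<^sub>m mat_exp A) w"
    and td: "trace_dist (proj (circuit_mat (s + k) cs *\<^sub>v v0)) (proj w) \<le> eps"
    using prep unfolding prepares_def by blast
  define v where "v = circuit_mat (s + k) cs *\<^sub>v v0"
  have v0c: "v0 \<in> carrier_vec (2 ^ (s + k))" using v0 unfolding product_state_def by auto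
  have vc: "v \<in> carrier_vec (2 ^ (s + k))"
    unfolding v_def by (rule mult_mat_vec_carrier[OF circuit_mat_carrier v0c])
  have vn: "(\<Sum>x<2 ^ (s + k). (cmod (v $ x))\<^sup>2) = 1"
    unfolding v_def using circuit_reduction[OF S v0 cs] by metis
  have wc: "w \<in> carrier_vec (2 ^ (s + k))" and wn: "(\<Sum>x<2 ^ (s + k). (cmod (w $ x))\<^sup>2) = 1"
    using w unfolding is_purification_def by (auto intro: carrier_vecI)
  obtain \<theta> where \<theta>: "cmod \<theta> = 1" and vw: "(\<Sum>x<2 ^ (s + k). (cmod (v $ x - \<theta> * w $ x))\<^sup>2) \<le> 8 * eps\<^sup>2"
    using close_up_to_phase[OF vc vn wc wn td[folded v_def]] by blast
  have split: "(\<Sum>e<2 ^ k. \<Sum>x<2 ^ s. g (x + 2 ^ s * e)) = (\<Sum>x<2 ^ (s + k). g x)" for g :: "nat \<Rightarrow> real"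
    unfolding power_add by (rule sum_shifted_blocks)
  let ?v = "\<lambda>e x. v $ (x + 2 ^ s * e)" and ?w = "\<lambda>e x. w $ (x + 2 ^ s * e) * \<theta>"
  have "\<bar>(\<Sum>e<2 ^ k. Re (qf (2 ^ s) A (?v e))) - (\<Sum>e<2 ^ k. Re (qf (2 ^ s) A (?w e)))\<bar> \<le> 5 / 2 * B * (3 * eps)"
  proof (rule qf_perturb[OF B])
    show "(\<Sum>e<2 ^ k. \<Sum>x<2 ^ s. (cmod (?v e x))\<^sup>2) = 1"
      using split[of "\<lambda>X. (cmod (v $ X))\<^sup>2"] vn by simp
    show "(\<Sum>e<2 ^ k. \<Sum>x<2 ^ s. (cmod (?w e x))\<^sup>2) = 1"
      using split[of "\<lambda>X. (cmod (w $ X))\<^sup>2"] wn \<theta> by (simp add: norm_mult)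
    have "(\<Sum>e<2 ^ k. \<Sum>x<2 ^ s. (cmod (?v e x - ?w e x))\<^sup>2) = (\<Sum>x<2 ^ (s + k). (cmod (v $ x - \<theta> * w $ x))\<^sup>2)"
      using split[of "\<lambda>X. (cmod (v $ X - w $ X * \<theta>))\<^sup>2"] by (simp only: mult.commute[of \<theta>])
    moreover have e: "8 * eps\<^sup>2 \<le> (3 * eps)\<^sup>2" by (simp add: power_mult_distrib)
    ultimately show "(\<Sum>e<2 ^ k. \<Sum>x<2 ^ s. (cmod (?v e x - ?w e x))\<^sup>2) \<le> (3 * eps)\<^sup>2"
      using vw e by linarith
  qed (use eps in simp)
  moreover have "(\<Sum>e<2 ^ k. Re (qf (2 ^ s) A (?w e))) = Gf (2 ^ s) A A / Zf (2 ^ s) A"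
    unfolding qf_scale \<theta> purification_energy[OF A w, symmetric] by simp
  ultimately have 1: "(\<Sum>e<2 ^ k. Re (qf (2 ^ s) A (?v e))) \<ge> Gf (2 ^ s) A A / Zf (2 ^ s) A - 15 / 2 * B * eps"
    by linarith
  obtain t g f where tg: "(t,g) \<in> net S s G K" and f: "nrm {..<s + t} f = 1"
    and fg: "sqrt (nrm {..<s + t} (\<lambda>c. f c - g c)) \<le> real (s + 2 * G) * (2 / real K)"
    and E: "\<And>A. (\<Sum>e<2 ^ k. qf (2 ^ s) A (?v e)) = ens s (s + t) f A"
    using net_close[OF S K v0 cs len] unfolding v_def by blast
  have pos: "real (s + 2 * G) * (2 / real K) > 0" using K M by (intro mult_pos_pos) (simp_all only: of_nat_0_less_iff, simp)
  have "\<bar>Re (ens s (s + t) f A) - Re (ens s (s + t) g A)\<bar> \<le> 5 / 2 * B * (real (s + 2 * G) * (2 / real K))"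
    unfolding Re_ens
  proof (rule qf_perturb[OF B])
    have n0: "nrm {..<s + t} (\<lambda>c. f c - g c) \<ge> 0" by (simp add: nrm_def sum_nonneg)
    show "(\<Sum>z\<in>Pow {s..<s + t}. \<Sum>x<2 ^ s. (cmod (f (set_decode x \<union> z) - g (set_decode x \<union> z)))\<^sup>2) \<le> (real (s + 2 * G) * (2 / real K))\<^sup>2"
      using ensemble_norm[where s = s and t = t and f = "\<lambda>c. f c - g c"] power_mono[OF fg, of 2] n0 by simp
  qed (simp_all only: ensemble_norm f net_norm[OF S tg] pos)
  moreover have "Re (ens s (s + t) f A) = (\<Sum>e<2 ^ k. Re (qf (2 ^ s) A (?v e)))"
    unfolding E[symmetric] by simp
  ultimately show thesis using 1 that[OF tg] by linarith
qed

subsection \<open>Good couplings\<close>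

lemma syk_couplings_gaussPi: "syk_couplings n q = gaussPi (sqrt (syk_var n q)) (qsets n q)"
  by (simp add: syk_couplings_def gauss_def)

text \<open>Measurability of this set is not established; the probability statements below concern a
  measurable subset of it.\<close>

definition hard_couplings ::
    "complex mat set \<Rightarrow> nat \<Rightarrow> nat \<Rightarrow> (nat \<Rightarrow> complex mat) \<Rightarrow> real \<Rightarrow> real \<Rightarrow> real \<Rightarrow> (nat set \<Rightarrow> real) set" where
  "hard_couplings S n q psi \<beta> eps l = {J \<in> space (syk_couplings n q).
     \<forall>k v0 cs. prepares S (n div 2) k v0 cs eps (gibbs \<beta> (syk_ham n q psi J)) \<longrightarrow> l \<le> real (length cs)}"

lemma hard_couplings_antimono:
  "l \<le> l' \<Longrightarrow> hard_couplings S n q psi \<beta> eps l' \<subseteq> hard_couplings S n q psi \<beta> eps l"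
  unfolding hard_couplings_def by (auto intro: order_trans)

lemma qf_ham: "qf d (ham d B K J) f = (\<Sum>I\<in>K. of_real (J I) * qf d (B I) f)"
proof -
  have "qf d (ham d B K J) f = (\<Sum>x<d. \<Sum>y<d. \<Sum>I\<in>K. of_real (J I) * (cnj (f x) * B I $$ (x,y) * f y))"
    unfolding qf_def by (intro sum.cong refl) (simp add: ham_entry sum_distrib_left sum_distrib_right mult_ac)
  also have "\<dots> = (\<Sum>x<d. \<Sum>I\<in>K. \<Sum>y<d. of_real (J I) * (cnj (f x) * B I $$ (x,y) * f y))"
    by (intro sum.cong refl sum.swap)
  also have "\<dots> = (\<Sum>I\<in>K. \<Sum>x<d. \<Sum>y<d. of_real (J I) * (cnj (f x) * B I $$ (x,y) * f y))"
    by (rule sum.swap)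
  finally show ?thesis by (simp only: qf_def sum_distrib_left)
qed

lemma Re_ens_ham: "Re (ens s M f (ham (2 ^ s) B K J)) = (\<Sum>I\<in>K. J I * Re (ens s M f (B I)))"
proof -
  have "Re (ens s M f (ham (2 ^ s) B K J)) = (\<Sum>z\<in>Pow {s..<M}. \<Sum>I\<in>K. J I * Re (qf (2 ^ s) (B I) (\<lambda>x. f (set_decode x \<union> z))))"
    unfolding Re_ens qf_ham by simp
  also have "\<dots> = (\<Sum>I\<in>K. \<Sum>z\<in>Pow {s..<M}. J I * Re (qf (2 ^ s) (B I) (\<lambda>x. f (set_decode x \<union> z))))"
    by (rule sum.swap)
  finally show ?thesis by (simp only: Re_ens sum_distrib_left)
qed

context majoranas
begin

text \<open>Outside a small event the Gibbs state has energy at least \<open>\<Gamma> / 2\<close>, the Hamiltonian has norm at most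
  \<open>B\<close>, and no element of the net has energy \<open>\<Gamma> / 4\<close>; a short circuit would produce such an element.\<close>
lemma good_couplings:
  fixes \<beta> B eps :: real and q G K :: nat
  assumes q: "even q" "1 \<le> q" "q \<le> n" and S: "finite S" "\<forall>U\<in>S. unitary_mat 4 U"
    and \<beta>: "\<beta> > 0" and eps: "eps > 0" and K: "K \<ge> 1"
  defines "\<sigma> \<equiv> sqrt (syk_var n q)" and "N \<equiv> real (card (qsets n q))"
    and "\<Lambda> \<equiv> 1 / 2 ^ q * (real q * real (q + 1) * 2 ^ q * real n) ^ (q div 2)"
  defines "\<Gamma> \<equiv> (\<beta> / 2)\<^sup>2 * \<sigma>\<^sup>2 * (1 / 2 ^ q * N - \<Lambda>) / (1 + (\<beta> / 2)\<^sup>2 * \<sigma>\<^sup>2 * (1 / 2 ^ q) * \<kappa> q)"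
  assumes \<Gamma>: "\<Gamma> > 0" and B: "B \<ge> ln (real d) + N * (1 / 2 ^ q * \<beta>\<^sup>2 * \<sigma>\<^sup>2 / 2) + real n"
    and small: "15 / 2 * B * eps + 5 / 2 * B * (real (n div 2 + 2 * G) * (2 / real K)) \<le> \<Gamma> / 4"
  shows "\<exists>E\<in>sets (syk_couplings n q). E \<subseteq> hard_couplings S n q psi \<beta> eps (real (G + 1))
      \<and> measure (syk_couplings n q) E \<ge> 1 - (4 * \<beta>\<^sup>2 * (1 / 2 ^ q) * \<sigma>\<^sup>2 * N / \<Gamma>\<^sup>2 + 2 * exp (- real n)
          + real (card (net S (n div 2) G K)) * exp (- (\<Gamma> / (4 * \<beta>))\<^sup>2 / (2 * \<sigma>\<^sup>2 * \<Lambda>)))"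
proof -
  let ?s = "n div 2"
  have n: "n \<ge> 1" using q by linarith
  have \<sigma>: "\<sigma> > 0" using n by (simp add: \<sigma>_def syk_var_def)
  have \<Lambda>: "\<Lambda> > 0" using n q by (simp add: \<Lambda>_def)
  interpret G: gaussian_ham "qsets n q" \<Psi> d "1 / 2 ^ q" \<sigma> "\<kappa> q" \<Lambda>
    unfolding \<Lambda>_def by (rule gaussian_ham_majorana[OF q \<sigma>])
  define P where "P = gaussPi \<sigma> (qsets n q)"
  have P: "syk_couplings n q = P" unfolding P_def \<sigma>_def by (rule syk_couplings_gaussPi)
  interpret Q: prob_space P unfolding P_def by (rule prob_space_gaussPi[OF \<sigma>])
  have lnZ [measurable]: "(\<lambda>J. ln (Zf d (G.A r J))) \<in> borel_measurable P" for r
    unfolding P_def by (rule borel_measurable_ln[OF G.Z_measurable])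
  have comp [measurable]: "(\<lambda>J. J I) \<in> borel_measurable P" if "I \<in> qsets n q" for I
    unfolding P_def by (rule gaussPi_component[OF that])
  define a where "a = (\<lambda>(t,g) I. Re (ens ?s (?s + t) g (\<Psi> I)))"
  define E0 where "E0 = {J \<in> space P. ln (Zf d (G.A (- \<beta>) J)) - ln (real d) \<le> \<Gamma> / 2}"
  \<comment> \<open>Used with r = -\<beta> and with r = \<beta>; outside both events the spectrum is
    bounded on both sides.\<close>
  define T where "T r = {J \<in> space P. ln (Zf d (G.A r J)) \<ge> ln (real d) + real (card (qsets n q)) * (1 / 2 ^ q * r\<^sup>2 * \<sigma>\<^sup>2 / 2) + real n}" for r
  \<comment> \<open>The coefficient -a and the division by \<beta> undo the factor -\<beta> in front
    of the Hamiltonian; the threshold corresponds to energy \<Gamma>/4.\<close>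
  define F where "F p = {J \<in> space P. (\<Sum>I\<in>qsets n q. (- a p I) * J I) \<ge> \<Gamma> / (4 * \<beta>)}" for p
  let ?N = "net S ?s G K"
  have meas: "E0 \<in> sets P" "T r \<in> sets P" "F p \<in> sets P" for r p
    unfolding E0_def T_def F_def by measurable
  have finN: "finite ?N" by (rule card_net(1)[OF S(1)])
  have E0: "measure P E0 \<le> 4 * \<beta>\<^sup>2 * (1 / 2 ^ q) * \<sigma>\<^sup>2 * N / \<Gamma>\<^sup>2"
  proof -
    \<comment> \<open>\<open>free_energy_gain\<close> doubles its parameter, so the event at
      -\<beta> uses the gain at -\<beta>/2.\<close>
    have gain: "G.gain (- \<beta> / 2) = \<Gamma>" by (simp add: G.gain_def \<Gamma>_def N_def)
    have "2 * (- \<beta> / 2) = - \<beta>" by simp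
    from G.free_energy_gain[of "- \<beta> / 2", unfolded gain this, OF \<Gamma>] show ?thesis
      unfolding E0_def P_def[symmetric] N_def by (simp add: power_divide)
  qed
  have T: "measure P (T r) \<le> exp (- real n)" for r
    unfolding T_def P_def by (rule G.norm_tail) (use n in simp)
  have F: "measure P (F p) \<le> exp (- (\<Gamma> / (4 * \<beta>))\<^sup>2 / (2 * \<sigma>\<^sup>2 * \<Lambda>))" if p: "p \<in> ?N" for p
  proof -
    obtain t g where tg: "p = (t,g)" using surj_pair[of p] by blast
    have "(\<Sum>I\<in>qsets n q. (\<Sum>z\<in>Pow {?s..<?s + t}. Re (qf d (\<Psi> I) (\<lambda>x. g (set_decode x \<union> z))))\<^sup>2) \<le> \<Lambda>"
      unfolding \<Lambda>_def
      by (rule \<Psi>_state_bound[OF q(1) n]) (use net_norm[OF S(2)] p tg in \<open>simp_all only: ensemble_norm finite_Pow_iff finite_atLeastLessThan\<close>)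
    then have "(\<Sum>I\<in>qsets n q. (- a p I)\<^sup>2) \<le> \<Lambda>" by (simp add: a_def tg Re_ens)
    from gaussPi_tail[OF \<sigma> finite_qsets this \<Lambda>, of "\<Gamma> / (4 * \<beta>)"] show ?thesis
      unfolding F_def P_def using \<Gamma> \<beta> by simp
  qed
  define bad where "bad = E0 \<union> (T (- \<beta>) \<union> (T \<beta> \<union> (\<Union>p\<in>?N. F p)))"
  have badm: "bad \<in> sets P" unfolding bad_def by (intro sets.Un meas sets.finite_UN finN)
  have "measure P bad \<le> measure P E0 + (measure P (T (- \<beta>)) + (measure P (T \<beta>) + (\<Sum>p\<in>?N. measure P (F p))))"
    unfolding bad_def
    by (intro order_trans[OF measure_Un_le] add_mono order_refl measure_UNION_le sets.Un meas sets.finite_UN finN)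
  also have "(\<Sum>p\<in>?N. measure P (F p)) \<le> (\<Sum>p\<in>?N. exp (- (\<Gamma> / (4 * \<beta>))\<^sup>2 / (2 * \<sigma>\<^sup>2 * \<Lambda>)))"
    by (rule sum_mono) (rule F)
  finally have bad: "measure P bad \<le> 4 * \<beta>\<^sup>2 * (1 / 2 ^ q) * \<sigma>\<^sup>2 * N / \<Gamma>\<^sup>2 + 2 * exp (- real n)
      + real (card ?N) * exp (- (\<Gamma> / (4 * \<beta>))\<^sup>2 / (2 * \<sigma>\<^sup>2 * \<Lambda>))"
    using E0 T[of \<beta>] T[of "- \<beta>"] by simp
  have good: "real (G + 1) \<le> real (length cs)"
    if J: "J \<in> space P - bad" and prep: "prepares S ?s k v0 cs eps (gibbs \<beta> (syk_ham n q psi J))" for J k v0 cs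
  proof (rule ccontr)
    assume "\<not> real (G + 1) \<le> real (length cs)"
    then have len: "length cs \<le> G" by simp
    have gb: "gibbs \<beta> (syk_ham n q psi J) = (1 / mtrace (mat_exp (G.A (- \<beta>) J))) \<cdot>\<^sub>m mat_exp (G.A (- \<beta>) J)"
      unfolding gibbs_def syk_ham_eq[OF q(1)] G.A_def ham_smult by simp
    have lnZB: "ln (Zf d (G.A r J)) \<le> B" if "r = \<beta> \<or> r = - \<beta>" for r
    proof -
      have "J \<notin> T r" "J \<in> space P" using J that by (auto simp: bad_def)
      moreover have "r\<^sup>2 = \<beta>\<^sup>2" using that by auto
      ultimately show ?thesis using B unfolding T_def N_def by auto
    qed
    have Bf: "\<bar>Re (qf d (G.A (- \<beta>) J) f)\<bar> \<le> B * (\<Sum>x<d. (cmod (f x))\<^sup>2)" for f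
    proof -
      let ?\<nu> = "\<Sum>x<d. (cmod (f x))\<^sup>2"
      have nu: "?\<nu> \<ge> 0" by (simp add: sum_nonneg)
      have le: "Re (qf d (G.A r J) f) \<le> B * ?\<nu>" if "r = \<beta> \<or> r = - \<beta>" for r
        using qf_le_ln_Zf[OF G.hA G.d, of r J f] mult_right_mono[OF lnZB[OF that] nu] by linarith
      have "Re (qf d (G.A (- \<beta>) J) f) = - Re (qf d (G.A \<beta> J) f)"
        unfolding G.A_def qf_ham by (simp add: sum_negf)
      then show ?thesis using le[of \<beta>] le[of "- \<beta>"] by linarith
    qed
    have B0: "B \<ge> 0"
    proof -
      have "0 \<le> ln (real d) + N * (1 / 2 ^ q * \<beta>\<^sup>2 * \<sigma>\<^sup>2 / 2) + real n"
        by (intro add_nonneg_nonneg mult_nonneg_nonneg divide_nonneg_nonneg) (simp_all add: N_def)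
      then show ?thesis using B by linarith
    qed
    have pos: "?s + 2 * G > 0"
    proof -
      have "even n" using fam by (simp add: majorana_family_def)
      then show ?thesis using n by (auto elim: evenE)
    qed
    obtain t g where tg: "(t,g) \<in> ?N" and le: "Re (ens ?s (?s + t) g (G.A (- \<beta>) J)) \<ge>
        Gf d (G.A (- \<beta>) J) (G.A (- \<beta>) J) / Zf d (G.A (- \<beta>) J) - 15 / 2 * B * eps - 5 / 2 * B * (real (?s + 2 * G) * (2 / real K))"
      using prepared_net_energy[OF S(2) G.hA Bf B0 prep[unfolded gb] len eps K pos] by blast
    have "J \<notin> E0" "J \<in> space P" using J by (auto simp: bad_def)
    then have "\<Gamma> / 2 < G.energy (- \<beta>) J" using G.energy_ge_ln_Z[of "- \<beta>" J] unfolding E0_def by auto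
    \<comment> \<open>The approximation errors consume at most \<Gamma>/4 of an energy above
      \<Gamma>/2.\<close>
    then have "\<Gamma> / 4 \<le> Re (ens ?s (?s + t) g (G.A (- \<beta>) J))" using le small unfolding G.energy_def by linarith
    also have "\<dots> = (\<Sum>I\<in>qsets n q. - \<beta> * J I * a (t,g) I)" unfolding G.A_def Re_ens_ham a_def by simp
    also have "\<dots> = \<beta> * (\<Sum>I\<in>qsets n q. (- a (t,g) I) * J I)" by (simp add: sum_distrib_left mult_ac)
    finally have "\<Gamma> / (4 * \<beta>) \<le> (\<Sum>I\<in>qsets n q. (- a (t,g) I) * J I)" using \<beta> by (simp only: field_simps)
    then have "J \<in> F (t,g)" using J unfolding F_def by blast
    then show False using J tg unfolding bad_def by blast
  qed
  have "measure P (space P - bad) = 1 - measure P bad" by (rule Q.prob_compl[OF badm])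
  then have pr: "measure P (space P - bad) \<ge> 1 - (4 * \<beta>\<^sup>2 * (1 / 2 ^ q) * \<sigma>\<^sup>2 * N / \<Gamma>\<^sup>2 + 2 * exp (- real n)
      + real (card ?N) * exp (- (\<Gamma> / (4 * \<beta>))\<^sup>2 / (2 * \<sigma>\<^sup>2 * \<Lambda>)))"
    using bad by linarith
  have "space P - bad \<in> sets P" using badm by blast
  then show ?thesis unfolding hard_couplings_def P
    by (rule bexI[rotated]) (use pr good in blast)
qed

end

subsection \<open>Asymptotics\<close>

text \<open>Together with the lower bound that follows, variance times number of terms is of order
  n; this normalisation makes the energy extensive.\<close>

lemma syk_var_card_le:
  assumes "1 \<le> q" "1 \<le> n"
  shows "syk_var n q * real (card (qsets n q)) \<le> real n / real q"
proof -
  have "real (n choose q) * fact q \<le> real n ^ q"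
    using of_nat_mono[OF binomial_fact_pow[of n q], where 'a = real] by simp
  moreover have "fact q = real q * fact (q - 1)" using assms by (simp add: fact_reduce)
  moreover have "real n ^ q = real n * real n ^ (q - 1)" using assms by (simp flip: power_Suc)
  ultimately have "real q * (fact (q - 1) * real (n choose q)) \<le> real n * real n ^ (q - 1)" by (simp add: mult_ac)
  then show ?thesis using assms by (simp add: syk_var_def card_qsets field_simps)
qed

lemma syk_var_card_ge:
  assumes "1 \<le> q" "q \<le> n"
  shows "real n / real q ^ q \<le> syk_var n q * real (card (qsets n q))"
proof -
  have "(real n / real q) ^ q \<le> real (n choose q)" by (rule binomial_ge_n_over_k_pow_k[OF assms(2)])
  then have "1 / real n ^ (q - 1) * (real n / real q) ^ q \<le> syk_var n q * real (n choose q)"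
    unfolding syk_var_def by (intro mult_mono divide_right_mono) (simp_all add: fact_ge_1)
  moreover have "1 / real n ^ (q - 1) * (real n / real q) ^ q = real n / real q ^ q"
  proof -
    have "real n ^ q = real n * real n ^ (q - 1)" using assms by (simp flip: power_Suc)
    then show ?thesis using assms by (simp add: power_divide)
  qed
  ultimately show ?thesis by (simp add: card_qsets)
qed

text \<open>Every factor of the cardinality is at most Y = D X^2 with X = n^(1+h), and there are 2 +
  G + 4 M of them. In D the 9 is the square in M \<le> 3 X, and 12/\<delta> + 5 comes from 2 K + 1.
  The choice of \<open>K\<close> makes the rounding error of the net at most \<delta>.\<close>

lemma card_net_le_exp:
  fixes \<delta> :: real and n h G :: nat
  assumes S: "finite S" and \<delta>: "\<delta> > 0" and n: "n \<ge> 3" and G: "real G \<le> real n ^ (1 + h)"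
  defines "K \<equiv> nat \<lceil>2 * real (n div 2 + 2 * G) / \<delta>\<rceil> + 1"
  shows "real (card (net S (n div 2) G K))
    \<le> exp ((2 + 9 * real G + 2 * real n) * ((ln (9 * real (card S) + 12 / \<delta> + 5) + 2 * (1 + real h)) * ln (real n)))"
proof -
  define M where "M = n div 2 + 2 * G"
  define X where "X = real n ^ (1 + h)"
  define D where "D = 9 * real (card S) + 12 / \<delta> + 5"
  define Y where "Y = D * X\<^sup>2"
  have nX: "real n \<le> X" unfolding X_def using n power_increasing[of 1 "1 + h" "real n"] by simp
  have X1: "X \<ge> 1" using nX n by linarith
  have XX: "X \<le> X\<^sup>2" using X1 by (simp add: power2_eq_square)
  have GX: "real G \<le> X" using G by (simp add: X_def)
  have "2 * M \<le> n + 4 * G" by (simp add: M_def)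
  then have "real (2 * M) \<le> real (n + 4 * G)" by (rule of_nat_mono)
  then have MX: "real M \<le> 3 * X" using GX nX X1 by simp
  have D5: "D \<ge> 5" using \<delta> by (simp add: D_def)
  have DX: "5 * X \<le> Y" unfolding Y_def using D5 XX X1 by (intro mult_mono) auto
  have Y1: "Y \<ge> 1" using DX X1 by linarith
  have y1: "2 * real G + 1 \<le> Y" "real G + 1 \<le> Y" using GX DX X1 by linarith+
  have "(real M)\<^sup>2 \<le> (3 * X)\<^sup>2" using MX by (intro power_mono) auto
  then have "real (card S) * (real M)\<^sup>2 + 1 \<le> real (card S) * (3 * X)\<^sup>2 + 1 * X\<^sup>2"
    using X1 XX by (intro add_mono mult_left_mono) auto
  also have "\<dots> = (9 * real (card S) + 1) * X\<^sup>2" by (simp add: power_mult_distrib algebra_simps)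
  also have "\<dots> \<le> Y" unfolding Y_def D_def using \<delta> by (intro mult_right_mono) auto
  finally have y2: "real (card S) * (real M)\<^sup>2 + 1 \<le> Y" .
  have "real K \<le> 2 * real M / \<delta> + 2"
  proof -
    have "0 \<le> 2 * real M / \<delta>" using \<delta> by simp
    then have "real (nat \<lceil>2 * real M / \<delta>\<rceil>) = of_int \<lceil>2 * real M / \<delta>\<rceil>" by simp
    moreover have "real K = real (nat \<lceil>2 * real M / \<delta>\<rceil>) + 1" by (simp add: K_def M_def)
    ultimately show ?thesis using of_int_ceiling_le_add_one[of "2 * real M / \<delta>"] by linarith
  qed
  moreover have "2 * real M / \<delta> \<le> 6 * X / \<delta>" using MX \<delta> by (intro divide_right_mono) auto
  moreover have "12 * X / \<delta> = 2 * (6 * X / \<delta>)" by simp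
  moreover have "12 * X / \<delta> + 5 * X \<le> Y"
  proof -
    have "12 * X / \<delta> + 5 * X = (12 / \<delta> + 5) * X" by (simp add: algebra_simps)
    also have "\<dots> \<le> D * X\<^sup>2" using \<delta> XX X1 by (intro mult_mono) (auto simp: D_def)
    finally show ?thesis by (simp add: Y_def)
  qed
  ultimately have y3: "2 * real K + 1 \<le> Y" using X1 by linarith
  have "real (card (net S (n div 2) G K)) \<le> real ((2 * G + 1) * ((G + 1) * (card S * M\<^sup>2 + 1) ^ G * ((2 * K + 1) ^ 4) ^ M))"
    unfolding M_def by (rule of_nat_mono[OF card_net(2)[OF S]])
  also have "\<dots> = (2 * real G + 1) * ((real G + 1) * (real (card S) * (real M)\<^sup>2 + 1) ^ G * (2 * real K + 1) ^ (4 * M))"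
    by (simp only: of_nat_mult of_nat_add of_nat_power of_nat_1 of_nat_numeral power_mult)
  also have "\<dots> \<le> Y * (Y * Y ^ G * Y ^ (4 * M))"
    by (intro mult_mono power_mono y1 y2 y3) (use Y1 in \<open>auto intro!: mult_nonneg_nonneg zero_le_power\<close>)
  also have "\<dots> = Y ^ (2 + G + 4 * M)" by (simp add: power_add power2_eq_square mult_ac)
  also have "\<dots> = exp (real (2 + G + 4 * M) * ln Y)" using Y1 by (subst exp_of_nat_mult) simp
  also have "\<dots> \<le> exp ((2 + 9 * real G + 2 * real n) * ((ln D + 2 * (1 + real h)) * ln (real n)))"
  proof -
    have l1: "ln (real n) \<ge> 1" using n exp_le by (subst ln_ge_iff) auto
    have "ln Y = ln D + 2 * ((1 + real h) * ln (real n))"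
      unfolding Y_def X_def using D5 n by (simp add: ln_mult ln_realpow flip: power_mult) (simp add: algebra_simps)
    also have "\<dots> \<le> ln D * ln (real n) + 2 * ((1 + real h) * ln (real n))"
      using D5 l1 by (intro add_right_mono) (simp add: mult_le_cancel_left1)
    finally have "ln Y \<le> (ln D + 2 * (1 + real h)) * ln (real n)" by (simp add: algebra_simps)
    moreover have "real (2 + G + 4 * M) \<le> 2 + 9 * real G + 2 * real n"
    proof -
      have "2 + G + 4 * M \<le> 2 + 9 * G + 2 * n" by (simp add: M_def)
      then have "real (2 + G + 4 * M) \<le> real (2 + 9 * G + 2 * n)" by (rule of_nat_mono)
      then show ?thesis by simp
    qed
    ultimately show ?thesis using Y1 by (subst exp_le_cancel_iff, intro mult_mono) auto
  qed
  finally show ?thesis unfolding D_def .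
qed

context majoranas
begin

text \<open>Anticommuting partners share an index, which makes \<kappa> smaller than the number of
  terms by a factor of order n. The denominator of the gain therefore stays bounded.\<close>

lemma syk_var_\<kappa>_le:
  assumes "even q" "1 \<le> q" "q \<le> n"
  shows "syk_var n q * \<kappa> q \<le> real q"
proof -
  have n: "real n > 0" using assms by simp
  have "syk_var n q * \<kappa> q * real n \<le> real q ^ 2 * (syk_var n q * real (card (qsets n q)))"
    using mult_left_mono[OF \<kappa>_le[OF assms], of "syk_var n q"] by (simp add: syk_var_def mult_ac)
  also have "\<dots> \<le> real q ^ 2 * (real n / real q)"
    using syk_var_card_le[of q n] assms by (intro mult_left_mono) auto
  also have "\<dots> = real q * real n" using assms by (simp add: power2_eq_square)
  finally show ?thesis using n by simp
qed

end

text \<open>The powers of n combine to h - (q - 1) = -(h - 1). For one fixed state this product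
  bounds the variance of the energy.\<close>

lemma syk_var_state_bound:
  assumes "q = 2 * h" "1 \<le> h" "1 \<le> n"
  shows "syk_var n q * (1 / 2 ^ q * (real q * real (q + 1) * 2 ^ q * real n) ^ (q div 2))
    = fact (q - 1) * (1 / 2 ^ q * (real q * real (q + 1) * 2 ^ q) ^ h) / real n ^ (h - 1)"
proof -
  have "q - 1 = (h - 1) + h" using assms by simp
  then have "real n ^ (q - 1) = real n ^ (h - 1) * real n ^ h" by (simp add: power_add)
  moreover have "(w * real n) ^ (q div 2) = w ^ h * real n ^ h" for w using assms by (simp add: power_mult_distrib)
  ultimately show ?thesis using assms(3) unfolding syk_var_def by simp
qed

lemma circuit_lower_bound:
  fixes \<beta> :: real and q :: nat
  assumes q: "even q" "q \<ge> 4" and S: "finite S" "\<forall>U\<in>S. unitary_mat 4 U" and \<beta>: "\<beta> > 0"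
  shows "\<exists>eps>0. \<exists>c>0. \<exists>p :: nat \<Rightarrow> real. p \<longlonglongrightarrow> 0 \<and>
    (\<forall>\<^sub>F n in sequentially. \<forall>psi. majorana_family n psi \<longrightarrow> (\<exists>E\<in>sets (syk_couplings n q).
      E \<subseteq> hard_couplings S n q psi \<beta> eps (c * real n ^ (1 + q div 2) / ln (real n)) \<and>
      measure (syk_couplings n q) E \<ge> 1 - p n))"
proof -
  define h where "h = q div 2"
  have qh: "q = 2 * h" and h2: "h \<ge> 2" using q by (auto simp: h_def)
  define b :: real where "b = 1 / 2 ^ q"
  define a where "a = fact (q - 1) * (b * (real q * real (q + 1) * 2 ^ q) ^ h)"
  define r where "r = (\<beta> / 2)\<^sup>2"
  \<comment> \<open>The constants fit together as follows: \<gamma> n bounds the gain from below and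
    C n the norm from above; \<open>eps\<close> and \<open>\<delta>\<close> each spend \<gamma> n /
    8 of the energy; \<open>c'\<close> is the tail rate for one state; and the 36 in
    \<open>c\<close> makes 9 c D at most a quarter of \<open>c'\<close>.\<close>
  define \<gamma> where "\<gamma> = r * (b / (2 * real q ^ q)) / (1 + r * b * real q)"
  define C where "C = 2 + b * \<beta>\<^sup>2"
  define eps where "eps = \<gamma> / (60 * C)"
  define \<delta> where "\<delta> = \<gamma> / (20 * C)"
  define c' where "c' = \<gamma>\<^sup>2 / (32 * \<beta>\<^sup>2 * a)"
  define D where "D = ln (9 * real (card S) + 12 / \<delta> + 5) + 2 * (1 + real h)"
  define c where "c = min 1 (c' / (36 * D))"
  define k0 where "k0 = 4 * \<beta>\<^sup>2 / \<gamma>\<^sup>2"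
  define p where "p n = k0 / real n + 2 * exp (- real n) + exp (- (c' / 2 * real n))" for n :: nat
  have b: "0 < b" "b \<le> 1" by (simp_all add: b_def)
  have qpos: "real q > 0" "real q \<ge> 1" using q by auto
  have a: "a > 0" unfolding a_def using b qpos by (intro mult_pos_pos zero_less_power) auto
  have r: "r > 0" using \<beta> by (simp add: r_def)
  have den: "1 + r * b * real q > 0" using r b by (intro add_pos_nonneg) auto
  have \<gamma>: "\<gamma> > 0" unfolding \<gamma>_def using r b qpos den by (intro divide_pos_pos mult_pos_pos) auto
  have C: "C \<ge> 2" using b by (simp add: C_def)
  have eps: "eps > 0" and \<delta>: "\<delta> > 0" using \<gamma> C by (simp_all add: eps_def \<delta>_def)
  have c': "c' > 0" using \<gamma> \<beta> a by (simp add: c'_def)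
  have "ln (9 * real (card S) + 12 / \<delta> + 5) > 0" using \<delta> by (intro ln_gt_zero) (simp add: add_nonneg_pos)
  then have D: "D > 0" by (simp add: D_def)
  have c: "c > 0" "c \<le> 1" "c * D \<le> c' / 36"
  proof -
    show "c > 0" "c \<le> 1" using c' D by (simp_all add: c_def)
    have "c \<le> c' / (36 * D)" by (simp add: c_def)
    then show "c * D \<le> c' / 36" using D by (simp add: field_simps)
  qed
  have p0: "p \<longlonglongrightarrow> 0" unfolding p_def using c' by real_asymp
  \<comment> \<open>The part of the net's entropy that does not depend on the gate count is of order
    n log n. It is absorbed because X \<ge> n^3, which is where q \<ge> 4 enters.\<close>
  have ev: "\<forall>\<^sub>F n :: nat in sequentially. (2 + 2 * real n) * (D * ln (real n)) \<le> c' / 4 * real n ^ 3"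
    using c' D by real_asymp
  have main: "\<exists>E\<in>sets (syk_couplings n q).
      E \<subseteq> hard_couplings S n q psi \<beta> eps (c * real n ^ (1 + q div 2) / ln (real n)) \<and>
      measure (syk_couplings n q) E \<ge> 1 - p n"
    if n: "n \<ge> q" "real n \<ge> 2 * real q ^ q * a / b" "(2 + 2 * real n) * (D * ln (real n)) \<le> c' / 4 * real n ^ 3"
      and fam: "majorana_family n psi" for n psi
  proof -
    interpret M: majoranas n psi using fam by unfold_locales
    define \<sigma> where "\<sigma> = sqrt (syk_var n q)"
    define N where "N = real (card (qsets n q))"
    define \<Lambda> where "\<Lambda> = 1 / 2 ^ q * (real q * real (q + 1) * 2 ^ q * real n) ^ (q div 2)"
    define \<Gamma> where "\<Gamma> = (\<beta> / 2)\<^sup>2 * \<sigma>\<^sup>2 * (1 / 2 ^ q * N - \<Lambda>) / (1 + (\<beta> / 2)\<^sup>2 * \<sigma>\<^sup>2 * (1 / 2 ^ q) * M.\<kappa> q)"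
    define B where "B = C * real n"
    define X where "X = real n ^ (1 + h)"
    define G where "G = nat \<lfloor>c * X / ln (real n)\<rfloor>"
    define K where "K = nat \<lceil>2 * real (n div 2 + 2 * G) / \<delta>\<rceil> + 1"
    have n3: "n \<ge> 3" and n1: "1 \<le> n" and q1: "1 \<le> q" using n(1) q by auto
    have npos: "real n > 0" using n1 by simp
    have ln1: "ln (real n) \<ge> 1" using n3 exp_le by (subst ln_ge_iff) auto
    have \<sigma>2: "\<sigma>\<^sup>2 = syk_var n q" by (simp add: \<sigma>_def syk_var_def)
    have \<sigma>N: "\<sigma>\<^sup>2 * N \<le> real n / real q" "real n / real q ^ q \<le> \<sigma>\<^sup>2 * N"
      unfolding \<sigma>2 N_def by (rule syk_var_card_le[OF q1 n1], rule syk_var_card_ge[OF q1 n(1)])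
    have \<sigma>N': "0 \<le> \<sigma>\<^sup>2 * N" "\<sigma>\<^sup>2 * N \<le> real n"
      using \<sigma>N(1) divide_left_mono[of 1 "real q" "real n"] qpos by (simp_all add: N_def)
    have \<sigma>\<Lambda>: "\<sigma>\<^sup>2 * \<Lambda> = a / real n ^ (h - 1)"
      unfolding \<sigma>2 \<Lambda>_def a_def b_def by (rule syk_var_state_bound[OF qh _ n1]) (use h2 in simp)
    have \<sigma>\<kappa>: "\<sigma>\<^sup>2 * M.\<kappa> q \<le> real q" unfolding \<sigma>2 by (rule M.syk_var_\<kappa>_le[OF q(1) q1 n(1)])
    \<comment> \<open>For large n the subtracted \<Lambda> is at most half of the main term, which
      explains the 2 in \<gamma>.\<close>
    have \<Gamma>n: "\<Gamma> \<ge> \<gamma> * real n"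
    proof -
      have "a / real n ^ (h - 1) \<le> a / 1" using n1 a by (intro divide_left_mono) auto
      also have "a / 1 \<le> b * (real n / real q ^ q) / 2" using n(2) b qpos by (simp add: field_simps)
      finally have "\<sigma>\<^sup>2 * \<Lambda> \<le> b * (real n / real q ^ q) / 2" unfolding \<sigma>\<Lambda> .
      moreover have "b * (real n / real q ^ q) \<le> b * (\<sigma>\<^sup>2 * N)" using b \<sigma>N(2) by (intro mult_left_mono) auto
      ultimately have num: "\<sigma>\<^sup>2 * (b * N - \<Lambda>) \<ge> real n * (b / (2 * real q ^ q))" by (simp add: algebra_simps)
      have "0 \<le> real n * (b / (2 * real q ^ q))" using b by simp
      then have num0: "0 \<le> r * (\<sigma>\<^sup>2 * (b * N - \<Lambda>))" using num r by (intro mult_nonneg_nonneg[of r]) linarith+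
      have "r * b * (\<sigma>\<^sup>2 * M.\<kappa> q) \<le> r * b * real q" using r b \<sigma>\<kappa> by (intro mult_left_mono) auto
      moreover have "r * b * (\<sigma>\<^sup>2 * M.\<kappa> q) \<ge> 0" using r b by (simp add: M.\<kappa>_def[OF q(1)])
      ultimately have "r * (real n * (b / (2 * real q ^ q))) / (1 + r * b * real q) \<le> r * (\<sigma>\<^sup>2 * (b * N - \<Lambda>)) / (1 + r * b * (\<sigma>\<^sup>2 * M.\<kappa> q))"
        using r num num0 by (intro frac_le mult_left_mono) auto
      then show ?thesis unfolding \<Gamma>_def \<gamma>_def r_def[symmetric] b_def[symmetric] by (simp add: mult_ac)
    qed
    have \<gamma>n: "\<gamma> * real n > 0" using \<gamma> npos by simp
    then have \<Gamma>: "\<Gamma> > 0" using \<Gamma>n by linarith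
    have Bge: "B \<ge> ln (real (2 ^ (n div 2))) + N * (1 / 2 ^ q * \<beta>\<^sup>2 * \<sigma>\<^sup>2 / 2) + real n"
    proof -
      have "ln (real (2 ^ (n div 2))) = real (n div 2) * ln 2" by (simp add: ln_realpow)
      also have "\<dots> \<le> real n * 1" using ln_2_less_1 by (intro mult_mono) auto
      finally have "ln (real (2 ^ (n div 2))) \<le> real n" by simp
      moreover have "N * (1 / 2 ^ q * \<beta>\<^sup>2 * \<sigma>\<^sup>2 / 2) = (b * \<beta>\<^sup>2 / 2) * (\<sigma>\<^sup>2 * N)" by (simp add: b_def)
      moreover have "(b * \<beta>\<^sup>2 / 2) * (\<sigma>\<^sup>2 * N) \<le> (b * \<beta>\<^sup>2) * real n"
        using b \<sigma>N' by (intro mult_mono) auto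
      ultimately show ?thesis unfolding B_def C_def by (simp add: algebra_simps)
    qed
    have K: "K \<ge> 1" by (simp add: K_def)
    have MK: "real (n div 2 + 2 * G) * (2 / real K) \<le> \<delta>"
    proof -
      have "2 * real (n div 2 + 2 * G) / \<delta> \<le> real K" unfolding K_def by linarith
      then show ?thesis using \<delta> K by (simp add: field_simps)
    qed
    have small: "15 / 2 * B * eps + 5 / 2 * B * (real (n div 2 + 2 * G) * (2 / real K)) \<le> \<Gamma> / 4"
    proof -
      have "15 / 2 * B * eps = \<gamma> * real n / 8" using C by (simp add: B_def eps_def)
      moreover have "5 / 2 * B * (real (n div 2 + 2 * G) * (2 / real K)) \<le> 5 / 2 * B * \<delta>"
        using MK C by (intro mult_left_mono) (auto simp: B_def)
      moreover have "5 / 2 * B * \<delta> = \<gamma> * real n / 8" using C by (simp add: B_def \<delta>_def)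
      ultimately show ?thesis using \<Gamma>n by linarith
    qed
    obtain E where E: "E \<in> sets (syk_couplings n q)" "E \<subseteq> hard_couplings S n q psi \<beta> eps (real (G + 1))"
      and ME: "measure (syk_couplings n q) E \<ge> 1 - (4 * \<beta>\<^sup>2 * (1 / 2 ^ q) * \<sigma>\<^sup>2 * N / \<Gamma>\<^sup>2 + 2 * exp (- real n)
          + real (card (net S (n div 2) G K)) * exp (- (\<Gamma> / (4 * \<beta>))\<^sup>2 / (2 * \<sigma>\<^sup>2 * \<Lambda>)))"
      using M.good_couplings[OF q(1) q1 n(1) S \<beta> eps K, folded \<sigma>_def N_def \<Lambda>_def, folded \<Gamma>_def, OF \<Gamma> Bge small] by blast
    have Gle: "real G \<le> c * X / ln (real n)"
      unfolding G_def using c ln1 by (intro of_nat_floor) (simp add: X_def)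
    have Glt: "c * X / ln (real n) \<le> real (G + 1)" unfolding G_def by linarith
    have X: "X \<ge> real n ^ 3" "X \<ge> real n" unfolding X_def
      using n1 h2 power_increasing[of 3 "1 + h" "real n"] power_increasing[of 1 "1 + h" "real n"] by auto
    have GX: "real G \<le> X"
    proof -
      have "c * X / ln (real n) \<le> 1 * X / 1" using c ln1 X npos by (intro frac_le mult_right_mono) auto
      then show ?thesis using Gle by simp
    qed
    have first: "4 * \<beta>\<^sup>2 * (1 / 2 ^ q) * \<sigma>\<^sup>2 * N / \<Gamma>\<^sup>2 \<le> k0 / real n"
    proof -
      have "4 * \<beta>\<^sup>2 * (1 / 2 ^ q) * \<sigma>\<^sup>2 * N = 4 * \<beta>\<^sup>2 * (b * (\<sigma>\<^sup>2 * N))" by (simp add: b_def)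
      also have "\<dots> \<le> 4 * \<beta>\<^sup>2 * (1 * real n)" using b \<sigma>N' by (intro mult_left_mono mult_mono) auto
      finally have "4 * \<beta>\<^sup>2 * (1 / 2 ^ q) * \<sigma>\<^sup>2 * N / \<Gamma>\<^sup>2 \<le> 4 * \<beta>\<^sup>2 * real n / (\<gamma> * real n)\<^sup>2"
        using \<Gamma>n \<gamma>n by (intro frac_le power_mono zero_less_power) auto
      also have "\<dots> = k0 / real n" using npos by (simp add: k0_def power2_eq_square)
      finally show ?thesis .
    qed
    \<comment> \<open>\<Gamma>^2 is at least of order n^2 and the variance bound is of order
      n^(1-h), so the exponent is at least of order n^(1+h).\<close>
    have tail: "c' * X \<le> (\<Gamma> / (4 * \<beta>))\<^sup>2 / (2 * \<sigma>\<^sup>2 * \<Lambda>)"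
    proof -
      have "real n ^ (1 + h) = real n ^ 2 * real n ^ (h - 1)" using h2 by (simp flip: power_add)
      then have "c' * X = (\<gamma> * real n / (4 * \<beta>))\<^sup>2 / (2 * (a / real n ^ (h - 1)))"
        unfolding c'_def X_def using a \<beta> npos by (simp add: field_simps)
      also have "\<dots> \<le> (\<Gamma> / (4 * \<beta>))\<^sup>2 / (2 * (a / real n ^ (h - 1)))"
        using \<Gamma>n \<gamma>n \<beta> a npos by (intro divide_right_mono power_mono) auto
      finally show ?thesis unfolding \<sigma>\<Lambda>[symmetric] by (simp add: mult.assoc)
    qed
    \<comment> \<open>The gates and the input each take a quarter of the rate \<open>c'\<close>, so
      half of it is left after the union bound.\<close>
    have net: "real (card (net S (n div 2) G K)) * exp (- (\<Gamma> / (4 * \<beta>))\<^sup>2 / (2 * \<sigma>\<^sup>2 * \<Lambda>)) \<le> exp (- (c' / 2 * real n))"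
    proof -
      have "9 * real G * (D * ln (real n)) \<le> 9 * (c * X / ln (real n)) * (D * ln (real n))"
        using Gle D ln1 by (intro mult_right_mono mult_left_mono) auto
      also have "\<dots> = 9 * (c * D) * X" using ln1 by simp
      also have "\<dots> \<le> 9 * (c' / 36) * X" using c X npos by (intro mult_right_mono mult_left_mono) auto
      finally have "9 * real G * (D * ln (real n)) \<le> c' / 4 * X" by simp
      moreover have "(2 + 2 * real n) * (D * ln (real n)) \<le> c' / 4 * X"
        using n(3) mult_left_mono[OF X(1), of "c' / 4"] c' by linarith
      ultimately have ex: "(2 + 9 * real G + 2 * real n) * (D * ln (real n)) \<le> c' / 2 * X" by (simp add: algebra_simps)
      have "real (card (net S (n div 2) G K)) \<le> exp ((2 + 9 * real G + 2 * real n) * (D * ln (real n)))"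
        unfolding K_def D_def by (rule card_net_le_exp[OF S(1) \<delta> n3]) (use GX in \<open>simp add: X_def\<close>)
      also have "\<dots> \<le> exp (c' / 2 * X)" using ex by simp
      finally have "real (card (net S (n div 2) G K)) * exp (- (\<Gamma> / (4 * \<beta>))\<^sup>2 / (2 * \<sigma>\<^sup>2 * \<Lambda>)) \<le> exp (c' / 2 * X) * exp (- (c' * X))"
        using tail by (intro mult_mono) auto
      also have "\<dots> = exp (- (c' / 2 * X))" by (simp flip: exp_add)
      also have "\<dots> \<le> exp (- (c' / 2 * real n))" using X(2) c' by simp
      finally show ?thesis .
    qed
    have "measure (syk_couplings n q) E \<ge> 1 - p n" using ME first net unfolding p_def by linarith
    moreover have "E \<subseteq> hard_couplings S n q psi \<beta> eps (c * real n ^ (1 + q div 2) / ln (real n))"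
      using E(2) hard_couplings_antimono[OF Glt] unfolding X_def h_def by blast
    ultimately show ?thesis using E(1) by blast
  qed
  have "\<forall>\<^sub>F n :: nat in sequentially. n \<ge> q" by (rule eventually_ge_at_top)
  moreover have "\<forall>\<^sub>F n :: nat in sequentially. real n \<ge> 2 * real q ^ q * a / b" by real_asymp
  ultimately have "\<forall>\<^sub>F n in sequentially. \<forall>psi. majorana_family n psi \<longrightarrow> (\<exists>E\<in>sets (syk_couplings n q).
      E \<subseteq> hard_couplings S n q psi \<beta> eps (c * real n ^ (1 + q div 2) / ln (real n)) \<and>
      measure (syk_couplings n q) E \<ge> 1 - p n)"
    using ev by eventually_elim (use main in blast)
  then show ?thesis using eps c(1) p0 by blast
qed

theorem mainTheorem10:
  fixes q :: nat and S :: "complex mat set" and psi :: "nat \<Rightarrow> nat \<Rightarrow> complex mat"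
  assumes "even q" and "q \<ge> 4"
    and "universal_gate_set S"
    and "\<And>m. majorana_family (2*m) (psi m)"
  shows "\<forall>\<beta>>0. \<exists>eps>0. \<exists>c>0. \<exists>A :: nat \<Rightarrow> (nat set \<Rightarrow> real) set.
    (\<forall>m. A m \<in> sets (syk_couplings (2*m) q) \<and>
       A m \<subseteq> {J \<in> space (syk_couplings (2*m) q).
          \<forall>k v0 cs. prepares S m k v0 cs eps (gibbs \<beta> (syk_ham (2*m) q (psi m) J)) \<longrightarrow>
             real (length cs) \<ge> c * real (2*m) ^ (1 + q div 2) / ln (real (2*m))}) \<and>
    (\<lambda>m. measure (syk_couplings (2*m) q) (A m)) \<longlonglongrightarrow> 1"
proof (intro allI impI)
  fix \<beta> :: real
  assume \<beta>: "\<beta> > 0"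
  have S: "finite S" "\<forall>U\<in>S. unitary_mat 4 U" using assms(3) by (auto simp: universal_gate_set_def)
  obtain eps c p where eps: "eps > 0" and c: "c > 0" and p: "p \<longlonglongrightarrow> (0 :: real)"
    and ev: "\<forall>\<^sub>F n in sequentially. \<forall>psi. majorana_family n psi \<longrightarrow> (\<exists>E\<in>sets (syk_couplings n q).
      E \<subseteq> hard_couplings S n q psi \<beta> eps (c * real n ^ (1 + q div 2) / ln (real n)) \<and>
      measure (syk_couplings n q) E \<ge> 1 - p n)"
    using circuit_lower_bound[OF assms(1,2) S \<beta>] by blast
  obtain n0 where n0: "\<And>n psi. n \<ge> n0 \<Longrightarrow> majorana_family n psi \<Longrightarrow> \<exists>E\<in>sets (syk_couplings n q).
      E \<subseteq> hard_couplings S n q psi \<beta> eps (c * real n ^ (1 + q div 2) / ln (real n)) \<and>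
      measure (syk_couplings n q) E \<ge> 1 - p n"
    using ev unfolding eventually_sequentially by blast
  define H where "H m = hard_couplings S (2*m) q (psi m) \<beta> eps (c * real (2*m) ^ (1 + q div 2) / ln (real (2*m)))" for m
  have "\<exists>E\<in>sets (syk_couplings (2*m) q). E \<subseteq> H m \<and> (n0 \<le> 2*m \<longrightarrow> measure (syk_couplings (2*m) q) E \<ge> 1 - p (2*m))" for m
  proof (cases "n0 \<le> 2*m")
    case True
    from n0[OF this assms(4)] show ?thesis unfolding H_def by blast
  next
    \<comment> \<open>Below the threshold nothing is claimed about the probability, and the empty
      set satisfies the inclusion.\<close>
    case False
    then show ?thesis by (intro bexI[of _ "{}"]) auto
  qed
  then obtain A where A: "\<And>m. A m \<in> sets (syk_couplings (2*m) q)" "\<And>m. A m \<subseteq> H m"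
    and M: "\<And>m. n0 \<le> 2*m \<Longrightarrow> measure (syk_couplings (2*m) q) (A m) \<ge> 1 - p (2*m)"
    by metis
  have "(\<lambda>m. measure (syk_couplings (2*m) q) (A m)) \<longlonglongrightarrow> 1"
  proof (rule tendsto_sandwich[of "\<lambda>m. 1 - p (2*m)" _ _ "\<lambda>_. 1"])
    have "(\<lambda>m. p (2*m)) \<longlonglongrightarrow> 0"
      using LIMSEQ_subseq_LIMSEQ[OF p, of "\<lambda>m. 2*m"] by (simp add: o_def strict_mono_def)
    from tendsto_diff[OF tendsto_const this, of 1] show "(\<lambda>m. 1 - p (2*m)) \<longlonglongrightarrow> 1" by simp
    show "\<forall>\<^sub>F m in sequentially. 1 - p (2*m) \<le> measure (syk_couplings (2*m) q) (A m)"
      unfolding eventually_sequentially by (rule exI[of _ n0]) (use M in force)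
    show "\<forall>\<^sub>F m in sequentially. measure (syk_couplings (2*m) q) (A m) \<le> 1"
      unfolding eventually_sequentially
    \<comment> \<open>At m = 0 the variance \<open>syk_var\<close> is 0 by the convention for
      division, so positivity of the standard deviation requires m \<ge> 1.\<close>
    proof (intro exI[of _ 1] allI impI)
      fix m :: nat assume "1 \<le> m"
      then have "sqrt (syk_var (2*m) q) > 0" by (simp add: syk_var_def)
      then interpret prob_space "syk_couplings (2*m) q"
        unfolding syk_couplings_gaussPi by (rule prob_space_gaussPi)
      show "measure (syk_couplings (2*m) q) (A m) \<le> 1" by (rule prob_le_1)
    qed
  qed simp
  with A eps c show "\<exists>eps>0. \<exists>c>0. \<exists>A :: nat \<Rightarrow> (nat set \<Rightarrow> real) set.
    (\<forall>m. A m \<in> sets (syk_couplings (2*m) q) \<and>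
       A m \<subseteq> {J \<in> space (syk_couplings (2*m) q).
          \<forall>k v0 cs. prepares S m k v0 cs eps (gibbs \<beta> (syk_ham (2*m) q (psi m) J)) \<longrightarrow>
             real (length cs) \<ge> c * real (2*m) ^ (1 + q div 2) / ln (real (2*m))}) \<and>
    (\<lambda>m. measure (syk_couplings (2*m) q) (A m)) \<longlonglongrightarrow> 1"
    unfolding H_def hard_couplings_def nonzero_mult_div_cancel_left[OF zero_neq_numeral[symmetric]] by blast
qed

end
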